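(* Assume (A1)–(A4) and fix $k\in[p]$. Then for any $\xi>1$, $$\big\|\hat{\mathbf b}_k\,\mathrm{sgn}(\mathbf u_k^{\mathrm T}\hat{\mathbf u}_k)-\mathbf b(\hat{\mathbf u}_k)\big\|_\infty=\widetilde O_{\mathbb P}\Big\{\frac{\sqrt n\rho_n}{\Delta_n^2}\max\Big(\frac1{q_n},\frac{\sqrt{n\rho_n}}{\Delta_n}\Big)(\log n)^\xi\Big\}.$$ Furthermore, if $(n\rho_n)^{3/2}/\Delta_n^2\to0$, then the bias-corrected eigenvector $\hat{\mathbf u}_k^{(c)}:=\hat{\mathbf u}_k-\hat{\mathbf b}_k$ has zero second-order bias: $\mathbf b(\hat{\mathbf u}_k^{(c)})=\mathbf 0_n$.
   Context: Setting: $d$ fixed; $\mathbf P\in\mathbb R^{n\times n}$ deterministic symmetric of rank $d$; $\mathbf A=\mathbf P+\mathbf E$ with $\mathbf E=[E_{ij}]$ random symmetric, upper-triangular entries independent, mean zero, $\sigma_{ij}^2=\mathrm{var}(E_{ij})$. Nonzero eigenvalues of $\mathbf P$: $\lambda_1\ge\dots\ge\lambda_d$, orthonormal eigenvectors $\mathbf u_1,\dots,\mathbf u_d$, $\mathbf U_{\mathbf P}=[\mathbf u_1,\dots,\mathbf u_d]$; $p,q$ the numbers of positive/negative eigenvalues. Let $\lambda_1(\mathbf A)\ge\dots\ge\lambda_n(\mathbf A)$ be the eigenvalues of $\mathbf A$ with orthonormal eigenvectors $\hat{\mathbf u}_1,\dots,\hat{\mathbf u}_n$; $\mathbf U_{\mathbf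 A}=[\hat{\mathbf u}_1,\dots,\hat{\mathbf u}_p,\hat{\mathbf u}_{n-q+1},\dots,\hat{\mathbf u}_n]$, $\mathbf S_{\mathbf A}=\mathrm{diag}(\lambda_1(\mathbf A),\dots,\lambda_p(\mathbf A),\lambda_{n-q+1}(\mathbf A),\dots,\lambda_n(\mathbf A))$; for $m\in[d]$, $\hat\lambda_m$ denotes the $m$-th diagonal entry of $\mathbf S_{\mathbf A}$ and (in the formula for $\hat{\mathbf b}_k$) $\hat{\mathbf u}_m$ the $m$-th column of $\mathbf U_{\mathbf A}$. Let $\hat{\mathbf P}=\mathbf U_{\mathbf A}\mathbf S_{\mathbf A}\mathbf U_{\mathbf A}^{\mathrm T}=[\hat p_{ij}]$, $\mathbf D:=\mathbb E\mathbf E^2=\mathrm{diag}(\sum_j\sigma_{1j}^2,\dots,\sum_j\sigma_{nj}^2)$, $\hat{\mathbf D}=\mathrm{diag}(\sum_j(A_{1j}-\hat p_{1j})^2,\dots,\sum_j(A_{nj}-\hat p_{nj})^2)$, $$\mathbf b(\hat{\mathbf u}_k)=\Big(\mathbf I_n-\tfrac32\mathbf u_k\mathbf u_k^{\mathrm T}+\sum_{m\in[d]\setminus\{k\}}\frac{\lambda_m\mathbf u_m\mathbf u_m^{\mathrm T}}{\lambda_k-\lambda_m}\Big)\frac{\mathbf D\mathbf u_k}{\lambda_k^2},\quad \hat{\mathbf b}_k=\Big(\mathbf I_n-\tfrac32\hat{\mathbf u}_k\hat{\mathbf u}_k^{\mathrm T}+\sum_{m\in[d]\setminus\{k\}}\frac{\hat\lambda_m\hat{\mathbf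 u}_m\hat{\mathbf u}_m^{\mathrm T}}{\hat\lambda_k-\hat\lambda_m}\Big)\frac{\hat{\mathbf D}\hat{\mathbf u}_k}{\hat\lambda_k^2}.$$ General notion of second-order bias: if an estimator $\tilde{\mathbf u}_k$ of $\mathbf u_k$ admits an expansion $\tilde{\mathbf u}_k\mathrm{sgn}(\mathbf u_k^{\mathrm T}\tilde{\mathbf u}_k)-\mathbf u_k=\boldsymbol\psi_k(\mathbf E)+\mathbf q_k(\mathbf E)+\mathbf t_k$ with $\boldsymbol\psi_k$ linear in $\mathbf E$, $\mathbf q_k$ quadratic in $\mathbf E$, and for each $i$: $\mathbf e_i^{\mathrm T}\boldsymbol\psi_k(\mathbf E)=O_{\mathbb P}(\rho_n^{1/2}/\Delta_n)$, $\mathbf e_i^{\mathrm T}\mathbf q_k(\mathbf E)=O_{\mathbb P}(\sqrt n\rho_n/\Delta_n^2)$, $\mathbf e_i^{\mathrm T}\mathbf t_k=o_{\mathbb P}(\sqrt n\rho_n/\Delta_n^2)$, then its second-order bias is $\mathbf b(\tilde{\mathbf u}_k)=\mathbb E\mathbf q_k(\mathbf E)$ (for $\tilde{\mathbf u}_k=\hat{\mathbf u}_k$ this is the formula above). Norms: $\|\cdot\|_\infty$ vector max-norm, $\|\cdot\|_2$ spectral, $\|\mathbf M\|_{2\to\infty}$ max row Euclidean norm. $\widetilde O_{\mathbb P}(Y_n)$: bounded by $K_cY_n$ with probability $\ge1-n^{-c}$ for every $c>0$ and $n\ge N_c$. (A1) Constants $\beta_\Delta,C_1,C_2,c>0$ and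 $\rho_n\in(0,1]$ with $n\rho_n=\omega(n^c)$ and $C_1n^{\beta_\Delta}\sqrt{n\rho_n}\le\min_k|\lambda_k|\le\max_k|\lambda_k|\le C_2n^{\beta_\Delta}\sqrt{n\rho_n}$. (A2) $\Delta_n:=\min(\min_k|\lambda_k|,\min_{k\le d-1}|\lambda_k-\lambda_{k+1}|)\ge\delta_0\min_k|\lambda_k|$, $\delta_0>0$ constant. (A3) Constant $\epsilon\in(0,1/2]$, $q_n\in[n^\epsilon,\sqrt n]$, constant $C>0$: $\mathbb E E_{ij}^2\le C\rho_n$, $\mathbb E|E_{ij}|^p\le C^p(n\rho_n)^{p/2}/(nq_n^{p-2})$ for $3\le p\le(2\log n)^{A_0\log\log n}$, $A_0\ge11$. (A4) $\|\mathbf U_{\mathbf P}\|_{2\to\infty}\le C_\mu\sqrt{d/n}$ for a constant $C_\mu\ge1$. *)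

theory Defs
  imports "HOL-Probability.Probability"
begin

text \<open>Conventions. Indices are 0-based: an n-vector is a function nat => real
  used on {..<n}; an n x n matrix is nat => nat => real used on {..<n} x {..<n}.
  The d eigenpairs of P are indexed by {..<d}; the m-th eigenvector is U m.\<close>

definition inner_n :: "nat \<Rightarrow> (nat \<Rightarrow> real) \<Rightarrow> (nat \<Rightarrow> real) \<Rightarrow> real" where
  "inner_n n x y = (\<Sum>j<n. x j * y j)"

definition vinf :: "nat \<Rightarrow> (nat \<Rightarrow> real) \<Rightarrow> real" where
  "vinf n v = Max ((\<lambda>i. \<bar>v i\<bar>) ` {..<n})"

definition lowrank :: "nat \<Rightarrow> (nat \<Rightarrow> real) \<Rightarrow> (nat \<Rightarrow> nat \<Rightarrow> real) \<Rightarrow> nat \<Rightarrow> nat \<Rightarrow> real" where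
  "lowrank d s U i j = (\<Sum>m<d. s m * U m i * U m j)"

definition gapDelta :: "nat \<Rightarrow> (nat \<Rightarrow> real) \<Rightarrow> real" where
  "gapDelta d lam = Min ((\<lambda>m. \<bar>lam m\<bar>) ` {..<d} \<union> (\<lambda>m. \<bar>lam m - lam (Suc m)\<bar>) ` {..<d - 1})"

text \<open>The bias formula
  (I - 3/2 U_k U_k^T + sum_{m in [d]-{k}} lam_m/(lam_k-lam_m) U_m U_m^T) Dg U_k / lam_k^2,
  where Dg is the diagonal of a diagonal matrix; evaluated at coordinate i.\<close>
definition bias_formula :: "nat \<Rightarrow> nat \<Rightarrow> (nat \<Rightarrow> real) \<Rightarrow> (nat \<Rightarrow> nat \<Rightarrow> real)
    \<Rightarrow> (nat \<Rightarrow> real) \<Rightarrow> nat \<Rightarrow> nat \<Rightarrow> real" where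
  "bias_formula n d lam U Dg k i =
    (let w = (\<lambda>j. Dg j * U k j / (lam k)\<^sup>2) in
      w i - 3/2 * U k i * inner_n n (U k) w
      + (\<Sum>m\<in>{..<d} - {k}. lam m / (lam k - lam m) * U m i * inner_n n (U m) w))"

text \<open>Column selection of U_A / S_A: the p top and the q = d - p bottom eigenpairs.
  0-based, the m-th selected index is m if m < p, and n - d + m otherwise.\<close>
definition selidx :: "nat \<Rightarrow> nat \<Rightarrow> nat \<Rightarrow> nat \<Rightarrow> nat" where
  "selidx n d p m = (if m < p then m else n - d + m)"

definition Dhat_diag :: "nat \<Rightarrow> (nat \<Rightarrow> nat \<Rightarrow> real) \<Rightarrow> (nat \<Rightarrow> nat \<Rightarrow> real) \<Rightarrow> nat \<Rightarrow> real" where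
  "Dhat_diag n A Ph i = (\<Sum>j<n. (A i j - Ph i j)\<^sup>2)"

definition tildeOP :: "(nat \<Rightarrow> 'a measure) \<Rightarrow> (nat \<Rightarrow> 'a \<Rightarrow> real) \<Rightarrow> (nat \<Rightarrow> real) \<Rightarrow> bool" where
  "tildeOP M X Y \<longleftrightarrow> (\<forall>c>0. \<exists>K N. \<forall>n\<ge>N. \<exists>S\<in>sets (M n).
      measure (M n) S \<ge> 1 - real n powr (- c) \<and> (\<forall>\<omega>\<in>S. \<bar>X n \<omega>\<bar> \<le> K * Y n))"

definition coordOP :: "(nat \<Rightarrow> 'a measure) \<Rightarrow> (nat \<Rightarrow> 'a \<Rightarrow> nat \<Rightarrow> real) \<Rightarrow> (nat \<Rightarrow> real) \<Rightarrow> bool" where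
  "coordOP M X Y \<longleftrightarrow> (\<forall>e>0. \<exists>K N. \<forall>n\<ge>N. \<forall>i<n. \<exists>S\<in>sets (M n).
      measure (M n) S \<ge> 1 - e \<and> (\<forall>\<omega>\<in>S. \<bar>X n \<omega> i\<bar> \<le> K * Y n))"

definition coordoP :: "(nat \<Rightarrow> 'a measure) \<Rightarrow> (nat \<Rightarrow> 'a \<Rightarrow> nat \<Rightarrow> real) \<Rightarrow> (nat \<Rightarrow> real) \<Rightarrow> bool" where
  "coordoP M X Y \<longleftrightarrow> (\<forall>e>0. \<forall>\<delta>>0. \<exists>N. \<forall>n\<ge>N. \<forall>i<n. \<exists>S\<in>sets (M n).
      measure (M n) S \<ge> 1 - e \<and> (\<forall>\<omega>\<in>S. \<bar>X n \<omega> i\<bar> \<le> \<delta> * Y n))"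

definition linmap :: "nat \<Rightarrow> (nat \<Rightarrow> nat \<Rightarrow> nat \<Rightarrow> real) \<Rightarrow> (nat \<Rightarrow> nat \<Rightarrow> real) \<Rightarrow> nat \<Rightarrow> real" where
  "linmap n L Em i = (\<Sum>j<n. \<Sum>l<n. L i j l * Em j l)"

definition quadmap :: "nat \<Rightarrow> (nat \<Rightarrow> nat \<Rightarrow> nat \<Rightarrow> nat \<Rightarrow> nat \<Rightarrow> real) \<Rightarrow> (nat \<Rightarrow> nat \<Rightarrow> real) \<Rightarrow> nat \<Rightarrow> real" where
  "quadmap n Q Em i = (\<Sum>j<n. \<Sum>l<n. \<Sum>j'<n. \<Sum>l'<n. Q i j l j' l' * Em j l * Em j' l')"

definition second_order_expansion ::
  "(nat \<Rightarrow> 'a measure) \<Rightarrow> (nat \<Rightarrow> 'a \<Rightarrow> nat \<Rightarrow> nat \<Rightarrow> real) \<Rightarrow> (nat \<Rightarrow> nat \<Rightarrow> real)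
   \<Rightarrow> (nat \<Rightarrow> 'a \<Rightarrow> nat \<Rightarrow> real) \<Rightarrow> (nat \<Rightarrow> real) \<Rightarrow> (nat \<Rightarrow> real)
   \<Rightarrow> (nat \<Rightarrow> nat \<Rightarrow> nat \<Rightarrow> nat \<Rightarrow> real)
   \<Rightarrow> (nat \<Rightarrow> nat \<Rightarrow> nat \<Rightarrow> nat \<Rightarrow> nat \<Rightarrow> nat \<Rightarrow> real)
   \<Rightarrow> (nat \<Rightarrow> 'a \<Rightarrow> nat \<Rightarrow> real) \<Rightarrow> bool" where
  "second_order_expansion M E uk ut rho Delta L Q t \<longleftrightarrow>
     (\<forall>n. \<forall>\<omega>\<in>space (M n). \<forall>i<n.
        ut n \<omega> i * sgn (inner_n n (uk n) (ut n \<omega>)) - uk n i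
          = linmap n (L n) (E n \<omega>) i + quadmap n (Q n) (E n \<omega>) i + t n \<omega> i)
   \<and> coordOP M (\<lambda>n \<omega> i. linmap n (L n) (E n \<omega>) i) (\<lambda>n. sqrt (rho n) / Delta n)
   \<and> coordOP M (\<lambda>n \<omega> i. quadmap n (Q n) (E n \<omega>) i) (\<lambda>n. sqrt (real n) * rho n / (Delta n)\<^sup>2)
   \<and> coordoP M t (\<lambda>n. sqrt (real n) * rho n / (Delta n)\<^sup>2)"

definition zero_second_order_bias ::
  "(nat \<Rightarrow> 'a measure) \<Rightarrow> (nat \<Rightarrow> 'a \<Rightarrow> nat \<Rightarrow> nat \<Rightarrow> real) \<Rightarrow> (nat \<Rightarrow> nat \<Rightarrow> real)
   \<Rightarrow> (nat \<Rightarrow> 'a \<Rightarrow> nat \<Rightarrow> real) \<Rightarrow> (nat \<Rightarrow> real) \<Rightarrow> (nat \<Rightarrow> real) \<Rightarrow> bool" where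
  "zero_second_order_bias M E uk ut rho Delta \<longleftrightarrow>
     (\<exists>L Q t. second_order_expansion M E uk ut rho Delta L Q t
        \<and> (\<forall>n i. i < n \<longrightarrow> integral\<^sup>L (M n) (\<lambda>\<omega>. quadmap n (Q n) (E n \<omega>) i) = 0))"

end

theory Submission
  imports Defs "HOL-Real_Asymp.Real_Asymp"
begin

text \<open>
  Counting the moments of \<open>(E\<^sup>r y)\<^sub>i\<close> over walks shows that, with high probability, the vectors
  \<open>E\<^sup>r u\<^sub>m\<close> stay delocalised and \<open>E\<close> has operator norm close to \<open>sqrt (n * rho)\<close>; Bernstein's inequality gives
  the sharp logarithmic factor for \<open>E u\<^sub>m\<close> and for the row sums of \<open>E\<^sub>i\<^sub>j\<^sup>2\<close>. On that event, iterating
  the eigenvalue equation \<open>v = (P v + E v) / L\<close> a fixed number of times yields entrywise expansions, to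
  second order, of the eigenvectors and eigenvalues of \<open>A\<close>. To first order they say that the plug-in bias
  differs from the true one by a factor \<open>1 + O(max (1/q) (sqrt (n * rho) / Delta) * log n)\<close>. To second
  order the quadratic term of the expansion is a fixed linear image of \<open>E\<^sup>2 u\<^sub>k\<close>. The diagonal of \<open>E\<^sup>2\<close>
  contributes exactly the bias formula at the empirical row sums of \<open>E\<^sub>i\<^sub>j\<^sup>2\<close>, which the correction removes
  up to a negligible error; the off-diagonal part that is left has mean zero.
\<close>

section \<open>Finite-dimensional spectral theory\<close>

text \<open>Three scales shape the argument. Moment counting loses a small power of
  \<open>n\<close>, which is harmless because the normalised noise
  \<open>tau n = snr n / Del n\<close> itself decays like a power of \<open>n\<close>; where the
  claimed rate leaves room for one logarithm only, Bernstein bounds take over. The operator norm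
  says nothing about single coordinates and misses delocalisation by a factor of order
  \<open>sqrt n\<close>. Each pass through the eigenvalue equation multiplies the part not yet
  expanded by about \<open>tau n\<close>, so a number of passes that depends only on
  \<open>betaD\<close> repays this loss. The eigenvectors of A are not assumed measurable, so all
  randomness is confined to one measurable event, on which every estimate is deterministic.
  Uniformity in sample point and coordinate is carried by Landau symbols along a filter on triples
  \<open>(n, \<omega>, i)\<close>, so the perturbation algebra reads like a scalar expansion. The
  factor 3/2 arises there: one copy of the second-order eigenvalue shift comes from the quotient of
  the true by the perturbed eigenvalue, half a copy from the unit length of the eigenvector.\<close>

definition mv :: "nat \<Rightarrow> (nat \<Rightarrow> nat \<Rightarrow> real) \<Rightarrow> (nat \<Rightarrow> real) \<Rightarrow> nat \<Rightarrow> real" where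
  "mv n E y i = (\<Sum>j<n. E i j * y j)"

lemma inner_n_commute: "inner_n n x y = inner_n n y x"
  by (simp add: inner_n_def mult.commute)

lemma inner_n_cong:
  "(\<And>i. i < n \<Longrightarrow> x i = x' i) \<Longrightarrow> (\<And>i. i < n \<Longrightarrow> y i = y' i) \<Longrightarrow> inner_n n x y = inner_n n x' y'"
  by (simp add: inner_n_def)

lemma inner_n_nonneg: "0 \<le> inner_n n x x"
  by (simp add: inner_n_def sum_nonneg)

lemma inner_n_sum_left: "inner_n n (\<lambda>i. \<Sum>l\<in>L. f l i) y = (\<Sum>l\<in>L. inner_n n (f l) y)"
  unfolding inner_n_def sum_distrib_right by (rule sum.swap)

lemma inner_n_scale_left: "inner_n n (\<lambda>i. c * f i) y = c * inner_n n f y"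
  by (simp add: inner_n_def sum_distrib_left mult.assoc)

lemma inner_n_lc_left:
  "inner_n n (\<lambda>i. \<Sum>l\<in>L. c l * f l i) y = (\<Sum>l\<in>L. c l * inner_n n (f l) y)"
  by (simp add: inner_n_sum_left inner_n_scale_left)

lemma inner_n_lc_right:
  "inner_n n y (\<lambda>i. \<Sum>l\<in>L. c l * f l i) = (\<Sum>l\<in>L. c l * inner_n n y (f l))"
  by (simp add: inner_n_commute[of n y] inner_n_lc_left)

lemma inner_n_add_right: "inner_n n x (\<lambda>i. y i + z i) = inner_n n x y + inner_n n x z"
  by (simp add: inner_n_def distrib_left sum.distrib)

lemma inner_n_diff_right: "inner_n n x (\<lambda>i. y i - z i) = inner_n n x y - inner_n n x z"
  by (simp add: inner_n_def right_diff_distrib sum_subtractf)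

lemma inner_n_diff_left: "inner_n n (\<lambda>i. y i - z i) x = inner_n n y x - inner_n n z x"
  by (simp add: inner_n_commute[of n _ x] inner_n_diff_right)

lemma inner_n_scale_right: "inner_n n y (\<lambda>i. c * f i) = c * inner_n n y f"
  by (simp add: inner_n_commute[of n y] inner_n_scale_left)

lemma inner_n_self_eq_0:
  assumes "inner_n n x x = 0" "i < n" shows "x i = 0"
proof -
  have "\<forall>j\<in>{..<n}. x j * x j = 0"
    using assms(1) unfolding inner_n_def by (subst (asm) sum_nonneg_eq_0_iff) auto
  then show ?thesis using assms(2) by auto
qed

lemma inner_n_Cauchy_Schwarz:
  "(inner_n n x y)\<^sup>2 \<le> inner_n n x x * inner_n n y y"
  using Cauchy_Schwarz_ineq_sum[of x y "{..<n}"]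
  by (simp add: inner_n_def power2_eq_square)

lemma mv_cong: "(\<And>j. j < n \<Longrightarrow> y j = z j) \<Longrightarrow> mv n E y i = mv n E z i"
  by (simp add: mv_def)

lemma mv_lc: "mv n E (\<lambda>i. \<Sum>l\<in>L. c l * f l i) i = (\<Sum>l\<in>L. c l * mv n E (f l) i)"
  unfolding mv_def sum_distrib_left
  by (subst sum.swap) (simp add: algebra_simps)

lemma mv_add: "mv n E (\<lambda>i. f i + g i) i = mv n E f i + mv n E g i"
  by (simp add: mv_def distrib_left sum.distrib)

lemma mv_scale: "mv n E (\<lambda>i. c * f i) i = c * mv n E f i"
  by (simp add: mv_def sum_distrib_left algebra_simps)

lemma inner_mv_sym:
  assumes "\<And>i j. i < n \<Longrightarrow> j < n \<Longrightarrow> E i j = E j i"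
  shows "inner_n n x (mv n E y) = inner_n n (mv n E x) y"
proof -
  have "inner_n n x (mv n E y) = (\<Sum>i<n. \<Sum>j<n. x i * (E i j * y j))"
    by (simp add: inner_n_def mv_def sum_distrib_left)
  also have "\<dots> = (\<Sum>j<n. \<Sum>i<n. x i * (E i j * y j))"
    by (rule sum.swap)
  also have "\<dots> = (\<Sum>j<n. \<Sum>i<n. E j i * x i * y j)"
    by (intro sum.cong refl) (use assms in auto)
  finally show ?thesis by (simp add: inner_n_def mv_def sum_distrib_right)
qed

text \<open>Gaussian elimination by induction on the equations: a nonzero coefficient
  \<open>a i0 j0\<close> serves as pivot and removes one equation together with one unknown. All
  dimension counts below rest on it.\<close>

lemma homogeneous_system_solution:
  fixes a :: "'i \<Rightarrow> 'j \<Rightarrow> real"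
  assumes "finite I" "finite J" "card I < card J"
  shows "\<exists>c. (\<exists>j\<in>J. c j \<noteq> 0) \<and> (\<forall>i\<in>I. (\<Sum>j\<in>J. a i j * c j) = 0)"
  using assms
proof (induction I arbitrary: J a rule: finite_induct)
  case empty
  then obtain j where "j \<in> J" by (metis card_gt_0_iff card.empty ex_in_conv)
  then show ?case by (intro exI[of _ "\<lambda>_. 1"]) auto
next
  case (insert i0 I)
  show ?case
  proof (cases "\<exists>j0\<in>J. a i0 j0 \<noteq> 0")
    case False
    have "card I < card J" using insert by auto
    from insert.IH[OF insert.prems(1) this, of a] obtain c where
      "\<exists>j\<in>J. c j \<noteq> 0" "\<forall>i\<in>I. (\<Sum>j\<in>J. a i j * c j) = 0" by blast
    with False show ?thesis by (intro exI[of _ c]) auto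
  next
    case True
    then obtain j0 where j0: "j0 \<in> J" "a i0 j0 \<noteq> 0" by blast
    define a' where "a' i j = a i j - a i j0 * a i0 j / a i0 j0" for i j
    have "card I < card (J - {j0})" using insert j0 by (simp add: card_insert_disjoint)
    from insert.IH[OF _ this, of a'] insert.prems obtain c where
      c: "\<exists>j\<in>J-{j0}. c j \<noteq> 0" "\<And>i. i \<in> I \<Longrightarrow> (\<Sum>j\<in>J-{j0}. a' i j * c j) = 0" by auto
    define T where "T = (\<Sum>j\<in>J-{j0}. a i0 j * c j)"
    \<comment> \<open>The pivot unknown is the one that makes equation \<open>i0\<close>
      hold.\<close>
    define c' where "c' = c(j0 := - T / a i0 j0)"
    have split: "(\<Sum>j\<in>J. a i j * c' j) = - a i j0 * T / a i0 j0 + (\<Sum>j\<in>J-{j0}. a i j * c j)" for i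
    proof -
      have "(\<Sum>j\<in>J. a i j * c' j) = a i j0 * c' j0 + (\<Sum>j\<in>J-{j0}. a i j * c' j)"
        using j0 insert.prems by (subst sum.remove[of _ j0]) auto
      also have "(\<Sum>j\<in>J-{j0}. a i j * c' j) = (\<Sum>j\<in>J-{j0}. a i j * c j)"
        by (intro sum.cong) (auto simp: c'_def)
      finally show ?thesis by (simp add: c'_def)
    qed
    have "(\<Sum>j\<in>J. a i j * c' j) = 0" if "i \<in> insert i0 I" for i
    proof (cases "i = i0")
      case True
      then show ?thesis using j0 unfolding split by (simp add: T_def)
    next
      case False
      then have "i \<in> I" using that by simp
      from c(2)[OF this] have "(\<Sum>j\<in>J-{j0}. a i j * c j) - (\<Sum>j\<in>J-{j0}. a i j0 / a i0 j0 * (a i0 j * c j)) = 0"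
        by (simp add: a'_def left_diff_distrib sum_subtractf mult.assoc)
      moreover have "(\<Sum>j\<in>J-{j0}. a i j0 / a i0 j0 * (a i0 j * c j)) = a i j0 / a i0 j0 * T"
        by (simp only: T_def sum_distrib_left)
      ultimately show ?thesis unfolding split by simp
    qed
    moreover have "\<exists>j\<in>J. c' j \<noteq> 0" using c(1) by (auto simp: c'_def)
    ultimately show ?thesis by blast
  qed
qed

lemma orthonormal_lc_self:
  assumes "finite L" "\<And>l l'. l \<in> L \<Longrightarrow> l' \<in> L \<Longrightarrow> inner_n n (f l) (f l') = (if l = l' then 1 else 0)"
    and "l' \<in> L"
  shows "inner_n n (\<lambda>i. \<Sum>l\<in>L. c l * f l i) (f l') = c l'"
proof -
  have "inner_n n (\<lambda>i. \<Sum>l\<in>L. c l * f l i) (f l') = (\<Sum>l\<in>L. if l = l' then c l else 0)"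
    unfolding inner_n_lc_left by (intro sum.cong) (use assms in auto)
  then show ?thesis using assms by simp
qed

lemma orthonormal_lc_norm:
  assumes "finite L" "\<And>l l'. l \<in> L \<Longrightarrow> l' \<in> L \<Longrightarrow> inner_n n (f l) (f l') = (if l = l' then 1 else 0)"
  shows "inner_n n (\<lambda>i. \<Sum>l\<in>L. c l * f l i) (\<lambda>i. \<Sum>l\<in>L. c l * f l i) = (\<Sum>l\<in>L. (c l)\<^sup>2)"
proof -
  have "inner_n n (\<lambda>i. \<Sum>l\<in>L. c l * f l i) (\<lambda>i. \<Sum>l\<in>L. c l * f l i)
      = (\<Sum>l\<in>L. c l * inner_n n (\<lambda>i. \<Sum>l\<in>L. c l * f l i) (f l))"
    by (rule inner_n_lc_right)
  also have "\<dots> = (\<Sum>l\<in>L. (c l)\<^sup>2)"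
    by (intro sum.cong refl) (use orthonormal_lc_self[OF assms] in \<open>auto simp: power2_eq_square\<close>)
  finally show ?thesis .
qed

lemma Bessel_inequality:
  assumes "finite L" "\<And>l l'. l \<in> L \<Longrightarrow> l' \<in> L \<Longrightarrow> inner_n n (f l) (f l') = (if l = l' then 1 else 0)"
  shows "(\<Sum>l\<in>L. (inner_n n x (f l))\<^sup>2) \<le> inner_n n x x"
proof -
  define y where "y i = (\<Sum>l\<in>L. inner_n n x (f l) * f l i)" for i
  have yy: "inner_n n y y = (\<Sum>l\<in>L. (inner_n n x (f l))\<^sup>2)"
    unfolding y_def[abs_def] by (rule orthonormal_lc_norm) (use assms in auto)
  have xy: "inner_n n x y = (\<Sum>l\<in>L. (inner_n n x (f l))\<^sup>2)"
    unfolding y_def[abs_def] inner_n_lc_right by (simp add: power2_eq_square)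
  have "0 \<le> inner_n n (\<lambda>i. x i - y i) (\<lambda>i. x i - y i)" by (rule inner_n_nonneg)
  also have "\<dots> = inner_n n x x - 2 * inner_n n x y + inner_n n y y"
    by (simp add: inner_n_diff_left inner_n_diff_right inner_n_commute[of n y x])
  finally show ?thesis using xy yy by simp
qed

text \<open>The residual \<open>y\<close> is orthogonal to the \<open>n\<close> vectors
  \<open>f l\<close>, and together they are \<open>n + 1\<close> vectors with \<open>n\<close>
  coordinates, hence dependent. Pairing the dependency with \<open>f l\<close> kills every
  coefficient except that of \<open>y\<close>; pairing it with \<open>y\<close> then shows that
  \<open>y\<close> vanishes.\<close>

lemma orthonormal_basis_expansion:
  assumes orth: "\<And>l l'. l < n \<Longrightarrow> l' < n \<Longrightarrow> inner_n n (f l) (f l') = (if l = l' then 1 else 0)"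
    and "i < n"
  shows "x i = (\<Sum>l<n. inner_n n x (f l) * f l i)"
proof -
  define y where "y i = x i - (\<Sum>l<n. inner_n n x (f l) * f l i)" for i
  have perp: "inner_n n y (f l) = 0" if "l < n" for l
    unfolding y_def[abs_def] inner_n_diff_left
    by (subst orthonormal_lc_self) (use orth that in auto)
  obtain c where c: "\<exists>j\<in>{..n}. c j \<noteq> 0"
      "\<And>i. i \<in> {..<n} \<Longrightarrow> (\<Sum>j\<in>{..n}. (if j < n then f j i else y i) * c j) = 0"
    using homogeneous_system_solution[of "{..<n}" "{..n}" "\<lambda>i j. if j < n then f j i else y i"]
    by auto
  have c2: "(\<Sum>j<n. c j * f j i) + c n * y i = 0" if "i < n" for i
    using c(2)[of i] that by (simp add: lessThan_Suc_atMost[symmetric] mult.commute)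
  have 0: "inner_n n (\<lambda>i. (\<Sum>j<n. c j * f j i) + c n * y i) z = 0" for z
    unfolding inner_n_def using c2 by simp
  have add: "inner_n n (\<lambda>i. (\<Sum>j<n. c j * f j i) + c n * y i) z
      = inner_n n (\<lambda>i. \<Sum>j<n. c j * f j i) z + c n * inner_n n y z" for z
    by (simp add: inner_n_def distrib_right sum.distrib sum_distrib_left mult.assoc)
  have cl: "c l = 0" if "l < n" for l
  proof -
    have "inner_n n (\<lambda>i. \<Sum>j<n. c j * f j i) (f l) = c l"
      by (rule orthonormal_lc_self) (use orth that in auto)
    then show ?thesis using 0[of "f l"] add[of "f l"] perp[OF that] by simp
  qed
  have "c n \<noteq> 0" using c(1) cl by (metis atMost_iff le_neq_implies_less)
  moreover have "c n * inner_n n y y = 0"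
    using 0[of y] add[of y] cl by (simp add: inner_n_def)
  ultimately have "inner_n n y y = 0" by simp
  from inner_n_self_eq_0[OF this \<open>i < n\<close>] show ?thesis by (simp add: y_def)
qed

section \<open>Weyl's inequality for the selected eigenvalues of a low-rank matrix plus
  noise\<close>

lemma mv_lowrank:
  "mv n (lowrank d s U) x i = (\<Sum>m<d. s m * inner_n n (U m) x * U m i)"
  unfolding mv_def lowrank_def inner_n_def sum_distrib_left sum_distrib_right
  by (subst sum.swap) (simp add: algebra_simps)

lemma decseq_on_chain:
  fixes f :: "nat \<Rightarrow> real"
  assumes "\<And>m. Suc m < n \<Longrightarrow> f (Suc m) \<le> f m" "i \<le> j" "j < n"
  shows "f j \<le> f i"
  using assms(2,3)
proof (induction j rule: dec_induct)
  case (step j) then show ?case using assms(1)[of j] by simp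
qed auto

text \<open>A Courant-Fischer argument: some combination of the \<open>m + 1\<close> top
  eigenvectors of one matrix is orthogonal to the first \<open>m\<close> eigenvectors of the other,
  and its quadratic form is squeezed from both sides. The restriction to positive
  \<open>lam m\<close> reflects that P also has zero eigenvalues, which the list \<open>lam\<close>
  does not show.\<close>

lemma Weyl_positive:
  assumes E: "\<And>x. \<bar>inner_n n x (mv n E x)\<bar> \<le> h * inner_n n x x"
    and v: "\<And>m m'. m < n \<Longrightarrow> m' < n \<Longrightarrow> inner_n n (v m) (v m') = (if m = m' then 1 else 0)"
    and eig: "\<And>m i. m < n \<Longrightarrow> i < n \<Longrightarrow> mv n (\<lambda>i j. lowrank d lam u i j + E i j) (v m) i = lh m * v m i"
    and lh: "\<And>m. Suc m < n \<Longrightarrow> lh (Suc m) \<le> lh m"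
    and u: "\<And>m m'. m < d \<Longrightarrow> m' < d \<Longrightarrow> inner_n n (u m) (u m') = (if m = m' then 1 else 0)"
    and lam: "\<And>m. Suc m < d \<Longrightarrow> lam (Suc m) \<le> lam m"
    and m: "m < d" "lam m > 0" and dn: "d \<le> n"
  shows "\<bar>lh m - lam m\<bar> \<le> h"
proof -
  let ?A = "\<lambda>i j. lowrank d lam u i j + E i j"
  have mvA: "mv n ?A x i = (\<Sum>l<d. lam l * inner_n n (u l) x * u l i) + mv n E x i" for x i
    unfolding mv_lowrank[symmetric] by (simp add: mv_def distrib_right sum.distrib)
  have qA: "inner_n n x (mv n ?A x) = (\<Sum>l<d. lam l * (inner_n n (u l) x)\<^sup>2) + inner_n n x (mv n E x)" for x
  proof -
    have "inner_n n x (mv n ?A x)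
        = inner_n n x (\<lambda>i. \<Sum>l<d. (lam l * inner_n n (u l) x) * u l i) + inner_n n x (mv n E x)"
      unfolding inner_n_add_right[symmetric] by (rule inner_n_cong) (auto simp: mvA)
    then show ?thesis unfolding inner_n_lc_right by (simp add: inner_n_commute[of n x "u _"] power2_eq_square mult.assoc)
  qed
  have qA2: "inner_n n x (mv n ?A x) = (\<Sum>l<n. lh l * (inner_n n x (v l))\<^sup>2)" for x
  proof -
    have "mv n ?A x i = (\<Sum>l<n. inner_n n x (v l) * (lh l * v l i))" if "i < n" for i
    proof -
      have "mv n ?A x i = mv n ?A (\<lambda>i. \<Sum>l<n. inner_n n x (v l) * v l i) i"
        by (rule mv_cong) (rule orthonormal_basis_expansion[OF v])
      then show ?thesis unfolding mv_lc using eig that by simp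
    qed
    then have "inner_n n x (mv n ?A x) = inner_n n x (\<lambda>i. \<Sum>l<n. (inner_n n x (v l) * lh l) * v l i)"
      by (intro inner_n_cong) (auto simp: mult.assoc)
    then show ?thesis unfolding inner_n_lc_right by (simp add: power2_eq_square mult_ac)
  qed
  have pars: "inner_n n x x = (\<Sum>l<n. (inner_n n x (v l))\<^sup>2)" for x
  proof -
    have "inner_n n x x = inner_n n x (\<lambda>i. \<Sum>l<n. inner_n n x (v l) * v l i)"
      by (intro inner_n_cong refl orthonormal_basis_expansion[OF v])
    then show ?thesis unfolding inner_n_lc_right by (simp add: power2_eq_square)
  qed
  have lam_le: "lam j \<le> lam i" if "i \<le> j" "j < d" for i j
    using decseq_on_chain[of d lam i j, OF lam that] by simp
  have lh_le: "lh j \<le> lh i" if "i \<le> j" "j < n" for i j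
    using decseq_on_chain[of n lh i j, OF lh that] by simp
  have "lam m - h \<le> lh m"
  proof -
    obtain c where c: "\<exists>l\<in>{..m}. c l \<noteq> 0" "\<And>i. i < m \<Longrightarrow> (\<Sum>l\<le>m. inner_n n (u l) (v i) * c l) = 0"
      using homogeneous_system_solution[of "{..<m}" "{..m}" "\<lambda>i l. inner_n n (u l) (v i)"] by auto
    define x where "x i = (\<Sum>l\<le>m. c l * u l i)" for i
    have xx: "inner_n n x x = (\<Sum>l\<le>m. (c l)\<^sup>2)"
      unfolding x_def[abs_def] by (rule orthonormal_lc_norm) (use u m in auto)
    have xpos: "inner_n n x x > 0" using c(1) unfolding xx
      by (metis finite_atMost sum_pos2 zero_le_power2 zero_less_power2)
    have xv: "inner_n n x (v i) = 0" if "i < m" for i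
      unfolding x_def[abs_def] inner_n_lc_left using c(2)[OF that] by (simp add: mult.commute)
    have xu: "inner_n n (u l) x = (if l \<le> m then c l else 0)" if "l < d" for l
    proof (cases "l \<le> m")
      case True
      then show ?thesis unfolding x_def[abs_def] inner_n_commute[of n "u l"]
        by (subst orthonormal_lc_self) (use u m in auto)
    next
      case False
      then show ?thesis unfolding x_def[abs_def] inner_n_lc_right using u m that by auto
    qed
    have "(\<Sum>l<d. lam l * (inner_n n (u l) x)\<^sup>2) = (\<Sum>l\<le>m. lam l * (c l)\<^sup>2)"
      by (rule sum.mono_neutral_cong_right) (use xu m in auto)
    also have "\<dots> \<ge> (\<Sum>l\<le>m. lam m * (c l)\<^sup>2)"
      by (intro sum_mono mult_right_mono lam_le) (use m in auto)
    finally have 1: "(\<Sum>l<d. lam l * (inner_n n (u l) x)\<^sup>2) \<ge> lam m * inner_n n x x"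
      unfolding xx sum_distrib_left .
    have "(\<Sum>l<n. lh l * (inner_n n x (v l))\<^sup>2) \<le> (\<Sum>l<n. lh m * (inner_n n x (v l))\<^sup>2)"
    proof (intro sum_mono)
      fix l assume l: "l \<in> {..<n}"
      show "lh l * (inner_n n x (v l))\<^sup>2 \<le> lh m * (inner_n n x (v l))\<^sup>2"
      proof (cases "l < m")
        case True then show ?thesis using xv by simp
      next
        case False
        then show ?thesis using l by (intro mult_right_mono lh_le) auto
      qed
    qed
    also have "\<dots> = lh m * inner_n n x x" unfolding pars sum_distrib_left ..
    finally have "(\<Sum>l<n. lh l * (inner_n n x (v l))\<^sup>2) \<le> lh m * inner_n n x x" .
    with 1 qA[of x] qA2[of x] E[of x] have "(lam m - h) * inner_n n x x \<le> lh m * inner_n n x x"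
      by (simp add: left_diff_distrib abs_le_iff)
    then show ?thesis using xpos by simp
  qed
  moreover have "lh m \<le> lam m + h"
  proof -
    obtain c where c: "\<exists>l\<in>{..m}. c l \<noteq> 0" "\<And>i. i < m \<Longrightarrow> (\<Sum>l\<le>m. inner_n n (v l) (u i) * c l) = 0"
      using homogeneous_system_solution[of "{..<m}" "{..m}" "\<lambda>i l. inner_n n (v l) (u i)"] by auto
    define x where "x i = (\<Sum>l\<le>m. c l * v l i)" for i
    have xx: "inner_n n x x = (\<Sum>l\<le>m. (c l)\<^sup>2)"
      unfolding x_def[abs_def] by (rule orthonormal_lc_norm) (use v m dn in auto)
    have xpos: "inner_n n x x > 0" using c(1) unfolding xx
      by (metis finite_atMost sum_pos2 zero_le_power2 zero_less_power2)
    have xu: "inner_n n (u i) x = 0" if "i < m" for i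
      unfolding x_def[abs_def] inner_n_lc_right using c(2)[OF that] by (simp add: mult.commute inner_n_commute)
    have xv: "inner_n n x (v l) = (if l \<le> m then c l else 0)" if "l < n" for l
    proof (cases "l \<le> m")
      case True
      then show ?thesis unfolding x_def[abs_def]
        by (subst orthonormal_lc_self) (use v m dn in auto)
    next
      case False
      then show ?thesis unfolding x_def[abs_def] inner_n_lc_left using v m dn that by auto
    qed
    have "(\<Sum>l<n. lh l * (inner_n n x (v l))\<^sup>2) = (\<Sum>l\<le>m. lh l * (c l)\<^sup>2)"
      by (rule sum.mono_neutral_cong_right) (use xv m dn in auto)
    also have "\<dots> \<ge> (\<Sum>l\<le>m. lh m * (c l)\<^sup>2)"
      by (intro sum_mono mult_right_mono lh_le) (use m dn in auto)
    finally have 1: "(\<Sum>l<n. lh l * (inner_n n x (v l))\<^sup>2) \<ge> lh m * inner_n n x x"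
      unfolding xx sum_distrib_left .
    have "(\<Sum>l<d. lam l * (inner_n n (u l) x)\<^sup>2) \<le> (\<Sum>l<d. lam m * (inner_n n (u l) x)\<^sup>2)"
    proof (intro sum_mono)
      fix l assume l: "l \<in> {..<d}"
      show "lam l * (inner_n n (u l) x)\<^sup>2 \<le> lam m * (inner_n n (u l) x)\<^sup>2"
      proof (cases "l < m")
        case True then show ?thesis using xu by simp
      next
        case False
        then show ?thesis using l by (intro mult_right_mono lam_le) auto
      qed
    qed
    \<comment> \<open>Positivity of \<open>lam m\<close> enters here: Bessel controls only the part
      of \<open>x\<close> inside the span of the \<open>u l\<close>, and P annihilates the
      rest.\<close>
    also have "\<dots> \<le> lam m * inner_n n x x" unfolding sum_distrib_left[symmetric]
      using m Bessel_inequality[of "{..<d}" n u x] u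
      by (intro mult_left_mono) (auto simp: inner_n_commute)
    finally have "(\<Sum>l<d. lam l * (inner_n n (u l) x)\<^sup>2) \<le> lam m * inner_n n x x" .
    with 1 qA[of x] qA2[of x] E[of x] have "lh m * inner_n n x x \<le> (lam m + h) * inner_n n x x"
      by (simp add: distrib_right abs_le_iff)
    then show ?thesis using xpos by simp
  qed
  ultimately show ?thesis by simp
qed

text \<open>Negative eigenvalues are positive eigenvalues of the negated matrix. With signs flipped
  and all lists reversed, \<open>Weyl_positive\<close> applies at position
  \<open>d - 1 - m\<close>.\<close>

lemma Weyl_selidx:
  assumes E: "\<And>x. \<bar>inner_n n x (mv n E x)\<bar> \<le> h * inner_n n x x"
    and v: "\<And>m m'. m < n \<Longrightarrow> m' < n \<Longrightarrow> inner_n n (v m) (v m') = (if m = m' then 1 else 0)"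
    and eig: "\<And>m i. m < n \<Longrightarrow> i < n \<Longrightarrow> mv n (\<lambda>i j. lowrank d lam u i j + E i j) (v m) i = lh m * v m i"
    and lh: "\<And>m. Suc m < n \<Longrightarrow> lh (Suc m) \<le> lh m"
    and u: "\<And>m m'. m < d \<Longrightarrow> m' < d \<Longrightarrow> inner_n n (u m) (u m') = (if m = m' then 1 else 0)"
    and lam: "\<And>m. Suc m < d \<Longrightarrow> lam (Suc m) \<le> lam m"
    and pos: "\<And>m. m < p \<Longrightarrow> lam m > 0" and neg: "\<And>m. p \<le> m \<Longrightarrow> m < d \<Longrightarrow> lam m < 0"
    and m: "m < d" and dn: "d \<le> n"
  shows "\<bar>lh (selidx n d p m) - lam m\<bar> \<le> h"
proof (cases "m < p")
  case True
  then show ?thesis using Weyl_positive[OF E v eig lh u lam m _ dn] pos by (simp add: selidx_def)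
next
  case False
  define E' where "E' i j = - E i j" for i j
  define v' where "v' i = v (n - 1 - i)" for i
  define lh' where "lh' i = - lh (n - 1 - i)" for i
  define u' where "u' i = u (d - 1 - i)" for i
  define lam' where "lam' i = - lam (d - 1 - i)" for i
  define m' where "m' = d - 1 - m"
  have lr: "lowrank d lam' u' i j = - lowrank d lam u i j" for i j
    unfolding lowrank_def lam'_def u'_def sum_negf[symmetric]
    by (rule sum.reindex_bij_witness[of _ "\<lambda>i. d - 1 - i" "\<lambda>i. d - 1 - i"]) auto
  have "\<bar>lh' m' - lam' m'\<bar> \<le> h"
  proof (rule Weyl_positive[where E = E' and v = v' and u = u' and n = n and d = d])
    show "\<bar>inner_n n x (mv n E' x)\<bar> \<le> h * inner_n n x x" for x
    proof -
      have "inner_n n x (mv n E' x) = - inner_n n x (mv n E x)"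
        by (simp add: inner_n_def mv_def E'_def sum_negf)
      then show ?thesis using E[of x] by simp
    qed
    show "inner_n n (v' m) (v' m') = (if m = m' then 1 else 0)" if "m < n" "m' < n" for m m'
      unfolding v'_def using that by (subst v) auto
    show "inner_n n (u' m) (u' m') = (if m = m' then 1 else 0)" if "m < d" "m' < d" for m m'
      unfolding u'_def using that by (subst u) auto
    show "mv n (\<lambda>i j. lowrank d lam' u' i j + E' i j) (v' m) i = lh' m * v' m i" if "m < n" "i < n" for m i
    proof -
      have "mv n (\<lambda>i j. lowrank d lam' u' i j + E' i j) (v' m) i
          = - mv n (\<lambda>i j. lowrank d lam u i j + E i j) (v (n - 1 - m)) i"
        unfolding mv_def lr E'_def v'_def sum_negf[symmetric] by (simp add: algebra_simps)
      then show ?thesis using eig[of "n - 1 - m" i] that by (simp add: lh'_def v'_def)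
    qed
    show "lh' (Suc m) \<le> lh' m" if "Suc m < n" for m
      using lh[of "n - 1 - Suc m"] that by (simp add: lh'_def Suc_diff_Suc)
    show "lam' (Suc m) \<le> lam' m" if "Suc m < d" for m
      using lam[of "d - 1 - Suc m"] that by (simp add: lam'_def Suc_diff_Suc)
    show "m' < d" using m by (simp add: m'_def)
    show "lam' m' > 0" using neg[of m] m False by (simp add: lam'_def m'_def)
  qed (rule dn)
  moreover have "lh' m' = - lh (selidx n d p m)"
  proof -
    \<comment> \<open>Reversal happens in a list of length \<open>d\<close> for P but of length
      \<open>n\<close> for A; the mismatch produces exactly the offset \<open>n - d\<close> in
      \<open>selidx\<close>.\<close>
    have "n - 1 - (d - 1 - m) = n - d + m" using m dn by linarith
    then show ?thesis using False by (simp add: lh'_def m'_def selidx_def)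
  qed
  moreover have "lam' m' = - lam m" using m by (simp add: lam'_def m'_def)
  ultimately show ?thesis by linarith
qed

section \<open>Operator norm from the trace of a high power\<close>

lemma funpow_mv_sym:
  assumes "\<And>i j. i < n \<Longrightarrow> j < n \<Longrightarrow> E i j = E j i"
  shows "inner_n n x ((mv n E ^^ r) y) = inner_n n ((mv n E ^^ r) x) y"
proof (induction r arbitrary: x)
  case (Suc r)
  have "inner_n n x ((mv n E ^^ Suc r) y) = inner_n n (mv n E x) ((mv n E ^^ r) y)"
    using inner_mv_sym[OF assms] by simp
  then show ?case using Suc[of "mv n E x"] by (simp add: funpow_swap1)
qed simp

lemma funpow_mv_matrix:
  "i < n \<Longrightarrow> (mv n E ^^ r) x i = (\<Sum>j<n. (mv n E ^^ r) (\<lambda>l. if l = j then 1 else 0) i * x j)"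
proof (induction r arbitrary: i)
  case 0
  have "(\<Sum>j<n. (if i = j then 1 else 0) * x j) = (\<Sum>j<n. if i = j then x j else 0)"
    by (intro sum.cong) auto
  then show ?case using 0 by simp
next
  case (Suc r)
  have "(mv n E ^^ Suc r) x i = (\<Sum>l<n. E i l * (\<Sum>j<n. (mv n E ^^ r) (\<lambda>l. if l = j then 1 else 0) l * x j))"
    unfolding funpow.simps comp_apply mv_def[of n E "(mv n E ^^ r) x"] using Suc.IH by (intro sum.cong) auto
  also have "\<dots> = (\<Sum>j<n. (\<Sum>l<n. E i l * (mv n E ^^ r) (\<lambda>l. if l = j then 1 else 0) l) * x j)"
    unfolding sum_distrib_left sum_distrib_right by (subst sum.swap) (simp add: mult.assoc)
  finally show ?case by (simp add: mv_def[of n E "(mv n E ^^ r) _"])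
qed

text \<open>The operator norm of \<open>E^r\<close> is at most its Frobenius norm, whose square is
  the trace of \<open>E^(2r)\<close> by symmetry. A trace contains no supremum over
  \<open>x\<close>, so its expectation can be computed.\<close>

lemma funpow_mv_Frobenius:
  assumes "\<And>i j. i < n \<Longrightarrow> j < n \<Longrightarrow> E i j = E j i"
  shows "inner_n n ((mv n E ^^ r) x) ((mv n E ^^ r) x)
    \<le> (\<Sum>j<n. (mv n E ^^ (2 * r)) (\<lambda>l. if l = j then 1 else 0) j) * inner_n n x x"
proof -
  let ?e = "\<lambda>j l. if l = j then 1 else 0 :: real"
  have "inner_n n ((mv n E ^^ r) x) ((mv n E ^^ r) x) = (\<Sum>i<n. (\<Sum>j<n. (mv n E ^^ r) (?e j) i * x j)\<^sup>2)"
    unfolding inner_n_def power2_eq_square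
    by (intro sum.cong refl) (use funpow_mv_matrix[of _ n r E x] in auto)
  also have "\<dots> \<le> (\<Sum>i<n. (\<Sum>j<n. ((mv n E ^^ r) (?e j) i)\<^sup>2) * inner_n n x x)"
    by (intro sum_mono) (use Cauchy_Schwarz_ineq_sum[of _ x "{..<n}"] in \<open>auto simp: inner_n_def power2_eq_square\<close>)
  also have "\<dots> = (\<Sum>j<n. inner_n n ((mv n E ^^ r) (?e j)) ((mv n E ^^ r) (?e j))) * inner_n n x x"
    unfolding sum_distrib_right[symmetric] by (subst sum.swap) (simp add: inner_n_def power2_eq_square)
  also have "(\<Sum>j<n. inner_n n ((mv n E ^^ r) (?e j)) ((mv n E ^^ r) (?e j)))
      = (\<Sum>j<n. (mv n E ^^ (2 * r)) (?e j) j)"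
  proof (intro sum.cong refl)
    fix j assume j: "j \<in> {..<n}"
    have "inner_n n ((mv n E ^^ r) (?e j)) ((mv n E ^^ r) (?e j)) = inner_n n (?e j) ((mv n E ^^ r) ((mv n E ^^ r) (?e j)))"
      by (rule funpow_mv_sym[OF assms, symmetric])
    also have "(mv n E ^^ r) ((mv n E ^^ r) (?e j)) = (mv n E ^^ (2 * r)) (?e j)"
      by (simp add: funpow_add mult_2)
    also have "inner_n n (?e j) ((mv n E ^^ (2 * r)) (?e j)) = (\<Sum>l<n. if l = j then (mv n E ^^ (2 * r)) (?e j) l else 0)"
      unfolding inner_n_def by (intro sum.cong) auto
    also have "\<dots> = (mv n E ^^ (2 * r)) (?e j) j" using j by simp
    finally show "inner_n n ((mv n E ^^ r) (?e j)) ((mv n E ^^ r) (?e j)) = (mv n E ^^ (2 * r)) (?e j) j" .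
  qed
  finally show ?thesis .
qed

text \<open>Log-convexity of the norms of the iterates transfers a bound on a high power to the matrix itself.\<close>

lemma mv_norm_power_le:
  assumes "\<And>i j. i < n \<Longrightarrow> j < n \<Longrightarrow> E i j = E j i"
  shows "(inner_n n (mv n E x) (mv n E x)) ^ (2 ^ s)
    \<le> inner_n n x x ^ (2 ^ s - 1) * inner_n n ((mv n E ^^ (2 ^ s)) x) ((mv n E ^^ (2 ^ s)) x)"
proof (induction s)
  case (Suc s)
  let ?N = "inner_n n x x"
  define Q where "Q r = inner_n n ((mv n E ^^ r) x) ((mv n E ^^ r) x)" for r
  have Qeq: "Q r = inner_n n x ((mv n E ^^ (r + r)) x)" for r
    unfolding Q_def funpow_add comp_apply by (rule funpow_mv_sym[OF assms, symmetric])
  have "(Q 1) ^ (2 ^ Suc s) = ((Q 1) ^ (2 ^ s))\<^sup>2"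
    by (simp only: power_Suc2 power_mult)
  also have "\<dots> \<le> (?N ^ (2 ^ s - 1) * Q (2 ^ s))\<^sup>2"
    by (intro power_mono) (use Suc in \<open>auto simp: Q_def inner_n_nonneg\<close>)
  also have "\<dots> = (?N ^ (2 ^ s - 1))\<^sup>2 * (Q (2 ^ s))\<^sup>2" by (simp add: power_mult_distrib)
  \<comment> \<open>Cauchy-Schwarz between \<open>x\<close> and the iterate of order
    \<open>2 ^ Suc s\<close>; each use doubles the exponent, which is why only powers of two
    occur.\<close>
  also have "(Q (2 ^ s))\<^sup>2 \<le> ?N * Q (2 ^ Suc s)"
    using inner_n_Cauchy_Schwarz[of n x "(mv n E ^^ (2 ^ s + 2 ^ s)) x"] unfolding Qeq[of "2 ^ s"]
    by (simp add: Q_def mult_2)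
  also have "(?N ^ (2 ^ s - 1))\<^sup>2 * (?N * Q (2 ^ Suc s)) = ?N ^ (2 ^ Suc s - 1) * Q (2 ^ Suc s)"
  proof -
    have "(2::nat) ^ Suc s - 1 = (2 ^ s - 1) * 2 + 1" by (cases "(2::nat) ^ s") auto
    then show ?thesis by (simp only: power_add power_mult power_one_right mult.assoc)
  qed
  finally show ?case using inner_n_nonneg by (simp add: Q_def mult_left_mono)
qed simp

lemma mv_norm_le_of_trace:
  assumes sym: "\<And>i j. i < n \<Longrightarrow> j < n \<Longrightarrow> E i j = E j i"
    and tr: "(\<Sum>j<n. (mv n E ^^ (2 * 2 ^ s)) (\<lambda>l. if l = j then 1 else 0) j) \<le> h ^ (2 * 2 ^ s)"
    and h: "0 \<le> h"
  shows "inner_n n (mv n E x) (mv n E x) \<le> h\<^sup>2 * inner_n n x x"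
proof -
  let ?N = "inner_n n x x"
  have "(inner_n n (mv n E x) (mv n E x)) ^ (2 ^ s)
      \<le> ?N ^ (2 ^ s - 1) * inner_n n ((mv n E ^^ (2 ^ s)) x) ((mv n E ^^ (2 ^ s)) x)"
    by (rule mv_norm_power_le[OF sym])
  also have "\<dots> \<le> ?N ^ (2 ^ s - 1) * (h ^ (2 * 2 ^ s) * ?N)"
    by (intro mult_left_mono order_trans[OF funpow_mv_Frobenius[OF sym]] mult_right_mono tr)
       (auto simp: inner_n_nonneg)
  also have "\<dots> = (h\<^sup>2 * ?N) ^ (2 ^ s)"
    by (simp add: power_mult_distrib power_mult power_eq_if[of ?N "2 ^ s"])
  finally show ?thesis
    by (rule power_le_imp_le_base[where n = "2 ^ s - 1", simplified]) (auto simp: inner_n_nonneg)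
qed

section \<open>Moments of powers of a sparse random matrix\<close>

text \<open>Independence is assumed on and above the diagonal only, so both orientations of an edge
  must be read as the same random variable.\<close>

definition canon :: "nat \<times> nat \<Rightarrow> nat \<times> nat" where
  "canon e = (min (fst e) (snd e), max (fst e) (snd e))"

lemma canon_inj: "canon (x, z) = canon (x, z') \<Longrightarrow> z = z'"
  by (auto simp: canon_def min_def max_def split: if_splits)

text \<open>Collecting equal factors turns a product along a walk into a product over distinct
  edges, to which independence applies.\<close>

lemma prod_list_count:
  fixes f :: "'b \<Rightarrow> 'c::comm_monoid_mult"
  shows "prod_list (map f xs) = (\<Prod>x\<in>set xs. f x ^ count_list xs x)"
proof (induction xs)
  case (Cons a xs)
  have "(\<Prod>x\<in>set (a # xs). f x ^ count_list (a # xs) x) = f a * (\<Prod>x\<in>set xs. f x ^ count_list xs x)"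
  proof (cases "a \<in> set xs")
    case True
    then have "(\<Prod>x\<in>set xs. f x ^ count_list (a # xs) x)
        = f a ^ Suc (count_list xs a) * (\<Prod>x\<in>set xs - {a}. f x ^ count_list xs x)"
      by (subst prod.remove[of _ a]) (auto intro!: prod.cong arg_cong2[of _ _ _ _ "(*)"] split: if_splits)
    also have "\<dots> = f a * (\<Prod>x\<in>set xs. f x ^ count_list xs x)"
      using True by (subst (2) prod.remove[of _ a]) (auto simp: mult.assoc)
    finally show ?thesis using True by (simp add: insert_absorb)
  next
    case False
    then show ?thesis by (auto intro!: prod.cong arg_cong2[of _ _ _ _ "(*)"] simp: count_notin)
  qed
  then show ?case using Cons by simp
qed simp

locale sparse_noise =
  fixes M :: "nat \<Rightarrow> 'a measure"
    and E :: "nat \<Rightarrow> 'a \<Rightarrow> nat \<Rightarrow> nat \<Rightarrow> real"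
    and N0 :: nat and rho qn :: "nat \<Rightarrow> real" and eps C A0 :: real
  assumes prob: "\<And>n. prob_space (M n)"
    and Emeas: "\<And>n i j. (\<lambda>\<omega>. E n \<omega> i j) \<in> borel_measurable (M n)"
    and Esym: "\<And>n \<omega> i j. \<omega> \<in> space (M n) \<Longrightarrow> i < n \<Longrightarrow> j < n \<Longrightarrow> E n \<omega> i j = E n \<omega> j i"
    and Eindep: "\<And>n. n \<ge> N0 \<Longrightarrow> prob_space.indep_vars (M n) (\<lambda>_. borel)
                   (\<lambda>(i, j) \<omega>. E n \<omega> i j) {(i, j). i \<le> j \<and> j < n}"
    and Emean: "\<And>n i j. n \<ge> N0 \<Longrightarrow> i < n \<Longrightarrow> j < n \<Longrightarrow>
                 integrable (M n) (\<lambda>\<omega>. E n \<omega> i j) \<and> integral\<^sup>L (M n) (\<lambda>\<omega>. E n \<omega> i j) = 0"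
    and rho: "\<And>n. n \<ge> N0 \<Longrightarrow> 0 < rho n \<and> rho n \<le> 1"
    and params: "0 < eps" "eps \<le> 1/2" "C > 0" "A0 \<ge> 11"
    and qn: "\<And>n. n \<ge> N0 \<Longrightarrow> real n powr eps \<le> qn n \<and> qn n \<le> sqrt (real n)"
    and Evar: "\<And>n i j. n \<ge> N0 \<Longrightarrow> i < n \<Longrightarrow> j < n \<Longrightarrow>
                  integrable (M n) (\<lambda>\<omega>. (E n \<omega> i j)\<^sup>2) \<and>
                  integral\<^sup>L (M n) (\<lambda>\<omega>. (E n \<omega> i j)\<^sup>2) \<le> C * rho n"
    and Emom: "\<And>n i j r. n \<ge> N0 \<Longrightarrow> i < n \<Longrightarrow> j < n \<Longrightarrow> 3 \<le> r \<Longrightarrow>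
                  real r \<le> (2 * ln (real n)) powr (A0 * ln (ln (real n))) \<Longrightarrow>
                  integrable (M n) (\<lambda>\<omega>. \<bar>E n \<omega> i j\<bar> ^ r) \<and>
                  integral\<^sup>L (M n) (\<lambda>\<omega>. \<bar>E n \<omega> i j\<bar> ^ r)
                    \<le> C ^ r * (real n * rho n) powr (real r / 2) / (real n * qn n ^ (r - 2))"
begin

text \<open>Being at least 1, this constant has increasing powers; in particular \<open>C\<close> is
  below \<open>C'\<close> squared, so the variance bound takes the same form as the higher
  moments.\<close>

definition C' :: real where "C' = max 1 C"
definition snr :: "nat \<Rightarrow> real" where "snr n = sqrt (real n * rho n)"
text \<open>The highest moment that (A3) provides. It outgrows every multiple of
  \<open>ln n\<close>, so Markov's inequality may be used with exponents of logarithmic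
  order.\<close>

definition max_mom :: "nat \<Rightarrow> real" where
  "max_mom n = (2 * ln (real n)) powr (A0 * ln (ln (real n)))"

lemma C'_ge: "1 \<le> C'" "C \<le> C'" "0 < C'" by (auto simp: C'_def)

lemma snr_pos: "n \<ge> N0 \<Longrightarrow> 0 < n \<Longrightarrow> 0 < snr n"
  using rho[of n] by (simp add: snr_def)

lemma snr_sq: "n \<ge> N0 \<Longrightarrow> (snr n)\<^sup>2 = real n * rho n"
  using rho[of n] by (simp add: snr_def)

lemma qn_ge_1: "n \<ge> N0 \<Longrightarrow> 0 < n \<Longrightarrow> 1 \<le> qn n"
  using qn[of n] params ge_one_powr_ge_zero[of "real n" eps] by linarith

lemma qn_sq_le: "n \<ge> N0 \<Longrightarrow> 0 < n \<Longrightarrow> (qn n)\<^sup>2 \<le> real n"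
  using qn[of n] qn_ge_1[of n] power_mono[of "qn n" "sqrt (real n)" 2] by simp

lemma powr_half_snr:
  assumes "n \<ge> N0" "0 < n"
  shows "(real n * rho n) powr (real r / 2) = snr n ^ r"
proof -
  have "real n * rho n = (snr n) powr 2"
    using snr_sq[OF assms(1)] snr_pos[OF assms] by (simp add: powr_numeral)
  then have "(real n * rho n) powr (real r / 2) = (snr n) powr (real r)"
    by (simp add: powr_powr)
  then show ?thesis using snr_pos[OF assms] by (simp add: powr_realpow)
qed

lemma abs_moment:
  assumes "n \<ge> N0" "i < n" "j < n" "2 \<le> r" "real r \<le> max_mom n"
  shows "integrable (M n) (\<lambda>\<omega>. \<bar>E n \<omega> i j\<bar> ^ r)"
    and "integral\<^sup>L (M n) (\<lambda>\<omega>. \<bar>E n \<omega> i j\<bar> ^ r) \<le> (C' * snr n) ^ r / (real n * qn n ^ (r - 2))"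
proof -
  have n: "0 < n" using assms by simp
  have s: "0 < snr n" using snr_pos[OF assms(1) n] .
  have "integrable (M n) (\<lambda>\<omega>. \<bar>E n \<omega> i j\<bar> ^ r)
    \<and> integral\<^sup>L (M n) (\<lambda>\<omega>. \<bar>E n \<omega> i j\<bar> ^ r) \<le> (C' * snr n) ^ r / (real n * qn n ^ (r - 2))"
  proof (cases "r = 2")
    case True
    have "C * rho n \<le> (C' * snr n) ^ 2 / real n"
    proof -
      have "(C' * snr n) ^ 2 / real n = C'\<^sup>2 * rho n"
        using n snr_sq[OF assms(1)] by (simp add: power_mult_distrib)
      moreover have "C \<le> C'\<^sup>2" using C'_ge self_le_power[of C' 2] by simp
      ultimately show ?thesis using rho[OF assms(1)] by (simp add: mult_right_mono)
    qed
    then show ?thesis using Evar[OF assms(1-3)] True by auto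
  next
    case False
    then have r: "3 \<le> r" using assms by simp
    have "C ^ r * (real n * rho n) powr (real r / 2) / (real n * qn n ^ (r - 2))
       \<le> (C' * snr n) ^ r / (real n * qn n ^ (r - 2))"
      unfolding powr_half_snr[OF assms(1) n] power_mult_distrib
      by (intro divide_right_mono mult_right_mono power_mono)
         (use s params C'_ge qn_ge_1[OF assms(1) n] n in auto)
    then show ?thesis using Emom[OF assms(1-3) r] assms(5) unfolding max_mom_def by auto
  qed
  then show "integrable (M n) (\<lambda>\<omega>. \<bar>E n \<omega> i j\<bar> ^ r)"
    "integral\<^sup>L (M n) (\<lambda>\<omega>. \<bar>E n \<omega> i j\<bar> ^ r) \<le> (C' * snr n) ^ r / (real n * qn n ^ (r - 2))" by auto
qed

text \<open>Centring extends the bound to \<open>r = 1\<close>, where the left side is zero. The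
  powers of \<open>qn n\<close> are discarded: each distinct edge keeps just the factor
  \<open>1 / n\<close> that the walk count consumes.\<close>

lemma signed_moment:
  assumes "n \<ge> N0" "i < n" "j < n" "1 \<le> r" "real r \<le> max_mom n"
  shows "integrable (M n) (\<lambda>\<omega>. E n \<omega> i j ^ r)"
    and "\<bar>integral\<^sup>L (M n) (\<lambda>\<omega>. E n \<omega> i j ^ r)\<bar> \<le> (C' * snr n) ^ r / real n"
proof -
  have n: "0 < n" using assms by simp
  have s: "0 < snr n" using snr_pos[OF assms(1) n] .
  have "integrable (M n) (\<lambda>\<omega>. E n \<omega> i j ^ r) \<and>
     \<bar>integral\<^sup>L (M n) (\<lambda>\<omega>. E n \<omega> i j ^ r)\<bar> \<le> (C' * snr n) ^ r / real n"
  proof (cases "r = 1")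
    case True then show ?thesis using Emean[OF assms(1-3)] s C'_ge by simp
  next
    case False
    then have r: "2 \<le> r" using assms by simp
    note m = abs_moment[OF assms(1-3) r assms(5)]
    have int: "integrable (M n) (\<lambda>\<omega>. E n \<omega> i j ^ r)"
      by (rule Bochner_Integration.integrable_bound[OF m(1)])
         (auto simp: power_abs intro!: borel_measurable_power Emeas)
    have "\<bar>integral\<^sup>L (M n) (\<lambda>\<omega>. E n \<omega> i j ^ r)\<bar> \<le> integral\<^sup>L (M n) (\<lambda>\<omega>. \<bar>E n \<omega> i j\<bar> ^ r)"
      using integral_abs_bound[of "M n" "\<lambda>\<omega>. E n \<omega> i j ^ r"] by (simp add: power_abs)
    also note m(2)
    also have "(C' * snr n) ^ r / (real n * qn n ^ (r - 2)) \<le> (C' * snr n) ^ r / real n"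
      using n s C'_ge one_le_power[OF qn_ge_1[OF assms(1) n], of "r - 2"]
      by (intro divide_left_mono) auto
    finally show ?thesis using int by simp
  qed
  then show "integrable (M n) (\<lambda>\<omega>. E n \<omega> i j ^ r)"
    "\<bar>integral\<^sup>L (M n) (\<lambda>\<omega>. E n \<omega> i j ^ r)\<bar> \<le> (C' * snr n) ^ r / real n" by auto
qed

definition monomial :: "nat \<Rightarrow> (nat \<times> nat) list \<Rightarrow> 'a \<Rightarrow> real" where
  "monomial n es \<omega> = prod_list (map (\<lambda>e. E n \<omega> (fst e) (snd e)) es)"

lemma monomial_canon:
  assumes "\<omega> \<in> space (M n)" "\<And>e. e \<in> set es \<Longrightarrow> fst e < n \<and> snd e < n"
  shows "monomial n es \<omega> = monomial n (map canon es) \<omega>"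
  unfolding monomial_def map_map comp_def
  by (intro arg_cong[of _ _ prod_list] map_cong refl)
     (use assms Esym in \<open>auto simp: canon_def min_def max_def\<close>)

text \<open>An edge of multiplicity one kills the expectation, so the moment bound
  holds for all multiplicities and each distinct edge contributes a factor 1/n.\<close>

lemma monomial_expectation:
  assumes n: "n \<ge> N0" and es: "\<And>e. e \<in> set es \<Longrightarrow> fst e < n \<and> snd e < n"
    and len: "real (length es) \<le> max_mom n"
  shows "integrable (M n) (monomial n es)"
    and "\<bar>integral\<^sup>L (M n) (monomial n es)\<bar> \<le> (C' * snr n) ^ length es / real n ^ card (canon ` set es)"
proof -
  interpret prob_space "M n" by (rule prob)
  define ec where "ec = map canon es"
  define P where "P = {(i, j). i \<le> j \<and> j < n}"
  have sub: "set ec \<subseteq> P" using es by (fastforce simp: ec_def P_def canon_def)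
  define X where "X = (\<lambda>e \<omega>. (E n \<omega> (fst e) (snd e)) ^ count_list ec e)"
  have mon: "monomial n ec \<omega> = (\<Prod>e\<in>set ec. X e \<omega>)" for \<omega>
    unfolding monomial_def X_def by (rule prod_list_count)
  have "indep_vars (\<lambda>_. borel) (\<lambda>(i, j) \<omega>. E n \<omega> i j) (set ec)"
    by (rule indep_vars_subset[OF _ sub]) (use Eindep[OF n] in \<open>simp add: P_def\<close>)
  then have "indep_vars (\<lambda>_. borel) (\<lambda>e \<omega>. (\<lambda>x. x ^ count_list ec e) ((\<lambda>(i, j) \<omega>. E n \<omega> i j) e \<omega>)) (set ec)"
    by (rule indep_vars_compose2) auto
  then have ind: "indep_vars (\<lambda>_. borel) X (set ec)"
    by (simp add: X_def case_prod_beta)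
  have cnt: "1 \<le> count_list ec e" "real (count_list ec e) \<le> max_mom n" if "e \<in> set ec" for e
  proof -
    show "1 \<le> count_list ec e" using that count_list_0_iff[of ec e] by linarith
    have "count_list ec e \<le> length ec" by (rule count_le_length)
    then show "real (count_list ec e) \<le> max_mom n" using len by (simp add: ec_def)
  qed
  have lt: "fst e < n" "snd e < n" if "e \<in> set ec" for e using sub that by (auto simp: P_def)
  have X: "integrable (M n) (X e)" "\<bar>integral\<^sup>L (M n) (X e)\<bar> \<le> (C' * snr n) ^ count_list ec e / real n"
    if "e \<in> set ec" for e
    unfolding X_def using signed_moment[OF n lt[OF that] cnt[OF that]] by auto
  have "integrable (M n) (monomial n ec)"
    unfolding mon[abs_def] by (rule indep_vars_integrable[OF _ ind X(1)]) auto
  then show "integrable (M n) (monomial n es)"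
    by (subst Bochner_Integration.integrable_cong[OF refl]) (auto simp: ec_def intro!: monomial_canon es)
  have "integral\<^sup>L (M n) (monomial n es) = integral\<^sup>L (M n) (monomial n ec)"
    by (rule Bochner_Integration.integral_cong) (auto simp: ec_def intro!: monomial_canon es)
  also have "\<dots> = (\<Prod>e\<in>set ec. integral\<^sup>L (M n) (X e))"
    unfolding mon[abs_def] by (rule indep_vars_lebesgue_integral[OF _ ind X(1)]) auto
  also have "\<bar>\<dots>\<bar> = (\<Prod>e\<in>set ec. \<bar>integral\<^sup>L (M n) (X e)\<bar>)" by (rule abs_prod)
  also have "\<dots> \<le> (\<Prod>e\<in>set ec. (C' * snr n) ^ count_list ec e / real n)"
    by (intro prod_mono) (use X(2) in auto)
  also have "\<dots> = (C' * snr n) ^ length es / real n ^ card (canon ` set es)"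
    by (simp add: prod_dividef power_sum[symmetric] sum_count_set ec_def)
  finally show "\<bar>integral\<^sup>L (M n) (monomial n es)\<bar> \<le> (C' * snr n) ^ length es / real n ^ card (canon ` set es)" .
qed

text \<open>An entry \<open>(x, r)\<close> stands for a walker at vertex \<open>x\<close> that still
  has \<open>r\<close> steps to go. Unfolding one step moves an edge from \<open>walkers\<close> to
  \<open>monomial\<close>.\<close>

definition walkers :: "nat \<Rightarrow> (nat \<Rightarrow> real) \<Rightarrow> (nat \<times> nat) list \<Rightarrow> 'a \<Rightarrow> real" where
  "walkers n y ws \<omega> = prod_list (map (\<lambda>w. (mv n (E n \<omega>) ^^ snd w) y (fst w)) ws)"

text \<open>For fixed \<open>x\<close> the edge \<open>canon (x, z)\<close> determines
  \<open>z\<close>, so at most \<open>card S\<close> endpoints reuse an edge of \<open>S\<close>.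
  The others, at most \<open>n\<close> of them, each pay a factor \<open>1 / n\<close>.\<close>

lemma sum_new_edge:
  assumes "finite S" "0 < n"
  shows "(\<Sum>z<n. 1 / real n ^ card (insert (canon (x, z)) S)) \<le> (real (card S) + 1) / real n ^ card S"
proof -
  define B where "B = {z. z < n \<and> canon (x, z) \<in> S}"
  have fB: "finite B" by (simp add: B_def)
  have cB: "card B \<le> card S"
    by (rule card_inj_on_le[of "\<lambda>z. canon (x, z)"]) (auto simp: B_def inj_on_def assms dest: canon_inj)
  have "(\<Sum>z<n. 1 / real n ^ card (insert (canon (x, z)) S))
     = (\<Sum>z\<in>B. 1 / real n ^ card S) + (\<Sum>z\<in>{..<n} - B. 1 / real n ^ Suc (card S))"
  proof -
    have "(\<Sum>z<n. 1 / real n ^ card (insert (canon (x, z)) S))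
       = (\<Sum>z\<in>B. 1 / real n ^ card (insert (canon (x, z)) S)) + (\<Sum>z\<in>{..<n} - B. 1 / real n ^ card (insert (canon (x, z)) S))"
      by (subst add.commute, rule sum.subset_diff) (auto simp: B_def)
    also have "(\<Sum>z\<in>B. 1 / real n ^ card (insert (canon (x, z)) S)) = (\<Sum>z\<in>B. 1 / real n ^ card S)"
      by (intro sum.cong) (auto simp: B_def insert_absorb)
    also have "(\<Sum>z\<in>{..<n} - B. 1 / real n ^ card (insert (canon (x, z)) S)) = (\<Sum>z\<in>{..<n} - B. 1 / real n ^ Suc (card S))"
      by (intro sum.cong) (auto simp: B_def assms)
    finally show ?thesis .
  qed
  also have "\<dots> \<le> real (card S) / real n ^ card S + real n / real n ^ Suc (card S)"
  proof (intro add_mono)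
    show "(\<Sum>z\<in>B. 1 / real n ^ card S) \<le> real (card S) / real n ^ card S"
      using cB by (simp add: divide_right_mono)
    have "card ({..<n} - B) \<le> n" using card_mono[of "{..<n}" "{..<n} - B"] by simp
    moreover have "(\<Sum>z\<in>{..<n} - B. 1 / real n ^ Suc (card S)) = real (card ({..<n} - B)) / real n ^ Suc (card S)"
      by simp
    ultimately show "(\<Sum>z\<in>{..<n} - B. 1 / real n ^ Suc (card S)) \<le> real n / real n ^ Suc (card S)"
      by (simp only:) (intro divide_right_mono, auto)
  qed
  also have "\<dots> = (real (card S) + 1) / real n ^ card S"
    using assms by (simp add: add_divide_distrib)
  finally show ?thesis .
qed

text \<open>Expanding one step of one walk exposes an edge: it is either one of the edges already present,
  which leaves boundedly many endpoints, or a new one, whose factor 1/n pays for the n choices.\<close>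

lemma walkers_expectation:
  assumes n: "n \<ge> N0" and y: "\<And>j. j < n \<Longrightarrow> \<bar>y j\<bar> \<le> b" and b: "0 \<le> b"
    and "\<And>e. e \<in> set es \<Longrightarrow> fst e < n \<and> snd e < n"
    and "\<And>w. w \<in> set ws \<Longrightarrow> fst w < n"
    and "T = length es + sum_list (map snd ws)" and "real T \<le> max_mom n"
  shows "integrable (M n) (\<lambda>\<omega>. monomial n es \<omega> * walkers n y ws \<omega>) \<and>
    \<bar>integral\<^sup>L (M n) (\<lambda>\<omega>. monomial n es \<omega> * walkers n y ws \<omega>)\<bar>
      \<le> real T ^ sum_list (map snd ws) * b ^ length ws * (C' * snr n) ^ T / real n ^ card (canon ` set es)"
  using assms(4-)
proof (induction ws arbitrary: es)
  case Nil
  then show ?case using monomial_expectation[OF n, of es] by (simp add: walkers_def)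
next
  case (Cons w ws)
  obtain x r where w: "w = (x, r)" by (cases w)
  \<comment> \<open>The outer induction runs over the walkers, the inner one over the remaining
    steps of the first walker. The edges exposed so far are handed on through
    \<open>es\<close>.\<close>
  have "integrable (M n) (\<lambda>\<omega>. monomial n es \<omega> * walkers n y ((x, r) # ws) \<omega>) \<and>
    \<bar>integral\<^sup>L (M n) (\<lambda>\<omega>. monomial n es \<omega> * walkers n y ((x, r) # ws) \<omega>)\<bar>
      \<le> real T ^ (r + sum_list (map snd ws)) * b ^ Suc (length ws) * (C' * snr n) ^ T / real n ^ card (canon ` set es)"
    if "x < n" "T = length es + r + sum_list (map snd ws)" "\<And>e. e \<in> set es \<Longrightarrow> fst e < n \<and> snd e < n" for r x es
    using that
  proof (induction r arbitrary: x es)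
    case 0
    let ?B = "real T ^ sum_list (map snd ws) * b ^ length ws * (C' * snr n) ^ T / real n ^ card (canon ` set es)"
    have T': "T = length es + sum_list (map snd ws)" using 0 by simp
    have ws: "fst w < n" if "w \<in> set ws" for w using Cons.prems(2) that by simp
    have IH: "integrable (M n) (\<lambda>\<omega>. monomial n es \<omega> * walkers n y ws \<omega>)"
      "\<bar>integral\<^sup>L (M n) (\<lambda>\<omega>. monomial n es \<omega> * walkers n y ws \<omega>)\<bar> \<le> ?B"
      using Cons.IH[of es, OF 0(3) ws T' Cons.prems(4)] by auto
    have eq: "monomial n es \<omega> * walkers n y ((x, 0) # ws) \<omega> = y x * (monomial n es \<omega> * walkers n y ws \<omega>)" for \<omega>
      by (simp add: walkers_def)
    have "\<bar>y x * integral\<^sup>L (M n) (\<lambda>\<omega>. monomial n es \<omega> * walkers n y ws \<omega>)\<bar> \<le> b * ?B"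
      unfolding abs_mult by (intro mult_mono IH y 0 b) auto
    then show ?case using IH(1) unfolding eq by (simp add: mult_ac)
  next
    case (Suc r)
    have n0: "0 < n" using Suc.prems by simp
    let ?F = "\<lambda>z \<omega>. monomial n ((x, z) # es) \<omega> * walkers n y ((z, r) # ws) \<omega>"
    let ?G = "r + sum_list (map snd ws)"
    let ?c = "real T ^ ?G * b ^ Suc (length ws) * (C' * snr n) ^ T"
    have c0: "0 \<le> ?c" using b C'_ge snr_pos[OF n n0] by (intro mult_nonneg_nonneg) auto
    have IH: "integrable (M n) (?F z)" "\<bar>integral\<^sup>L (M n) (?F z)\<bar> \<le> ?c / real n ^ card (canon ` set ((x, z) # es))"
      if z: "z < n" for z
    proof -
      have "fst e < n \<and> snd e < n" if "e \<in> set ((x, z) # es)" for e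
        using that z Suc.prems(1) Suc.prems(3)[of e] by auto
      moreover have "T = length ((x, z) # es) + r + sum_list (map snd ws)" using Suc.prems by simp
      ultimately show "integrable (M n) (?F z)" "\<bar>integral\<^sup>L (M n) (?F z)\<bar> \<le> ?c / real n ^ card (canon ` set ((x, z) # es))"
        using Suc.IH[of z "(x, z) # es", OF z] by auto
    qed
    have eq: "monomial n es \<omega> * walkers n y ((x, Suc r) # ws) \<omega> = (\<Sum>z<n. ?F z \<omega>)" for \<omega>
      by (simp add: monomial_def walkers_def mv_def[of n "E n \<omega>" "(mv n (E n \<omega>) ^^ r) y"] sum_distrib_left sum_distrib_right mult_ac)
    have int: "integrable (M n) (\<lambda>\<omega>. \<Sum>z<n. ?F z \<omega>)"
      by (rule Bochner_Integration.integrable_sum) (use IH in auto)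
    have "\<bar>integral\<^sup>L (M n) (\<lambda>\<omega>. \<Sum>z<n. ?F z \<omega>)\<bar> = \<bar>\<Sum>z<n. integral\<^sup>L (M n) (?F z)\<bar>"
      by (subst Bochner_Integration.integral_sum) (use IH in auto)
    also have "\<dots> \<le> (\<Sum>z<n. \<bar>integral\<^sup>L (M n) (?F z)\<bar>)" by (rule sum_abs)
    also have "\<dots> \<le> (\<Sum>z<n. ?c * (1 / real n ^ card (insert (canon (x, z)) (canon ` set es))))"
      by (intro sum_mono) (use IH(2) in simp)
    also have "\<dots> \<le> ?c * ((real (card (canon ` set es)) + 1) / real n ^ card (canon ` set es))"
      unfolding sum_distrib_left[symmetric] by (intro mult_left_mono sum_new_edge c0 n0) auto
    \<comment> \<open>A step is still outstanding, so fewer than \<open>T\<close> edges are exposed;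
      hence every step costs at most a factor \<open>T\<close>.\<close>
    also have "\<dots> \<le> ?c * (real T / real n ^ card (canon ` set es))"
    proof (intro mult_left_mono divide_right_mono c0)
      have "card (canon ` set es) \<le> length es"
        by (meson card_image_le card_length finite_set le_trans)
      then show "real (card (canon ` set es)) + 1 \<le> real T" using Suc.prems by simp
    qed simp
    finally show ?case using int unfolding eq by (simp add: mult_ac)
  qed
  moreover have "x < n" using Cons.prems(2)[of w] by (simp add: w)
  ultimately show ?case using Cons.prems by (simp add: w add.assoc)
qed

text \<open>All \<open>L\<close> walkers start at \<open>i\<close> and no edge is exposed yet. With
  \<open>L\<close> and \<open>r\<close> fixed the combinatorial factor is a constant, so moments of
  the iterate have the size \<open>b * snr n ^ r\<close> per factor: delocalisation of
  \<open>y\<close> survives multiplication by powers of E.\<close>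

lemma iterate_moment:
  assumes n: "n \<ge> N0" and i: "i < n" and y: "\<And>j. j < n \<Longrightarrow> \<bar>y j\<bar> \<le> b" and b: "0 \<le> b"
    and L: "real (L * r) \<le> max_mom n"
  shows "integrable (M n) (\<lambda>\<omega>. ((mv n (E n \<omega>) ^^ r) y i) ^ L)"
    and "\<bar>integral\<^sup>L (M n) (\<lambda>\<omega>. ((mv n (E n \<omega>) ^^ r) y i) ^ L)\<bar>
      \<le> real (L * r) ^ (L * r) * b ^ L * (C' * snr n) ^ (L * r)"
proof -
  have w: "monomial n [] \<omega> * walkers n y (replicate L (i, r)) \<omega> = ((mv n (E n \<omega>) ^^ r) y i) ^ L" for \<omega>
    by (simp add: monomial_def walkers_def)
  have "sum_list (map snd (replicate L (i, r))) = L * r"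
    by (simp add: sum_list_replicate)
  then show "integrable (M n) (\<lambda>\<omega>. ((mv n (E n \<omega>) ^^ r) y i) ^ L)"
    "\<bar>integral\<^sup>L (M n) (\<lambda>\<omega>. ((mv n (E n \<omega>) ^^ r) y i) ^ L)\<bar>
      \<le> real (L * r) ^ (L * r) * b ^ L * (C' * snr n) ^ (L * r)"
    using walkers_expectation[where y = y and es = "[]" and ws = "replicate L (i, r)" and T = "L * r", OF n y b] i L unfolding w by auto
qed

end

section \<open>Bernstein bounds for linear and square forms\<close>

lemma exp_le_quadratic: "\<bar>x\<bar> \<le> 1 \<Longrightarrow> exp x \<le> 1 + x + 2 * x\<^sup>2" for x :: real
proof -
  assume x: "\<bar>x\<bar> \<le> 1"
  obtain t where t: "\<bar>t\<bar> \<le> \<bar>x\<bar>" "exp x = (\<Sum>m<2. x ^ m / fact m) + exp t / fact 2 * x\<^sup>2"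
    using Maclaurin_exp_le[of x 2] by blast
  have "exp t \<le> 3" using t x exp_le exp_le_cancel_iff[of t 1] by linarith
  then have "exp t / 2 * x\<^sup>2 \<le> 2 * x\<^sup>2" by (intro mult_right_mono) auto
  then show ?thesis using t(2) by (simp add: numeral_2_eq_2)
qed

lemma tail_truncation:
  fixes x :: real
  assumes "0 < m" "1 \<le> r" "m < \<bar>x\<bar>"
  shows "\<bar>x\<bar> \<le> \<bar>x\<bar> ^ r / m ^ (r - 1)"
proof -
  obtain k where r: "r = Suc k" using assms by (cases r) auto
  have "m ^ k \<le> \<bar>x\<bar> ^ k" using assms by (intro power_mono) auto
  then have "\<bar>x\<bar> * m ^ k \<le> \<bar>x\<bar> * \<bar>x\<bar> ^ k" by (intro mult_left_mono) auto
  then show ?thesis using assms by (simp add: r field_simps)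
qed

text \<open>Large values are replaced by zero, not capped, so the truncated variable agrees with the
  original one unless the absolute value exceeds \<open>m\<close>.\<close>

definition trunc :: "real \<Rightarrow> real \<Rightarrow> real" where
  "trunc m x = (if \<bar>x\<bar> \<le> m then x else 0)"

lemma trunc_measurable [measurable]: "trunc m \<in> borel_measurable borel"
  unfolding trunc_def[abs_def] by measurable

context prob_space
begin

text \<open>Truncation destroys the mean zero, but the new mean is the negative of the discarded
  part, which the moment of order \<open>r\<close> bounds by \<open>m * exp (- r)\<close>. The
  division by \<open>exp 1\<close> in the moment hypothesis is what creates this exponential
  gain.\<close>

lemma truncated_mgf:
  assumes X: "integrable M X" "expectation X = 0" "integrable M (\<lambda>\<omega>. (X \<omega>)\<^sup>2)"
    and Xr: "integrable M (\<lambda>\<omega>. \<bar>X \<omega>\<bar> ^ r)" "expectation (\<lambda>\<omega>. \<bar>X \<omega>\<bar> ^ r) \<le> (m / exp 1) ^ r"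
    and m: "0 < m" "1 \<le> r" and th: "\<bar>\<theta>\<bar> * m \<le> 1"
  shows "expectation (\<lambda>\<omega>. exp (\<theta> * trunc m (X \<omega>)))
           \<le> exp (exp (- real r) + 2 * \<theta>\<^sup>2 * expectation (\<lambda>\<omega>. (X \<omega>)\<^sup>2))"
    and "integrable M (\<lambda>\<omega>. exp (\<theta> * trunc m (X \<omega>)))"
proof -
  have Xm[measurable]: "X \<in> borel_measurable M" using X by auto
  have b: "\<bar>\<theta> * trunc m x\<bar> \<le> 1" for x
  proof -
    have "\<bar>trunc m x\<bar> \<le> m" using m by (simp add: trunc_def)
    then have "\<bar>\<theta>\<bar> * \<bar>trunc m x\<bar> \<le> \<bar>\<theta>\<bar> * m" by (intro mult_left_mono) auto
    then show ?thesis using th by (simp add: abs_mult)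
  qed
  have int: "integrable M (\<lambda>\<omega>. trunc m (X \<omega>))"
  proof (rule integrable_const_bound[of _ m])
    show "AE \<omega> in M. norm (trunc m (X \<omega>)) \<le> m" using m by (auto simp: trunc_def)
  qed measurable
  have int2: "integrable M (\<lambda>\<omega>. (trunc m (X \<omega>))\<^sup>2)"
  proof (rule Bochner_Integration.integrable_bound[OF X(3)])
    show "AE \<omega> in M. norm ((trunc m (X \<omega>))\<^sup>2) \<le> norm ((X \<omega>)\<^sup>2)" by (auto simp: trunc_def)
  qed measurable
  show inte: "integrable M (\<lambda>\<omega>. exp (\<theta> * trunc m (X \<omega>)))"
  proof (rule integrable_const_bound[of _ "exp 1"])
    show "AE \<omega> in M. norm (exp (\<theta> * trunc m (X \<omega>))) \<le> exp 1"
      using b by (auto simp: abs_le_iff)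
  qed measurable
  have "\<bar>expectation (\<lambda>\<omega>. trunc m (X \<omega>))\<bar> \<le> m * exp (- real r)"
  proof -
    have "expectation (\<lambda>\<omega>. trunc m (X \<omega>)) = expectation (\<lambda>\<omega>. trunc m (X \<omega>) - X \<omega>)"
      using X int by (simp add: Bochner_Integration.integral_diff)
    also have "\<bar>\<dots>\<bar> \<le> expectation (\<lambda>\<omega>. \<bar>trunc m (X \<omega>) - X \<omega>\<bar>)" by (rule integral_abs_bound)
    also have "\<dots> \<le> expectation (\<lambda>\<omega>. \<bar>X \<omega>\<bar> ^ r / m ^ (r - 1))"
    proof (rule integral_mono)
      show "\<bar>trunc m (X \<omega>) - X \<omega>\<bar> \<le> \<bar>X \<omega>\<bar> ^ r / m ^ (r - 1)" for \<omega>
        using tail_truncation[OF m, of "X \<omega>"] m by (auto simp: trunc_def)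
    qed (use int X Xr in auto)
    also have "\<dots> = expectation (\<lambda>\<omega>. \<bar>X \<omega>\<bar> ^ r) / m ^ (r - 1)" by simp
    also have "\<dots> \<le> (m / exp 1) ^ r / m ^ (r - 1)" using Xr m by (intro divide_right_mono) auto
    also have "\<dots> = m * exp (- real r)"
    proof -
      have "m ^ r = m * m ^ (r - 1)" using m by (cases r) auto
      moreover have "exp 1 ^ r = exp (real r)" using exp_of_nat_mult[of r "1::real"] by simp
      ultimately show ?thesis using m by (simp add: power_divide exp_minus field_simps)
    qed
    finally show ?thesis .
  qed
  then have "\<bar>\<theta>\<bar> * \<bar>expectation (\<lambda>\<omega>. trunc m (X \<omega>))\<bar> \<le> \<bar>\<theta>\<bar> * (m * exp (- real r))"
    by (rule mult_left_mono) simp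
  then have "\<theta> * expectation (\<lambda>\<omega>. trunc m (X \<omega>)) \<le> \<bar>\<theta>\<bar> * (m * exp (- real r))"
    unfolding abs_mult[symmetric] by linarith
  also have "\<dots> \<le> exp (- real r)"
    using mult_right_mono[OF th, of "exp (- real r)"] by (simp only: mult.assoc mult_1 exp_ge_zero)
  finally have mean: "\<theta> * expectation (\<lambda>\<omega>. trunc m (X \<omega>)) \<le> exp (- real r)" .
  have sq: "expectation (\<lambda>\<omega>. (trunc m (X \<omega>))\<^sup>2) \<le> expectation (\<lambda>\<omega>. (X \<omega>)\<^sup>2)"
    by (rule integral_mono) (use int2 X in \<open>auto simp: trunc_def\<close>)
  have "expectation (\<lambda>\<omega>. exp (\<theta> * trunc m (X \<omega>)))
     \<le> expectation (\<lambda>\<omega>. 1 + \<theta> * trunc m (X \<omega>) + 2 * (\<theta> * trunc m (X \<omega>))\<^sup>2)"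
    by (rule integral_mono) (use int int2 inte exp_le_quadratic[OF b] in \<open>auto simp: power_mult_distrib\<close>)
  also have "\<dots> = 1 + \<theta> * expectation (\<lambda>\<omega>. trunc m (X \<omega>)) + 2 * \<theta>\<^sup>2 * expectation (\<lambda>\<omega>. (trunc m (X \<omega>))\<^sup>2)"
    using int int2 by (simp add: power_mult_distrib prob_space)
  also have "\<dots> \<le> 1 + exp (- real r) + 2 * \<theta>\<^sup>2 * expectation (\<lambda>\<omega>. (X \<omega>)\<^sup>2)"
    by (intro add_mono mean mult_left_mono sq) auto
  also have "\<dots> \<le> exp (exp (- real r) + 2 * \<theta>\<^sup>2 * expectation (\<lambda>\<omega>. (X \<omega>)\<^sup>2))"
    using exp_ge_add_one_self[of "exp (- real r) + 2 * \<theta>\<^sup>2 * expectation (\<lambda>\<omega>. (X \<omega>)\<^sup>2)"] by linarith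
  finally show "expectation (\<lambda>\<omega>. exp (\<theta> * trunc m (X \<omega>)))
           \<le> exp (exp (- real r) + 2 * \<theta>\<^sup>2 * expectation (\<lambda>\<omega>. (X \<omega>)\<^sup>2))" .
qed

text \<open>The first error term is the union bound for some variable being truncated, the second is
  Chernoff's bound on both sides for the truncated sum.\<close>

lemma Bernstein_truncated:
  assumes I: "finite I" and ind: "indep_vars (\<lambda>_. borel) X I"
    and X: "\<And>e. e \<in> I \<Longrightarrow> integrable M (X e)" "\<And>e. e \<in> I \<Longrightarrow> expectation (X e) = 0"
      "\<And>e. e \<in> I \<Longrightarrow> integrable M (\<lambda>\<omega>. (X e \<omega>)\<^sup>2)"
    and Xr: "\<And>e. e \<in> I \<Longrightarrow> integrable M (\<lambda>\<omega>. \<bar>X e \<omega>\<bar> ^ r)"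
      "\<And>e. e \<in> I \<Longrightarrow> expectation (\<lambda>\<omega>. \<bar>X e \<omega>\<bar> ^ r) \<le> (m / exp 1) ^ r"
    and V: "(\<Sum>e\<in>I. expectation (\<lambda>\<omega>. (X e \<omega>)\<^sup>2)) \<le> V\<^sup>2" "0 \<le> V"
    and m: "0 < m" "1 \<le> r" and r: "real (card I) * exp (- real r) \<le> 1"
  shows "prob {\<omega> \<in> space M. \<bar>\<Sum>e\<in>I. X e \<omega>\<bar> \<ge> t * (V + m)} \<le> real (card I) * exp (- real r) + 2 * exp (3 - t)"
proof -
  have Xm[measurable]: "X e \<in> borel_measurable M" if "e \<in> I" for e using X(1)[OF that] by auto
  have one_sided: "prob {\<omega> \<in> space M. \<sigma> * (\<Sum>e\<in>I. trunc m (X e \<omega>)) \<ge> t * (V + m)} \<le> exp (3 - t)"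
    if \<sigma>: "\<sigma> = 1 \<or> \<sigma> = -1" for \<sigma> :: real
  proof -
    \<comment> \<open>This parameter is not optimised: it gives an exponential tail in units of
      \<open>V + m\<close>, enough for deviations of logarithmic size. In the exponent 3, the
      truncated means contribute 1 and the variances 2.\<close>
    define \<theta> where "\<theta> = \<sigma> / (V + m)"
    have Vm: "0 < V + m" using V m by simp
    have th: "\<bar>\<theta>\<bar> * m \<le> 1" "\<bar>\<theta>\<bar> * V \<le> 1" using V m \<sigma> by (auto simp: \<theta>_def divide_simps)
    note mgf = truncated_mgf[OF X Xr m th(1)]
    have ind': "indep_vars (\<lambda>_. borel) (\<lambda>e \<omega>. (\<lambda>x. exp (\<theta> * trunc m x)) (X e \<omega>)) I"
      by (rule indep_vars_compose2[OF ind]) measurable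
    have expsum: "exp (\<theta> * (\<Sum>e\<in>I. trunc m (X e \<omega>))) = (\<Prod>e\<in>I. exp (\<theta> * trunc m (X e \<omega>)))" for \<omega>
      using I by (simp add: sum_distrib_left exp_sum)
    have inte: "integrable M (\<lambda>\<omega>. exp (\<theta> * (\<Sum>e\<in>I. trunc m (X e \<omega>))))"
      unfolding expsum by (rule indep_vars_integrable[OF I ind']) (use mgf(2) in auto)
    have "expectation (\<lambda>\<omega>. exp (\<theta> * (\<Sum>e\<in>I. trunc m (X e \<omega>))))
        = (\<Prod>e\<in>I. expectation (\<lambda>\<omega>. exp (\<theta> * trunc m (X e \<omega>))))"
      unfolding expsum by (rule indep_vars_lebesgue_integral[OF I ind']) (use mgf(2) in auto)
    also have "\<dots> \<le> (\<Prod>e\<in>I. exp (exp (- real r) + 2 * \<theta>\<^sup>2 * expectation (\<lambda>\<omega>. (X e \<omega>)\<^sup>2)))"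
      by (intro prod_mono conjI mgf(1) Bochner_Integration.integral_nonneg) auto
    also have "\<dots> = exp (\<Sum>e\<in>I. exp (- real r) + 2 * \<theta>\<^sup>2 * expectation (\<lambda>\<omega>. (X e \<omega>)\<^sup>2))"
      using I by (simp add: exp_sum)
    also have "(\<Sum>e\<in>I. exp (- real r) + 2 * \<theta>\<^sup>2 * expectation (\<lambda>\<omega>. (X e \<omega>)\<^sup>2))
        = real (card I) * exp (- real r) + 2 * \<theta>\<^sup>2 * (\<Sum>e\<in>I. expectation (\<lambda>\<omega>. (X e \<omega>)\<^sup>2))"
      by (simp add: sum.distrib sum_distrib_left)
    also have "exp \<dots> \<le> exp (1 + 2 * \<theta>\<^sup>2 * V\<^sup>2)"
      using r V by (intro iffD2[OF exp_le_cancel_iff] add_mono mult_left_mono) auto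
    also have "\<dots> \<le> exp 3"
      using th(2) V power_mono[of "\<bar>\<theta>\<bar> * V" 1 2] by (simp add: power_mult_distrib)
    finally have E: "expectation (\<lambda>\<omega>. exp (\<theta> * (\<Sum>e\<in>I. trunc m (X e \<omega>)))) \<le> exp 3" .
    have "prob {\<omega> \<in> space M. \<sigma> * (\<Sum>e\<in>I. trunc m (X e \<omega>)) \<ge> t * (V + m)}
       = prob {\<omega> \<in> space M. exp (\<theta> * (\<Sum>e\<in>I. trunc m (X e \<omega>))) \<ge> exp t}"
      using Vm by (simp add: \<theta>_def pos_le_divide_eq)
    also have "\<dots> \<le> expectation (\<lambda>\<omega>. exp (\<theta> * (\<Sum>e\<in>I. trunc m (X e \<omega>)))) / exp t"
      by (rule integral_Markov_inequality_measure[where A = "{}", OF inte]) auto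
    also have "\<dots> \<le> exp 3 / exp t" using E by (intro divide_right_mono) auto
    finally show ?thesis by (simp add: exp_diff)
  qed
  have tail: "prob {\<omega> \<in> space M. m < \<bar>X e \<omega>\<bar>} \<le> exp (- real r)" if e: "e \<in> I" for e
  proof -
    have "prob {\<omega> \<in> space M. m < \<bar>X e \<omega>\<bar>} \<le> prob {\<omega> \<in> space M. m ^ r \<le> \<bar>X e \<omega>\<bar> ^ r}"
      using e m by (intro finite_measure_mono) (auto intro!: power_mono)
    also have "\<dots> \<le> expectation (\<lambda>\<omega>. \<bar>X e \<omega>\<bar> ^ r) / m ^ r"
      by (rule integral_Markov_inequality_measure[where A = "{}", OF Xr(1)[OF e]]) (use m in auto)
    also have "\<dots> \<le> (m / exp 1) ^ r / m ^ r" using Xr(2)[OF e] m by (intro divide_right_mono) auto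
    also have "\<dots> = exp (- real r)" using m exp_of_nat_mult[of r "1::real"] by (simp add: power_divide exp_minus field_simps)
    finally show ?thesis .
  qed
  let ?B = "\<lambda>\<sigma>. {\<omega> \<in> space M. \<sigma> * (\<Sum>e\<in>I. trunc m (X e \<omega>)) \<ge> t * (V + m)}"
  let ?T = "\<Union>e\<in>I. {\<omega> \<in> space M. m < \<bar>X e \<omega>\<bar>}"
  have [measurable]: "(\<lambda>\<omega>. \<Sum>e\<in>I. trunc m (X e \<omega>)) \<in> borel_measurable M"
    by (rule borel_measurable_sum) measurable
  have T: "?T \<in> events" by (rule sets.finite_UN[OF I]) measurable
  have B: "?B \<sigma> \<in> events" for \<sigma> by measurable
  have "prob {\<omega> \<in> space M. \<bar>\<Sum>e\<in>I. X e \<omega>\<bar> \<ge> t * (V + m)} \<le> prob (?T \<union> (?B 1 \<union> ?B (-1)))"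
  proof (rule finite_measure_mono)
    show "{\<omega> \<in> space M. \<bar>\<Sum>e\<in>I. X e \<omega>\<bar> \<ge> t * (V + m)} \<subseteq> ?T \<union> (?B 1 \<union> ?B (-1))"
    proof
      fix \<omega> assume w: "\<omega> \<in> {\<omega> \<in> space M. \<bar>\<Sum>e\<in>I. X e \<omega>\<bar> \<ge> t * (V + m)}"
      show "\<omega> \<in> ?T \<union> (?B 1 \<union> ?B (-1))"
      proof (cases "\<omega> \<in> ?T")
        case False
        then have "(\<Sum>e\<in>I. trunc m (X e \<omega>)) = (\<Sum>e\<in>I. X e \<omega>)"
          using w by (intro sum.cong) (auto simp: trunc_def)
        then show ?thesis using w by auto
      qed simp
    qed
  qed (use T B in auto)
  also have "\<dots> \<le> prob ?T + prob (?B 1 \<union> ?B (-1))"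
    by (rule measure_Un_le) (use T B in auto)
  also have "\<dots> \<le> prob ?T + (prob (?B 1) + prob (?B (-1)))"
    by (intro add_left_mono measure_Un_le) (use T B in auto)
  also have "prob ?T \<le> (\<Sum>e\<in>I. prob {\<omega> \<in> space M. m < \<bar>X e \<omega>\<bar>})"
    by (rule finite_measure_subadditive_finite[OF I]) auto
  also have "\<dots> \<le> (\<Sum>e\<in>I. exp (- real r))" by (intro sum_mono tail)
  also have "(\<Sum>e\<in>I. exp (- real r)) + (prob (?B 1) + prob (?B (-1))) \<le> real (card I) * exp (- real r) + 2 * exp (3 - t)"
    using one_sided[of 1] one_sided[of "-1"] by simp
  finally show ?thesis by simp
qed

end

definition upper_pairs :: "nat \<Rightarrow> (nat \<times> nat) set" where
  "upper_pairs n = {(i, j). i \<le> j \<and> j < n}"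

lemma upper_pairs_subset: "upper_pairs n \<subseteq> {..<n} \<times> {..<n}"
  by (auto simp: upper_pairs_def)

lemma finite_upper_pairs: "finite (upper_pairs n)"
  using upper_pairs_subset by (rule finite_subset) auto

lemma card_upper_pairs: "card (upper_pairs n) \<le> n\<^sup>2"
  using card_mono[OF _ upper_pairs_subset[of n]] by (simp add: power2_eq_square)

lemma sum_upper_pairs:
  fixes g :: "nat \<Rightarrow> nat \<Rightarrow> real"
  shows "(\<Sum>i<n. \<Sum>j<n. g i j) = (\<Sum>(i, j)\<in>upper_pairs n. if i = j then g i i else g i j + g j i)"
proof -
  let ?S = "{(i, j). i < j \<and> j < n}" and ?L = "{(i, j). j < i \<and> i < n}"
  have "(\<Sum>i<n. \<Sum>j<n. g i j) = (\<Sum>(i, j)\<in>{..<n} \<times> {..<n}. g i j)"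
    by (rule sum.cartesian_product)
  also have "{..<n} \<times> {..<n} = upper_pairs n \<union> ?L" by (auto simp: upper_pairs_def)
  also have "(\<Sum>(i, j)\<in>upper_pairs n \<union> ?L. g i j) = (\<Sum>(i, j)\<in>upper_pairs n. g i j) + (\<Sum>(i, j)\<in>?L. g i j)"
    by (rule sum.union_disjoint)
       (auto simp: upper_pairs_def finite_upper_pairs intro: finite_subset[of _ "{..<n} \<times> {..<n}"])
  also have "(\<Sum>(i, j)\<in>?L. g i j) = (\<Sum>(i, j)\<in>?S. g j i)"
    by (rule sum.reindex_bij_witness[of _ "\<lambda>(i, j). (j, i)" "\<lambda>(i, j). (j, i)"]) auto
  also have "\<dots> = (\<Sum>(i, j)\<in>upper_pairs n. if i = j then 0 else g j i)"
    by (rule sum.mono_neutral_cong_left)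
       (use finite_upper_pairs[of n] in \<open>auto simp: upper_pairs_def split: if_splits\<close>)
  finally show ?thesis
    by (simp add: sum.distrib[symmetric] case_prod_beta if_distrib cong: if_cong)
qed

context prob_space
begin

text \<open>Symmetry folds the double sum onto independent entries. A pair off the diagonal carries
  \<open>b i j + b j i\<close>, whence the factor 2 in \<open>2 * B\<close> and, through the square
  of a sum, in \<open>2 * v\<close>.\<close>

lemma symmetric_linear_form_deviation:
  fixes F :: "nat \<Rightarrow> nat \<Rightarrow> 'a \<Rightarrow> real" and b :: "nat \<Rightarrow> nat \<Rightarrow> real"
  assumes ind: "indep_vars (\<lambda>_. borel) (\<lambda>(i, j). F i j) (upper_pairs n)"
    and sym: "\<And>\<omega> i j. \<omega> \<in> space M \<Longrightarrow> i < n \<Longrightarrow> j < n \<Longrightarrow> F i j \<omega> = F j i \<omega>"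
    and F: "\<And>i j. i < n \<Longrightarrow> j < n \<Longrightarrow> integrable M (F i j)" "\<And>i j. i < n \<Longrightarrow> j < n \<Longrightarrow> expectation (F i j) = 0"
    and F2: "\<And>i j. i < n \<Longrightarrow> j < n \<Longrightarrow> integrable M (\<lambda>\<omega>. (F i j \<omega>)\<^sup>2)"
      "\<And>i j. i < n \<Longrightarrow> j < n \<Longrightarrow> expectation (\<lambda>\<omega>. (F i j \<omega>)\<^sup>2) \<le> v"
    and Fr: "\<And>i j. i < n \<Longrightarrow> j < n \<Longrightarrow> integrable M (\<lambda>\<omega>. \<bar>F i j \<omega>\<bar> ^ r)"
      "\<And>i j. i < n \<Longrightarrow> j < n \<Longrightarrow> expectation (\<lambda>\<omega>. \<bar>F i j \<omega>\<bar> ^ r) \<le> (m / exp 1) ^ r"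
    and b: "\<And>i j. i < n \<Longrightarrow> j < n \<Longrightarrow> \<bar>b i j\<bar> \<le> B" "(\<Sum>i<n. \<Sum>j<n. (b i j)\<^sup>2) \<le> w\<^sup>2"
    and pos: "0 < B" "0 < m" "0 \<le> w" "0 \<le> v" "1 \<le> r" and r: "real n ^ 2 * exp (- real r) \<le> 1"
  shows "prob {\<omega> \<in> space M. \<bar>\<Sum>i<n. \<Sum>j<n. b i j * F i j \<omega>\<bar> \<ge> t * (sqrt (2 * v) * w + 2 * B * m)}
    \<le> real n ^ 2 * exp (- real r) + 2 * exp (3 - t)"
proof -
  define a where "a = (\<lambda>(i, j). if i = j then b i i else b i j + b j i)"
  define X where "X = (\<lambda>e \<omega>. a e * F (fst e) (snd e) \<omega>)"
  have lt: "fst e < n" "snd e < n" if "e \<in> upper_pairs n" for e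
    using that upper_pairs_subset by fastforce+
  have a: "\<bar>a e\<bar> \<le> 2 * B" if "e \<in> upper_pairs n" for e
    using b(1)[OF lt[OF that]] b(1)[OF lt(2)[OF that] lt(1)[OF that]] pos(1)
    by (cases e) (auto simp: a_def)
  have ind': "indep_vars (\<lambda>_. borel) X (upper_pairs n)"
  proof -
    have "indep_vars (\<lambda>_. borel) (\<lambda>e \<omega>. (\<lambda>x. a e * x) ((\<lambda>(i, j). F i j) e \<omega>)) (upper_pairs n)"
      by (rule indep_vars_compose2[OF ind]) measurable
    then show ?thesis by (simp add: X_def case_prod_beta)
  qed
  have sumX: "(\<Sum>i<n. \<Sum>j<n. b i j * F i j \<omega>) = (\<Sum>e\<in>upper_pairs n. X e \<omega>)" if "\<omega> \<in> space M" for \<omega>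
    unfolding sum_upper_pairs X_def a_def
    by (intro sum.cong refl) (use sym that lt in \<open>auto simp: algebra_simps\<close>)
  have V: "(\<Sum>e\<in>upper_pairs n. expectation (\<lambda>\<omega>. (X e \<omega>)\<^sup>2)) \<le> (sqrt (2 * v) * w)\<^sup>2"
  proof -
    have "(\<Sum>e\<in>upper_pairs n. expectation (\<lambda>\<omega>. (X e \<omega>)\<^sup>2))
       = (\<Sum>e\<in>upper_pairs n. (a e)\<^sup>2 * expectation (\<lambda>\<omega>. (F (fst e) (snd e) \<omega>)\<^sup>2))"
      by (intro sum.cong refl) (auto simp: X_def power_mult_distrib)
    also have "\<dots> \<le> (\<Sum>e\<in>upper_pairs n. (a e)\<^sup>2 * v)"
      by (intro sum_mono mult_left_mono F2 lt) auto
    also have "\<dots> \<le> (\<Sum>e\<in>upper_pairs n. (2 * (if fst e = snd e then (b (fst e) (snd e))\<^sup>2 else (b (fst e) (snd e))\<^sup>2 + (b (snd e) (fst e))\<^sup>2)) * v)"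
    proof (intro sum_mono mult_right_mono pos)
      fix e
      have "(x + y)\<^sup>2 \<le> 2 * (x\<^sup>2 + y\<^sup>2)" for x y :: real
        using sum_squares_bound[of x y] by (simp add: power2_sum)
      then show "(a e)\<^sup>2 \<le> 2 * (if fst e = snd e then (b (fst e) (snd e))\<^sup>2 else (b (fst e) (snd e))\<^sup>2 + (b (snd e) (fst e))\<^sup>2)"
        by (cases e) (simp add: a_def)
    qed
    also have "\<dots> = 2 * v * (\<Sum>i<n. \<Sum>j<n. (b i j)\<^sup>2)"
      unfolding sum_upper_pairs by (auto simp: sum_distrib_left case_prod_beta mult_ac intro!: sum.cong)
    also have "\<dots> \<le> 2 * v * w\<^sup>2" using b pos by (intro mult_left_mono) auto
    finally show ?thesis using pos by (simp add: power_mult_distrib)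
  qed
  have card: "real (card (upper_pairs n)) * exp (- real r) \<le> real n ^ 2 * exp (- real r)"
    using card_upper_pairs[of n] by (intro mult_right_mono) (auto simp flip: of_nat_power)
  have "prob {\<omega> \<in> space M. \<bar>\<Sum>e\<in>upper_pairs n. X e \<omega>\<bar> \<ge> t * (sqrt (2 * v) * w + 2 * B * m)}
     \<le> real (card (upper_pairs n)) * exp (- real r) + 2 * exp (3 - t)"
  proof (rule Bernstein_truncated[OF finite_upper_pairs ind' _ _ _ _ _ V])
    fix e assume e: "e \<in> upper_pairs n"
    have Xe: "X e \<omega> = a e * F (fst e) (snd e) \<omega>" for \<omega> by (simp add: X_def case_prod_beta)
    note l = lt[OF e]
    show "integrable M (X e)" "expectation (X e) = 0" "integrable M (\<lambda>\<omega>. (X e \<omega>)\<^sup>2)"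
      "integrable M (\<lambda>\<omega>. \<bar>X e \<omega>\<bar> ^ r)"
      using F[OF l] F2(1)[OF l] Fr(1)[OF l] by (auto simp: Xe[abs_def] power_mult_distrib abs_mult)
    have "expectation (\<lambda>\<omega>. \<bar>X e \<omega>\<bar> ^ r) = \<bar>a e\<bar> ^ r * expectation (\<lambda>\<omega>. \<bar>F (fst e) (snd e) \<omega>\<bar> ^ r)"
      by (simp add: Xe power_mult_distrib abs_mult)
    also have "\<dots> \<le> (2 * B) ^ r * (m / exp 1) ^ r"
      using Fr(2)[OF l] a[OF e] pos by (intro mult_mono power_mono) auto
    finally show "expectation (\<lambda>\<omega>. \<bar>X e \<omega>\<bar> ^ r) \<le> (2 * B * m / exp 1) ^ r"
      by (simp only: power_mult_distrib[symmetric] times_divide_eq_right)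
  next
    show "0 \<le> sqrt (2 * v) * w" "0 < 2 * B * m" "1 \<le> r" using pos by auto
    show "real (card (upper_pairs n)) * exp (- real r) \<le> 1" using card r by linarith
  qed
  also have "prob {\<omega> \<in> space M. \<bar>\<Sum>e\<in>upper_pairs n. X e \<omega>\<bar> \<ge> t * (sqrt (2 * v) * w + 2 * B * m)}
     = prob {\<omega> \<in> space M. \<bar>\<Sum>i<n. \<Sum>j<n. b i j * F i j \<omega>\<bar> \<ge> t * (sqrt (2 * v) * w + 2 * B * m)}"
    by (rule arg_cong[of _ _ prob]) (use sumX in auto)
  finally show ?thesis using card by linarith
qed

end

context sparse_noise
begin

text \<open>Trading \<open>n\<close> for the smaller \<open>qn n\<close> squared gives a pure power
  of order \<open>r\<close>: in this sense an entry has size at most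
  \<open>C' * snr n / qn n\<close>.\<close>

lemma abs_moment_crude:
  assumes "n \<ge> N0" "i < n" "j < n" "2 \<le> r" "real r \<le> max_mom n"
  shows "integral\<^sup>L (M n) (\<lambda>\<omega>. \<bar>E n \<omega> i j\<bar> ^ r) \<le> (C' * snr n / qn n) ^ r"
proof -
  have n: "0 < n" using assms by simp
  have q: "1 \<le> qn n" using qn_ge_1[OF assms(1) n] .
  have "(C' * snr n) ^ r / (real n * qn n ^ (r - 2)) \<le> (C' * snr n / qn n) ^ r"
  proof -
    have "(C' * snr n / qn n) ^ r = (C' * snr n) ^ r / (qn n ^ 2 * qn n ^ (r - 2))"
      using assms(4) by (simp only: power_divide power_add[symmetric] le_add_diff_inverse)
    moreover have "(C' * snr n) ^ r / (real n * qn n ^ (r - 2)) \<le> (C' * snr n) ^ r / (qn n ^ 2 * qn n ^ (r - 2))"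
      using q C'_ge snr_pos[OF assms(1) n] n qn_sq_le[OF assms(1) n]
      by (intro divide_left_mono mult_right_mono) auto
    ultimately show ?thesis by simp
  qed
  then show ?thesis using abs_moment(2)[OF assms] by simp
qed

text \<open>The truncation level is \<open>exp 1\<close> times the crude size of an entry, the value
  for which the moment hypothesis of the Bernstein bound becomes
  \<open>abs_moment_crude\<close>.\<close>

lemma linear_form_deviation:
  assumes n: "n \<ge> N0" "0 < n"
    and b: "\<And>i j. i < n \<Longrightarrow> j < n \<Longrightarrow> \<bar>b i j\<bar> \<le> B" "(\<Sum>i<n. \<Sum>j<n. (b i j)\<^sup>2) \<le> w\<^sup>2"
    and pos: "0 < B" "0 \<le> w" "2 \<le> r" and r: "real n ^ 2 * exp (- real r) \<le> 1" "real r \<le> max_mom n"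
  shows "measure (M n) {\<omega> \<in> space (M n). \<bar>\<Sum>i<n. \<Sum>j<n. b i j * E n \<omega> i j\<bar>
      \<ge> t * (sqrt (2 * (C * rho n)) * w + 2 * B * (exp 1 * (C' * snr n / qn n)))}
    \<le> real n ^ 2 * exp (- real r) + 2 * exp (3 - t)"
proof -
  interpret prob_space "M n" by (rule prob)
  have q: "1 \<le> qn n" using qn_ge_1[OF n] .
  show ?thesis
  proof (rule symmetric_linear_form_deviation[where F = "\<lambda>i j \<omega>. E n \<omega> i j", OF _ _ _ _ _ _ _ _ b])
    show "indep_vars (\<lambda>_. borel) (\<lambda>(i, j) \<omega>. E n \<omega> i j) (upper_pairs n)"
      using Eindep[OF n(1)] by (simp add: upper_pairs_def)
    show "expectation (\<lambda>\<omega>. \<bar>E n \<omega> i j\<bar> ^ r) \<le> (exp 1 * (C' * snr n / qn n) / exp 1) ^ r"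
      if "i < n" "j < n" for i j
      using abs_moment_crude[OF n(1) that pos(3) r(2)] by simp
    show "0 < exp 1 * (C' * snr n / qn n)" using C'_ge snr_pos[OF n] q by (intro mult_pos_pos divide_pos_pos) auto
  qed (use n Esym Emean Evar abs_moment(1) pos r params rho[OF n(1)] in auto)
qed

definition sigma2 :: "nat \<Rightarrow> nat \<Rightarrow> nat \<Rightarrow> real" where
  "sigma2 n i j = integral\<^sup>L (M n) (\<lambda>\<omega>. (E n \<omega> i j)\<^sup>2)"

text \<open>The Bernstein bound for the centred squares. The variance proxy comes from the fourth
  moment of an entry, and a moment of order \<open>r\<close> of a square uses order
  \<open>2 * r\<close> of the entry.\<close>

lemma square_form_deviation:
  assumes n: "n \<ge> N0" "0 < n"
    and b: "\<And>i j. i < n \<Longrightarrow> j < n \<Longrightarrow> \<bar>b i j\<bar> \<le> B" "(\<Sum>i<n. \<Sum>j<n. (b i j)\<^sup>2) \<le> w\<^sup>2"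
    and pos: "0 < B" "0 \<le> w" "2 \<le> r" and r: "real n ^ 2 * exp (- real r) \<le> 1" "real (2 * r) \<le> max_mom n"
  shows "measure (M n) {\<omega> \<in> space (M n). \<bar>\<Sum>i<n. \<Sum>j<n. b i j * ((E n \<omega> i j)\<^sup>2 - sigma2 n i j)\<bar>
      \<ge> t * (sqrt (2 * ((C' * snr n) ^ 4 / (real n * qn n ^ 2))) * w + 2 * B * (exp 1 * (4 * (C' * snr n / qn n)\<^sup>2)))}
    \<le> real n ^ 2 * exp (- real r) + 2 * exp (3 - t)"
proof -
  interpret prob_space "M n" by (rule prob)
  have q: "1 \<le> qn n" using qn_ge_1[OF n] .
  have s: "0 < snr n" using snr_pos[OF n] .
  let ?K = "C' * snr n / qn n"
  have K: "0 < ?K" using C'_ge s q by (intro divide_pos_pos mult_pos_pos) auto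
  have m4: "real 4 \<le> max_mom n" "real 2 \<le> max_mom n" using r pos by auto
  let ?F = "\<lambda>i j \<omega>. (E n \<omega> i j)\<^sup>2 - sigma2 n i j"
  have sig: "0 \<le> sigma2 n i j" "sigma2 n i j \<le> ?K\<^sup>2" if "i < n" "j < n" for i j
    using abs_moment_crude[OF n(1) that, of 2] m4 by (auto simp: sigma2_def)
  have int4: "integrable (M n) (\<lambda>\<omega>. (E n \<omega> i j) ^ 4)" "expectation (\<lambda>\<omega>. (E n \<omega> i j) ^ 4) \<le> (C' * snr n) ^ 4 / (real n * qn n ^ 2)"
    if "i < n" "j < n" for i j
    using abs_moment[OF n(1) that, of 4] m4 by auto
  have sq: "(?F i j \<omega>)\<^sup>2 = (E n \<omega> i j) ^ 4 - 2 * sigma2 n i j * (E n \<omega> i j)\<^sup>2 + (sigma2 n i j)\<^sup>2" for i j \<omega>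
    by (simp add: power2_diff flip: power_mult)
  have Fr_le: "\<bar>?F i j \<omega>\<bar> ^ r \<le> 2 ^ r * (\<bar>E n \<omega> i j\<bar> ^ (2 * r) + sigma2 n i j ^ r)" if "i < n" "j < n" for i j \<omega>
  proof -
    let ?x = "(E n \<omega> i j)\<^sup>2" and ?y = "sigma2 n i j"
    have "\<bar>?F i j \<omega>\<bar> \<le> 2 * max ?x ?y" using sig(1)[OF that] zero_le_power2[of "E n \<omega> i j"]
      by (simp only: abs_le_iff max_def split: if_split) linarith
    then have "\<bar>?F i j \<omega>\<bar> ^ r \<le> (2 * max ?x ?y) ^ r" by (intro power_mono) auto
    also have "\<dots> \<le> 2 ^ r * (?x ^ r + ?y ^ r)"
      using sig(1)[OF that] by (auto simp: power_mult_distrib max_def)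
    also have "?x ^ r = \<bar>E n \<omega> i j\<bar> ^ (2 * r)" by (simp add: power_mult)
    finally show ?thesis .
  qed
  have intr: "integrable (M n) (\<lambda>\<omega>. \<bar>E n \<omega> i j\<bar> ^ (2 * r))" if "i < n" "j < n" for i j
    using abs_moment(1)[OF n(1) that, of "2 * r"] r pos by auto
  have intF: "integrable (M n) (\<lambda>\<omega>. \<bar>?F i j \<omega>\<bar> ^ r)" if "i < n" "j < n" for i j
  proof (rule Bochner_Integration.integrable_bound[where f = "\<lambda>\<omega>. 2 ^ r * (\<bar>E n \<omega> i j\<bar> ^ (2 * r) + sigma2 n i j ^ r)"])
    show "AE \<omega> in M n. norm (\<bar>?F i j \<omega>\<bar> ^ r) \<le> norm (2 ^ r * (\<bar>E n \<omega> i j\<bar> ^ (2 * r) + sigma2 n i j ^ r))"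
    proof (intro AE_I2)
      fix \<omega>
      have "norm (\<bar>?F i j \<omega>\<bar> ^ r) = \<bar>?F i j \<omega>\<bar> ^ r" by simp
      also have "\<dots> \<le> 2 ^ r * (\<bar>E n \<omega> i j\<bar> ^ (2 * r) + sigma2 n i j ^ r)" by (rule Fr_le[OF that])
      also have "\<dots> \<le> norm (2 ^ r * (\<bar>E n \<omega> i j\<bar> ^ (2 * r) + sigma2 n i j ^ r))"
        unfolding real_norm_def by (rule abs_ge_self)
      finally show "norm (\<bar>?F i j \<omega>\<bar> ^ r) \<le> norm (2 ^ r * (\<bar>E n \<omega> i j\<bar> ^ (2 * r) + sigma2 n i j ^ r))" .
    qed
    show "(\<lambda>\<omega>. \<bar>?F i j \<omega>\<bar> ^ r) \<in> borel_measurable (M n)"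
      using Emeas by measurable
  qed (use intr[OF that] in auto)
  show ?thesis
  proof (rule symmetric_linear_form_deviation[where F = ?F, OF _ _ _ _ _ _ _ _ b])
    have "indep_vars (\<lambda>_. borel) (\<lambda>e \<omega>. (\<lambda>x. x\<^sup>2 - sigma2 n (fst e) (snd e)) ((\<lambda>(i, j) \<omega>. E n \<omega> i j) e \<omega>)) (upper_pairs n)"
      by (rule indep_vars_compose2[OF Eindep[OF n(1), folded upper_pairs_def]]) measurable
    then show "indep_vars (\<lambda>_. borel) (\<lambda>(i, j). ?F i j) (upper_pairs n)"
      by (simp add: case_prod_unfold)
    show "?F i j \<omega> = ?F j i \<omega>" if "\<omega> \<in> space (M n)" "i < n" "j < n" for i j \<omega>
    proof -
      have "sigma2 n i j = sigma2 n j i"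
        unfolding sigma2_def by (intro Bochner_Integration.integral_cong refl) (use Esym that in auto)
      then show ?thesis using Esym[OF that] by simp
    qed
    show "integrable (M n) (?F i j)" if "i < n" "j < n" for i j using Evar[OF n(1) that] by auto
    show "expectation (?F i j) = 0" if "i < n" "j < n" for i j
      using Evar[OF n(1) that] by (simp add: prob_space sigma2_def)
    show "integrable (M n) (\<lambda>\<omega>. (?F i j \<omega>)\<^sup>2)" if "i < n" "j < n" for i j
      unfolding sq using Evar[OF n(1) that] int4[OF that] by auto
    show "expectation (\<lambda>\<omega>. (?F i j \<omega>)\<^sup>2) \<le> (C' * snr n) ^ 4 / (real n * qn n ^ 2)" if "i < n" "j < n" for i j
    proof -
      have "expectation (\<lambda>\<omega>. (?F i j \<omega>)\<^sup>2) = expectation (\<lambda>\<omega>. (E n \<omega> i j) ^ 4) - (sigma2 n i j)\<^sup>2"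
        unfolding sq using Evar[OF n(1) that] int4[OF that]
        by (simp add: prob_space power2_eq_square flip: sigma2_def)
           (simp add: sigma2_def power2_eq_square)
      then show ?thesis using int4(2)[OF that] by (smt (verit) zero_le_power2)
    qed
    show "integrable (M n) (\<lambda>\<omega>. \<bar>?F i j \<omega>\<bar> ^ r)" if "i < n" "j < n" for i j
      by (rule intF[OF that])
    show "expectation (\<lambda>\<omega>. \<bar>?F i j \<omega>\<bar> ^ r) \<le> (exp 1 * (4 * ?K\<^sup>2) / exp 1) ^ r" if "i < n" "j < n" for i j
    proof -
      have "expectation (\<lambda>\<omega>. \<bar>?F i j \<omega>\<bar> ^ r) \<le> expectation (\<lambda>\<omega>. 2 ^ r * (\<bar>E n \<omega> i j\<bar> ^ (2 * r) + sigma2 n i j ^ r))"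
        by (rule integral_mono[OF intF[OF that] _ Fr_le[OF that]]) (use intr[OF that] in auto)
      also have "\<dots> = 2 ^ r * (expectation (\<lambda>\<omega>. \<bar>E n \<omega> i j\<bar> ^ (2 * r)) + sigma2 n i j ^ r)"
        using intr[OF that] by (simp add: prob_space)
      also have "\<dots> \<le> 2 ^ r * (?K ^ (2 * r) + (?K\<^sup>2) ^ r)"
        using abs_moment_crude[OF n(1) that, of "2 * r"] r pos sig[OF that]
        by (intro mult_left_mono add_mono power_mono) auto
      also have "\<dots> = 2 * (2 * ?K\<^sup>2) ^ r"
      proof -
        have "2 ^ r * (x ^ (2 * r) + (x\<^sup>2) ^ r) = 2 * (2 * x\<^sup>2) ^ r" for x :: real
          by (simp add: power_mult power_mult_distrib)
        then show ?thesis .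
      qed
      \<comment> \<open>The stray factor 2 is absorbed into \<open>2 ^ r\<close>; this produces the
        4 in the truncation level.\<close>
      also have "\<dots> \<le> 2 ^ r * (2 * ?K\<^sup>2) ^ r"
        using pos self_le_power[of "2::real" r] by (intro mult_right_mono zero_le_power mult_nonneg_nonneg zero_le_power2) auto
      also have "\<dots> = (4 * ?K\<^sup>2) ^ r"
      proof -
        have "2 ^ r * (2 * x) ^ r = (4 * x) ^ r" for x :: real
          unfolding power_mult_distrib[of "2::real" x] power_mult_distrib[of "4::real" x]
          using power_mult_distrib[of "2::real" 2 r] by simp
        then show ?thesis .
      qed
      also have "4 * ?K\<^sup>2 = exp 1 * (4 * ?K\<^sup>2) / exp 1" by (rule nonzero_mult_div_cancel_left[symmetric]) simp
      finally show ?thesis .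
    qed
    show "0 < exp 1 * (4 * ?K\<^sup>2)" by (intro mult_pos_pos zero_less_power K) auto
  qed (use pos r in auto)
qed

text \<open>A measurable witness set stands in for the event itself, because \<open>P n\<close> may
  quantify over all vectors and need not define a measurable set.\<close>

definition hp :: "real \<Rightarrow> (nat \<Rightarrow> 'a \<Rightarrow> bool) \<Rightarrow> bool" where
  "hp c P \<longleftrightarrow> (\<exists>N. \<forall>n\<ge>N. \<exists>S\<in>sets (M n). 1 - real n powr (- c) \<le> measure (M n) S \<and> (\<forall>\<omega>\<in>S. P n \<omega>))"

lemma intersection_prob:
  assumes "finite I" "\<And>i. i \<in> I \<Longrightarrow> S i \<in> sets (M n)" "\<And>i. i \<in> I \<Longrightarrow> 1 - \<delta> \<le> measure (M n) (S i)"
  shows "1 - real (card I) * \<delta> \<le> measure (M n) (space (M n) \<inter> (\<Inter>i\<in>I. S i))"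
    and "space (M n) \<inter> (\<Inter>i\<in>I. S i) \<in> sets (M n)"
proof -
  interpret prob_space "M n" by (rule prob)
  show sets: "space (M n) \<inter> (\<Inter>i\<in>I. S i) \<in> sets (M n)"
  proof (cases "I = {}")
    case False
    then have "(\<Inter>i\<in>I. S i) \<in> sets (M n)" using assms by (intro sets.finite_INT) auto
    then show ?thesis by auto
  qed simp
  have U: "(\<Union>i\<in>I. space (M n) - S i) \<in> sets (M n)"
    by (intro sets.finite_UN assms sets.compl_sets)
  have "prob (space (M n) - (space (M n) \<inter> (\<Inter>i\<in>I. S i))) \<le> prob (\<Union>i\<in>I. space (M n) - S i)"
    by (rule finite_measure_mono[OF _ U]) blast
  also have "\<dots> \<le> (\<Sum>i\<in>I. prob (space (M n) - S i))"
    by (rule finite_measure_subadditive_finite) (use assms in auto)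
  also have "\<dots> \<le> (\<Sum>i\<in>I. \<delta>)"
    using assms(2,3) by (intro sum_mono) (fastforce simp: prob_compl)
  finally show "1 - real (card I) * \<delta> \<le> prob (space (M n) \<inter> (\<Inter>i\<in>I. S i))"
    using prob_compl[OF sets] by simp
qed

lemma hp_mono:
  assumes "hp c P" "\<And>n \<omega>. n \<ge> NA \<Longrightarrow> \<omega> \<in> space (M n) \<Longrightarrow> P n \<omega> \<Longrightarrow> Q n \<omega>"
  shows "hp c Q"
proof -
  obtain N where N: "\<And>n. n \<ge> N \<Longrightarrow> \<exists>S\<in>sets (M n). 1 - real n powr (- c) \<le> measure (M n) S \<and> (\<forall>\<omega>\<in>S. P n \<omega>)"
    using assms(1) unfolding hp_def by blast
  show ?thesis unfolding hp_def
  proof (intro exI[of _ "max N NA"] allI impI)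
    fix n assume n: "max N NA \<le> n"
    then obtain S where S: "S \<in> sets (M n)" "1 - real n powr (- c) \<le> measure (M n) S" "\<forall>\<omega>\<in>S. P n \<omega>"
      using N[of n] by auto
    then show "\<exists>S\<in>sets (M n). 1 - real n powr (- c) \<le> measure (M n) S \<and> (\<forall>\<omega>\<in>S. Q n \<omega>)"
      using assms(2)[of n] n sets.sets_into_space[OF S(1)] by (intro bexI[of _ S]) auto
  qed
qed

text \<open>Union bound over at most \<open>n\<close> events: one unit of the exponent pays for
  their number.\<close>

lemma hp_all_less:
  assumes "\<And>n i. n \<ge> NA \<Longrightarrow> i < f n \<Longrightarrow>
      \<exists>S\<in>sets (M n). 1 - real n powr (- (c + 1)) \<le> measure (M n) S \<and> (\<forall>\<omega>\<in>S. P i n \<omega>)"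
    and f: "\<And>n. n \<ge> NB \<Longrightarrow> f n \<le> n"
  shows "hp c (\<lambda>n \<omega>. \<forall>i<f n. P i n \<omega>)"
  unfolding hp_def
proof (intro exI[of _ "max 1 (max NA NB)"] allI impI)
  fix n assume n: "max 1 (max NA NB) \<le> n"
  then have "\<forall>i\<in>{..<f n}. \<exists>S. S \<in> sets (M n) \<and> 1 - real n powr (- (c + 1)) \<le> measure (M n) S \<and> (\<forall>\<omega>\<in>S. P i n \<omega>)"
    using assms(1) by fastforce
  from bchoice[OF this] obtain S where S: "\<And>i. i < f n \<Longrightarrow> S i \<in> sets (M n)"
      "\<And>i. i < f n \<Longrightarrow> 1 - real n powr (- (c + 1)) \<le> measure (M n) (S i)"
      "\<And>i \<omega>. i < f n \<Longrightarrow> \<omega> \<in> S i \<Longrightarrow> P i n \<omega>"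
    by auto
  have "real (f n) * real n powr (- (c + 1)) \<le> real n * real n powr (- (c + 1))"
    using f[of n] n by (intro mult_right_mono) auto
  also have "\<dots> = real n powr (- c)"
    using n powr_add[of "real n" 1 "- (c + 1)"] by simp
  finally have "1 - real n powr (- c) \<le> measure (M n) (space (M n) \<inter> (\<Inter>i\<in>{..<f n}. S i))"
    using intersection_prob(1)[of "{..<f n}" S n "real n powr (- (c + 1))"] S by simp
  then show "\<exists>S\<in>sets (M n). 1 - real n powr (- c) \<le> measure (M n) S \<and> (\<forall>\<omega>\<in>S. \<forall>i<f n. P i n \<omega>)"
    using intersection_prob(2)[of "{..<f n}" S n "real n powr (- (c + 1))"] S
    by (intro bexI[of _ "space (M n) \<inter> (\<Inter>i\<in>{..<f n}. S i)"]) auto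
qed

lemma hp_finite:
  fixes d :: nat
  assumes "\<And>m. m < d \<Longrightarrow> hp (c + 1) (P m)"
  shows "hp c (\<lambda>n \<omega>. \<forall>m<d. P m n \<omega>)"
proof -
  have "\<forall>m\<in>{..<d}. \<exists>N. \<forall>n\<ge>N. \<exists>S\<in>sets (M n). 1 - real n powr (- (c + 1)) \<le> measure (M n) S \<and> (\<forall>\<omega>\<in>S. P m n \<omega>)"
    using assms unfolding hp_def by blast
  then obtain N where N: "\<And>m n. m < d \<Longrightarrow> n \<ge> N m \<Longrightarrow>
      \<exists>S\<in>sets (M n). 1 - real n powr (- (c + 1)) \<le> measure (M n) S \<and> (\<forall>\<omega>\<in>S. P m n \<omega>)"
    by (subst (asm) bchoice_iff) auto
  show ?thesis
  \<comment> \<open>The sum of the \<open>d\<close> thresholds dominates each of them, and from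
    \<open>n = d\<close> on there are at most \<open>n\<close> events.\<close>
  proof (rule hp_all_less[where NA = "\<Sum>m<d. N m" and NB = d])
    fix n m assume "(\<Sum>m<d. N m) \<le> n" "m < d"
    moreover from \<open>m < d\<close> have "N m \<le> (\<Sum>m<d. N m)" by (intro member_le_sum) auto
    ultimately show "\<exists>S\<in>sets (M n). 1 - real n powr (- (c + 1)) \<le> measure (M n) S \<and> (\<forall>\<omega>\<in>S. P m n \<omega>)"
      using N[of m n] by simp
  qed simp
qed

lemma hp_conj:
  assumes "hp (c + 1) P" "hp (c + 1) Q"
  shows "hp c (\<lambda>n \<omega>. P n \<omega> \<and> Q n \<omega>)"
proof -
  have "hp c (\<lambda>n \<omega>. \<forall>m<(2::nat). (if m = 0 then P else Q) n \<omega>)"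
    by (rule hp_finite) (use assms in auto)
  then show ?thesis
    by (rule hp_mono[where NA = 0]) (auto simp: numeral_2_eq_2 less_Suc_eq)
qed

lemma event_of_deviation:
  fixes f :: "'a \<Rightarrow> real"
  assumes f: "f \<in> borel_measurable (M n)"
    and "measure (M n) {\<omega> \<in> space (M n). \<bar>f \<omega>\<bar> \<ge> t} \<le> \<delta>"
  shows "\<exists>S\<in>sets (M n). 1 - \<delta> \<le> measure (M n) S \<and> (\<forall>\<omega>\<in>S. \<omega> \<in> space (M n) \<and> \<bar>f \<omega>\<bar> \<le> t)"
proof -
  interpret prob_space "M n" by (rule prob)
  let ?B = "{\<omega> \<in> space (M n). \<bar>f \<omega>\<bar> \<ge> t}"
  have "?B \<in> sets (M n)"
    by (rule borel_measurable_le) (use f in \<open>auto intro: borel_measurable_abs\<close>)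
  then show ?thesis using assms(2)
    by (intro bexI[of _ "space (M n) - ?B"]) (auto simp: prob_compl not_le less_imp_le)
qed

text \<open>The exponent \<open>A0 * ln (ln n)\<close> eventually exceeds 2, and a squared logarithm
  already beats every affine function of \<open>ln n\<close>.\<close>

lemma max_mom_large: "eventually (\<lambda>n. (2 * ln (real n))\<^sup>2 \<le> max_mom n) sequentially"
proof -
  have "eventually (\<lambda>n. 1 \<le> ln (ln (real n))) sequentially" "eventually (\<lambda>n. 1 \<le> ln (real n)) sequentially"
    by real_asymp+
  then show ?thesis
  proof eventually_elim
    case (elim n)
    have "(2 * ln (real n)) powr 2 \<le> (2 * ln (real n)) powr (A0 * ln (ln (real n)))"
    proof (rule powr_mono)
      have "11 * 1 \<le> A0 * ln (ln (real n))" using elim params by (intro mult_mono) auto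
      then show "2 \<le> A0 * ln (ln (real n))" by simp
    qed (use elim in auto)
    then show ?case using elim by (simp add: max_mom_def)
  qed
qed

lemma max_mom_ge: "eventually (\<lambda>n. a * ln (real n) + b \<le> max_mom n) sequentially"
proof -
  have "eventually (\<lambda>n. a * ln (real n) + b \<le> (2 * ln (real n))\<^sup>2) sequentially"
    by real_asymp
  then show ?thesis using max_mom_large by eventually_elim linarith
qed

lemma mv_funpow_measurable: "(\<lambda>\<omega>. (mv n (E n \<omega>) ^^ r) y i) \<in> borel_measurable (M n)"
proof (induction r arbitrary: i)
  case (Suc r)
  have [measurable]: "\<And>i j. (\<lambda>\<omega>. E n \<omega> i j) \<in> borel_measurable (M n)" by (rule Emeas)
  note Suc[measurable]
  have "(\<lambda>\<omega>. \<Sum>j<n. E n \<omega> i j * (mv n (E n \<omega>) ^^ r) y j) \<in> borel_measurable (M n)" by measurable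
  then show ?case by (simp add: mv_def[of n "E n _" "(mv n (E n _) ^^ r) y"])
qed simp

text \<open>One choice of moment order and deviation level, both logarithmic in \<open>n\<close>,
  that brings the total failure probability below the power \<open>- c\<close>.\<close>

lemma Bernstein_parameters:
  assumes c: "0 < c"
  shows "\<exists>N\<ge>N0. \<forall>n\<ge>N. \<exists>r t. 2 \<le> r \<and> real n ^ 2 * exp (- real r) \<le> 1 \<and> real (2 * r) \<le> max_mom n \<and>
     t \<le> (c + 7) * ln (real n) \<and> 0 \<le> t \<and> real n ^ 2 * exp (- real r) + 2 * exp (3 - t) \<le> real n powr (- c) \<and> 3 \<le> n"
proof -
  have "eventually (\<lambda>n. 2 * ((c + 4) * ln (real n)) + 2 \<le> max_mom n) sequentially"
    using max_mom_ge[of "2 * (c + 4)" 2] by (simp only: mult.assoc)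
  moreover have "eventually (\<lambda>n::nat. 1 \<le> ln (real n)) sequentially" by real_asymp
  moreover have "eventually (\<lambda>n. N0 \<le> n \<and> 3 \<le> n) sequentially"
    by (intro eventually_conj eventually_ge_at_top)
  ultimately have "eventually (\<lambda>n. 2 * ((c + 4) * ln (real n)) + 2 \<le> max_mom n \<and> 1 \<le> ln (real n) \<and> N0 \<le> n \<and> 3 \<le> n) sequentially"
    by eventually_elim auto
  then obtain N where N: "\<And>n. n \<ge> N \<Longrightarrow> 2 * ((c + 4) * ln (real n)) + 2 \<le> max_mom n \<and> 1 \<le> ln (real n) \<and> N0 \<le> n \<and> 3 \<le> n"
    unfolding eventually_sequentially by blast
  show ?thesis
  proof (rule exI[of _ N], intro conjI allI impI)
    show "N0 \<le> N" using N[of N] by simp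
    fix n assume "N \<le> n"
    note n = N[OF this]
    \<comment> \<open>With \<open>r\<close> at least \<open>(c + 4) * ln n\<close> the truncation
      term is at most \<open>n powr (- c - 2)\<close>; the 5 in \<open>t\<close> leaves
      \<open>exp (- 2)\<close> to beat the factor 2 of the other term. Twice
      \<open>n powr (- c - 2)\<close> is then below the target.\<close>
    define r where "r = nat \<lceil>(c + 4) * ln (real n)\<rceil>"
    define t where "t = (c + 2) * ln (real n) + 5"
    have cl: "0 \<le> (c + 4) * ln (real n)" using c n by auto
    have r: "(c + 4) * ln (real n) \<le> real r" "real r \<le> (c + 4) * ln (real n) + 1"
      using cl by (auto simp: r_def ceiling_correct)
    have "4 * 1 \<le> (c + 4) * ln (real n)" using c n by (intro mult_mono) auto
    then have r2: "2 \<le> r" using r by linarith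
    have npow: "exp (- (a * ln (real n))) = real n powr (- a)" for a
      using n by (simp add: powr_def)
    have n2: "real n ^ 2 = real n powr 2" using n by (simp add: powr_numeral)
    have e1: "real n ^ 2 * exp (- real r) \<le> real n powr (- c - 2)"
    proof -
      have "exp (- real r) \<le> real n powr (- (c + 4))" unfolding npow[symmetric] using r by simp
      then have "real n ^ 2 * exp (- real r) \<le> real n powr 2 * real n powr (- (c + 4))"
        unfolding n2 by (intro mult_left_mono) auto
      also have "\<dots> = real n powr (2 + - (c + 4))" by (simp only: powr_add)
      also have "2 + - (c + 4) = - c - 2" by simp
      finally show ?thesis .
    qed
    have e2: "2 * exp (3 - t) \<le> real n powr (- c - 2)"
    proof -
      have "3 - t = - ((c + 2) * ln (real n)) + (-2)" by (simp add: t_def)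
      then have "exp (3 - t) = real n powr (- (c + 2)) * exp (-2)"
        by (simp only: exp_add npow)
      moreover have "exp (-2::real) \<le> 1/2"
        using exp_ge_add_one_self[of "2::real"] by (simp add: exp_minus field_simps)
      ultimately show ?thesis using mult_left_mono[of "exp (-2)" "1/2" "real n powr (- (c + 2))"] by simp
    qed
    have e3: "2 * real n powr (- c - 2) \<le> real n powr (- c)"
    proof -
      have "real n powr (- c + - 2) = real n powr (- c) * real n powr (- 2)" by (rule powr_add)
      then have "real n powr (- c - 2) = real n powr (- c) * real n powr (- 2)" by simp
      moreover have "real n powr (- 2) \<le> 1 / 2"
      proof -
        have "2 \<le> real n ^ 2" using n power_mono[of 3 "real n" 2] by simp
        then have "1 / real n ^ 2 \<le> 1 / 2" using n by (intro divide_left_mono) auto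
        then show ?thesis unfolding powr_minus_divide[of "real n" 2] n2 .
      qed
      ultimately show ?thesis using mult_left_mono[of "real n powr (- 2)" "1/2" "real n powr (- c)"] by simp
    qed
    have e4: "real n powr (- c - 2) \<le> 1"
      using n c powr_mono[of "- c - 2" 0 "real n"] by simp
    show "\<exists>r t. 2 \<le> r \<and> real n ^ 2 * exp (- real r) \<le> 1 \<and> real (2 * r) \<le> max_mom n \<and>
     t \<le> (c + 7) * ln (real n) \<and> 0 \<le> t \<and> real n ^ 2 * exp (- real r) + 2 * exp (3 - t) \<le> real n powr (- c) \<and> 3 \<le> n"
    proof (intro exI[of _ r] exI[of _ t] conjI)
      show "t \<le> (c + 7) * ln (real n)" using n by (simp add: t_def algebra_simps)
      show "0 \<le> t" using n c by (simp add: t_def)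
    qed (use r2 e1 e2 e3 e4 r n in auto)
  qed
qed

text \<open>The threshold is chosen before the coefficients. Coefficients may therefore depend on
  \<open>n\<close> and on a coordinate, and a union bound over coordinates stays possible.\<close>

lemma linear_form_whp:
  assumes c: "0 < c"
  shows "\<exists>N. \<forall>n\<ge>N. \<forall>b B w. (\<forall>i<n. \<forall>j<n. \<bar>b i j\<bar> \<le> B) \<longrightarrow> (\<Sum>i<n. \<Sum>j<n. (b i j)\<^sup>2) \<le> w\<^sup>2 \<longrightarrow> 0 < B \<longrightarrow> 0 \<le> w \<longrightarrow>
     (\<exists>S\<in>sets (M n). 1 - real n powr (- c) \<le> measure (M n) S \<and> (\<forall>\<omega>\<in>S. \<omega> \<in> space (M n) \<and>
        \<bar>\<Sum>i<n. \<Sum>j<n. b i j * E n \<omega> i j\<bar>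
          \<le> (c + 7) * ln (real n) * (sqrt (2 * (C * rho n)) * w + 2 * B * (exp 1 * (C' * snr n / qn n)))))"
proof -
  obtain N where N: "N \<ge> N0" "\<And>n. n \<ge> N \<Longrightarrow> \<exists>r t. 2 \<le> r \<and> real n ^ 2 * exp (- real r) \<le> 1 \<and> real (2 * r) \<le> max_mom n \<and>
     t \<le> (c + 7) * ln (real n) \<and> 0 \<le> t \<and> real n ^ 2 * exp (- real r) + 2 * exp (3 - t) \<le> real n powr (- c) \<and> 3 \<le> n"
    using Bernstein_parameters[OF c] by blast
  show ?thesis
  proof (intro exI[of _ N] allI impI)
    fix n and b :: "nat \<Rightarrow> nat \<Rightarrow> real" and B w :: real
    assume n: "N \<le> n" and b: "\<forall>i<n. \<forall>j<n. \<bar>b i j\<bar> \<le> B" "(\<Sum>i<n. \<Sum>j<n. (b i j)\<^sup>2) \<le> w\<^sup>2" "0 < B" "0 \<le> w"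
    interpret prob_space "M n" by (rule prob)
    obtain r t where rt: "2 \<le> r" "real n ^ 2 * exp (- real r) \<le> 1" "real (2 * r) \<le> max_mom n"
      "t \<le> (c + 7) * ln (real n)" "0 \<le> t" "real n ^ 2 * exp (- real r) + 2 * exp (3 - t) \<le> real n powr (- c)" "3 \<le> n"
      using N(2)[OF n] by blast
    let ?W = "sqrt (2 * (C * rho n)) * w + 2 * B * (exp 1 * (C' * snr n / qn n))"
    have nn: "n \<ge> N0" "0 < n" using n N rt by auto
    have W: "0 \<le> ?W" using b rho[OF nn(1)] params C'_ge snr_pos[OF nn] qn_ge_1[OF nn] by auto
    have "measure (M n) {\<omega> \<in> space (M n). \<bar>\<Sum>i<n. \<Sum>j<n. b i j * E n \<omega> i j\<bar> \<ge> t * ?W} \<le> real n powr (- c)"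
      by (rule order_trans[OF linear_form_deviation[OF nn] rt(6)]) (use b rt in auto)
    moreover have "(\<lambda>\<omega>. \<Sum>i<n. \<Sum>j<n. b i j * E n \<omega> i j) \<in> borel_measurable (M n)"
      using Emeas by measurable
    ultimately obtain S where "S \<in> sets (M n)" "1 - real n powr (- c) \<le> measure (M n) S"
      and S: "\<forall>\<omega>\<in>S. \<omega> \<in> space (M n) \<and> \<bar>\<Sum>i<n. \<Sum>j<n. b i j * E n \<omega> i j\<bar> \<le> t * ?W"
      using event_of_deviation by blast
    moreover have "t * ?W \<le> (c + 7) * ln (real n) * ?W" using rt W by (intro mult_right_mono) auto
    ultimately show "\<exists>S\<in>sets (M n). 1 - real n powr (- c) \<le> measure (M n) S \<and> (\<forall>\<omega>\<in>S. \<omega> \<in> space (M n) \<and>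
        \<bar>\<Sum>i<n. \<Sum>j<n. b i j * E n \<omega> i j\<bar> \<le> (c + 7) * ln (real n) * ?W)"
      by (intro bexI[of _ S]) (auto intro: order_trans)
  qed
qed

lemma square_form_whp:
  assumes c: "0 < c"
  shows "\<exists>N. \<forall>n\<ge>N. \<forall>b B w. (\<forall>i<n. \<forall>j<n. \<bar>b i j\<bar> \<le> B) \<longrightarrow> (\<Sum>i<n. \<Sum>j<n. (b i j)\<^sup>2) \<le> w\<^sup>2 \<longrightarrow> 0 < B \<longrightarrow> 0 \<le> w \<longrightarrow>
     (\<exists>S\<in>sets (M n). 1 - real n powr (- c) \<le> measure (M n) S \<and> (\<forall>\<omega>\<in>S. \<omega> \<in> space (M n) \<and>
        \<bar>\<Sum>i<n. \<Sum>j<n. b i j * ((E n \<omega> i j)\<^sup>2 - sigma2 n i j)\<bar>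
          \<le> (c + 7) * ln (real n) * (sqrt (2 * ((C' * snr n) ^ 4 / (real n * qn n ^ 2))) * w + 2 * B * (exp 1 * (4 * (C' * snr n / qn n)\<^sup>2)))))"
proof -
  obtain N where N: "N \<ge> N0" "\<And>n. n \<ge> N \<Longrightarrow> \<exists>r t. 2 \<le> r \<and> real n ^ 2 * exp (- real r) \<le> 1 \<and> real (2 * r) \<le> max_mom n \<and>
     t \<le> (c + 7) * ln (real n) \<and> 0 \<le> t \<and> real n ^ 2 * exp (- real r) + 2 * exp (3 - t) \<le> real n powr (- c) \<and> 3 \<le> n"
    using Bernstein_parameters[OF c] by blast
  show ?thesis
  proof (intro exI[of _ N] allI impI)
    fix n and b :: "nat \<Rightarrow> nat \<Rightarrow> real" and B w :: real
    assume n: "N \<le> n" and b: "\<forall>i<n. \<forall>j<n. \<bar>b i j\<bar> \<le> B" "(\<Sum>i<n. \<Sum>j<n. (b i j)\<^sup>2) \<le> w\<^sup>2" "0 < B" "0 \<le> w"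
    interpret prob_space "M n" by (rule prob)
    obtain r t where rt: "2 \<le> r" "real n ^ 2 * exp (- real r) \<le> 1" "real (2 * r) \<le> max_mom n"
      "t \<le> (c + 7) * ln (real n)" "0 \<le> t" "real n ^ 2 * exp (- real r) + 2 * exp (3 - t) \<le> real n powr (- c)" "3 \<le> n"
      using N(2)[OF n] by blast
    let ?W = "sqrt (2 * ((C' * snr n) ^ 4 / (real n * qn n ^ 2))) * w + 2 * B * (exp 1 * (4 * (C' * snr n / qn n)\<^sup>2))"
    have nn: "n \<ge> N0" "0 < n" using n N rt by auto
    have W: "0 \<le> ?W" using b by auto
    have "measure (M n) {\<omega> \<in> space (M n). \<bar>\<Sum>i<n. \<Sum>j<n. b i j * ((E n \<omega> i j)\<^sup>2 - sigma2 n i j)\<bar> \<ge> t * ?W} \<le> real n powr (- c)"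
      by (rule order_trans[OF square_form_deviation[OF nn] rt(6)]) (use b rt in auto)
    moreover have "(\<lambda>\<omega>. \<Sum>i<n. \<Sum>j<n. b i j * ((E n \<omega> i j)\<^sup>2 - sigma2 n i j)) \<in> borel_measurable (M n)"
      using Emeas by measurable
    ultimately obtain S where "S \<in> sets (M n)" "1 - real n powr (- c) \<le> measure (M n) S"
      and S: "\<forall>\<omega>\<in>S. \<omega> \<in> space (M n) \<and> \<bar>\<Sum>i<n. \<Sum>j<n. b i j * ((E n \<omega> i j)\<^sup>2 - sigma2 n i j)\<bar> \<le> t * ?W"
      using event_of_deviation[of _ n "t * ?W" "real n powr (- c)"] by blast
    moreover have "t * ?W \<le> (c + 7) * ln (real n) * ?W" using rt W by (intro mult_right_mono) auto
    ultimately show "\<exists>S\<in>sets (M n). 1 - real n powr (- c) \<le> measure (M n) S \<and> (\<forall>\<omega>\<in>S. \<omega> \<in> space (M n) \<and>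
        \<bar>\<Sum>i<n. \<Sum>j<n. b i j * ((E n \<omega> i j)\<^sup>2 - sigma2 n i j)\<bar> \<le> (c + 7) * ln (real n) * ?W)"
      by (intro bexI[of _ S]) (auto intro: order_trans)
  qed
qed

text \<open>Markov's inequality for a fixed even moment \<open>L\<close> with \<open>e * L\<close>
  at least \<open>c + 1\<close>: a power gain \<open>e\<close> per factor beats any polynomial
  failure rate, and the spare unit absorbs the constant \<open>K\<close>.\<close>

lemma iterate_whp:
  assumes c: "0 < c" and e: "0 < e"
  shows "\<exists>N. \<forall>n\<ge>N. \<forall>i<n. \<forall>y b. (\<forall>j<n. \<bar>y j\<bar> \<le> b) \<longrightarrow> 0 < b \<longrightarrow>
     (\<exists>S\<in>sets (M n). 1 - real n powr (- c) \<le> measure (M n) S \<and> (\<forall>\<omega>\<in>S. \<omega> \<in> space (M n) \<and>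
        \<bar>(mv n (E n \<omega>) ^^ r) y i\<bar> \<le> real n powr e * b * snr n ^ r))"
proof -
  define L where "L = 2 * nat \<lceil>(c + 1) / e\<rceil>"
  define K where "K = real (L * r) ^ (L * r) * C' ^ (L * r)"
  have "(c + 1) / e \<le> real L" unfolding L_def by linarith
  then have eL: "c + 1 \<le> e * real L" using e by (simp add: field_simps)
  have "eventually (\<lambda>n. K \<le> real n) sequentially" by real_asymp
  moreover have "eventually (\<lambda>n. real (L * r) \<le> max_mom n) sequentially"
    using max_mom_ge[of 0 "real (L * r)"] by simp
  moreover have "eventually (\<lambda>n. N0 \<le> n \<and> 1 \<le> n) sequentially"
    by (intro eventually_conj eventually_ge_at_top)
  ultimately have "eventually (\<lambda>n. K \<le> real n \<and> real (L * r) \<le> max_mom n \<and> N0 \<le> n \<and> 1 \<le> n) sequentially"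
    by eventually_elim auto
  then obtain N where N: "\<And>n. n \<ge> N \<Longrightarrow> K \<le> real n \<and> real (L * r) \<le> max_mom n \<and> N0 \<le> n \<and> 1 \<le> n"
    unfolding eventually_sequentially by blast
  show ?thesis
  proof (intro exI[of _ N] allI impI)
    fix n i and y :: "nat \<Rightarrow> real" and b :: real
    assume n: "N \<le> n" and i: "i < n" and y: "\<forall>j<n. \<bar>y j\<bar> \<le> b" and b: "0 < b"
    interpret prob_space "M n" by (rule prob)
    note nn = N[OF n]
    have s: "0 < snr n" using snr_pos[of n] nn by simp
    let ?X = "\<lambda>\<omega>. (mv n (E n \<omega>) ^^ r) y i"
    let ?t = "real n powr e * b * snr n ^ r"
    have t: "0 < ?t" using b s nn by simp
    have m: "integrable (M n) (\<lambda>\<omega>. ?X \<omega> ^ L)" "\<bar>expectation (\<lambda>\<omega>. ?X \<omega> ^ L)\<bar> \<le> real (L * r) ^ (L * r) * b ^ L * (C' * snr n) ^ (L * r)"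
      using iterate_moment[of n i y b L r] nn i y b by auto
    have [measurable]: "?X \<in> borel_measurable (M n)" by (rule mv_funpow_measurable)
    have even: "even L" by (simp add: L_def)
    have "prob {\<omega> \<in> space (M n). \<bar>?X \<omega>\<bar> \<ge> ?t} \<le> prob {\<omega> \<in> space (M n). ?t ^ L \<le> ?X \<omega> ^ L}"
    proof (rule finite_measure_mono)
      show "{\<omega> \<in> space (M n). \<bar>?X \<omega>\<bar> \<ge> ?t} \<subseteq> {\<omega> \<in> space (M n). ?t ^ L \<le> ?X \<omega> ^ L}"
      proof
        fix \<omega> assume w: "\<omega> \<in> {\<omega> \<in> space (M n). \<bar>?X \<omega>\<bar> \<ge> ?t}"
        then have "?t ^ L \<le> \<bar>?X \<omega>\<bar> ^ L" by (intro power_mono less_imp_le[OF t]) simp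
        also have "\<dots> = ?X \<omega> ^ L" by (rule power_even_abs[OF even])
        finally show "\<omega> \<in> {\<omega> \<in> space (M n). ?t ^ L \<le> ?X \<omega> ^ L}" using w by simp
      qed
    qed measurable
    also have "\<dots> \<le> expectation (\<lambda>\<omega>. ?X \<omega> ^ L) / ?t ^ L"
      by (rule integral_Markov_inequality_measure[where A = "{}", OF m(1)]) (use t even in \<open>auto intro: zero_le_even_power\<close>)
    also have "\<dots> \<le> (real (L * r) ^ (L * r) * b ^ L * (C' * snr n) ^ (L * r)) / ?t ^ L"
      using m t by (intro divide_right_mono) auto
    also have "?t ^ L = real n powr (e * real L) * b ^ L * snr n ^ (L * r)"
    proof -
      have "(real n powr e) ^ L = real n powr (e * real L)"
        using nn by (simp add: powr_powr powr_realpow[symmetric])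
      then show ?thesis by (simp only: power_mult_distrib power_mult[symmetric] mult.commute[of r L])
    qed
    also have "(real (L * r) ^ (L * r) * b ^ L * (C' * snr n) ^ (L * r)) / (real n powr (e * real L) * b ^ L * snr n ^ (L * r))
       = K / real n powr (e * real L)"
      using b s by (simp add: K_def power_mult_distrib)
    also have "\<dots> \<le> real n / real n powr (c + 1)"
      using nn eL by (intro frac_le powr_mono) auto
    also have "\<dots> = real n powr (- c)"
      using nn by (simp add: powr_add powr_minus field_simps)
    finally have "prob {\<omega> \<in> space (M n). \<bar>?X \<omega>\<bar> \<ge> ?t} \<le> real n powr (- c)" .
    then show "\<exists>S\<in>sets (M n). 1 - real n powr (- c) \<le> prob S \<and> (\<forall>\<omega>\<in>S. \<omega> \<in> space (M n) \<and> \<bar>?X \<omega>\<bar> \<le> ?t)"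
      by (intro event_of_deviation) measurable
  qed
qed

text \<open>Markov's inequality for the trace of \<open>E^R\<close>, where \<open>R\<close> is twice
  a power of two. Of the two spare units in \<open>c + 2\<close>, one pays for the \<open>n\<close>
  summands of the trace and one for the constant \<open>K\<close>.\<close>

lemma operator_norm_whp:
  assumes c: "0 < c" and e: "0 < e"
  shows "hp c (\<lambda>n \<omega>. \<forall>x. inner_n n (mv n (E n \<omega>) x) (mv n (E n \<omega>) x) \<le> (real n powr e * snr n)\<^sup>2 * inner_n n x x)"
proof -
  obtain k :: nat where k: "(c + 2) / e \<le> 2 ^ k"
    using real_arch_pow[of 2 "(c + 2) / e"] by (auto intro: less_imp_le)
  define R :: nat where "R = 2 * 2 ^ k"
  have "real R = 2 * 2 ^ k" by (simp add: R_def)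
  then have "(c + 2) / e \<le> real R" using k one_le_power[of "2::real" k] by linarith
  then have eR: "c + 2 \<le> e * real R" using e by (simp add: field_simps)
  define K where "K = real R ^ R * C' ^ R"
  have "eventually (\<lambda>n. K \<le> real n) sequentially" by real_asymp
  moreover have "eventually (\<lambda>n. real R \<le> max_mom n) sequentially"
    using max_mom_ge[of 0 "real R"] by simp
  moreover have "eventually (\<lambda>n. N0 \<le> n \<and> 1 \<le> n) sequentially"
    by (intro eventually_conj eventually_ge_at_top)
  ultimately have "eventually (\<lambda>n. K \<le> real n \<and> real R \<le> max_mom n \<and> N0 \<le> n \<and> 1 \<le> n) sequentially"
    by eventually_elim auto
  then obtain N where N: "\<And>n. n \<ge> N \<Longrightarrow> K \<le> real n \<and> real R \<le> max_mom n \<and> N0 \<le> n \<and> 1 \<le> n"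
    unfolding eventually_sequentially by blast
  show ?thesis unfolding hp_def
  proof (intro exI[of _ N] allI impI)
    fix n assume n: "N \<le> n"
    interpret prob_space "M n" by (rule prob)
    note nn = N[OF n]
    have s: "0 < snr n" using snr_pos[of n] nn by simp
    let ?e = "\<lambda>j l. if l = j then 1 else 0 :: real"
    let ?D = "\<lambda>\<omega>. \<Sum>j<n. (mv n (E n \<omega>) ^^ R) (?e j) j"
    let ?h = "real n powr e * snr n"
    have h: "0 < ?h" using s nn by simp
    have m: "integrable (M n) (\<lambda>\<omega>. (mv n (E n \<omega>) ^^ R) (?e j) j)"
      "\<bar>expectation (\<lambda>\<omega>. (mv n (E n \<omega>) ^^ R) (?e j) j)\<bar> \<le> real R ^ R * (C' * snr n) ^ R" if "j < n" for j
      using iterate_moment[of n j "?e j" 1 1 R] nn that by auto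
    have D[measurable]: "?D \<in> borel_measurable (M n)" using mv_funpow_measurable by measurable
    have pos: "0 \<le> ?D \<omega>" if w: "\<omega> \<in> space (M n)" for \<omega>
    proof (intro sum_nonneg)
      fix j assume j: "j \<in> {..<n}"
      have "(mv n (E n \<omega>) ^^ R) (?e j) j = inner_n n (?e j) ((mv n (E n \<omega>) ^^ R) (?e j))"
        unfolding inner_n_def using j by (simp add: if_distrib[of "\<lambda>x. x * _"] cong: if_cong)
      also have "\<dots> = inner_n n (?e j) ((mv n (E n \<omega>) ^^ (2 ^ k)) ((mv n (E n \<omega>) ^^ (2 ^ k)) (?e j)))"
        by (simp add: R_def mult_2 funpow_add)
      also have "\<dots> = inner_n n ((mv n (E n \<omega>) ^^ (2 ^ k)) (?e j)) ((mv n (E n \<omega>) ^^ (2 ^ k)) (?e j))"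
        by (rule funpow_mv_sym) (use Esym w in auto)
      finally show "0 \<le> (mv n (E n \<omega>) ^^ R) (?e j) j" by (simp add: inner_n_nonneg)
    qed
    have "prob {\<omega> \<in> space (M n). \<bar>?D \<omega>\<bar> \<ge> ?h ^ R} = prob {\<omega> \<in> space (M n). ?h ^ R \<le> ?D \<omega>}"
      by (rule arg_cong[of _ _ prob]) (use pos in auto)
    also have "\<dots> \<le> expectation ?D / ?h ^ R"
      by (rule integral_Markov_inequality_measure[where A = "{}"])
         (use m(1) h pos in \<open>auto intro!: Bochner_Integration.integrable_sum\<close>)
    also have "\<dots> \<le> (real n * (real R ^ R * (C' * snr n) ^ R)) / ?h ^ R"
    proof (intro divide_right_mono)
      have "expectation ?D = (\<Sum>j<n. expectation (\<lambda>\<omega>. (mv n (E n \<omega>) ^^ R) (?e j) j))"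
        by (rule Bochner_Integration.integral_sum) (use m in auto)
      also have "\<dots> \<le> (\<Sum>j<n. real R ^ R * (C' * snr n) ^ R)"
        using m(2) by (intro sum_mono) (auto simp: abs_le_iff)
      finally show "expectation ?D \<le> real n * (real R ^ R * (C' * snr n) ^ R)" by simp
    qed (use h in auto)
    also have "\<dots> = real n * K / real n powr (e * real R)"
    proof -
      have "?h ^ R = real n powr (e * real R) * snr n ^ R"
        using nn by (simp add: power_mult_distrib powr_powr powr_realpow[symmetric])
      then show ?thesis using s by (simp add: K_def power_mult_distrib)
    qed
    also have "\<dots> \<le> real n * real n / real n powr (c + 2)"
      using nn eR by (intro frac_le powr_mono mult_left_mono) auto
    also have "\<dots> = real n powr (- c)"
    proof -
      have "real n * real n = real n powr 2" using nn by (simp add: powr_numeral power2_eq_square)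
      then have "real n * real n / real n powr (c + 2) = real n powr (2 - (c + 2))"
        by (simp only: powr_diff)
      then show ?thesis by simp
    qed
    finally have "prob {\<omega> \<in> space (M n). \<bar>?D \<omega>\<bar> \<ge> ?h ^ R} \<le> real n powr (- c)" .
    from event_of_deviation[OF D this] obtain S where S: "S \<in> sets (M n)" "1 - real n powr (- c) \<le> prob S"
      "\<forall>\<omega>\<in>S. \<omega> \<in> space (M n) \<and> \<bar>?D \<omega>\<bar> \<le> ?h ^ R"
      by auto
    show "\<exists>S\<in>sets (M n). 1 - real n powr (- c) \<le> prob S \<and> (\<forall>\<omega>\<in>S. \<forall>x. inner_n n (mv n (E n \<omega>) x) (mv n (E n \<omega>) x) \<le> ?h\<^sup>2 * inner_n n x x)"
    proof (intro bexI[of _ S] conjI ballI allI S)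
      fix \<omega> x assume w: "\<omega> \<in> S"
      show "inner_n n (mv n (E n \<omega>) x) (mv n (E n \<omega>) x) \<le> ?h\<^sup>2 * inner_n n x x"
        by (rule mv_norm_le_of_trace[where s = k])
           (use S(3) w Esym h in \<open>auto simp: R_def[symmetric]\<close>)
    qed
  qed
qed

end

section \<open>Spiked matrices and the good event\<close>

locale spiked_noise = sparse_noise M E N0 rho qn eps C A0
  for M :: "nat \<Rightarrow> 'a measure" and E N0 rho qn eps C A0 +
  fixes d p :: nat
    and lam :: "nat \<Rightarrow> nat \<Rightarrow> real"
    and u :: "nat \<Rightarrow> nat \<Rightarrow> nat \<Rightarrow> real"
    and lamA :: "nat \<Rightarrow> 'a \<Rightarrow> nat \<Rightarrow> real"
    and uhat :: "nat \<Rightarrow> 'a \<Rightarrow> nat \<Rightarrow> nat \<Rightarrow> real"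
    and betaD C1 C2 delta0 Cmu :: real
  assumes pd: "p \<le> d" and d_pos: "0 < d"
    and lam_sorted: "\<And>n m. n \<ge> N0 \<Longrightarrow> Suc m < d \<Longrightarrow> lam n (Suc m) \<le> lam n m"
    and lam_pos: "\<And>n m. n \<ge> N0 \<Longrightarrow> m < p \<Longrightarrow> lam n m > 0"
    and lam_neg: "\<And>n m. n \<ge> N0 \<Longrightarrow> p \<le> m \<Longrightarrow> m < d \<Longrightarrow> lam n m < 0"
    and u_orth: "\<And>n m m'. n \<ge> N0 \<Longrightarrow> m < d \<Longrightarrow> m' < d \<Longrightarrow>
                   inner_n n (u n m) (u n m') = (if m = m' then 1 else 0)"
    and A_eig: "\<And>n \<omega> m i. \<omega> \<in> space (M n) \<Longrightarrow> m < n \<Longrightarrow> i < n \<Longrightarrow>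
                  (\<Sum>j<n. (lowrank d (lam n) (u n) i j + E n \<omega> i j) * uhat n \<omega> m j) = lamA n \<omega> m * uhat n \<omega> m i"
    and A_orth: "\<And>n \<omega> m m'. \<omega> \<in> space (M n) \<Longrightarrow> m < n \<Longrightarrow> m' < n \<Longrightarrow>
                  inner_n n (uhat n \<omega> m) (uhat n \<omega> m') = (if m = m' then 1 else 0)"
    and A_sorted: "\<And>n \<omega> m. \<omega> \<in> space (M n) \<Longrightarrow> Suc m < n \<Longrightarrow> lamA n \<omega> (Suc m) \<le> lamA n \<omega> m"
    and spike: "betaD > 0" "C1 > 0" "C2 > 0"
    and lam_lo: "\<And>n. n \<ge> N0 \<Longrightarrow>
                 C1 * real n powr betaD * sqrt (real n * rho n) \<le> Min ((\<lambda>m. \<bar>lam n m\<bar>) ` {..<d})"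
    and lam_hi: "\<And>n. n \<ge> N0 \<Longrightarrow>
                 Max ((\<lambda>m. \<bar>lam n m\<bar>) ` {..<d}) \<le> C2 * real n powr betaD * sqrt (real n * rho n)"
    and gap: "delta0 > 0" "\<And>n. n \<ge> N0 \<Longrightarrow> gapDelta d (lam n) \<ge> delta0 * Min ((\<lambda>m. \<bar>lam n m\<bar>) ` {..<d})"
    and deloc: "Cmu \<ge> 1" "\<And>n i. n \<ge> N0 \<Longrightarrow> i < n \<Longrightarrow>
               sqrt (\<Sum>m<d. (u n m i)\<^sup>2) \<le> Cmu * sqrt (real d / real n)"
begin

definition Del :: "nat \<Rightarrow> real" where "Del n = gapDelta d (lam n)"
definition Ku :: real where "Ku = Cmu * sqrt (real d)"

lemma Ku_pos: "0 < Ku" using deloc d_pos by (simp add: Ku_def)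

lemma u_bound: "n \<ge> N0 \<Longrightarrow> i < n \<Longrightarrow> m < d \<Longrightarrow> \<bar>u n m i\<bar> \<le> Ku / sqrt (real n)"
proof -
  assume n: "n \<ge> N0" "i < n" "m < d"
  have "(u n m i)\<^sup>2 \<le> (\<Sum>m<d. (u n m i)\<^sup>2)" using n by (intro member_le_sum) auto
  then have "sqrt ((u n m i)\<^sup>2) \<le> sqrt (\<Sum>m<d. (u n m i)\<^sup>2)" by (rule real_sqrt_le_mono)
  then show ?thesis using deloc(2)[OF n(1,2)] by (simp add: Ku_def real_sqrt_divide)
qed

lemma snr_div_sqrt: "n \<ge> N0 \<Longrightarrow> 0 < n \<Longrightarrow> snr n / sqrt (real n) = sqrt (rho n)"
  by (simp add: snr_def real_sqrt_mult)

text \<open>The first two clauses lose \<open>n powr e\<close> and serve only higher-order terms.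
  The last three are sharp up to one logarithm, because they feed directly into the stated rate; in
  the fourth, averaging over coordinates saves a factor \<open>sqrt n\<close> against a
  coordinatewise estimate.\<close>

definition good :: "real \<Rightarrow> real \<Rightarrow> nat \<Rightarrow> nat \<Rightarrow> 'a \<Rightarrow> bool" where
  "good K e R n \<omega> \<longleftrightarrow>
     (\<forall>m<d. \<forall>r<R. \<forall>i<n. \<bar>(mv n (E n \<omega>) ^^ r) (u n m) i\<bar> \<le> real n powr e * snr n ^ r / sqrt (real n))
   \<and> (\<forall>x. inner_n n (mv n (E n \<omega>) x) (mv n (E n \<omega>) x) \<le> (real n powr e * snr n)\<^sup>2 * inner_n n x x)
   \<and> (\<forall>m<d. \<forall>i<n. \<bar>mv n (E n \<omega>) (u n m) i\<bar> \<le> K * (sqrt (rho n) * ln (real n)))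
   \<and> (\<forall>l<d. \<forall>m<d. \<bar>inner_n n (u n l) (mv n (E n \<omega>) (u n m))\<bar> \<le> K * (sqrt (rho n) * ln (real n)))
   \<and> (\<forall>i<n. \<bar>\<Sum>j<n. (E n \<omega> i j)\<^sup>2 - sigma2 n i j\<bar> \<le> K * ((snr n)\<^sup>2 / qn n * ln (real n)))"

lemma iterates_good:
  assumes c: "0 < c" and e: "0 < e"
  shows "hp c (\<lambda>n \<omega>. \<forall>m<d. \<forall>r<R. \<forall>i<n. \<bar>(mv n (E n \<omega>) ^^ r) (u n m) i\<bar> \<le> real n powr e * snr n ^ r / sqrt (real n))"
proof (rule hp_finite, rule hp_finite)
  fix m r assume m: "m < d" and r: "r < R"
  have "eventually (\<lambda>n. Ku * real n powr (e / 2) \<le> real n powr e) sequentially"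
    using e by real_asymp
  then obtain N1 where N1: "\<And>n. n \<ge> N1 \<Longrightarrow> Ku * real n powr (e / 2) \<le> real n powr e"
    unfolding eventually_sequentially by blast
  \<comment> \<open>Half of the exponent \<open>e\<close> goes into the probability bound, the other
    half absorbs the delocalisation constant \<open>Ku\<close>.\<close>
  have ce: "0 < c + 1 + 1 + 1" "0 < e / 2" using c e by auto
  from iterate_whp[OF ce, of r] obtain N2 where N2: "\<forall>n\<ge>N2. \<forall>i<n. \<forall>y b. (\<forall>j<n. \<bar>y j\<bar> \<le> b) \<longrightarrow> 0 < b \<longrightarrow>
     (\<exists>S\<in>sets (M n). 1 - real n powr (- (c + 1 + 1 + 1)) \<le> measure (M n) S \<and> (\<forall>\<omega>\<in>S. \<omega> \<in> space (M n) \<and>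
        \<bar>(mv n (E n \<omega>) ^^ r) y i\<bar> \<le> real n powr (e / 2) * b * snr n ^ r))" ..
  show "hp (c + 1 + 1) (\<lambda>n \<omega>. \<forall>i<n. \<bar>(mv n (E n \<omega>) ^^ r) (u n m) i\<bar> \<le> real n powr e * snr n ^ r / sqrt (real n))"
  proof (rule hp_all_less[where NA = "max N0 (max N1 N2)" and NB = 0])
    fix n i assume n: "max N0 (max N1 N2) \<le> n" and i: "i < n"
    have n0: "0 < n" using i by simp
    have s: "0 < snr n" using snr_pos[of n] n n0 by simp
    have nN: "N2 \<le> n" and bb: "\<forall>j<n. \<bar>u n m j\<bar> \<le> Ku / sqrt (real n)" and pos: "0 < Ku / sqrt (real n)"
      using n u_bound[of n _ m] m Ku_pos n0 by auto
    from N2[THEN spec, THEN mp, OF nN, THEN spec, THEN mp, OF i, THEN spec, THEN spec, THEN mp, OF bb, THEN mp, OF pos]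
    obtain S where S: "S \<in> sets (M n)" "1 - real n powr (- (c + 1 + 1 + 1)) \<le> measure (M n) S"
      "\<And>\<omega>. \<omega> \<in> S \<Longrightarrow> \<bar>(mv n (E n \<omega>) ^^ r) (u n m) i\<bar> \<le> real n powr (e / 2) * (Ku / sqrt (real n)) * snr n ^ r"
      by blast
    have "real n powr (e / 2) * (Ku / sqrt (real n)) * snr n ^ r = (Ku * real n powr (e / 2)) * (snr n ^ r / sqrt (real n))"
      by simp
    also have "\<dots> \<le> real n powr e * (snr n ^ r / sqrt (real n))"
      using N1[of n] n s by (intro mult_right_mono) auto
    finally have "real n powr (e / 2) * (Ku / sqrt (real n)) * snr n ^ r \<le> real n powr e * snr n ^ r / sqrt (real n)"
      by simp
    then show "\<exists>S\<in>sets (M n). 1 - real n powr (- (c + 1 + 1 + 1)) \<le> measure (M n) S \<and>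
        (\<forall>\<omega>\<in>S. \<bar>(mv n (E n \<omega>) ^^ r) (u n m) i\<bar> \<le> real n powr e * snr n ^ r / sqrt (real n))"
      using S by (intro bexI[of _ S]) (auto intro: order_trans)
  qed simp
qed

definition KB :: "real \<Rightarrow> real \<Rightarrow> real" where
  "KB c B = (c + 7) * (sqrt (2 * C) + 2 * B * (exp 1 * C'))"

text \<open>For coefficients of size \<open>1 / sqrt n\<close> the range term of the Bernstein bound
  is no larger than the standard deviation term, since \<open>snr n / sqrt n\<close> is
  \<open>sqrt (rho n)\<close> and \<open>qn n\<close> is at least 1.\<close>

lemma Bernstein_scale:
  assumes n: "n \<ge> N0" "0 < n" and c: "0 < c" and B: "0 < B" "b \<le> B / sqrt (real n)" "0 \<le> b"
  shows "(c + 7) * ln (real n) * (sqrt (2 * (C * rho n)) * 1 + 2 * b * (exp 1 * (C' * snr n / qn n)))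
    \<le> KB c B * (sqrt (rho n) * ln (real n))"
proof -
  have s: "0 < snr n" using snr_pos[OF n] .
  have q: "1 \<le> qn n" using qn_ge_1[OF n] .
  have "2 * b * (exp 1 * (C' * snr n / qn n)) \<le> 2 * (B / sqrt (real n)) * (exp 1 * (C' * snr n / 1))"
    using s q C'_ge B n by (intro mult_mono divide_left_mono) auto
  also have "\<dots> = 2 * B * (exp 1 * C') * (snr n / sqrt (real n))" by simp
  also have "\<dots> = 2 * B * (exp 1 * C') * sqrt (rho n)" by (simp only: snr_div_sqrt[OF n])
  finally have "sqrt (2 * (C * rho n)) * 1 + 2 * b * (exp 1 * (C' * snr n / qn n))
     \<le> (sqrt (2 * C) + 2 * B * (exp 1 * C')) * sqrt (rho n)"
    by (simp add: real_sqrt_mult distrib_right)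
  then have "(c + 7) * ln (real n) * (sqrt (2 * (C * rho n)) * 1 + 2 * b * (exp 1 * (C' * snr n / qn n)))
     \<le> (c + 7) * ln (real n) * ((sqrt (2 * C) + 2 * B * (exp 1 * C')) * sqrt (rho n))"
    using c n by (intro mult_left_mono) auto
  then show ?thesis by (simp add: KB_def mult_ac)
qed

lemma KB_nonneg: "0 < c \<Longrightarrow> 0 < B \<Longrightarrow> 0 \<le> KB c B"
  using C'_ge params by (simp add: KB_def)

lemma rows_good:
  assumes c: "0 < c"
  shows "\<exists>K\<ge>0. hp c (\<lambda>n \<omega>. \<forall>m<d. \<forall>i<n. \<bar>mv n (E n \<omega>) (u n m) i\<bar> \<le> K * (sqrt (rho n) * ln (real n)))"
proof -
  define cc where "cc = c + 1 + 1"
  have cc: "0 < cc" using c by (simp add: cc_def)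
  from linear_form_whp[OF cc] obtain N where N: "\<forall>n\<ge>N. \<forall>b B w. (\<forall>i<n. \<forall>j<n. \<bar>b i j\<bar> \<le> B) \<longrightarrow> (\<Sum>i<n. \<Sum>j<n. (b i j)\<^sup>2) \<le> w\<^sup>2 \<longrightarrow> 0 < B \<longrightarrow> 0 \<le> w \<longrightarrow>
     (\<exists>S\<in>sets (M n). 1 - real n powr (- cc) \<le> measure (M n) S \<and> (\<forall>\<omega>\<in>S. \<omega> \<in> space (M n) \<and>
        \<bar>\<Sum>i<n. \<Sum>j<n. b i j * E n \<omega> i j\<bar>
          \<le> (cc + 7) * ln (real n) * (sqrt (2 * (C * rho n)) * w + 2 * B * (exp 1 * (C' * snr n / qn n)))))" ..
  have "hp c (\<lambda>n \<omega>. \<forall>m<d. \<forall>i<n. \<bar>mv n (E n \<omega>) (u n m) i\<bar> \<le> KB cc Ku * (sqrt (rho n) * ln (real n)))"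
  proof (rule hp_finite)
    fix m assume m: "m < d"
    show "hp (c + 1) (\<lambda>n \<omega>. \<forall>i<n. \<bar>mv n (E n \<omega>) (u n m) i\<bar> \<le> KB cc Ku * (sqrt (rho n) * ln (real n)))"
    proof (rule hp_all_less[where NA = "max N0 N" and NB = 0])
      fix n i assume n: "max N0 N \<le> n" and i: "i < n"
      \<comment> \<open>A coefficient matrix supported on row \<open>i\<close>; its Frobenius norm
        is 1 because \<open>u n m\<close> is a unit vector.\<close>
      define b where "b x y = (if x = i then u n m y else 0)" for x y
      have n0: "n \<ge> N0" "0 < n" using n i by auto
      have "(\<Sum>x<n. \<Sum>y<n. (b x y)\<^sup>2) = (\<Sum>x<n. if x = i then (\<Sum>y<n. (u n m y)\<^sup>2) else 0)"
        by (intro sum.cong) (auto simp: b_def)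
      also have "\<dots> = 1" using i u_orth[OF n0(1) m m] by (simp add: inner_n_def power2_eq_square)
      finally have b2: "(\<Sum>x<n. \<Sum>y<n. (b x y)\<^sup>2) \<le> 1\<^sup>2" by simp
      have bE: "(\<Sum>x<n. \<Sum>y<n. b x y * E n \<omega> x y) = mv n (E n \<omega>) (u n m) i" for \<omega>
      proof -
        have "(\<Sum>x<n. \<Sum>y<n. b x y * E n \<omega> x y) = (\<Sum>x<n. if x = i then (\<Sum>y<n. u n m y * E n \<omega> x y) else 0)"
          by (intro sum.cong) (auto simp: b_def)
        then show ?thesis using i by (simp add: mv_def mult.commute)
      qed
      have bb: "\<forall>x<n. \<forall>y<n. \<bar>b x y\<bar> \<le> Ku / sqrt (real n)"
        using u_bound[OF n0(1) _ m] Ku_pos by (auto simp: b_def)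
      have nN: "N \<le> n" and pos: "0 < Ku / sqrt (real n)" "0 \<le> (1::real)" using n n0 Ku_pos by auto
      from N[THEN spec, THEN mp, OF nN, THEN spec, THEN spec, THEN spec, THEN mp, OF bb, THEN mp, OF b2, THEN mp, OF pos(1), THEN mp, OF pos(2), unfolded bE] obtain S where S: "S \<in> sets (M n)" "1 - real n powr (- cc) \<le> measure (M n) S"
        "\<And>\<omega>. \<omega> \<in> S \<Longrightarrow> \<bar>mv n (E n \<omega>) (u n m) i\<bar>
          \<le> (cc + 7) * ln (real n) * (sqrt (2 * (C * rho n)) * 1 + 2 * (Ku / sqrt (real n)) * (exp 1 * (C' * snr n / qn n)))"
        by blast
      then show "\<exists>S\<in>sets (M n). 1 - real n powr (- (c + 1 + 1)) \<le> measure (M n) S \<and>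
          (\<forall>\<omega>\<in>S. \<bar>mv n (E n \<omega>) (u n m) i\<bar> \<le> KB cc Ku * (sqrt (rho n) * ln (real n)))"
        using Bernstein_scale[OF n0 cc Ku_pos order_refl less_imp_le[OF pos(1)]]
        by (intro bexI[of _ S]) (auto simp: cc_def intro: order_trans)
    qed simp
  qed
  then show ?thesis using KB_nonneg[OF cc Ku_pos] by blast
qed

lemma quadratic_forms_good:
  assumes c: "0 < c"
  shows "\<exists>K\<ge>0. hp c (\<lambda>n \<omega>. \<forall>l<d. \<forall>m<d. \<bar>inner_n n (u n l) (mv n (E n \<omega>) (u n m))\<bar> \<le> K * (sqrt (rho n) * ln (real n)))"
proof -
  define cc where "cc = c + 1 + 1"
  have cc: "0 < cc" using c by (simp add: cc_def)
  from linear_form_whp[OF cc] obtain N where N: "\<forall>n\<ge>N. \<forall>b B w. (\<forall>i<n. \<forall>j<n. \<bar>b i j\<bar> \<le> B) \<longrightarrow> (\<Sum>i<n. \<Sum>j<n. (b i j)\<^sup>2) \<le> w\<^sup>2 \<longrightarrow> 0 < B \<longrightarrow> 0 \<le> w \<longrightarrow>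
     (\<exists>S\<in>sets (M n). 1 - real n powr (- cc) \<le> measure (M n) S \<and> (\<forall>\<omega>\<in>S. \<omega> \<in> space (M n) \<and>
        \<bar>\<Sum>i<n. \<Sum>j<n. b i j * E n \<omega> i j\<bar>
          \<le> (cc + 7) * ln (real n) * (sqrt (2 * (C * rho n)) * w + 2 * B * (exp 1 * (C' * snr n / qn n)))))" ..
  have Ku2: "0 < Ku\<^sup>2" using Ku_pos by simp
  have "hp c (\<lambda>n \<omega>. \<forall>l<d. \<forall>m<d. \<bar>inner_n n (u n l) (mv n (E n \<omega>) (u n m))\<bar> \<le> KB cc (Ku\<^sup>2) * (sqrt (rho n) * ln (real n)))"
  proof (rule hp_finite, rule hp_finite)
    fix l m assume l: "l < d" and m: "m < d"
    show "hp (c + 1 + 1) (\<lambda>n \<omega>. \<bar>inner_n n (u n l) (mv n (E n \<omega>) (u n m))\<bar> \<le> KB cc (Ku\<^sup>2) * (sqrt (rho n) * ln (real n)))"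
      unfolding hp_def
    proof (intro exI[of _ "max 1 (max N0 N)"] allI impI)
      fix n assume n: "max 1 (max N0 N) \<le> n"
      \<comment> \<open>A rank-one coefficient matrix of Frobenius norm 1, with entries of size
        \<open>1 / n\<close>.\<close>
      define b where "b x y = u n l x * u n m y" for x y
      have n0: "n \<ge> N0" "0 < n" using n by auto
      have "(\<Sum>x<n. \<Sum>y<n. (b x y)\<^sup>2) = inner_n n (u n l) (u n l) * inner_n n (u n m) (u n m)"
        by (simp add: b_def inner_n_def sum_product power2_eq_square mult_ac)
      then have b2: "(\<Sum>x<n. \<Sum>y<n. (b x y)\<^sup>2) \<le> 1\<^sup>2" using u_orth[OF n0(1)] l m by simp
      have bE: "(\<Sum>x<n. \<Sum>y<n. b x y * E n \<omega> x y) = inner_n n (u n l) (mv n (E n \<omega>) (u n m))" for \<omega>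
        by (simp add: b_def inner_n_def mv_def sum_distrib_left mult_ac)
      have bb: "\<forall>x<n. \<forall>y<n. \<bar>b x y\<bar> \<le> Ku\<^sup>2 / real n"
      proof (intro allI impI)
        fix x y assume that: "x < n" "y < n"
        have "\<bar>b x y\<bar> \<le> (Ku / sqrt (real n)) * (Ku / sqrt (real n))"
          unfolding b_def abs_mult using u_bound[OF n0(1) that(1) l] u_bound[OF n0(1) that(2) m] Ku_pos n0
          by (intro mult_mono) auto
        then show "\<bar>b x y\<bar> \<le> Ku\<^sup>2 / real n" by (simp add: power2_eq_square)
      qed
      have nN: "N \<le> n" and pos: "0 < Ku\<^sup>2 / real n" "0 \<le> (1::real)" using n n0 Ku2 by auto
      from N[THEN spec, THEN mp, OF nN, THEN spec, THEN spec, THEN spec, THEN mp, OF bb, THEN mp, OF b2, THEN mp, OF pos(1), THEN mp, OF pos(2), unfolded bE] obtain S where S: "S \<in> sets (M n)" "1 - real n powr (- cc) \<le> measure (M n) S"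
        "\<And>\<omega>. \<omega> \<in> S \<Longrightarrow> \<bar>inner_n n (u n l) (mv n (E n \<omega>) (u n m))\<bar>
          \<le> (cc + 7) * ln (real n) * (sqrt (2 * (C * rho n)) * 1 + 2 * (Ku\<^sup>2 / real n) * (exp 1 * (C' * snr n / qn n)))"
        by blast
      have "Ku\<^sup>2 / real n \<le> Ku\<^sup>2 / sqrt (real n)"
      proof (intro divide_left_mono)
        have "sqrt (real n) * 1 \<le> sqrt (real n) * sqrt (real n)" using n0 by (intro mult_left_mono) auto
        then show "sqrt (real n) \<le> real n" by simp
      qed (use n0 in auto)
      from Bernstein_scale[OF n0 cc Ku2 this less_imp_le[OF pos(1)]] S
      show "\<exists>S\<in>sets (M n). 1 - real n powr (- (c + 1 + 1)) \<le> measure (M n) S \<and>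
          (\<forall>\<omega>\<in>S. \<bar>inner_n n (u n l) (mv n (E n \<omega>) (u n m))\<bar> \<le> KB cc (Ku\<^sup>2) * (sqrt (rho n) * ln (real n)))"
        by (intro bexI[of _ S]) (auto simp: cc_def intro: order_trans)
    qed
  qed
  then show ?thesis using KB_nonneg[OF cc Ku2] by blast
qed

lemma squares_good:
  assumes c: "0 < c"
  shows "\<exists>K\<ge>0. hp c (\<lambda>n \<omega>. \<forall>i<n. \<bar>\<Sum>j<n. (E n \<omega> i j)\<^sup>2 - sigma2 n i j\<bar> \<le> K * ((snr n)\<^sup>2 / qn n * ln (real n)))"
proof -
  define cc where "cc = c + 1"
  have cc: "0 < cc" using c by (simp add: cc_def)
  define K where "K = (cc + 7) * (sqrt 2 * C'\<^sup>2 + 2 * (exp 1 * (4 * C'\<^sup>2)))"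
  from square_form_whp[OF cc] obtain N where N: "\<forall>n\<ge>N. \<forall>b B w. (\<forall>i<n. \<forall>j<n. \<bar>b i j\<bar> \<le> B) \<longrightarrow> (\<Sum>i<n. \<Sum>j<n. (b i j)\<^sup>2) \<le> w\<^sup>2 \<longrightarrow> 0 < B \<longrightarrow> 0 \<le> w \<longrightarrow>
     (\<exists>S\<in>sets (M n). 1 - real n powr (- cc) \<le> measure (M n) S \<and> (\<forall>\<omega>\<in>S. \<omega> \<in> space (M n) \<and>
        \<bar>\<Sum>i<n. \<Sum>j<n. b i j * ((E n \<omega> i j)\<^sup>2 - sigma2 n i j)\<bar>
          \<le> (cc + 7) * ln (real n) * (sqrt (2 * ((C' * snr n) ^ 4 / (real n * qn n ^ 2))) * w + 2 * B * (exp 1 * (4 * (C' * snr n / qn n)\<^sup>2)))))" ..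
  have "hp c (\<lambda>n \<omega>. \<forall>i<n. \<bar>\<Sum>j<n. (E n \<omega> i j)\<^sup>2 - sigma2 n i j\<bar> \<le> K * ((snr n)\<^sup>2 / qn n * ln (real n)))"
  proof (rule hp_all_less[where NA = "max N0 N" and NB = 0])
    fix n i assume n: "max N0 N \<le> n" and i: "i < n"
    \<comment> \<open>Ones on row \<open>i\<close>: here the Frobenius norm is
      \<open>sqrt n\<close>, which cancels the \<open>1 / n\<close> inside the variance
      proxy.\<close>
    define b where "b x y = (if x = i then 1 else 0 :: real)" for x y :: nat
    have n0: "n \<ge> N0" "0 < n" using n i by auto
    have s: "0 < snr n" using snr_pos[OF n0] .
    have q: "1 \<le> qn n" using qn_ge_1[OF n0] .
    have "(\<Sum>x<n. \<Sum>y<n. (b x y)\<^sup>2) = (\<Sum>x<n. if x = i then real n else 0)"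
      by (intro sum.cong) (auto simp: b_def)
    then have b2: "(\<Sum>x<n. \<Sum>y<n. (b x y)\<^sup>2) \<le> (sqrt (real n))\<^sup>2" using i by simp
    have bE: "(\<Sum>x<n. \<Sum>y<n. b x y * ((E n \<omega> x y)\<^sup>2 - sigma2 n x y)) = (\<Sum>j<n. (E n \<omega> i j)\<^sup>2 - sigma2 n i j)" for \<omega>
    proof -
      have "(\<Sum>x<n. \<Sum>y<n. b x y * ((E n \<omega> x y)\<^sup>2 - sigma2 n x y)) = (\<Sum>x<n. if x = i then (\<Sum>y<n. (E n \<omega> x y)\<^sup>2 - sigma2 n x y) else 0)"
        by (intro sum.cong) (auto simp: b_def)
      then show ?thesis using i by simp
    qed
    have bb: "\<forall>x<n. \<forall>y<n. \<bar>b x y\<bar> \<le> 1" by (auto simp: b_def)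
    have nN: "N \<le> n" and pos: "0 < (1::real)" "0 \<le> sqrt (real n)" using n by auto
    from N[THEN spec, THEN mp, OF nN, THEN spec, THEN spec, THEN spec, THEN mp, OF bb, THEN mp, OF b2, THEN mp, OF pos(1), THEN mp, OF pos(2), unfolded bE] obtain S where S: "S \<in> sets (M n)" "1 - real n powr (- cc) \<le> measure (M n) S"
      "\<And>\<omega>. \<omega> \<in> S \<Longrightarrow> \<bar>\<Sum>j<n. (E n \<omega> i j)\<^sup>2 - sigma2 n i j\<bar>
        \<le> (cc + 7) * ln (real n) * (sqrt (2 * ((C' * snr n) ^ 4 / (real n * qn n ^ 2))) * sqrt (real n) + 2 * 1 * (exp 1 * (4 * (C' * snr n / qn n)\<^sup>2)))"
      by blast
    have 1: "sqrt (2 * ((C' * snr n) ^ 4 / (real n * qn n ^ 2))) * sqrt (real n) = sqrt 2 * C'\<^sup>2 * ((snr n)\<^sup>2 / qn n)"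
    proof -
      have "sqrt (2 * ((C' * snr n) ^ 4 / (real n * qn n ^ 2))) * sqrt (real n) = sqrt (2 * ((C' * snr n)\<^sup>2 / qn n)\<^sup>2)"
        using n0 by (simp flip: real_sqrt_mult) (simp add: power_divide flip: power_mult)
      also have "\<dots> = sqrt 2 * ((C' * snr n)\<^sup>2 / qn n)" using q by (simp add: real_sqrt_mult)
      finally show ?thesis by (simp add: power_mult_distrib)
    qed
    have 2: "(C' * snr n / qn n)\<^sup>2 \<le> C'\<^sup>2 * ((snr n)\<^sup>2 / qn n)"
    proof -
      have "(snr n)\<^sup>2 / (qn n)\<^sup>2 \<le> (snr n)\<^sup>2 / qn n"
        using q self_le_power[of "qn n" 2] by (intro divide_left_mono) auto
      then have "C'\<^sup>2 * ((snr n)\<^sup>2 / (qn n)\<^sup>2) \<le> C'\<^sup>2 * ((snr n)\<^sup>2 / qn n)" by (rule mult_left_mono) simp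
      then show ?thesis by (simp add: power_divide power_mult_distrib)
    qed
    have "sqrt (2 * ((C' * snr n) ^ 4 / (real n * qn n ^ 2))) * sqrt (real n) + 2 * 1 * (exp 1 * (4 * (C' * snr n / qn n)\<^sup>2))
      \<le> sqrt 2 * C'\<^sup>2 * ((snr n)\<^sup>2 / qn n) + 2 * 1 * (exp 1 * (4 * (C'\<^sup>2 * ((snr n)\<^sup>2 / qn n))))"
      unfolding 1 using 2 by (intro add_left_mono mult_left_mono) auto
    also have "\<dots> = (sqrt 2 * C'\<^sup>2 + 2 * (exp 1 * (4 * C'\<^sup>2))) * ((snr n)\<^sup>2 / qn n)"
      by (simp add: algebra_simps add_divide_distrib)
    finally have "(cc + 7) * ln (real n) * (sqrt (2 * ((C' * snr n) ^ 4 / (real n * qn n ^ 2))) * sqrt (real n) + 2 * 1 * (exp 1 * (4 * (C' * snr n / qn n)\<^sup>2)))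
      \<le> (cc + 7) * ln (real n) * ((sqrt 2 * C'\<^sup>2 + 2 * (exp 1 * (4 * C'\<^sup>2))) * ((snr n)\<^sup>2 / qn n))"
      using cc n0 by (intro mult_left_mono) auto
    also have "\<dots> = K * ((snr n)\<^sup>2 / qn n * ln (real n))" by (simp add: K_def mult_ac)
    finally show "\<exists>S\<in>sets (M n). 1 - real n powr (- (c + 1)) \<le> measure (M n) S \<and>
        (\<forall>\<omega>\<in>S. \<bar>\<Sum>j<n. (E n \<omega> i j)\<^sup>2 - sigma2 n i j\<bar> \<le> K * ((snr n)\<^sup>2 / qn n * ln (real n)))"
      using S by (intro bexI[of _ S]) (auto simp: cc_def intro: order_trans)
  qed simp
  then show ?thesis using cc C'_ge by (intro exI[of _ K]) (auto simp: K_def)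
qed

lemma good_whp:
  assumes c: "0 < c" and e: "0 < e"
  shows "\<exists>K\<ge>0. hp c (good K e R)"
proof -
  obtain K1 where K1: "0 \<le> K1" "hp (c + 1 + 1 + 1) (\<lambda>n \<omega>. \<forall>m<d. \<forall>i<n. \<bar>mv n (E n \<omega>) (u n m) i\<bar> \<le> K1 * (sqrt (rho n) * ln (real n)))"
    using rows_good[of "c + 1 + 1 + 1"] c by auto
  obtain K2 where K2: "0 \<le> K2" "hp (c + 1) (\<lambda>n \<omega>. \<forall>l<d. \<forall>m<d. \<bar>inner_n n (u n l) (mv n (E n \<omega>) (u n m))\<bar> \<le> K2 * (sqrt (rho n) * ln (real n)))"
    using quadratic_forms_good[of "c + 1"] c by auto
  obtain K3 where K3: "0 \<le> K3" "hp (c + 1 + 1 + 1) (\<lambda>n \<omega>. \<forall>i<n. \<bar>\<Sum>j<n. (E n \<omega> i j)\<^sup>2 - sigma2 n i j\<bar> \<le> K3 * ((snr n)\<^sup>2 / qn n * ln (real n)))"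
    using squares_good[of "c + 1 + 1 + 1"] c by auto
  define K where "K = max K1 (max K2 K3)"
  have c3: "0 < c + 1 + 1 + 1" using c by simp
  \<comment> \<open>Every conjunction costs one unit of the exponent, which explains the staggered
    values of \<open>c\<close> above.\<close>
  note A = hp_conj[OF iterates_good[OF c3 e] operator_norm_whp[OF c3 e]]
  note B = hp_conj[OF K1(2) K3(2)]
  have "hp c (good K e R)"
  proof (rule hp_mono[OF hp_conj[OF hp_conj[OF A B] K2(2)], where NA = "max 1 N0"])
    fix n \<omega>
    let ?a = "sqrt (rho n) * ln (real n)" and ?b = "(snr n)\<^sup>2 / qn n * ln (real n)"
    assume n: "max 1 N0 \<le> n"
    have a: "0 \<le> ?a" using rho[of n] n by simp
    have b: "0 \<le> ?b" using qn_ge_1[of n] n by simp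
    have K: "K1 * ?a \<le> K * ?a" "K2 * ?a \<le> K * ?a" "K3 * ?b \<le> K * ?b"
      by (intro mult_right_mono a b; simp add: K_def)+
    assume H: "(((\<forall>m<d. \<forall>r<R. \<forall>i<n. \<bar>(mv n (E n \<omega>) ^^ r) (u n m) i\<bar> \<le> real n powr e * snr n ^ r / sqrt (real n))
      \<and> (\<forall>x. inner_n n (mv n (E n \<omega>) x) (mv n (E n \<omega>) x) \<le> (real n powr e * snr n)\<^sup>2 * inner_n n x x))
      \<and> ((\<forall>m<d. \<forall>i<n. \<bar>mv n (E n \<omega>) (u n m) i\<bar> \<le> K1 * ?a) \<and> (\<forall>i<n. \<bar>\<Sum>j<n. (E n \<omega> i j)\<^sup>2 - sigma2 n i j\<bar> \<le> K3 * ?b)))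
      \<and> (\<forall>l<d. \<forall>m<d. \<bar>inner_n n (u n l) (mv n (E n \<omega>) (u n m))\<bar> \<le> K2 * ?a)"
    then show "good K e R n \<omega>" unfolding good_def using K by (blast intro: order_trans)
  qed
  then show ?thesis using K1 K2 K3 by (intro exI[of _ K]) (auto simp: K_def)
qed

end

section \<open>Abstract second-order perturbation\<close>

lemma bigo_ev_cong:
  fixes f g :: "'z \<Rightarrow> real"
  assumes "g \<in> O[F](h)" "eventually (\<lambda>z. f z = g z) F"
  shows "f \<in> O[F](h)"
  using assms by (subst landau_o.big.in_cong)

text \<open>Everything is normalised: eigenvalues by the gap, the noise by the gap, and coordinates by
  the square root of the dimension. The errors fall into classes: \<open>small\<close> for first-order
  quantities that average over coordinates, \<open>med\<close> for first-order coordinates, \<open>negl\<close> for what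
  is negligible at second order.\<close>

locale second_order_perturbation =
  fixes F :: "'z filter" and \<tau> \<zeta> lg \<eta> :: "'z \<Rightarrow> real" and d k :: nat
    and l al w ups y1 y2 :: "nat \<Rightarrow> 'z \<Rightarrow> real"
    and x1 x2 :: "nat \<Rightarrow> nat \<Rightarrow> 'z \<Rightarrow> real"
    and Lh nu ev z3 ww :: "'z \<Rightarrow> real"
  assumes kd: "k < d"
    and scale: "\<zeta> \<in> o[F](\<lambda>_. 1)" "\<tau> \<in> O[F](\<zeta>)" "(\<lambda>_. 1) \<in> O[F](lg)" "(\<lambda>z. lg z * \<zeta> z) \<in> O[F](\<lambda>_. 1)"
      "(\<lambda>_. 1) \<in> O[F](\<eta>)"
    and bd: "\<And>m. m < d \<Longrightarrow> l m \<in> O[F](\<lambda>_. 1)" "(\<lambda>z. 1 / l k z) \<in> O[F](\<lambda>_. 1)"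
      "Lh \<in> O[F](\<lambda>_. 1)" "(\<lambda>z. 1 / Lh z) \<in> O[F](\<lambda>_. 1)"
      "\<And>m. m < d \<Longrightarrow> al m \<in> O[F](\<lambda>_. 1)"
      "\<And>m. m < d \<Longrightarrow> m \<noteq> k \<Longrightarrow> (\<lambda>z. 1 / (l k z - l m z)) \<in> O[F](\<lambda>_. 1)"
      "\<And>m. m < d \<Longrightarrow> m \<noteq> k \<Longrightarrow> (\<lambda>z. 1 / (Lh z - l m z)) \<in> O[F](\<lambda>_. 1)"
      "\<And>m. m < d \<Longrightarrow> ups m \<in> O[F](\<lambda>_. 1)"
    and sm: "\<And>m m'. m < d \<Longrightarrow> m' < d \<Longrightarrow> x1 m m' \<in> O[F](\<lambda>z. \<tau> z * (\<zeta> z)\<^sup>2)"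
      "\<And>m m'. m < d \<Longrightarrow> m' < d \<Longrightarrow> x2 m m' \<in> O[F](\<lambda>z. \<tau> z * (\<zeta> z)\<^sup>2)"
      "\<And>m. m < d \<Longrightarrow> y2 m \<in> O[F](\<lambda>z. \<tau> z * (\<zeta> z)\<^sup>2)"
      "\<And>m. m < d \<Longrightarrow> y2 m \<in> O[F](\<lambda>z. (\<tau> z)\<^sup>2 * \<eta> z)"
      "\<And>m. m < d \<Longrightarrow> y1 m \<in> O[F](\<lambda>z. \<tau> z * lg z)"
    and ng: "\<And>m. m < d \<Longrightarrow> w m \<in> O[F](\<lambda>z. (\<tau> z)\<^sup>2 * \<zeta> z)"
      "z3 \<in> O[F](\<lambda>z. (\<tau> z)\<^sup>2 * \<zeta> z)" "ww \<in> O[F](\<lambda>z. (\<tau> z)\<^sup>2 * \<zeta> z)"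
    and nz: "eventually (\<lambda>z. Lh z \<noteq> 0 \<and> l k z \<noteq> 0 \<and> (\<forall>m<d. m \<noteq> k \<longrightarrow> Lh z \<noteq> l m z \<and> l k z \<noteq> l m z)) F"
    \<comment> \<open>Up to scaling, \<open>l m\<close> and \<open>Lh\<close> are eigenvalues of P
      and A; \<open>al m\<close> is the overlap of the unit eigenvector v of A with
      \<open>u_m\<close>; \<open>ups m\<close>, \<open>y1 m\<close>, \<open>y2 m\<close> are
      coordinates of \<open>u_m\<close>, \<open>E u_m\<close>, \<open>E^2 u_m\<close>;
      \<open>x1 m m'\<close>, \<open>x2 m m'\<close> pair \<open>u_m\<close> with
      \<open>E u_m'\<close>, \<open>E^2 u_m'\<close>; \<open>nu\<close> and \<open>ev\<close> are
      coordinates of v and \<open>E v\<close>; \<open>z3\<close>, \<open>w m\<close>,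
      \<open>ww\<close> come from \<open>E^3 v\<close>. The equations \<open>eqA\<close> and
      \<open>eqD\<close> iterate the eigenvalue equation, \<open>eqB\<close> projects it onto
      \<open>u_m\<close>, and \<open>eqC\<close> says that v has length 1.\<close>
    and eqA: "eventually (\<lambda>z. nu z = (\<Sum>m<d. l m z * al m z / Lh z * (ups m z + y1 m z / Lh z + y2 m z / (Lh z)\<^sup>2)) + z3 z / (Lh z)^3) F"
    and eqD: "eventually (\<lambda>z. ev z = (\<Sum>m<d. l m z * al m z / Lh z * (y1 m z + y2 m z / Lh z)) + z3 z / (Lh z)\<^sup>2) F"
    and eqB: "eventually (\<lambda>z. \<forall>m<d. (Lh z - l m z) * al m z
        = (\<Sum>m'<d. l m' z * al m' z / Lh z * (x1 m m' z + x2 m m' z / Lh z)) + w m z / (Lh z)\<^sup>2) F"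
    and eqC: "eventually (\<lambda>z. 1 = (\<Sum>m<d. l m z * al m z / Lh z *
        (al m z + 2 * ((Lh z - l m z) * al m z) / Lh z - (\<Sum>m'<d. al m' z * l m' z * x1 m m' z) / (Lh z)\<^sup>2)) + ww z / (Lh z)^3) F"
begin

abbreviation "bdd \<equiv> O[F](\<lambda>_. 1)"
abbreviation "small \<equiv> O[F](\<lambda>z. \<tau> z * (\<zeta> z)\<^sup>2)"
text \<open>After multiplication by \<open>sqrt n\<close> the second-order scale is
  \<open>tau\<close> squared; the extra factor \<open>\<zeta>\<close>, which tends to zero, makes
  this class of smaller order.\<close>

abbreviation "negl \<equiv> O[F](\<lambda>z. (\<tau> z)\<^sup>2 * \<zeta> z)"
abbreviation "med \<equiv> O[F](\<lambda>z. \<tau> z * lg z)"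

lemma zeta_bdd: "\<zeta> \<in> bdd" by (rule landau_o.small_imp_big[OF scale(1)])
lemma tau_bdd: "\<tau> \<in> bdd" by (rule landau_o.big_trans[OF scale(2) zeta_bdd])

lemma bdd_mult: "f \<in> bdd \<Longrightarrow> g \<in> bdd \<Longrightarrow> (\<lambda>z. f z * g z) \<in> bdd"
  using landau_o.big.mult[of f F "\<lambda>_. 1" g "\<lambda>_. 1"] by simp
lemma mult_bdd_left: "f \<in> bdd \<Longrightarrow> g \<in> O[F](h) \<Longrightarrow> (\<lambda>z. f z * g z) \<in> O[F](h)"
  using landau_o.big.mult[of f F "\<lambda>_. 1" g h] by simp
lemma mult_bdd_right: "g \<in> O[F](h) \<Longrightarrow> f \<in> bdd \<Longrightarrow> (\<lambda>z. g z * f z) \<in> O[F](h)"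
  using landau_o.big.mult[of g F h f "\<lambda>_. 1"] by simp
lemma bdd_power: "f \<in> bdd \<Longrightarrow> (\<lambda>z. f z ^ n) \<in> bdd"
  using landau_o.big_power[of f F "\<lambda>_. 1" n] by simp

lemma negl_small: "f \<in> negl \<Longrightarrow> f \<in> small"
proof (rule landau_o.big_trans)
  have "(\<lambda>z. (\<tau> z * \<zeta> z) * \<tau> z) \<in> O[F](\<lambda>z. (\<tau> z * \<zeta> z) * \<zeta> z)"
    by (rule landau_o.big.mult[OF _ scale(2)]) simp
  then show "(\<lambda>z. (\<tau> z)\<^sup>2 * \<zeta> z) \<in> small" by (simp add: power2_eq_square mult_ac)
qed

lemma small_tau: "f \<in> small \<Longrightarrow> f \<in> O[F](\<tau>)"
proof (rule landau_o.big_trans)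
  have "(\<lambda>z. \<tau> z * (\<zeta> z)\<^sup>2) \<in> O[F](\<lambda>z. \<tau> z * 1)"
    by (rule landau_o.big.mult[OF _ bdd_power[OF zeta_bdd]]) simp
  then show "(\<lambda>z. \<tau> z * (\<zeta> z)\<^sup>2) \<in> O[F](\<tau>)" by simp
qed

lemma small_bdd: "f \<in> small \<Longrightarrow> f \<in> bdd"
  by (rule landau_o.big_trans[OF small_tau tau_bdd])

lemma tau_med: "f \<in> O[F](\<tau>) \<Longrightarrow> f \<in> med"
  using landau_o.big.mult[of f F \<tau> "\<lambda>_. 1" lg] scale(3) by simp

lemma small_o1: "f \<in> small \<Longrightarrow> f \<in> o[F](\<lambda>_. 1)"
proof -
  assume f: "f \<in> small"
  have "(\<lambda>z. (\<tau> z * \<zeta> z) * \<zeta> z) \<in> o[F](\<lambda>z. 1 * 1)"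
    by (rule landau_o.big_small_mult[OF bdd_mult[OF tau_bdd zeta_bdd] scale(1)])
  then have "(\<lambda>z. \<tau> z * (\<zeta> z)\<^sup>2) \<in> o[F](\<lambda>_. 1)" by (simp add: power2_eq_square mult_ac)
  with f show ?thesis by (rule landau_o.big_small_trans)
qed

lemma small_small: "f \<in> small \<Longrightarrow> g \<in> small \<Longrightarrow> (\<lambda>z. f z * g z) \<in> negl"
proof (rule landau_o.big_trans)
  assume "f \<in> small" "g \<in> small"
  then show "(\<lambda>z. f z * g z) \<in> O[F](\<lambda>z. (\<tau> z * (\<zeta> z)\<^sup>2) * (\<tau> z * (\<zeta> z)\<^sup>2))" by (rule landau_o.big.mult)
  have "(\<lambda>z. ((\<tau> z)\<^sup>2 * \<zeta> z) * \<zeta> z ^ 3) \<in> negl"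
    by (rule mult_bdd_right[OF landau_o.big_refl bdd_power[OF zeta_bdd]])
  then show "(\<lambda>z. (\<tau> z * (\<zeta> z)\<^sup>2) * (\<tau> z * (\<zeta> z)\<^sup>2)) \<in> negl"
    by (simp add: power2_eq_square power3_eq_cube mult_ac)
qed

text \<open>The logarithm in \<open>med\<close> is absorbed by one of the two factors
  \<open>\<zeta>\<close> in \<open>small\<close>. Two factors of type \<open>med\<close> have no
  such reserve, so the expansions must never produce their product.\<close>

lemma small_med: "f \<in> small \<Longrightarrow> g \<in> med \<Longrightarrow> (\<lambda>z. f z * g z) \<in> negl"
proof (rule landau_o.big_trans)
  assume "f \<in> small" "g \<in> med"
  then show "(\<lambda>z. f z * g z) \<in> O[F](\<lambda>z. (\<tau> z * (\<zeta> z)\<^sup>2) * (\<tau> z * lg z))" by (rule landau_o.big.mult)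
  have "(\<lambda>z. ((\<tau> z)\<^sup>2 * \<zeta> z) * (lg z * \<zeta> z)) \<in> negl"
    by (rule mult_bdd_right[OF landau_o.big_refl scale(4)])
  then show "(\<lambda>z. (\<tau> z * (\<zeta> z)\<^sup>2) * (\<tau> z * lg z)) \<in> negl"
    by (simp add: power2_eq_square mult_ac)
qed

lemma div_bdd: "f \<in> O[F](h) \<Longrightarrow> (\<lambda>z. 1 / g z) \<in> bdd \<Longrightarrow> (\<lambda>z. f z / g z) \<in> O[F](h)"
  using mult_bdd_right[of f h "\<lambda>z. 1 / g z"] by simp

lemma inv_power_bdd: "(\<lambda>z. 1 / g z) \<in> bdd \<Longrightarrow> (\<lambda>z. 1 / g z ^ n) \<in> bdd" for g :: "'z \<Rightarrow> real"
  using bdd_power[of "\<lambda>z. 1 / g z" n] by (simp add: power_one_over)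

lemma sum_bigo: "(\<And>m. m \<in> A \<Longrightarrow> f m \<in> O[F](h)) \<Longrightarrow> (\<lambda>z. \<Sum>m\<in>A. f m z) \<in> O[F](h)"
  for f :: "'i \<Rightarrow> 'z \<Rightarrow> real"
  by (rule big_sum_in_bigo)

lemma cmult: "f \<in> O[F](h) \<Longrightarrow> (\<lambda>z. c * f z) \<in> O[F](h)" for c :: real
  by (rule mult_bdd_left) simp_all

lemmas add_O = sum_in_bigo(1) and diff_O = sum_in_bigo(2)

lemma split_k: "(\<Sum>m<d. f m) = f k + (\<Sum>m\<in>{..<d}-{k}. f m)" for f :: "nat \<Rightarrow> real"
  using kd by (simp add: sum.remove[of "{..<d}" k])

lemma div_Lh: "f \<in> O[F](h) \<Longrightarrow> (\<lambda>z. f z / Lh z) \<in> O[F](h)"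
  by (rule div_bdd[OF _ bd(4)])
lemma div_Lh_power: "f \<in> O[F](h) \<Longrightarrow> (\<lambda>z. f z / Lh z ^ n) \<in> O[F](h)"
  by (rule div_bdd[OF _ inv_power_bdd[OF bd(4)]])
lemma div_lk: "f \<in> O[F](h) \<Longrightarrow> (\<lambda>z. f z / l k z) \<in> O[F](h)"
  by (rule div_bdd[OF _ bd(2)])
lemma div_lk_power: "f \<in> O[F](h) \<Longrightarrow> (\<lambda>z. f z / l k z ^ n) \<in> O[F](h)"
  by (rule div_bdd[OF _ inv_power_bdd[OF bd(2)]])
lemma div_gap: "m < d \<Longrightarrow> m \<noteq> k \<Longrightarrow> f \<in> O[F](h) \<Longrightarrow> (\<lambda>z. f z / (l k z - l m z)) \<in> O[F](h)"
  by (rule div_bdd[OF _ bd(6)])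
lemma div_gap_hat: "m < d \<Longrightarrow> m \<noteq> k \<Longrightarrow> f \<in> O[F](h) \<Longrightarrow> (\<lambda>z. f z / (Lh z - l m z)) \<in> O[F](h)"
  by (rule div_bdd[OF _ bd(7)])
lemma coeff_bdd: "m < d \<Longrightarrow> (\<lambda>z. l m z * al m z / Lh z) \<in> bdd"
  by (intro div_Lh mult_bdd_left bd)

section \<open>First-order bounds on residuals, overlaps and normalisation\<close>

lemma noise_small: "m < d \<Longrightarrow> m' < d \<Longrightarrow> (\<lambda>z. x1 m m' z + x2 m m' z / Lh z) \<in> small"
  by (intro add_O div_Lh sm)

lemma residual_small: "m < d \<Longrightarrow> (\<lambda>z. (Lh z - l m z) * al m z) \<in> small"
proof (rule bigo_ev_cong)
  assume m: "m < d"
  show "eventually (\<lambda>z. (Lh z - l m z) * al m z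
        = (\<Sum>m'<d. l m' z * al m' z / Lh z * (x1 m m' z + x2 m m' z / Lh z)) + w m z / (Lh z)\<^sup>2) F"
    using eqB by eventually_elim (use m in blast)
  show "(\<lambda>z. (\<Sum>m'<d. l m' z * al m' z / Lh z * (x1 m m' z + x2 m m' z / Lh z)) + w m z / (Lh z)\<^sup>2) \<in> small"
    by (intro add_O sum_bigo mult_bdd_left coeff_bdd noise_small div_Lh_power negl_small[OF ng(1)] m) auto
qed

text \<open>The residual \<open>(Lh - l m) * al m\<close> is small by \<open>eqB\<close>, and away
  from \<open>m = k\<close> its first factor stays away from zero.\<close>

lemma al_small: assumes "m < d" "m \<noteq> k" shows "al m \<in> small"
proof (rule bigo_ev_cong)
  show "(\<lambda>z. (Lh z - l m z) * al m z / (Lh z - l m z)) \<in> small"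
    by (intro div_gap_hat residual_small assms)
  show "eventually (\<lambda>z. al m z = (Lh z - l m z) * al m z / (Lh z - l m z)) F"
    using nz by eventually_elim (use assms in auto)
qed

text \<open>The bracket of \<open>eqC\<close>: the pairing of the eigenvector with the three-term
  expansion attached to \<open>u_m\<close>, in which the term with \<open>E^2\<close> has already
  been rewritten by the eigenvalue equation.\<close>

definition T :: "nat \<Rightarrow> 'z \<Rightarrow> real" where
  "T m z = al m z + 2 * ((Lh z - l m z) * al m z) / Lh z - (\<Sum>m'<d. al m' z * l m' z * x1 m m' z) / (Lh z)\<^sup>2"

lemma T_small_diff: "m < d \<Longrightarrow> (\<lambda>z. T m z - al m z) \<in> small"
proof -
  assume m: "m < d"
  have 1: "(\<lambda>z. 2 * ((Lh z - l m z) * al m z) / Lh z) \<in> small"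
    by (intro div_Lh cmult residual_small m)
  have 2: "(\<lambda>z. (\<Sum>m'<d. al m' z * l m' z * x1 m m' z) / (Lh z)\<^sup>2) \<in> small"
    by (intro div_Lh_power sum_bigo mult_bdd_left bd sm m) auto
  have "(\<lambda>z. 2 * ((Lh z - l m z) * al m z) / Lh z - (\<Sum>m'<d. al m' z * l m' z * x1 m m' z) / (Lh z)\<^sup>2) \<in> small"
    by (rule diff_O[OF 1 2])
  then show ?thesis by (simp add: T_def)
qed

text \<open>Away from \<open>k\<close> both the coefficient \<open>al m\<close> and the bracket
  \<open>T m\<close> are small, so their product is negligible and only the term at \<open>k\<close>
  remains in the normalisation.\<close>

lemma eqC_k: "(\<lambda>z. 1 - l k z * al k z / Lh z * T k z) \<in> negl"
proof (rule bigo_ev_cong)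
  show "(\<lambda>z. (\<Sum>m\<in>{..<d}-{k}. l m z / Lh z * (al m z * T m z)) + ww z / (Lh z)^3) \<in> negl"
  proof (intro add_O sum_bigo div_Lh_power ng)
    fix m assume m: "m \<in> {..<d} - {k}"
    then have al: "al m \<in> small" "m < d" using al_small by auto
    then have "(\<lambda>z. (T m z - al m z) + al m z) \<in> small" by (intro add_O T_small_diff)
    then have "T m \<in> small" by simp
    from small_small[OF al(1) this] show "(\<lambda>z. l m z / Lh z * (al m z * T m z)) \<in> negl"
      by (rule mult_bdd_left[rotated]) (intro div_Lh bd al)
  qed
  show "eventually (\<lambda>z. 1 - l k z * al k z / Lh z * T k z = (\<Sum>m\<in>{..<d}-{k}. l m z / Lh z * (al m z * T m z)) + ww z / (Lh z)^3) F"
    using eqC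
  proof eventually_elim
    case (elim z)
    have "1 = (\<Sum>m<d. l m z * al m z / Lh z * T m z) + ww z / (Lh z)^3" using elim by (simp only: T_def)
    moreover have "(\<Sum>m<d. l m z * al m z / Lh z * T m z)
        = l k z * al k z / Lh z * T k z + (\<Sum>m\<in>{..<d}-{k}. l m z * al m z / Lh z * T m z)" by (rule split_k)
    moreover have "(\<Sum>m\<in>{..<d}-{k}. l m z / Lh z * (al m z * T m z)) = (\<Sum>m\<in>{..<d}-{k}. l m z * al m z / Lh z * T m z)"
      by (intro sum.cong) auto
    ultimately show ?case by linarith
  qed
qed

lemma norm_k: "(\<lambda>z. 1 - l k z / Lh z * (al k z)\<^sup>2) \<in> small"
proof (rule bigo_ev_cong)
  show "(\<lambda>z. (1 - l k z * al k z / Lh z * T k z) + l k z * al k z / Lh z * (T k z - al k z)) \<in> small"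
    by (rule add_O[OF negl_small[OF eqC_k] mult_bdd_left[OF coeff_bdd[OF kd] T_small_diff[OF kd]]])
qed (intro always_eventually allI, simp add: divide_inverse algebra_simps power2_eq_square)

text \<open>The normalisation forces \<open>l k / Lh\<close> times the squared overlap to be close
  to 1; dividing by the overlap bounds its reciprocal by a bounded coefficient.\<close>

lemma al_k_inv: "(\<lambda>z. 1 / al k z) \<in> bdd" "eventually (\<lambda>z. al k z \<noteq> 0) F"
proof -
  have "eventually (\<lambda>z. norm (1 - l k z / Lh z * (al k z)\<^sup>2) \<le> 1/2 * norm (1::real)) F"
    using landau_o.smallD[OF small_o1[OF norm_k], of "1/2"] by simp
  then have 1: "eventually (\<lambda>z. 1/2 \<le> l k z / Lh z * (al k z)\<^sup>2) F"
  proof eventually_elim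
    case (elim z)
    then have "\<bar>1 - l k z / Lh z * (al k z)\<^sup>2\<bar> \<le> 1/2" by simp
    then show ?case by linarith
  qed
  then show ne: "eventually (\<lambda>z. al k z \<noteq> 0) F" by eventually_elim auto
  have "(\<lambda>z. 1 / al k z) \<in> O[F](\<lambda>z. l k z * al k z / Lh z)"
  proof (rule landau_o.bigI[of 2])
    show "eventually (\<lambda>z. norm (1 / al k z) \<le> 2 * norm (l k z * al k z / Lh z)) F"
      using 1 ne
    proof eventually_elim
      case (elim z)
      have "1 \<le> \<bar>2 * (l k z / Lh z * (al k z)\<^sup>2)\<bar>" using elim(1) by linarith
      also have "\<dots> = (2 * \<bar>l k z * al k z / Lh z\<bar>) * \<bar>al k z\<bar>" by (simp add: abs_mult power2_eq_square)
      finally show ?case using elim by (simp add: divide_le_eq)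
    qed
  qed simp
  then show "(\<lambda>z. 1 / al k z) \<in> bdd" by (rule landau_o.big_trans[OF _ coeff_bdd[OF kd]])
qed

text \<open>\<open>mu\<close> is the relative eigenvalue shift, \<open>x\<close> and
  \<open>X2\<close> are its first- and second-order candidates. Thus \<open>dl\<close> isolates the
  second-order part of the shift.\<close>

definition mu :: "'z \<Rightarrow> real" where "mu z = (Lh z - l k z) / Lh z"
definition x :: "'z \<Rightarrow> real" where "x z = x1 k k z / Lh z"
definition X2 :: "'z \<Rightarrow> real" where "X2 z = x2 k k z / (Lh z)\<^sup>2"
definition dl :: "'z \<Rightarrow> real" where "dl z = mu z - x z"

lemma mu_small: "mu \<in> small"
proof (rule bigo_ev_cong)
  show "(\<lambda>z. (Lh z - l k z) * al k z / al k z / Lh z) \<in> small"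
    by (rule div_Lh, rule div_bdd[OF residual_small[OF kd] al_k_inv(1)])
  show "eventually (\<lambda>z. mu z = (Lh z - l k z) * al k z / al k z / Lh z) F"
    using al_k_inv(2) by eventually_elim (simp add: mu_def)
qed

lemma x_small: "x \<in> small" unfolding x_def[abs_def] by (intro div_Lh sm kd)
lemma X2_small: "X2 \<in> small" unfolding X2_def[abs_def] by (intro div_Lh_power sm kd)
lemma dl_small: "dl \<in> small" unfolding dl_def[abs_def] by (intro diff_O mu_small x_small)

lemma lk_Lh: "eventually (\<lambda>z. l k z = Lh z * (1 - mu z)) F"
  using nz by eventually_elim (simp add: mu_def field_simps)

text \<open>Up to negligible terms \<open>T k\<close> is
  \<open>al k * (1 + 2 * mu - (1 - mu) * x)\<close> and its coefficient is
  \<open>(1 - mu) * al k\<close>. Multiplying out, \<open>eqC_k\<close> says that the squared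
  overlap times \<open>1 + dl\<close> is 1; the products collected in \<open>?q\<close> are
  negligible.\<close>

lemma sq_al: "(\<lambda>z. (al k z)\<^sup>2 - (1 - dl z)) \<in> negl"
proof -
  let ?R = "\<lambda>z. \<Sum>m\<in>{..<d}-{k}. al m z * (l m z * x1 k m z)"
  have R: "?R \<in> negl"
  proof (rule sum_bigo)
    fix m assume m: "m \<in> {..<d} - {k}"
    show "(\<lambda>z. al m z * (l m z * x1 k m z)) \<in> negl"
      by (rule small_small[OF al_small mult_bdd_left[OF bd(1) sm(1)[OF kd]]]) (use m in auto)
  qed
  let ?q = "\<lambda>z. - 2 * (mu z * mu z) + 2 * (mu z * x z) - mu z * (mu z * x z)"
  have q: "?q \<in> negl"
    by (rule diff_O[OF add_O[OF cmult[OF small_small[OF mu_small mu_small]] cmult[OF small_small[OF mu_small x_small]]]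
          mult_bdd_left[OF small_bdd[OF mu_small] small_small[OF mu_small x_small]]])
  have al2: "(\<lambda>z. (al k z)\<^sup>2) \<in> bdd" by (intro bdd_power bd kd)
  define N where "N z = (1 - l k z * al k z / Lh z * T k z) - l k z * al k z / Lh z * (?R z / (Lh z)\<^sup>2) + (al k z)\<^sup>2 * ?q z" for z
  have N: "N \<in> negl" unfolding N_def[abs_def]
    by (rule add_O[OF diff_O[OF eqC_k mult_bdd_left[OF coeff_bdd[OF kd] div_Lh_power[OF R]]] mult_bdd_left[OF al2 q]])
  have Neq: "eventually (\<lambda>z. N z = 1 - (al k z)\<^sup>2 * (1 + dl z)) F"
    using nz lk_Lh
  proof eventually_elim
    case (elim z)
    have "T k z = al k z + 2 * (mu z * al k z) - ((al k z * l k z * x1 k k z) + ?R z) / (Lh z)\<^sup>2"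
      using elim(1) by (simp add: T_def split_k mu_def mult.assoc)
    also have "\<dots> = al k z * (1 + 2 * mu z - (1 - mu z) * x z) - ?R z / (Lh z)\<^sup>2"
    proof -
      have "al k z * l k z * x1 k k z / (Lh z)\<^sup>2 = al k z * ((1 - mu z) * x z)"
        using elim by (simp add: x_def power2_eq_square)
      then show ?thesis unfolding add_divide_distrib by (simp add: algebra_simps)
    qed
    finally have T: "T k z = al k z * (1 + 2 * mu z - (1 - mu z) * x z) - ?R z / (Lh z)\<^sup>2" .
    have c: "l k z * al k z / Lh z = (1 - mu z) * al k z" using elim by simp
    show ?case unfolding N_def c T dl_def by (simp add: algebra_simps power2_eq_square)
  qed
  show ?thesis
  proof (rule bigo_ev_cong)
    \<comment> \<open>Inversion of \<open>1 + dl\<close>: multiplying by \<open>1 - dl\<close>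
      leaves only the square of \<open>dl\<close>.\<close>
    show "(\<lambda>z. (al k z)\<^sup>2 * (dl z * dl z) - (1 - dl z) * N z) \<in> negl"
      by (rule diff_O[OF mult_bdd_left[OF al2 small_small[OF dl_small dl_small]] mult_bdd_left[OF _ N]])
         (intro diff_O small_bdd[OF dl_small], simp)
    show "eventually (\<lambda>z. (al k z)\<^sup>2 - (1 - dl z) = (al k z)\<^sup>2 * (dl z * dl z) - (1 - dl z) * N z) F"
      using Neq by eventually_elim (simp only:, simp add: algebra_simps power2_eq_square)
  qed
qed

text \<open>Square root by difference of squares: the conjugate factor is bounded below, and the
  square of \<open>1 - dl / 2\<close> exceeds \<open>1 - dl\<close> by a negligible quarter of the
  square of \<open>dl\<close>.\<close>

lemma abs_al: "(\<lambda>z. \<bar>al k z\<bar> - (1 - dl z / 2)) \<in> negl"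
proof -
  have ev: "eventually (\<lambda>z. 1/2 \<le> \<bar>al k z\<bar> + (1 - dl z / 2)) F"
  proof -
    have "eventually (\<lambda>z. norm (dl z) \<le> 1 * norm (1::real)) F"
      using landau_o.smallD[OF small_o1[OF dl_small], of 1] by simp
    then show ?thesis
    proof eventually_elim
      case (elim z)
      then have "\<bar>dl z\<bar> \<le> 1" by simp
      then show ?case by linarith
    qed
  qed
  have inv: "(\<lambda>z. 1 / (\<bar>al k z\<bar> + (1 - dl z / 2))) \<in> bdd"
    by (rule landau_o.bigI[of 2], simp, use ev in eventually_elim) (simp add: divide_le_eq)
  show ?thesis
  proof (rule bigo_ev_cong)
    show "(\<lambda>z. ((al k z)\<^sup>2 - (1 - dl z) - dl z * dl z / 4) / (\<bar>al k z\<bar> + (1 - dl z / 2))) \<in> negl"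
      by (rule div_bdd[OF diff_O[OF sq_al div_bdd[OF small_small[OF dl_small dl_small]]] inv]) simp
    show "eventually (\<lambda>z. \<bar>al k z\<bar> - (1 - dl z / 2) = ((al k z)\<^sup>2 - (1 - dl z) - dl z * dl z / 4) / (\<bar>al k z\<bar> + (1 - dl z / 2))) F"
      using ev
    proof eventually_elim
      case (elim z)
      have "(\<bar>al k z\<bar> - (1 - dl z / 2)) * (\<bar>al k z\<bar> + (1 - dl z / 2)) = (al k z)\<^sup>2 - (1 - dl z) - dl z * dl z / 4"
        by (simp add: field_simps power2_eq_square)
      then show ?case using elim by (simp add: eq_divide_eq)
    qed
  qed
qed

text \<open>Equation \<open>eqB\<close> at \<open>m = k\<close>, divided by
  \<open>al k * Lh\<close>, reads \<open>mu = (1 - mu) * (x + X2)\<close> up to products of small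
  quantities.\<close>

lemma mu_expand: "(\<lambda>z. mu z - (x z + X2 z)) \<in> negl"
proof (rule bigo_ev_cong)
  let ?R = "\<lambda>z. (\<Sum>m\<in>{..<d}-{k}. al m z * (l m z / Lh z * (x1 k m z + x2 k m z / Lh z))) + w k z / (Lh z)\<^sup>2"
  have R: "?R \<in> negl"
  proof (intro add_O sum_bigo div_Lh_power ng kd)
    fix m assume m: "m \<in> {..<d} - {k}"
    show "(\<lambda>z. al m z * (l m z / Lh z * (x1 k m z + x2 k m z / Lh z))) \<in> negl"
      by (rule small_small[OF al_small mult_bdd_left[OF div_Lh[OF bd(1)] noise_small[OF kd]]]) (use m in auto)
  qed
  show "(\<lambda>z. ?R z / al k z / Lh z - mu z * (x z + X2 z)) \<in> negl"
    by (rule diff_O[OF div_Lh[OF div_bdd[OF R al_k_inv(1)]] small_small[OF mu_small add_O[OF x_small X2_small]]])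
  show "eventually (\<lambda>z. mu z - (x z + X2 z) = ?R z / al k z / Lh z - mu z * (x z + X2 z)) F"
    using eqB nz lk_Lh al_k_inv(2)
  proof eventually_elim
    case (elim z)
    have "(Lh z - l k z) * al k z = l k z * al k z / Lh z * (x1 k k z + x2 k k z / Lh z) + ?R z"
      using elim(1)[rule_format, OF kd] by (simp add: split_k mult_ac)
    moreover have "(Lh z - l k z) * al k z = mu z * Lh z * al k z" using elim(2) by (simp add: mu_def)
    moreover have "l k z * al k z / Lh z * (x1 k k z + x2 k k z / Lh z) = (1 - mu z) * al k z * Lh z * (x z + X2 z)"
    proof -
      have "l k z * al k z / Lh z = (1 - mu z) * al k z" using elim by simp
      moreover have "x1 k k z + x2 k k z / Lh z = Lh z * (x z + X2 z)"
        using elim by (simp add: x_def X2_def field_simps power2_eq_square)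
      ultimately show ?thesis by (simp add: mult.assoc)
    qed
    ultimately have "?R z = mu z * Lh z * al k z - (1 - mu z) * al k z * Lh z * (x z + X2 z)"
      by linarith
    also have "\<dots> = (mu z - (1 - mu z) * (x z + X2 z)) * al k z * Lh z"
      by (simp add: algebra_simps)
    finally have "?R z / al k z / Lh z = mu z - (1 - mu z) * (x z + X2 z)" using elim by simp
    then show ?case by (simp only:) (simp add: algebra_simps)
  qed
qed

definition g :: "'z \<Rightarrow> real" where "g z = (1 - mu z) * \<bar>al k z\<bar>"

text \<open>The origin of 3/2: \<open>g\<close> is about \<open>1 - mu - dl / 2\<close>, where
  \<open>mu\<close> is about \<open>x + X2\<close> and \<open>dl\<close> is about \<open>X2\<close>.
  The eigenvalue quotient contributes one \<open>X2\<close> and the normalisation half of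
  another.\<close>

lemma g_expand: "(\<lambda>z. g z - (1 - x z - 3/2 * X2 z)) \<in> negl"
proof (rule bigo_ev_cong)
  show "(\<lambda>z. (1 - mu z) * (\<bar>al k z\<bar> - (1 - dl z / 2)) + mu z * dl z / 2 - 3/2 * (mu z - (x z + X2 z))) \<in> negl"
    by (rule diff_O[OF add_O[OF mult_bdd_left[OF diff_O[OF _ small_bdd[OF mu_small]] abs_al]
          div_bdd[OF small_small[OF mu_small dl_small]]] cmult[OF mu_expand]]) simp_all
qed (intro always_eventually allI, simp add: g_def dl_def field_simps)

lemma g_small: "(\<lambda>z. g z - 1) \<in> small"
proof -
  have "(\<lambda>z. (g z - (1 - x z - 3/2 * X2 z)) - (x z + 3/2 * X2 z)) \<in> small"
    by (rule diff_O[OF negl_small[OF g_expand] add_O[OF x_small cmult[OF X2_small]]])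
  then show ?thesis by simp
qed

lemma inv_Lh_small: "(\<lambda>z. 1 / Lh z - 1 / l k z) \<in> small"
proof (rule bigo_ev_cong)
  show "(\<lambda>z. - (mu z / l k z)) \<in> small" using div_lk[OF mu_small] by simp
  show "eventually (\<lambda>z. 1 / Lh z - 1 / l k z = - (mu z / l k z)) F"
    using nz by eventually_elim (simp add: mu_def field_simps)
qed

lemma inv_Lh2_small: "(\<lambda>z. 1 / (Lh z)\<^sup>2 - 1 / (l k z)\<^sup>2) \<in> small"
proof -
  have "(\<lambda>z. (1 / Lh z - 1 / l k z) * (1 / Lh z + 1 / l k z)) \<in> small"
    by (rule mult_bdd_right[OF inv_Lh_small add_O[OF bd(4) bd(2)]])
  then show ?thesis by (simp add: algebra_simps power2_eq_square)
qed

definition s :: "'z \<Rightarrow> real" where "s z = sgn (al k z)"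

lemma s_bdd: "s \<in> bdd"
  by (rule landau_o.bigI[of 1]) (auto simp: s_def sgn_if)

lemma s_al: "s z * al k z = \<bar>al k z\<bar>"
  by (simp add: s_def sgn_if)

text \<open>In \<open>eqB\<close> at \<open>m\<close> only the summand at \<open>k\<close> matters,
  and its coefficient is \<open>g\<close> after the sign is fixed. Replacing \<open>g\<close> by 1
  and \<open>Lh\<close> by \<open>l k\<close> multiplies a small quantity by a small error, so it is
  allowed at second order.\<close>

lemma al_expand:
  assumes m: "m < d" "m \<noteq> k"
  shows "(\<lambda>z. s z * al m z - (x1 m k z + x2 m k z / l k z) / (l k z - l m z)) \<in> negl"
proof (rule bigo_ev_cong)
  let ?R = "\<lambda>z. s z * ((\<Sum>m'\<in>{..<d}-{k}. al m' z * (l m' z / Lh z * (x1 m m' z + x2 m m' z / Lh z))) + w m z / (Lh z)\<^sup>2)"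
  have R: "?R \<in> negl"
  proof (rule mult_bdd_left[OF s_bdd], intro add_O sum_bigo div_Lh_power ng m)
    fix m' assume m': "m' \<in> {..<d} - {k}"
    show "(\<lambda>z. al m' z * (l m' z / Lh z * (x1 m m' z + x2 m m' z / Lh z))) \<in> negl"
      by (rule small_small[OF al_small mult_bdd_left[OF div_Lh[OF bd(1)] noise_small[OF m(1)]]]) (use m' in auto)
  qed
  let ?e = "\<lambda>z. x1 m k z + x2 m k z / Lh z" and ?f = "\<lambda>z. x1 m k z + x2 m k z / l k z"
  have f: "?f \<in> small" by (intro add_O div_lk sm m kd)
  show "(\<lambda>z. ((g z - 1) * ?e z + x2 m k z * (1 / Lh z - 1 / l k z) + ?R z) / (Lh z - l m z)
       - mu z * ?f z * (Lh z / (Lh z - l m z) / (l k z - l m z))) \<in> negl"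
    by (rule diff_O[OF div_gap_hat[OF m add_O[OF add_O[OF small_small[OF g_small noise_small[OF m(1) kd]]
            small_small[OF sm(2)[OF m(1) kd] inv_Lh_small]] R]]
          mult_bdd_right[OF small_small[OF mu_small f] div_gap[OF m div_gap_hat[OF m bd(3)]]]])
  show "eventually (\<lambda>z. s z * al m z - ?f z / (l k z - l m z) = ((g z - 1) * ?e z + x2 m k z * (1 / Lh z - 1 / l k z) + ?R z) / (Lh z - l m z)
       - mu z * ?f z * (Lh z / (Lh z - l m z) / (l k z - l m z))) F"
    using eqB nz lk_Lh
  proof eventually_elim
    case (elim z)
    have nz': "Lh z - l m z \<noteq> 0" "l k z - l m z \<noteq> 0" "Lh z \<noteq> 0" using elim m by auto
    have "(Lh z - l m z) * al m z = l k z * al k z / Lh z * ?e z + ((\<Sum>m'\<in>{..<d}-{k}. al m' z * (l m' z / Lh z * (x1 m m' z + x2 m m' z / Lh z))) + w m z / (Lh z)\<^sup>2)"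
      using elim(1)[rule_format, OF m(1)] by (simp add: split_k mult_ac)
    then have "s z * ((Lh z - l m z) * al m z) = s z * (l k z * al k z / Lh z * ?e z) + ?R z"
      by (simp only: distrib_left)
    moreover have "s z * ((Lh z - l m z) * al m z) = (Lh z - l m z) * (s z * al m z)"
      "s z * (l k z * al k z / Lh z * ?e z) = l k z * (s z * al k z) / Lh z * ?e z" by simp_all
    ultimately have "(Lh z - l m z) * (s z * al m z) = l k z * (s z * al k z) / Lh z * ?e z + ?R z"
      by simp
    also have "l k z * (s z * al k z) / Lh z = g z" using elim(3) nz' by (simp add: s_al g_def)
    finally have "s z * al m z = (g z * ?e z + ?R z) / (Lh z - l m z)" using nz' by (simp add: field_simps)
    moreover have "g z * ?e z + ?R z = ((g z - 1) * ?e z + x2 m k z * (1 / Lh z - 1 / l k z) + ?R z) + ?f z"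
      by (simp add: algebra_simps)
    moreover have "?f z / (Lh z - l m z) - ?f z / (l k z - l m z) = - (mu z * ?f z * (Lh z / (Lh z - l m z) / (l k z - l m z)))"
    proof -
      have "1 / (Lh z - l m z) - 1 / (l k z - l m z) = (l k z - Lh z) / (Lh z - l m z) / (l k z - l m z)"
        using nz' by (simp add: field_simps)
      also have "l k z - Lh z = - (mu z * Lh z)" using nz' by (simp add: mu_def)
      finally have "?f z * (1 / (Lh z - l m z) - 1 / (l k z - l m z)) = ?f z * (- (mu z * Lh z) / (Lh z - l m z) / (l k z - l m z))"
        by (simp only:)
      then show ?thesis by (simp add: right_diff_distrib mult_ac)
    qed
    ultimately show ?case by (simp only: add_divide_distrib)
  qed
qed

definition psi :: "'z \<Rightarrow> real" where
  "psi z = y1 k z / l k z - ups k z * x1 k k z / l k z + (\<Sum>m\<in>{..<d}-{k}. l m z / (l k z - l m z) * ups m z * x1 m k z / l k z)"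
text \<open>The bias formula, in normalised form, with \<open>E^2 u_k\<close> in the place of
  \<open>D u_k\<close>.\<close>

definition q :: "'z \<Rightarrow> real" where
  "q z = y2 k z / (l k z)\<^sup>2 - 3/2 * ups k z * x2 k k z / (l k z)\<^sup>2
     + (\<Sum>m\<in>{..<d}-{k}. l m z / (l k z - l m z) * ups m z * x2 m k z / (l k z)\<^sup>2)"

lemma eigenvalue_diff: "(\<lambda>z. Lh z - l k z) \<in> small"
proof (rule bigo_ev_cong)
  show "(\<lambda>z. mu z * Lh z) \<in> small" by (rule mult_bdd_right[OF mu_small bd(3)])
  show "eventually (\<lambda>z. Lh z - l k z = mu z * Lh z) F" using nz by eventually_elim (simp add: mu_def)
qed

text \<open>The summand of \<open>eqA\<close> at \<open>k\<close>. The factor \<open>g\<close>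
  affects the zeroth-order coordinate \<open>ups k\<close> through second order, but the first- and
  second-order coordinates only negligibly.\<close>

lemma term_k: "(\<lambda>z. g z * (ups k z + y1 k z / Lh z + y2 k z / (Lh z)\<^sup>2)
    - (ups k z + y1 k z / l k z - ups k z * x1 k k z / l k z + y2 k z / (l k z)\<^sup>2 - 3/2 * ups k z * x2 k k z / (l k z)\<^sup>2)) \<in> negl"
proof (rule bigo_ev_cong)
  show "(\<lambda>z. ups k z * (g z - (1 - x z - 3/2 * X2 z)) + (g z - 1) * (y1 k z / Lh z + y2 k z / (Lh z)\<^sup>2)
     + (1 / Lh z - 1 / l k z) * y1 k z + (1 / (Lh z)\<^sup>2 - 1 / (l k z)\<^sup>2) * y2 k z
     - ups k z * ((1 / Lh z - 1 / l k z) * x1 k k z) - 3/2 * ups k z * ((1 / (Lh z)\<^sup>2 - 1 / (l k z)\<^sup>2) * x2 k k z)) \<in> negl"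
  proof (rule diff_O, rule diff_O, rule add_O, rule add_O, rule add_O)
    show "(\<lambda>z. ups k z * (g z - (1 - x z - 3/2 * X2 z))) \<in> negl" by (rule mult_bdd_left[OF bd(8)[OF kd] g_expand])
    show "(\<lambda>z. (g z - 1) * (y1 k z / Lh z + y2 k z / (Lh z)\<^sup>2)) \<in> negl"
      by (rule small_med[OF g_small add_O[OF div_Lh[OF sm(5)[OF kd]] div_Lh_power[OF tau_med[OF small_tau[OF sm(3)[OF kd]]]]]])
    show "(\<lambda>z. (1 / Lh z - 1 / l k z) * y1 k z) \<in> negl" by (rule small_med[OF inv_Lh_small sm(5)[OF kd]])
    show "(\<lambda>z. (1 / (Lh z)\<^sup>2 - 1 / (l k z)\<^sup>2) * y2 k z) \<in> negl" by (rule small_small[OF inv_Lh2_small sm(3)[OF kd]])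
    show "(\<lambda>z. ups k z * ((1 / Lh z - 1 / l k z) * x1 k k z)) \<in> negl" by (rule mult_bdd_left[OF bd(8)[OF kd]], rule small_small[OF inv_Lh_small sm(1)[OF kd kd]])
    show "(\<lambda>z. 3/2 * ups k z * ((1 / (Lh z)\<^sup>2 - 1 / (l k z)\<^sup>2) * x2 k k z)) \<in> negl" by (rule mult_bdd_left[OF cmult[OF bd(8)[OF kd]]], rule small_small[OF inv_Lh2_small sm(2)[OF kd kd]])
  qed
next
  \<comment> \<open>The factors \<open>1 * a\<close> reproduce the shape that
    \<open>1 / Lh z\<close> takes once \<open>divide_inverse\<close> is unfolded, so that the
    identity matches literally.\<close>
  have alg: "h * (u + y * a + y' * a2) - (u + y * b - u * r * b + y' * b2 - c * u * r' * b2)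
     = u * (h - (1 - r * a - c * (r' * a2))) + (h - 1) * (y * a + y' * a2) + (1 * a - 1 * b) * y + (1 * a2 - 1 * b2) * y'
       - u * ((1 * a - 1 * b) * r) - c * u * ((1 * a2 - 1 * b2) * r')" for h u y y' a a2 b b2 r r' c :: real
    by (simp add: algebra_simps)
  show "eventually (\<lambda>z. g z * (ups k z + y1 k z / Lh z + y2 k z / (Lh z)\<^sup>2)
    - (ups k z + y1 k z / l k z - ups k z * x1 k k z / l k z + y2 k z / (l k z)\<^sup>2 - 3/2 * ups k z * x2 k k z / (l k z)\<^sup>2)
     = ups k z * (g z - (1 - x z - 3/2 * X2 z)) + (g z - 1) * (y1 k z / Lh z + y2 k z / (Lh z)\<^sup>2)
     + (1 / Lh z - 1 / l k z) * y1 k z + (1 / (Lh z)\<^sup>2 - 1 / (l k z)\<^sup>2) * y2 k z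
     - ups k z * ((1 / Lh z - 1 / l k z) * x1 k k z) - 3/2 * ups k z * ((1 / (Lh z)\<^sup>2 - 1 / (l k z)\<^sup>2) * x2 k k z)) F"
    unfolding x_def X2_def divide_inverse by (intro always_eventually allI alg)
qed

text \<open>The overlap with \<open>u_m\<close> is already small, so within this summand only the
  zeroth-order coordinate \<open>ups m\<close> survives.\<close>

lemma term_m:
  assumes m: "m < d" "m \<noteq> k"
  shows "(\<lambda>z. l m z / Lh z * (s z * al m z) * (ups m z + y1 m z / Lh z + y2 m z / (Lh z)\<^sup>2)
     - l m z / (l k z - l m z) * ups m z * (x1 m k z / l k z + x2 m k z / (l k z)\<^sup>2)) \<in> negl"
proof (rule bigo_ev_cong)
  let ?f = "\<lambda>z. (x1 m k z + x2 m k z / l k z) / (l k z - l m z)"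
  have f: "?f \<in> small" by (intro div_gap add_O div_lk sm m kd)
  have sa: "(\<lambda>z. s z * al m z) \<in> small" by (rule mult_bdd_left[OF s_bdd al_small[OF m]])
  show "(\<lambda>z. l m z / Lh z * ((s z * al m z) * (y1 m z / Lh z + y2 m z / (Lh z)\<^sup>2))
     + l m z / Lh z * ups m z * (s z * al m z - ?f z) + l m z * ups m z * (?f z * (1 / Lh z - 1 / l k z))) \<in> negl"
    by (rule add_O[OF add_O[OF
          mult_bdd_left[OF div_Lh[OF bd(1)[OF m(1)]] small_med[OF sa add_O[OF div_Lh[OF sm(5)[OF m(1)]] div_Lh_power[OF tau_med[OF small_tau[OF sm(3)[OF m(1)]]]]]]]
          mult_bdd_left[OF mult_bdd_left[OF div_Lh[OF bd(1)[OF m(1)]] bd(8)[OF m(1)]] al_expand[OF m]]]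
          mult_bdd_left[OF mult_bdd_left[OF bd(1)[OF m(1)] bd(8)[OF m(1)]] small_small[OF f inv_Lh_small]]])
next
  have alg: "l / L * sa * (u + y + y') - l / gp * u * (x1 / lk + x2 / lk\<^sup>2)
     = l / L * (sa * (y + y')) + l / L * u * (sa - (x1 + x2 / lk) / gp) + l * u * ((x1 + x2 / lk) / gp * (1 / L - 1 / lk))"
    for l L sa u y y' gp x1 x2 lk :: real
  proof -
    have "inverse (lk\<^sup>2) = inverse lk * inverse lk" by (simp add: power2_eq_square)
    then show ?thesis by (simp add: divide_inverse algebra_simps del: power_inverse)
  qed
  show "eventually (\<lambda>z. l m z / Lh z * (s z * al m z) * (ups m z + y1 m z / Lh z + y2 m z / (Lh z)\<^sup>2)
     - l m z / (l k z - l m z) * ups m z * (x1 m k z / l k z + x2 m k z / (l k z)\<^sup>2)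
     = l m z / Lh z * ((s z * al m z) * (y1 m z / Lh z + y2 m z / (Lh z)\<^sup>2))
     + l m z / Lh z * ups m z * (s z * al m z - (x1 m k z + x2 m k z / l k z) / (l k z - l m z))
     + l m z * ups m z * ((x1 m k z + x2 m k z / l k z) / (l k z - l m z) * (1 / Lh z - 1 / l k z))) F"
    by (intro always_eventually allI alg)
qed

theorem eigenvector_expansion: "(\<lambda>z. s z * nu z - ups k z - psi z - q z) \<in> negl"
proof (rule bigo_ev_cong)
  let ?K = "\<lambda>z. g z * (ups k z + y1 k z / Lh z + y2 k z / (Lh z)\<^sup>2)
    - (ups k z + y1 k z / l k z - ups k z * x1 k k z / l k z + y2 k z / (l k z)\<^sup>2 - 3/2 * ups k z * x2 k k z / (l k z)\<^sup>2)"
  let ?M = "\<lambda>m z. l m z / Lh z * (s z * al m z) * (ups m z + y1 m z / Lh z + y2 m z / (Lh z)\<^sup>2)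
     - l m z / (l k z - l m z) * ups m z * (x1 m k z / l k z + x2 m k z / (l k z)\<^sup>2)"
  show "(\<lambda>z. ?K z + (\<Sum>m\<in>{..<d}-{k}. ?M m z) + s z * (z3 z / (Lh z)^3)) \<in> negl"
    by (intro add_O term_k sum_bigo term_m mult_bdd_left[OF s_bdd] div_Lh_power ng) auto
  show "eventually (\<lambda>z. s z * nu z - ups k z - psi z - q z = ?K z + (\<Sum>m\<in>{..<d}-{k}. ?M m z) + s z * (z3 z / (Lh z)^3)) F"
    using eqA lk_Lh nz
  proof eventually_elim
    case (elim z)
    have gk: "l k z / Lh z * (s z * al k z) = g z" using elim(2,3) by (simp add: s_al g_def)
    have "s z * nu z = g z * (ups k z + y1 k z / Lh z + y2 k z / (Lh z)\<^sup>2)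
       + (\<Sum>m\<in>{..<d}-{k}. l m z / Lh z * (s z * al m z) * (ups m z + y1 m z / Lh z + y2 m z / (Lh z)\<^sup>2)) + s z * (z3 z / (Lh z)^3)"
      unfolding elim(1) gk[symmetric] split_k distrib_left[of "s z"] sum_distrib_left by (simp add: mult_ac)
    moreover have "(\<Sum>m\<in>{..<d}-{k}. l m z / (l k z - l m z) * ups m z * (x1 m k z / l k z + x2 m k z / (l k z)\<^sup>2))
       = (\<Sum>m\<in>{..<d}-{k}. l m z / (l k z - l m z) * ups m z * x1 m k z / l k z) + (\<Sum>m\<in>{..<d}-{k}. l m z / (l k z - l m z) * ups m z * x2 m k z / (l k z)\<^sup>2)"
      unfolding sum.distrib[symmetric] by (simp add: distrib_left)
    ultimately show ?case unfolding psi_def q_def sum_subtractf by simp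
  qed
qed

lemma eigenvector_diff: "(\<lambda>z. s z * nu z - ups k z) \<in> med"
proof -
  have sm': "f \<in> small \<Longrightarrow> f \<in> med" for f by (rule tau_med[OF small_tau])
  have psi: "psi \<in> med" unfolding psi_def[abs_def]
    by (intro add_O diff_O div_lk sum_bigo mult_bdd_left div_gap bd kd sm(5) sm'[OF sm(1)]) auto
  have q: "q \<in> med" unfolding q_def[abs_def]
    by (intro add_O diff_O div_lk_power sum_bigo mult_bdd_left div_gap bd kd sm'[OF sm(3)] sm'[OF sm(2)]) auto
  have "(\<lambda>z. (s z * nu z - ups k z - psi z - q z) + psi z + q z) \<in> med"
    by (rule add_O[OF add_O[OF sm'[OF negl_small[OF eigenvector_expansion]] psi] q])
  then show ?thesis by simp
qed

text \<open>Needed for the pairing of the noise with the estimated low-rank part. Only one order is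
  expanded, and \<open>\<eta>\<close> records the power of \<open>n\<close> lost by moment counting
  on \<open>E^2 u_k\<close>.\<close>

lemma noise_eigenvector_diff: "(\<lambda>z. s z * ev z - y1 k z) \<in> O[F](\<lambda>z. (\<tau> z)\<^sup>2 * \<eta> z)"
proof (rule bigo_ev_cong)
  have ng': "f \<in> negl \<Longrightarrow> f \<in> O[F](\<lambda>z. (\<tau> z)\<^sup>2 * \<eta> z)" for f
    by (erule landau_o.big_trans, rule landau_o.big.mult[OF landau_o.big_refl landau_o.big_trans[OF zeta_bdd scale(5)]])
  have g_bdd: "g \<in> bdd" unfolding g_def[abs_def]
    by (rule mult_bdd_left[OF diff_O[OF _ small_bdd[OF mu_small]]]) (use bd(5)[OF kd] in auto)
  show "(\<lambda>z. (g z - 1) * y1 k z + g z * (y2 k z / Lh z)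
      + (\<Sum>m\<in>{..<d}-{k}. l m z / Lh z * s z * (al m z * (y1 m z + y2 m z / Lh z))) + s z * (z3 z / (Lh z)\<^sup>2)) \<in> O[F](\<lambda>z. (\<tau> z)\<^sup>2 * \<eta> z)"
  proof (intro add_O sum_bigo)
    show "(\<lambda>z. (g z - 1) * y1 k z) \<in> O[F](\<lambda>z. (\<tau> z)\<^sup>2 * \<eta> z)" by (rule ng'[OF small_med[OF g_small sm(5)[OF kd]]])
    show "(\<lambda>z. g z * (y2 k z / Lh z)) \<in> O[F](\<lambda>z. (\<tau> z)\<^sup>2 * \<eta> z)" by (rule mult_bdd_left[OF g_bdd div_Lh[OF sm(4)[OF kd]]])
    show "(\<lambda>z. s z * (z3 z / (Lh z)\<^sup>2)) \<in> O[F](\<lambda>z. (\<tau> z)\<^sup>2 * \<eta> z)" by (rule ng'[OF mult_bdd_left[OF s_bdd div_Lh_power[OF ng(2)]]])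
    fix m assume m: "m \<in> {..<d} - {k}"
    show "(\<lambda>z. l m z / Lh z * s z * (al m z * (y1 m z + y2 m z / Lh z))) \<in> O[F](\<lambda>z. (\<tau> z)\<^sup>2 * \<eta> z)"
      by (rule ng'[OF mult_bdd_left[OF mult_bdd_left[OF div_Lh[OF bd(1)] s_bdd]
            small_med[OF al_small add_O[OF sm(5) div_Lh[OF tau_med[OF small_tau[OF sm(3)]]]]]]]) (use m in auto)
  qed
  show "eventually (\<lambda>z. s z * ev z - y1 k z = (g z - 1) * y1 k z + g z * (y2 k z / Lh z)
      + (\<Sum>m\<in>{..<d}-{k}. l m z / Lh z * s z * (al m z * (y1 m z + y2 m z / Lh z))) + s z * (z3 z / (Lh z)\<^sup>2)) F"
    using eqD lk_Lh nz
  proof eventually_elim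
    case (elim z)
    have gk: "l k z / Lh z * (s z * al k z) = g z" using elim(2,3) by (simp add: s_al g_def)
    have "s z * ev z = g z * (y1 k z + y2 k z / Lh z)
       + (\<Sum>m\<in>{..<d}-{k}. l m z / Lh z * s z * (al m z * (y1 m z + y2 m z / Lh z))) + s z * (z3 z / (Lh z)\<^sup>2)"
      unfolding elim(1) gk[symmetric] split_k distrib_left[of "s z"] sum_distrib_left by (simp add: mult_ac)
    then show ?case by (simp add: algebra_simps)
  qed
qed

lemma abs_al_lower: "eventually (\<lambda>z. 1/2 \<le> \<bar>al k z\<bar>) F"
proof -
  have "(\<lambda>z. (\<bar>al k z\<bar> - (1 - dl z / 2)) - dl z / 2) \<in> small"
    by (rule diff_O[OF negl_small[OF abs_al] div_bdd[OF dl_small]]) simp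
  then have "(\<lambda>z. \<bar>al k z\<bar> - 1) \<in> small" by simp
  from landau_o.smallD[OF small_o1[OF this], of "1/2"]
  have "eventually (\<lambda>z. norm (\<bar>al k z\<bar> - 1) \<le> 1/2 * norm (1::real)) F" by simp
  then show ?thesis
  proof eventually_elim
    case (elim z)
    then have "\<bar>\<bar>al k z\<bar> - 1\<bar> \<le> 1/2" by simp
    then show ?case by linarith
  qed
qed

end

section \<open>Exact eigenvector equations\<close>

lemma funpow_mv_cong:
  assumes "\<And>j. j < n \<Longrightarrow> y j = z j" "i < n"
  shows "(mv n E ^^ q) y i = (mv n E ^^ q) z i"
  using assms(2)
proof (induction q arbitrary: i)
  case (Suc q)
  have "mv n E ((mv n E ^^ q) y) i = mv n E ((mv n E ^^ q) z) i" by (rule mv_cong) (rule Suc.IH)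
  then show ?case by simp
qed (simp add: assms(1))

lemma funpow_mv_lc: "(mv n E ^^ q) (\<lambda>i. \<Sum>l\<in>L. c l * f l i) = (\<lambda>i. \<Sum>l\<in>L. c l * (mv n E ^^ q) (f l) i)"
proof (induction q)
  case (Suc q)
  show ?case unfolding funpow.simps comp_apply Suc by (rule ext) (rule mv_lc)
qed simp

lemma funpow_mv_add: "(mv n E ^^ q) (\<lambda>i. f i + g i) = (\<lambda>i. (mv n E ^^ q) f i + (mv n E ^^ q) g i)"
proof (induction q)
  case (Suc q)
  show ?case unfolding funpow.simps comp_apply Suc by (rule ext) (rule mv_add)
qed simp

lemma funpow_mv_scale: "(mv n E ^^ q) (\<lambda>i. c * f i) = (\<lambda>i. c * (mv n E ^^ q) f i)"
proof (induction q)
  case (Suc q)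
  show ?case unfolding funpow.simps comp_apply Suc by (rule ext) (rule mv_scale)
qed simp

lemma abs_inner_n_le:
  assumes "\<And>i. i < n \<Longrightarrow> \<bar>x i\<bar> \<le> a" "\<And>i. i < n \<Longrightarrow> \<bar>y i\<bar> \<le> b" "0 \<le> a" "0 \<le> b"
  shows "\<bar>inner_n n x y\<bar> \<le> real n * (a * b)"
proof -
  have "\<bar>inner_n n x y\<bar> \<le> (\<Sum>i<n. \<bar>x i * y i\<bar>)" unfolding inner_n_def by (rule sum_abs)
  also have "\<dots> \<le> (\<Sum>i<n. a * b)"
    unfolding abs_mult using assms by (intro sum_mono mult_mono) auto
  finally show ?thesis by simp
qed

lemma abs_inner_n_unit_le:
  assumes "inner_n n x x = 1" "inner_n n y y = 1" shows "\<bar>inner_n n x y\<bar> \<le> 1"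
  using inner_n_Cauchy_Schwarz[of n x y] assms by (simp add: abs_square_le_1)

lemma abs_coordinate_le:
  assumes "i < n" shows "(x i)\<^sup>2 \<le> inner_n n x x"
  unfolding inner_n_def power2_eq_square using assms
  by (intro member_le_sum[of i "{..<n}" "\<lambda>i. x i * x i"]) auto

lemma gapDelta_le_abs: "m < d \<Longrightarrow> gapDelta d lam \<le> \<bar>lam m\<bar>"
  unfolding gapDelta_def by (intro Min_le) auto

text \<open>Only consecutive gaps enter the definition; by monotonicity a wider separation is at
  least the gap after \<open>m\<close>.\<close>

lemma gapDelta_le_diff:
  assumes dec: "\<And>m. Suc m < d \<Longrightarrow> lam (Suc m) \<le> lam m" and "m < m'" "m' < d"
  shows "gapDelta d lam \<le> lam m - lam m'"
proof -
  have "gapDelta d lam \<le> \<bar>lam m - lam (Suc m)\<bar>"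
    unfolding gapDelta_def using assms by (intro Min_le) auto
  moreover have "lam m' \<le> lam (Suc m)" using decseq_on_chain[of d lam "Suc m" m', OF dec] assms by simp
  ultimately show ?thesis using dec[of m] assms by simp
qed

context spiked_noise
begin

definition vh :: "nat \<Rightarrow> 'a \<Rightarrow> nat \<Rightarrow> nat \<Rightarrow> real" where "vh n \<omega> m = uhat n \<omega> (selidx n d p m)"
definition lh :: "nat \<Rightarrow> 'a \<Rightarrow> nat \<Rightarrow> real" where "lh n \<omega> m = lamA n \<omega> (selidx n d p m)"
definition alp :: "nat \<Rightarrow> 'a \<Rightarrow> nat \<Rightarrow> nat \<Rightarrow> real" where "alp n \<omega> m l = inner_n n (u n l) (vh n \<omega> m)"
definition Epow :: "nat \<Rightarrow> 'a \<Rightarrow> nat \<Rightarrow> (nat \<Rightarrow> real) \<Rightarrow> nat \<Rightarrow> real" where "Epow n \<omega> q y = (mv n (E n \<omega>) ^^ q) y"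

lemma Epow_0: "Epow n \<omega> 0 y = y" by (simp add: Epow_def)
lemma Epow_1: "Epow n \<omega> 1 y = mv n (E n \<omega>) y" by (simp add: Epow_def)
lemma Epow_Suc_0: "Epow n \<omega> (Suc 0) y = mv n (E n \<omega>) y" by (simp add: Epow_def)
lemma Epow_add: "Epow n \<omega> (a + b) y = Epow n \<omega> a (Epow n \<omega> b y)" by (simp add: Epow_def funpow_add)

lemma inner_Epow:
  assumes "\<omega> \<in> space (M n)" shows "inner_n n x (Epow n \<omega> q y) = inner_n n (Epow n \<omega> q x) y"
  unfolding Epow_def by (rule funpow_mv_sym) (use Esym assms in auto)

lemma selidx_less: "d \<le> n \<Longrightarrow> m < d \<Longrightarrow> selidx n d p m < n"
  using pd by (auto simp: selidx_def)

lemma vh_unit: "\<omega> \<in> space (M n) \<Longrightarrow> d \<le> n \<Longrightarrow> m < d \<Longrightarrow> inner_n n (vh n \<omega> m) (vh n \<omega> m) = 1"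
  unfolding vh_def using A_orth selidx_less by simp

lemma alp_le_1: "n \<ge> N0 \<Longrightarrow> \<omega> \<in> space (M n) \<Longrightarrow> d \<le> n \<Longrightarrow> m < d \<Longrightarrow> l < d \<Longrightarrow> \<bar>alp n \<omega> m l\<bar> \<le> 1"
  unfolding alp_def by (rule abs_inner_n_unit_le) (simp_all add: u_orth vh_unit)

lemma vh_eigen:
  assumes "\<omega> \<in> space (M n)" "d \<le> n" "m < d" "i < n"
  shows "lh n \<omega> m * vh n \<omega> m i = (\<Sum>l<d. (lam n l * alp n \<omega> m l) * u n l i) + mv n (E n \<omega>) (vh n \<omega> m) i"
proof -
  have "lh n \<omega> m * vh n \<omega> m i = (\<Sum>j<n. (lowrank d (lam n) (u n) i j + E n \<omega> i j) * vh n \<omega> m j)"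
    unfolding lh_def vh_def using A_eig[OF assms(1) selidx_less[OF assms(2,3)] assms(4)] by simp
  also have "\<dots> = mv n (lowrank d (lam n) (u n)) (vh n \<omega> m) i + mv n (E n \<omega>) (vh n \<omega> m) i"
    by (simp add: mv_def distrib_right sum.distrib)
  finally show ?thesis by (simp add: mv_lowrank alp_def)
qed

text \<open>Divide the eigenvalue equation by the eigenvalue and apply \<open>E^q\<close>: the
  low-rank part becomes a combination of the known vectors \<open>E^q u_l\<close>, and the rest
  gains one power of E over the eigenvalue.\<close>

lemma Epow_step:
  assumes "\<omega> \<in> space (M n)" "d \<le> n" "m < d" "i < n" "lh n \<omega> m \<noteq> 0"
  shows "Epow n \<omega> q (vh n \<omega> m) i
    = (\<Sum>l<d. lam n l * alp n \<omega> m l / lh n \<omega> m * Epow n \<omega> q (u n l) i) + Epow n \<omega> (Suc q) (vh n \<omega> m) i / lh n \<omega> m"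
proof -
  let ?c = "\<lambda>l. lam n l * alp n \<omega> m l / lh n \<omega> m"
  have v: "vh n \<omega> m j = (\<Sum>l<d. ?c l * u n l j) + 1 / lh n \<omega> m * mv n (E n \<omega>) (vh n \<omega> m) j" if "j < n" for j
  proof -
    have "vh n \<omega> m j = (lh n \<omega> m * vh n \<omega> m j) / lh n \<omega> m" using assms by simp
    then show ?thesis unfolding vh_eigen[OF assms(1-3) that] add_divide_distrib sum_divide_distrib by simp
  qed
  have "Epow n \<omega> q (vh n \<omega> m) i = (mv n (E n \<omega>) ^^ q) (\<lambda>j. (\<Sum>l<d. ?c l * u n l j) + 1 / lh n \<omega> m * mv n (E n \<omega>) (vh n \<omega> m) j) i"
    unfolding Epow_def by (rule funpow_mv_cong[OF v \<open>i < n\<close>])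
  also have "\<dots> = (\<Sum>l<d. ?c l * Epow n \<omega> q (u n l) i) + 1 / lh n \<omega> m * (mv n (E n \<omega>) ^^ q) (mv n (E n \<omega>) (vh n \<omega> m)) i"
    unfolding funpow_mv_add funpow_mv_lc funpow_mv_scale by (simp add: Epow_def)
  finally show ?thesis by (simp add: Epow_def funpow_swap1)
qed

lemma eq_A:
  assumes "\<omega> \<in> space (M n)" "d \<le> n" "m < d" "i < n" "lh n \<omega> m \<noteq> 0"
  shows "vh n \<omega> m i = (\<Sum>l<d. lam n l * alp n \<omega> m l / lh n \<omega> m *
     (u n l i + Epow n \<omega> 1 (u n l) i / lh n \<omega> m + Epow n \<omega> 2 (u n l) i / (lh n \<omega> m)\<^sup>2))
     + Epow n \<omega> 3 (vh n \<omega> m) i / (lh n \<omega> m) ^ 3"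
  using Epow_step[OF assms, of 0] Epow_step[OF assms, of 1] Epow_step[OF assms, of 2]
  by (simp add: Epow_0 numeral_2_eq_2 numeral_3_eq_3 distrib_left sum.distrib sum_divide_distrib add_divide_distrib mult_ac)

lemma eq_D:
  assumes "\<omega> \<in> space (M n)" "d \<le> n" "m < d" "i < n" "lh n \<omega> m \<noteq> 0"
  shows "Epow n \<omega> 1 (vh n \<omega> m) i = (\<Sum>l<d. lam n l * alp n \<omega> m l / lh n \<omega> m *
     (Epow n \<omega> 1 (u n l) i + Epow n \<omega> 2 (u n l) i / lh n \<omega> m))
     + Epow n \<omega> 3 (vh n \<omega> m) i / (lh n \<omega> m)\<^sup>2"
  using Epow_step[OF assms, of 1] Epow_step[OF assms, of 2]
  by (simp add: numeral_2_eq_2 numeral_3_eq_3 distrib_left sum.distrib sum_divide_distrib add_divide_distrib mult_ac)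

text \<open>Pairing the eigenvalue equation with \<open>u n l\<close>, which is an eigenvector of P,
  leaves only the noise.\<close>

lemma residual_eq:
  assumes "n \<ge> N0" "\<omega> \<in> space (M n)" "d \<le> n" "m < d" "l < d"
  shows "(lh n \<omega> m - lam n l) * alp n \<omega> m l = inner_n n (u n l) (Epow n \<omega> 1 (vh n \<omega> m))"
proof -
  have "lh n \<omega> m * alp n \<omega> m l = inner_n n (u n l) (\<lambda>i. lh n \<omega> m * vh n \<omega> m i)"
    by (simp add: inner_n_scale_right alp_def)
  also have "\<dots> = inner_n n (u n l) (\<lambda>i. (\<Sum>l<d. (lam n l * alp n \<omega> m l) * u n l i) + mv n (E n \<omega>) (vh n \<omega> m) i)"
    by (rule inner_n_cong) (use vh_eigen[OF assms(2-4)] in auto)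
  also have "\<dots> = (\<Sum>l'<d. (lam n l' * alp n \<omega> m l') * inner_n n (u n l) (u n l')) + inner_n n (u n l) (mv n (E n \<omega>) (vh n \<omega> m))"
    unfolding inner_n_add_right inner_n_lc_right ..
  also have "(\<Sum>l'<d. (lam n l' * alp n \<omega> m l') * inner_n n (u n l) (u n l')) = (\<Sum>l'<d. if l' = l then lam n l' * alp n \<omega> m l' else 0)"
    by (intro sum.cong refl) (use u_orth assms in auto)
  also have "\<dots> = lam n l * alp n \<omega> m l" using assms by simp
  finally show ?thesis by (simp add: Epow_Suc_0 left_diff_distrib)
qed

lemma eq_B:
  assumes "n \<ge> N0" "\<omega> \<in> space (M n)" "d \<le> n" "m < d" "l < d" "lh n \<omega> m \<noteq> 0"
  shows "(lh n \<omega> m - lam n l) * alp n \<omega> m l = (\<Sum>l'<d. lam n l' * alp n \<omega> m l' / lh n \<omega> m *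
     (inner_n n (u n l) (Epow n \<omega> 1 (u n l')) + inner_n n (u n l) (Epow n \<omega> 2 (u n l')) / lh n \<omega> m))
     + inner_n n (u n l) (Epow n \<omega> 3 (vh n \<omega> m)) / (lh n \<omega> m)\<^sup>2"
proof -
  let ?c = "\<lambda>l. lam n l * alp n \<omega> m l / lh n \<omega> m"
  have "inner_n n (u n l) (Epow n \<omega> 1 (vh n \<omega> m))
    = inner_n n (u n l) (\<lambda>i. ((\<Sum>l'<d. ?c l' * Epow n \<omega> 1 (u n l') i) + (\<Sum>l'<d. (?c l' / lh n \<omega> m) * Epow n \<omega> 2 (u n l') i))
     + (1 / (lh n \<omega> m)\<^sup>2) * Epow n \<omega> 3 (vh n \<omega> m) i)"
    by (rule inner_n_cong[OF refl], subst eq_D[OF assms(2-4) _ assms(6)]) (simp_all add: distrib_left sum.distrib)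
  also have "\<dots> = (\<Sum>l'<d. ?c l' * inner_n n (u n l) (Epow n \<omega> 1 (u n l'))) + (\<Sum>l'<d. (?c l' / lh n \<omega> m) * inner_n n (u n l) (Epow n \<omega> 2 (u n l')))
     + (1 / (lh n \<omega> m)\<^sup>2) * inner_n n (u n l) (Epow n \<omega> 3 (vh n \<omega> m))"
    unfolding inner_n_add_right inner_n_lc_right inner_n_scale_right ..
  finally show ?thesis unfolding residual_eq[OF assms(1-5)] by (simp add: distrib_left sum.distrib)
qed

text \<open>The equation \<open><v, v> = 1\<close> with one factor expanded. Moving E to the other
  side gives residuals in first order; in second order \<open>E v = L v - P v\<close> is used once
  more, so no pairing with \<open>E^2\<close> remains.\<close>

lemma eq_C:
  assumes "n \<ge> N0" "\<omega> \<in> space (M n)" "d \<le> n" "m < d" "lh n \<omega> m \<noteq> 0"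
  shows "1 = (\<Sum>l<d. lam n l * alp n \<omega> m l / lh n \<omega> m *
     (alp n \<omega> m l + 2 * ((lh n \<omega> m - lam n l) * alp n \<omega> m l) / lh n \<omega> m
       - (\<Sum>l'<d. alp n \<omega> m l' * lam n l' * inner_n n (u n l) (Epow n \<omega> 1 (u n l'))) / (lh n \<omega> m)\<^sup>2))
     + inner_n n (vh n \<omega> m) (Epow n \<omega> 3 (vh n \<omega> m)) / (lh n \<omega> m) ^ 3"
proof -
  let ?v = "vh n \<omega> m" and ?L = "lh n \<omega> m"
  let ?c = "\<lambda>l. lam n l * alp n \<omega> m l / ?L"
  \<comment> \<open>One E is moved onto the eigenvector and eliminated there; the remaining pairings
    are residuals and first-order quadratic forms.\<close>
  have v2: "inner_n n ?v (Epow n \<omega> 2 (u n l)) = ?L * ((?L - lam n l) * alp n \<omega> m l)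
      - (\<Sum>l'<d. alp n \<omega> m l' * lam n l' * inner_n n (u n l) (Epow n \<omega> 1 (u n l')))" if l: "l < d" for l
  proof -
    have "inner_n n ?v (Epow n \<omega> 2 (u n l)) = inner_n n (Epow n \<omega> 1 ?v) (Epow n \<omega> 1 (u n l))"
      using inner_Epow[OF assms(2), of ?v 1 "Epow n \<omega> 1 (u n l)"] Epow_add[of n \<omega> 1 1 "u n l"] by (simp add: numeral_2_eq_2)
    also have "\<dots> = inner_n n (\<lambda>i. ?L * ?v i - (\<Sum>l'<d. (lam n l' * alp n \<omega> m l') * u n l' i)) (Epow n \<omega> 1 (u n l))"
      by (rule inner_n_cong) (use vh_eigen[OF assms(2-4)] in \<open>auto simp: Epow_Suc_0\<close>)
    also have "\<dots> = ?L * inner_n n ?v (Epow n \<omega> 1 (u n l)) - (\<Sum>l'<d. (lam n l' * alp n \<omega> m l') * inner_n n (u n l') (Epow n \<omega> 1 (u n l)))"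
      unfolding inner_n_diff_left inner_n_scale_left inner_n_lc_left ..
    also have "inner_n n ?v (Epow n \<omega> 1 (u n l)) = (?L - lam n l) * alp n \<omega> m l"
      unfolding residual_eq[OF assms(1-4) l] inner_Epow[OF assms(2), of ?v 1 "u n l"] by (rule inner_n_commute)
    also have "(\<Sum>l'<d. (lam n l' * alp n \<omega> m l') * inner_n n (u n l') (Epow n \<omega> 1 (u n l)))
        = (\<Sum>l'<d. alp n \<omega> m l' * lam n l' * inner_n n (u n l) (Epow n \<omega> 1 (u n l')))"
    proof (intro sum.cong refl)
      fix l'
      have "inner_n n (u n l') (Epow n \<omega> 1 (u n l)) = inner_n n (u n l) (Epow n \<omega> 1 (u n l'))"
        by (simp only: inner_Epow[OF assms(2), of "u n l'" 1 "u n l"] inner_n_commute[of n "Epow n \<omega> 1 (u n l')"])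
      then show "lam n l' * alp n \<omega> m l' * inner_n n (u n l') (Epow n \<omega> 1 (u n l))
        = alp n \<omega> m l' * lam n l' * inner_n n (u n l) (Epow n \<omega> 1 (u n l'))" by simp
    qed
    finally show ?thesis .
  qed
  have v1: "inner_n n ?v (Epow n \<omega> 1 (u n l)) = (?L - lam n l) * alp n \<omega> m l" if "l < d" for l
    unfolding residual_eq[OF assms(1-4) that] inner_Epow[OF assms(2), of ?v 1 "u n l"] by (rule inner_n_commute)
  have "1 = inner_n n ?v ?v" using vh_unit assms by simp
  also have "\<dots> = inner_n n ?v (\<lambda>i. (((\<Sum>l<d. ?c l * u n l i) + (\<Sum>l<d. (?c l / ?L) * Epow n \<omega> 1 (u n l) i))
      + (\<Sum>l<d. (?c l / ?L\<^sup>2) * Epow n \<omega> 2 (u n l) i)) + (1 / ?L ^ 3) * Epow n \<omega> 3 ?v i)"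
    by (rule inner_n_cong[OF refl], subst eq_A[OF assms(2-4) _ assms(5)]) (simp_all add: distrib_left sum.distrib)
  also have "\<dots> = (\<Sum>l<d. ?c l * alp n \<omega> m l) + (\<Sum>l<d. (?c l / ?L) * ((?L - lam n l) * alp n \<omega> m l))
      + (\<Sum>l<d. (?c l / ?L\<^sup>2) * inner_n n ?v (Epow n \<omega> 2 (u n l))) + (1 / ?L ^ 3) * inner_n n ?v (Epow n \<omega> 3 ?v)"
    unfolding inner_n_add_right inner_n_lc_right inner_n_scale_right using v1
    by (simp add: alp_def inner_n_commute[of n ?v])
  also have "\<dots> = (\<Sum>l<d. ?c l * alp n \<omega> m l + (?c l / ?L) * ((?L - lam n l) * alp n \<omega> m l)
      + (?c l / ?L\<^sup>2) * inner_n n ?v (Epow n \<omega> 2 (u n l))) + (1 / ?L ^ 3) * inner_n n ?v (Epow n \<omega> 3 ?v)"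
    by (simp only: sum.distrib)
  also have "(\<Sum>l<d. ?c l * alp n \<omega> m l + (?c l / ?L) * ((?L - lam n l) * alp n \<omega> m l)
      + (?c l / ?L\<^sup>2) * inner_n n ?v (Epow n \<omega> 2 (u n l)))
    = (\<Sum>l<d. ?c l * (alp n \<omega> m l + 2 * ((?L - lam n l) * alp n \<omega> m l) / ?L
       - (\<Sum>l'<d. alp n \<omega> m l' * lam n l' * inner_n n (u n l) (Epow n \<omega> 1 (u n l'))) / ?L\<^sup>2))"
  proof (intro sum.cong refl)
    fix l assume l: "l \<in> {..<d}"
    have alg: "c * a + c / L * r + c / L\<^sup>2 * (L * r - t) = c * (a + 2 * r / L - t / L\<^sup>2)" if "L \<noteq> 0" for a c L r t :: real
      using that by (simp add: field_simps power2_eq_square)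
    from l have "l < d" by simp
    show "?c l * alp n \<omega> m l + (?c l / ?L) * ((?L - lam n l) * alp n \<omega> m l)
      + (?c l / ?L\<^sup>2) * inner_n n ?v (Epow n \<omega> 2 (u n l))
      = ?c l * (alp n \<omega> m l + 2 * ((?L - lam n l) * alp n \<omega> m l) / ?L
       - (\<Sum>l'<d. alp n \<omega> m l' * lam n l' * inner_n n (u n l) (Epow n \<omega> 1 (u n l'))) / ?L\<^sup>2)"
      unfolding v2[OF \<open>l < d\<close>] by (rule alg[OF assms(5)])
  qed
  finally show ?thesis by simp
qed

text \<open>A bound on every nonzero eigenvalue of P relative to the gap, from the two-sided bounds
  in (A1) and the gap condition (A2).\<close>

definition kap :: real where "kap = C2 / (delta0 * C1)"
definition tau :: "nat \<Rightarrow> real" where "tau n = snr n / Del n"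

lemma Del_lower: "n \<ge> N0 \<Longrightarrow> delta0 * C1 * (real n powr betaD * snr n) \<le> Del n"
proof -
  assume n: "n \<ge> N0"
  have "delta0 * (C1 * real n powr betaD * sqrt (real n * rho n)) \<le> delta0 * Min ((\<lambda>m. \<bar>lam n m\<bar>) ` {..<d})"
    using lam_lo[OF n] gap(1) by (intro mult_left_mono) auto
  also have "\<dots> \<le> Del n" unfolding Del_def by (rule gap(2)[OF n])
  finally show ?thesis by (simp add: snr_def mult.assoc)
qed

lemma Del_pos: "n \<ge> N0 \<Longrightarrow> 0 < n \<Longrightarrow> 0 < Del n"
  using Del_lower[of n] snr_pos[of n] gap spike by (intro less_le_trans[OF _ Del_lower]) auto

lemma tau_pos: "n \<ge> N0 \<Longrightarrow> 0 < n \<Longrightarrow> 0 < tau n"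
  using snr_pos Del_pos by (simp add: tau_def)

lemma lam_ge: "m < d \<Longrightarrow> Del n \<le> \<bar>lam n m\<bar>"
  unfolding Del_def by (rule gapDelta_le_abs)

lemma kap_pos: "0 < kap" using gap spike by (simp add: kap_def)

lemma lam_le: "n \<ge> N0 \<Longrightarrow> m < d \<Longrightarrow> \<bar>lam n m\<bar> \<le> kap * Del n"
proof -
  assume n: "n \<ge> N0" and m: "m < d"
  have "\<bar>lam n m\<bar> \<le> Max ((\<lambda>m. \<bar>lam n m\<bar>) ` {..<d})" using m by (intro Max_ge) auto
  also have "\<dots> \<le> C2 * (real n powr betaD * snr n)" using lam_hi[OF n] by (simp add: snr_def mult.assoc)
  also have "\<dots> = kap * (delta0 * C1 * (real n powr betaD * snr n))" using gap spike by (simp add: kap_def)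
  also have "\<dots> \<le> kap * Del n" using Del_lower[OF n] kap_pos by (intro mult_left_mono) auto
  finally show ?thesis .
qed

lemma lam_gap: "n \<ge> N0 \<Longrightarrow> m < d \<Longrightarrow> m' < d \<Longrightarrow> m \<noteq> m' \<Longrightarrow> Del n \<le> \<bar>lam n m - lam n m'\<bar>"
proof (induction m m' rule: linorder_wlog)
  case (le m m')
  then have "gapDelta d (lam n) \<le> lam n m - lam n m'"
    by (intro gapDelta_le_diff lam_sorted) auto
  then show ?case unfolding Del_def by linarith
next
  case (sym m m') then show ?case by (simp add: abs_minus_commute)
qed

lemma tau_upper: "n \<ge> N0 \<Longrightarrow> 0 < n \<Longrightarrow> tau n \<le> 1 / (delta0 * C1) * real n powr (- betaD)"
proof -
  assume n: "n \<ge> N0" "0 < n"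
  have s: "0 < snr n" using snr_pos n by simp
  have "tau n \<le> snr n / (delta0 * C1 * (real n powr betaD * snr n))"
    unfolding tau_def using s gap(1) spike n Del_pos[OF n] by (intro divide_left_mono Del_lower mult_pos_pos) auto
  also have "\<dots> = 1 / (delta0 * C1) * real n powr (- betaD)"
    using s by (simp add: powr_minus field_simps)
  finally show ?thesis .
qed

lemma eigenvalue_close:
  assumes n: "n \<ge> N0" "d \<le> n" and w: "\<omega> \<in> space (M n)" and good: "good K e R n \<omega>" and m: "m < d"
  shows "\<bar>lh n \<omega> m - lam n m\<bar> \<le> real n powr e * snr n"
  unfolding lh_def
proof (rule Weyl_selidx[where E = "E n \<omega>" and v = "uhat n \<omega>" and u = "u n" and d = d and p = p])
  let ?h = "real n powr e * snr n"
  have h: "0 \<le> ?h" using rho[OF n(1)] by (simp add: snr_def)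
  fix x
  have "(inner_n n x (mv n (E n \<omega>) x))\<^sup>2 \<le> inner_n n x x * inner_n n (mv n (E n \<omega>) x) (mv n (E n \<omega>) x)"
    by (rule inner_n_Cauchy_Schwarz)
  also have "\<dots> \<le> inner_n n x x * (?h\<^sup>2 * inner_n n x x)"
    using good inner_n_nonneg unfolding good_def by (intro mult_left_mono) auto
  also have "\<dots> = (?h * inner_n n x x)\<^sup>2" by (simp add: power2_eq_square mult_ac)
  finally have "\<bar>inner_n n x (mv n (E n \<omega>) x)\<bar> \<le> \<bar>?h * inner_n n x x\<bar>"
    by (simp only: abs_le_square_iff)
  also have "\<dots> = ?h * inner_n n x x" by (intro abs_of_nonneg mult_nonneg_nonneg h inner_n_nonneg)
  finally show "\<bar>inner_n n x (mv n (E n \<omega>) x)\<bar> \<le> ?h * inner_n n x x" .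
next
  show "mv n (\<lambda>i j. lowrank d (lam n) (u n) i j + E n \<omega> i j) (uhat n \<omega> m) i = lamA n \<omega> m * uhat n \<omega> m i"
    if "m < n" "i < n" for m i
    unfolding mv_def by (rule A_eig[OF w that])
qed (use n m w A_orth A_sorted u_orth lam_sorted lam_pos lam_neg in auto)

lemma Epow_norm:
  assumes "good K e R n \<omega>" "n \<ge> N0"
  shows "inner_n n (Epow n \<omega> q x) (Epow n \<omega> q x) \<le> ((real n powr e * snr n) ^ q)\<^sup>2 * inner_n n x x"
proof (induction q)
  case (Suc q)
  have "inner_n n (Epow n \<omega> (Suc q) x) (Epow n \<omega> (Suc q) x) \<le> (real n powr e * snr n)\<^sup>2 * inner_n n (Epow n \<omega> q x) (Epow n \<omega> q x)"
    using assms(1) by (simp add: good_def Epow_def)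
  also have "\<dots> \<le> (real n powr e * snr n)\<^sup>2 * (((real n powr e * snr n) ^ q)\<^sup>2 * inner_n n x x)"
    by (intro mult_left_mono Suc) simp
  finally show ?case by (simp add: power_mult_distrib mult_ac)
qed (simp add: Epow_0)

text \<open>Downward induction on \<open>q\<close> from \<open>Q\<close>. At \<open>q = Q\<close>
  the operator norm is used, without delocalisation; each step down adds delocalised vectors with
  coefficients at most \<open>2 * kap\<close> and multiplies the inherited bound by
  \<open>2 * tau n\<close>. Since \<open>4 * tau n\<close> is at most 1, the delocalised parts at
  most double.\<close>

lemma Epow_vh_bound:
  assumes n: "n \<ge> N0" "d \<le> n" "0 < n" and w: "\<omega> \<in> space (M n)" and good: "good K e (Suc Q) n \<omega>" and m: "m < d"
    and L: "Del n / 2 \<le> \<bar>lh n \<omega> m\<bar>" and t: "4 * tau n \<le> 1" and q: "q \<le> Q" and i: "i < n"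
  shows "\<bar>Epow n \<omega> q (vh n \<omega> m) i\<bar>
    \<le> snr n ^ q * (4 * real d * kap * real n powr e / sqrt (real n) + (2 * tau n) ^ (Q - q) * (real n powr e) ^ Q)"
  using q i
proof (induction "Q - q" arbitrary: q i)
  case 0
  then have q: "q = Q" by simp
  have s: "0 < snr n" using snr_pos n by simp
  have "(Epow n \<omega> Q (vh n \<omega> m) i)\<^sup>2 \<le> ((real n powr e * snr n) ^ Q)\<^sup>2"
    using abs_coordinate_le[OF 0(3), of "Epow n \<omega> Q (vh n \<omega> m)"] Epow_norm[OF good n(1), of Q "vh n \<omega> m"] vh_unit[OF w n(2) m] by simp
  then have "\<bar>Epow n \<omega> Q (vh n \<omega> m) i\<bar> \<le> (real n powr e * snr n) ^ Q"
    using abs_le_square_iff[of "Epow n \<omega> Q (vh n \<omega> m) i" "(real n powr e * snr n) ^ Q"] s by simp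
  also have "\<dots> \<le> snr n ^ Q * (4 * real d * kap * real n powr e / sqrt (real n) + (real n powr e) ^ Q)"
    using s kap_pos by (simp add: power_mult_distrib distrib_left)
  finally show ?case using q by simp
next
  case (Suc j)
  have s: "0 < snr n" using snr_pos n by simp
  have D: "0 < Del n" using Del_pos n by simp
  have L0: "lh n \<omega> m \<noteq> 0" using L D by auto
  have L2: "1 / \<bar>lh n \<omega> m\<bar> \<le> 2 / Del n" using L D L0 by (simp add: field_simps)
  let ?g = "real n powr e / sqrt (real n)"
  let ?B = "4 * real d * kap * ?g + (2 * tau n) ^ (Q - Suc q) * (real n powr e) ^ Q"
  have IH: "\<bar>Epow n \<omega> (Suc q) (vh n \<omega> m) i\<bar> \<le> snr n ^ Suc q * ?B"
    using Suc.hyps(1)[of "Suc q" i] Suc.hyps(2) Suc.prems by simp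
  have g: "0 \<le> ?g" by simp
  have summand: "\<bar>lam n l * alp n \<omega> m l / lh n \<omega> m * Epow n \<omega> q (u n l) i\<bar> \<le> 2 * kap * (snr n ^ q * ?g)" if l: "l < d" for l
  proof -
    have "\<bar>lam n l * alp n \<omega> m l / lh n \<omega> m\<bar> = \<bar>lam n l\<bar> * \<bar>alp n \<omega> m l\<bar> * (1 / \<bar>lh n \<omega> m\<bar>)" by (simp add: abs_mult)
    also have "\<dots> \<le> (kap * Del n) * 1 * (2 / Del n)"
      using lam_le[OF n(1) l] alp_le_1[OF n(1) w n(2) m l] L2 D kap_pos by (intro mult_mono) auto
    also have "\<dots> = 2 * kap" using D by simp
    finally have 1: "\<bar>lam n l * alp n \<omega> m l / lh n \<omega> m\<bar> \<le> 2 * kap" .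
    have "\<bar>Epow n \<omega> q (u n l) i\<bar> \<le> snr n ^ q * ?g"
      using good l Suc.prems unfolding good_def Epow_def by (auto simp: mult_ac)
    with 1 show ?thesis unfolding abs_mult[of "lam n l * alp n \<omega> m l / lh n \<omega> m"] using kap_pos by (intro mult_mono) auto
  qed
  have "\<bar>Epow n \<omega> q (vh n \<omega> m) i\<bar> \<le> \<bar>\<Sum>l<d. lam n l * alp n \<omega> m l / lh n \<omega> m * Epow n \<omega> q (u n l) i\<bar> + \<bar>Epow n \<omega> (Suc q) (vh n \<omega> m) i / lh n \<omega> m\<bar>"
    unfolding Epow_step[OF w n(2) m Suc.prems(2) L0, of q] by (rule abs_triangle_ineq)
  also have "\<dots> \<le> (\<Sum>l<d. 2 * kap * (snr n ^ q * ?g)) + snr n ^ Suc q * ?B * (2 / Del n)"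
  proof (intro add_mono)
    show "\<bar>\<Sum>l<d. lam n l * alp n \<omega> m l / lh n \<omega> m * Epow n \<omega> q (u n l) i\<bar> \<le> (\<Sum>l<d. 2 * kap * (snr n ^ q * ?g))"
      by (rule order_trans[OF sum_abs sum_mono]) (use summand in auto)
    have "\<bar>Epow n \<omega> (Suc q) (vh n \<omega> m) i / lh n \<omega> m\<bar> = \<bar>Epow n \<omega> (Suc q) (vh n \<omega> m) i\<bar> * (1 / \<bar>lh n \<omega> m\<bar>)" by simp
    also have "\<dots> \<le> snr n ^ Suc q * ?B * (2 / Del n)"
      by (intro mult_mono IH L2 order_trans[OF abs_ge_zero IH]) auto
    finally show "\<bar>Epow n \<omega> (Suc q) (vh n \<omega> m) i / lh n \<omega> m\<bar> \<le> snr n ^ Suc q * ?B * (2 / Del n)" .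
  qed
  also have "\<dots> = snr n ^ q * (2 * real d * kap * ?g + 2 * tau n * ?B)"
    by (simp add: tau_def algebra_simps)
  also have "2 * tau n * ?B = (4 * tau n) * (2 * real d * kap * ?g) + (2 * tau n) ^ (Q - q) * (real n powr e) ^ Q"
  proof -
    have "Q - q = Suc (Q - Suc q)" using Suc.hyps(2) by simp
    then show ?thesis by (simp add: algebra_simps)
  qed
  also have "snr n ^ q * (2 * real d * kap * ?g + ((4 * tau n) * (2 * real d * kap * ?g) + (2 * tau n) ^ (Q - q) * (real n powr e) ^ Q))
     \<le> snr n ^ q * (4 * real d * kap * ?g + (2 * tau n) ^ (Q - q) * (real n powr e) ^ Q)"
  proof (intro mult_left_mono)
    have h: "(4 * tau n) * (2 * real d * kap * ?g) \<le> 1 * (2 * real d * kap * ?g)"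
      using t kap_pos by (intro mult_right_mono) auto
    have aux: "a + (b + c) \<le> a2 + c" if "b \<le> 1 * a" "a2 = 2 * a" for a b c a2 :: real
      using that by simp
    show "2 * real d * kap * ?g + ((4 * tau n) * (2 * real d * kap * ?g) + (2 * tau n) ^ (Q - q) * (real n powr e) ^ Q)
       \<le> 4 * real d * kap * ?g + (2 * tau n) ^ (Q - q) * (real n powr e) ^ Q" by (rule aux[OF h]) simp
  qed (use s in auto)
  finally show ?case by simp
qed

text \<open>The exponent granted to moment counting. From \<open>4 * gam \<le> betaD\<close>, a
  factor \<open>tau n\<close> outweighs two losses \<open>n powr gam\<close> with
  \<open>n powr (- gam)\<close> to spare; from \<open>8 * gam \<le> 1\<close>, both
  \<open>n powr gam\<close> and \<open>ln n\<close> are controlled against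
  \<open>sqrt n\<close>.\<close>

definition gam :: real where "gam = min betaD (1/2) / 4"
text \<open>Number of passes through the eigenvalue equation. With \<open>1 / gam\<close> passes and
  a few more, the powers of \<open>tau n\<close> outweigh both the losses of moment counting and the
  missing \<open>sqrt n\<close>.\<close>

definition Q0 :: nat where "Q0 = nat \<lceil>1 / gam\<rceil> + 5"
definition cD :: real where "cD = 1 / (delta0 * C1)"
definition Kv :: real where "Kv = 4 * real d * kap + 1"

lemma gam: "0 < gam" "4 * gam \<le> betaD" "8 * gam \<le> 1"
  using spike by (auto simp: gam_def min_def)

lemma cD_pos: "0 < cD" using gap spike by (simp add: cD_def)
lemma Kv_pos: "0 < Kv" using kap_pos by (simp add: Kv_def add_nonneg_pos)

lemma eta_tau:
  assumes n: "n \<ge> N0" "1 \<le> n"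
  shows "real n powr gam * tau n \<le> cD * (real n powr (- gam))\<^sup>2"
    and "(real n powr gam)\<^sup>2 * tau n \<le> cD * real n powr (- gam)"
proof -
  have t: "tau n \<le> cD * real n powr (- betaD)" using tau_upper[of n] n by (simp add: cD_def)
  have "real n powr gam * tau n \<le> real n powr gam * (cD * real n powr (- betaD))"
    by (intro mult_left_mono t) simp
  also have "\<dots> = cD * real n powr (gam - betaD)" by (simp add: powr_diff powr_minus field_simps)
  also have "\<dots> \<le> cD * real n powr (- (2 * gam))"
    using n gam cD_pos by (intro mult_left_mono powr_mono) auto
  also have "real n powr (- (2 * gam)) = (real n powr (- gam))\<^sup>2"
    using n by (simp add: powr_power mult.commute)
  finally show "real n powr gam * tau n \<le> cD * (real n powr (- gam))\<^sup>2" .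
  have "(real n powr gam)\<^sup>2 * tau n \<le> (real n powr gam)\<^sup>2 * (cD * real n powr (- betaD))"
    by (intro mult_left_mono t) simp
  also have "\<dots> = cD * real n powr (2 * gam - betaD)"
    using n by (simp add: powr_diff powr_minus powr_power mult.commute field_simps)
  also have "\<dots> \<le> cD * real n powr (- gam)"
    using n gam cD_pos by (intro mult_left_mono powr_mono) auto
  finally show "(real n powr gam)\<^sup>2 * tau n \<le> cD * real n powr (- gam)" .
qed

text \<open>The exponent is \<open>Q0 - 3\<close> because the expansions keep \<open>E^3\<close> of
  the eigenvector as remainder, which leaves \<open>Q0 - 3\<close> passes. The total power of
  \<open>n\<close> is at most \<open>- 3\<close> by the choice of \<open>Q0\<close>, well below the
  required \<open>- 1 / 2\<close>.\<close>

lemma tail_negligible: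
  "eventually (\<lambda>n. (2 * tau n) ^ (Q0 - 3) * (real n powr gam) ^ Q0 \<le> real n powr gam / sqrt (real n)) sequentially"
proof -
  have Q: "1 \<le> gam * real Q0 - 5 * gam"
  proof -
    have "1 / gam + 5 \<le> real Q0" unfolding Q0_def using gam by simp
    then have "gam * (1 / gam + 5) \<le> gam * real Q0" using gam by (intro mult_left_mono) auto
    then show ?thesis using gam by (simp add: distrib_left)
  qed
  define D where "D = (2 * cD) ^ (Q0 - 3)"
  have "eventually (\<lambda>n::nat. D * real n powr (-3) \<le> real n powr (- 1 / 2)) sequentially" by real_asymp
  moreover have "eventually (\<lambda>n. N0 \<le> n \<and> 1 \<le> n) sequentially" by (intro eventually_conj eventually_ge_at_top)
  ultimately show ?thesis
  proof eventually_elim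
    case (elim n)
    then have n: "n \<ge> N0" "0 < n" "1 \<le> real n" by auto
    have "(2 * tau n) ^ (Q0 - 3) \<le> (2 * (cD * real n powr (- betaD))) ^ (Q0 - 3)"
      using tau_pos[OF n(1,2)] tau_upper[OF n(1,2)] by (intro power_mono) (auto simp: cD_def)
    also have "\<dots> = D * real n powr (- betaD * real (Q0 - 3))"
      using n by (simp add: D_def power_mult_distrib powr_power mult.commute)
    finally have "(2 * tau n) ^ (Q0 - 3) * (real n powr gam) ^ Q0
      \<le> D * real n powr (- betaD * real (Q0 - 3)) * (real n powr gam) ^ Q0"
      by (intro mult_right_mono) auto
    also have "\<dots> = D * real n powr (- betaD * real (Q0 - 3) + gam * real Q0)"
    proof -
      have "(real n powr gam) ^ Q0 = real n powr (gam * real Q0)" using n by (simp add: powr_power mult.commute)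
      then show ?thesis by (simp only: powr_add mult.assoc)
    qed
    also have "\<dots> \<le> D * real n powr (-3)"
    proof (intro mult_left_mono powr_mono)
      have "4 * gam * (real Q0 - 3) \<le> betaD * (real Q0 - 3)"
      proof (intro mult_right_mono gam)
        have "5 \<le> Q0" by (simp add: Q0_def)
        then show "0 \<le> real Q0 - 3" by simp
      qed
      moreover have "real (Q0 - 3) = real Q0 - 3" by (simp add: Q0_def)
      ultimately show "- betaD * real (Q0 - 3) + gam * real Q0 \<le> - 3"
        using Q gam by (simp add: algebra_simps)
    qed (use n cD_pos in \<open>auto simp: D_def\<close>)
    also have "\<dots> \<le> real n powr (- 1 / 2)" using elim by simp
    also have "\<dots> = 1 / sqrt (real n)" using n by (simp add: powr_minus powr_half_sqrt field_simps)
    also have "\<dots> \<le> real n powr gam / sqrt (real n)"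
      using n gam by (intro divide_right_mono ge_one_powr_ge_zero) auto
    finally show ?case .
  qed
qed

end

text \<open>The sets \<open>S n\<close> carry all the probabilistic information: inside this locale
  every statement is a deterministic consequence of \<open>good\<close> on
  \<open>S n\<close>.\<close>

locale spiked_event = spiked_noise M E N0 rho qn eps C A0 d p lam u lamA uhat betaD C1 C2 delta0 Cmu
  for M :: "nat \<Rightarrow> 'a measure" and E N0 rho qn eps C A0 d p lam u lamA uhat betaD C1 C2 delta0 Cmu +
  fixes S :: "nat \<Rightarrow> 'a set" and K :: real and NS :: nat
  assumes S_space: "\<And>n. S n \<subseteq> space (M n)"
    and S_good: "\<And>n \<omega>. n \<ge> NS \<Longrightarrow> \<omega> \<in> S n \<Longrightarrow> good K gam (Suc Q0) n \<omega>"
    and K_nonneg: "0 \<le> K"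
begin

text \<open>Triples with growing \<open>n\<close>, sample point in \<open>S n\<close> and coordinate
  below \<open>n\<close>. A Landau bound along this filter has a constant and a threshold uniform in
  sample point and coordinate, as both kinds of probabilistic order symbols demand.\<close>

definition EF :: "(nat \<times> 'a \<times> nat) filter" where
  "EF = inf (filtercomap fst sequentially) (principal {z. fst (snd z) \<in> S (fst z) \<and> snd (snd z) < fst z})"

lemma eventually_EF: "eventually P EF \<longleftrightarrow> (\<exists>N. \<forall>n\<ge>N. \<forall>\<omega>\<in>S n. \<forall>i<n. P (n, \<omega>, i))"
proof
  assume "eventually P EF"
  then obtain Q N where "\<forall>n\<ge>N. Q n"
      "\<forall>z. Q (fst z) \<longrightarrow> (z \<in> {z. fst (snd z) \<in> S (fst z) \<and> snd (snd z) < fst z} \<longrightarrow> P z)"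
    unfolding EF_def eventually_inf_principal eventually_filtercomap eventually_sequentially by blast
  then show "\<exists>N. \<forall>n\<ge>N. \<forall>\<omega>\<in>S n. \<forall>i<n. P (n, \<omega>, i)" by (intro exI[of _ N]) auto
next
  assume "\<exists>N. \<forall>n\<ge>N. \<forall>\<omega>\<in>S n. \<forall>i<n. P (n, \<omega>, i)"
  then obtain N where N: "\<And>n \<omega> i. n \<ge> N \<Longrightarrow> \<omega> \<in> S n \<Longrightarrow> i < n \<Longrightarrow> P (n, \<omega>, i)" by blast
  show "eventually P EF"
    unfolding EF_def eventually_inf_principal eventually_filtercomap eventually_sequentially
    by (intro exI[of _ "\<lambda>n. n \<ge> N"] conjI exI[of _ N]) (auto intro: N)
qed

lemma filterlim_fst_EF: "filterlim fst sequentially EF"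
  unfolding filterlim_def le_filter_def eventually_filtermap eventually_EF eventually_sequentially by auto

lemma bigo_seq_EF: "f \<in> O[sequentially](g) \<Longrightarrow> (\<lambda>z. f (fst z)) \<in> O[EF](\<lambda>z. g (fst z))"
  for f g :: "nat \<Rightarrow> real"
  by (rule landau_o.big.compose[OF _ filterlim_fst_EF])

lemma smallo_seq_EF: "f \<in> o[sequentially](g) \<Longrightarrow> (\<lambda>z. f (fst z)) \<in> o[EF](\<lambda>z. g (fst z))"
  for f g :: "nat \<Rightarrow> real"
  by (rule landau_o.small.compose[OF _ filterlim_fst_EF])

lemma bigo_EF_I:
  fixes f g :: "nat \<times> 'a \<times> nat \<Rightarrow> real"
  assumes "\<And>n \<omega> i. n \<ge> N \<Longrightarrow> \<omega> \<in> S n \<Longrightarrow> i < n \<Longrightarrow> \<bar>f (n, \<omega>, i)\<bar> \<le> c * \<bar>g (n, \<omega>, i)\<bar>"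
  shows "f \<in> O[EF](g)"
  by (rule bigoI[of _ c]) (use assms in \<open>auto simp: eventually_EF\<close>)

lemma bigo_EF_E:
  fixes f g :: "nat \<times> 'a \<times> nat \<Rightarrow> real"
  assumes "f \<in> O[EF](g)"
  obtains c N where "c > 0" "\<And>n \<omega> i. n \<ge> N \<Longrightarrow> \<omega> \<in> S n \<Longrightarrow> i < n \<Longrightarrow> \<bar>f (n, \<omega>, i)\<bar> \<le> c * \<bar>g (n, \<omega>, i)\<bar>"
proof -
  obtain c where "c > 0" "eventually (\<lambda>z. norm (f z) \<le> c * norm (g z)) EF" using landau_o.bigE[OF assms] by blast
  then show ?thesis using that unfolding eventually_EF by fastforce
qed

lemma large:
  obtains N where "\<And>n. n \<ge> N \<Longrightarrow> N0 \<le> n" "\<And>n. n \<ge> N \<Longrightarrow> NS \<le> n" "\<And>n. n \<ge> N \<Longrightarrow> d \<le> n" "\<And>n. n \<ge> N \<Longrightarrow> 1 \<le> n"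
    "\<And>n. n \<ge> N \<Longrightarrow> 1 \<le> ln (real n)" "\<And>n. n \<ge> N \<Longrightarrow> 4 * tau n \<le> 1" "\<And>n. n \<ge> N \<Longrightarrow> real n powr gam * tau n \<le> 1 / 2"
    "\<And>n. n \<ge> N \<Longrightarrow> (2 * tau n) ^ (Q0 - 3) * (real n powr gam) ^ Q0 \<le> real n powr gam / sqrt (real n)"
    "\<And>n. n \<ge> N \<Longrightarrow> ln (real n) / sqrt (real n) \<le> (real n powr (- gam))\<^sup>2"
proof -
  have e1: "eventually (\<lambda>n. N0 \<le> n \<and> NS \<le> n \<and> d \<le> n \<and> 1 \<le> n) sequentially"
    by (intro eventually_conj eventually_ge_at_top)
  have e2: "eventually (\<lambda>n::nat. 1 \<le> ln (real n)) sequentially" by real_asymp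
  have e3: "eventually (\<lambda>n::nat. cD * (real n powr (- gam))\<^sup>2 \<le> 1/4) sequentially" using gam(1) by real_asymp
  have e4: "eventually (\<lambda>n::nat. ln (real n) / sqrt (real n) \<le> real n powr (- 1 / 4)) sequentially" by real_asymp
  have "eventually (\<lambda>n. (N0 \<le> n \<and> NS \<le> n \<and> d \<le> n \<and> 1 \<le> n) \<and> 1 \<le> ln (real n) \<and> 4 * tau n \<le> 1 \<and> real n powr gam * tau n \<le> 1 / 2
    \<and> (2 * tau n) ^ (Q0 - 3) * (real n powr gam) ^ Q0 \<le> real n powr gam / sqrt (real n)
    \<and> ln (real n) / sqrt (real n) \<le> (real n powr (- gam))\<^sup>2) sequentially"
    using e1 e2 e3 e4 tail_negligible
  proof eventually_elim
    case (elim n)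
    have et: "real n powr gam * tau n \<le> 1/4" using eta_tau(1)[of n] elim by simp
    have "1 * tau n \<le> real n powr gam * tau n"
      using gam elim tau_pos[of n] by (intro mult_right_mono ge_one_powr_ge_zero) auto
    moreover have "real n powr (- 1 / 4) \<le> (real n powr (- gam))\<^sup>2"
    proof -
      have "real n powr (- 1 / 4) \<le> real n powr (- (2 * gam))" using gam elim by (intro powr_mono) auto
      then show ?thesis using elim by (simp add: powr_power mult.commute)
    qed
    ultimately show ?case using elim et by auto
  qed
  then obtain N where "\<And>n. n \<ge> N \<Longrightarrow> (N0 \<le> n \<and> NS \<le> n \<and> d \<le> n \<and> 1 \<le> n) \<and> 1 \<le> ln (real n) \<and> 4 * tau n \<le> 1 \<and> real n powr gam * tau n \<le> 1 / 2
    \<and> (2 * tau n) ^ (Q0 - 3) * (real n powr gam) ^ Q0 \<le> real n powr gam / sqrt (real n)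
    \<and> ln (real n) / sqrt (real n) \<le> (real n powr (- gam))\<^sup>2" unfolding eventually_sequentially by blast
  then show ?thesis by (intro that[of N]) auto
qed

text \<open>A named threshold beyond which all asymptotic side conditions hold together; later
  statements refer to it in place of an existential.\<close>

definition NL :: nat where
  "NL = (SOME N. \<forall>n\<ge>N. (N0 \<le> n \<and> NS \<le> n \<and> d \<le> n \<and> 1 \<le> n) \<and> 1 \<le> ln (real n) \<and> 4 * tau n \<le> 1 \<and> real n powr gam * tau n \<le> 1 / 2
    \<and> (2 * tau n) ^ (Q0 - 3) * (real n powr gam) ^ Q0 \<le> real n powr gam / sqrt (real n)
    \<and> ln (real n) / sqrt (real n) \<le> (real n powr (- gam))\<^sup>2)"

lemma NL:
  assumes "n \<ge> NL"
  shows "N0 \<le> n" "NS \<le> n" "d \<le> n" "1 \<le> n" "0 < n" "1 \<le> ln (real n)" "4 * tau n \<le> 1" "real n powr gam * tau n \<le> 1 / 2"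
    "(2 * tau n) ^ (Q0 - 3) * (real n powr gam) ^ Q0 \<le> real n powr gam / sqrt (real n)"
    "ln (real n) / sqrt (real n) \<le> (real n powr (- gam))\<^sup>2"
    "0 < snr n" "0 < Del n" "0 < tau n"
proof -
  let ?P = "\<lambda>n. (N0 \<le> n \<and> NS \<le> n \<and> d \<le> n \<and> 1 \<le> n) \<and> 1 \<le> ln (real n) \<and> 4 * tau n \<le> 1 \<and> real n powr gam * tau n \<le> 1 / 2
    \<and> (2 * tau n) ^ (Q0 - 3) * (real n powr gam) ^ Q0 \<le> real n powr gam / sqrt (real n)
    \<and> ln (real n) / sqrt (real n) \<le> (real n powr (- gam))\<^sup>2"
  have "\<exists>N. \<forall>n\<ge>N. ?P n" by (rule large) blast
  then have "\<forall>n\<ge>NL. ?P n" unfolding NL_def by (rule someI_ex)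
  then have *: "?P n" using assms by blast
  then show "N0 \<le> n" "NS \<le> n" "d \<le> n" "1 \<le> n" "0 < n" "1 \<le> ln (real n)" "4 * tau n \<le> 1" "real n powr gam * tau n \<le> 1 / 2"
    "(2 * tau n) ^ (Q0 - 3) * (real n powr gam) ^ Q0 \<le> real n powr gam / sqrt (real n)"
    "ln (real n) / sqrt (real n) \<le> (real n powr (- gam))\<^sup>2" by auto
  then show "0 < snr n" "0 < Del n" "0 < tau n" using snr_pos Del_pos tau_pos by auto
qed

lemma in_space: "\<omega> \<in> S n \<Longrightarrow> \<omega> \<in> space (M n)" using S_space by auto

text \<open>Weyl's bound \<open>n powr gam * snr n\<close> is at most half the gap, so each selected
  eigenvalue of A stays nearer to its own partner than to any other eigenvalue in
  \<open>lam\<close>.\<close>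

lemma lh_close: "n \<ge> NL \<Longrightarrow> \<omega> \<in> S n \<Longrightarrow> m < d \<Longrightarrow> \<bar>lh n \<omega> m - lam n m\<bar> \<le> Del n / 2"
proof -
  assume n: "n \<ge> NL" and w: "\<omega> \<in> S n" and m: "m < d"
  have "\<bar>lh n \<omega> m - lam n m\<bar> \<le> real n powr gam * snr n"
    by (rule eigenvalue_close[OF NL(1,3)[OF n] in_space[OF w] S_good[OF NL(2)[OF n] w] m])
  also have "\<dots> = (real n powr gam * tau n) * Del n" using NL(12)[OF n] by (simp add: tau_def)
  also have "\<dots> \<le> 1/2 * Del n" using NL[OF n] by (intro mult_right_mono) auto
  finally show ?thesis by simp
qed

lemma lh_lower: "n \<ge> NL \<Longrightarrow> \<omega> \<in> S n \<Longrightarrow> m < d \<Longrightarrow> Del n / 2 \<le> \<bar>lh n \<omega> m\<bar>"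
  using lh_close[of n \<omega> m] lam_ge[of m n] by linarith

lemma lh_nz: "n \<ge> NL \<Longrightarrow> \<omega> \<in> S n \<Longrightarrow> m < d \<Longrightarrow> lh n \<omega> m \<noteq> 0"
  using lh_lower[of n \<omega> m] NL(12)[of n] by auto

lemma lh_upper: "n \<ge> NL \<Longrightarrow> \<omega> \<in> S n \<Longrightarrow> m < d \<Longrightarrow> \<bar>lh n \<omega> m\<bar> \<le> (kap + 1) * Del n"
  unfolding distrib_right mult_1_left using lh_close[of n \<omega> m] lam_le[of n m] NL(1,12)[of n] by linarith

lemma lh_gap: "n \<ge> NL \<Longrightarrow> \<omega> \<in> S n \<Longrightarrow> m < d \<Longrightarrow> m' < d \<Longrightarrow> m \<noteq> m' \<Longrightarrow> Del n / 2 \<le> \<bar>lh n \<omega> m - lam n m'\<bar>"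
  using lh_close[of n \<omega> m] lam_gap[of n m m'] NL(1)[of n] by linarith

lemma Epow_u:
  assumes "n \<ge> NL" "\<omega> \<in> S n" "m < d" "i < n" "q \<le> Q0"
  shows "\<bar>Epow n \<omega> q (u n m) i\<bar> \<le> snr n ^ q * (real n powr gam / sqrt (real n))"
  using S_good[OF NL(2)[OF assms(1)] assms(2)] assms unfolding good_def Epow_def by (auto simp: mult_ac)

lemma Epow_vh:
  assumes n: "n \<ge> NL" and w: "\<omega> \<in> S n" and m: "m < d" and i: "i < n" and q: "q \<le> 3"
  shows "\<bar>Epow n \<omega> q (vh n \<omega> m) i\<bar> \<le> Kv * (snr n ^ q * (real n powr gam / sqrt (real n)))"
proof -
  note L = NL[OF n]
  have Q: "q \<le> Q0" using q by (simp add: Q0_def)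
  have "(2 * tau n) ^ (Q0 - q) \<le> (2 * tau n) ^ (Q0 - 3)"
    using L q by (intro power_decreasing) auto
  then have "(2 * tau n) ^ (Q0 - q) * (real n powr gam) ^ Q0 \<le> (2 * tau n) ^ (Q0 - 3) * (real n powr gam) ^ Q0"
    by (intro mult_right_mono) auto
  also note L(9)
  finally have t: "(2 * tau n) ^ (Q0 - q) * (real n powr gam) ^ Q0 \<le> real n powr gam / sqrt (real n)" .
  have "\<bar>Epow n \<omega> q (vh n \<omega> m) i\<bar>
    \<le> snr n ^ q * (4 * real d * kap * real n powr gam / sqrt (real n) + (2 * tau n) ^ (Q0 - q) * (real n powr gam) ^ Q0)"
    by (rule Epow_vh_bound[OF L(1,3,5) in_space[OF w] S_good[OF L(2) w] m lh_lower[OF n w m] L(7) Q i])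
  also have "\<dots> \<le> snr n ^ q * (4 * real d * kap * real n powr gam / sqrt (real n) + real n powr gam / sqrt (real n))"
    using L t by (intro mult_left_mono add_left_mono) auto
  also have "\<dots> = Kv * (snr n ^ q * (real n powr gam / sqrt (real n)))"
    by (simp add: Kv_def algebra_simps add_divide_distrib)
  finally show ?thesis .
qed

section \<open>Normalised quantities on the filter and verification of the abstract setting\<close>

abbreviation "zt \<equiv> (\<lambda>z::nat \<times> 'a \<times> nat. tau (fst z))"
abbreviation "zz \<equiv> (\<lambda>z::nat \<times> 'a \<times> nat. real (fst z) powr (- gam))"
abbreviation "zl \<equiv> (\<lambda>z::nat \<times> 'a \<times> nat. ln (real (fst z)))"
abbreviation "ze \<equiv> (\<lambda>z::nat \<times> 'a \<times> nat. real (fst z) powr gam)"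

definition Zl :: "nat \<Rightarrow> nat \<times> 'a \<times> nat \<Rightarrow> real" where "Zl m z = lam (fst z) m / Del (fst z)"
definition ZL :: "nat \<Rightarrow> nat \<times> 'a \<times> nat \<Rightarrow> real" where "ZL m z = lh (fst z) (fst (snd z)) m / Del (fst z)"
definition Zal :: "nat \<Rightarrow> nat \<Rightarrow> nat \<times> 'a \<times> nat \<Rightarrow> real" where "Zal k m z = alp (fst z) (fst (snd z)) k m"
definition Zups :: "nat \<Rightarrow> nat \<times> 'a \<times> nat \<Rightarrow> real" where "Zups m z = sqrt (real (fst z)) * u (fst z) m (snd (snd z))"
definition Zy :: "nat \<Rightarrow> nat \<Rightarrow> nat \<times> 'a \<times> nat \<Rightarrow> real" where
  "Zy q m z = sqrt (real (fst z)) * Epow (fst z) (fst (snd z)) q (u (fst z) m) (snd (snd z)) / Del (fst z) ^ q"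
definition Zx :: "nat \<Rightarrow> nat \<Rightarrow> nat \<Rightarrow> nat \<times> 'a \<times> nat \<Rightarrow> real" where
  "Zx q m m' z = inner_n (fst z) (u (fst z) m) (Epow (fst z) (fst (snd z)) q (u (fst z) m')) / Del (fst z) ^ q"
definition Znu :: "nat \<Rightarrow> nat \<Rightarrow> nat \<times> 'a \<times> nat \<Rightarrow> real" where
  "Znu q m z = sqrt (real (fst z)) * Epow (fst z) (fst (snd z)) q (vh (fst z) (fst (snd z)) m) (snd (snd z)) / Del (fst z) ^ q"
definition Zw :: "nat \<Rightarrow> nat \<Rightarrow> nat \<times> 'a \<times> nat \<Rightarrow> real" where
  "Zw k m z = inner_n (fst z) (u (fst z) m) (Epow (fst z) (fst (snd z)) 3 (vh (fst z) (fst (snd z)) k)) / Del (fst z) ^ 3"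
definition Zww :: "nat \<Rightarrow> nat \<times> 'a \<times> nat \<Rightarrow> real" where
  "Zww k z = inner_n (fst z) (vh (fst z) (fst (snd z)) k) (Epow (fst z) (fst (snd z)) 3 (vh (fst z) (fst (snd z)) k)) / Del (fst z) ^ 3"

lemmas Z_defs = Zl_def ZL_def Zal_def Zups_def Zy_def Zx_def Znu_def Zw_def Zww_def

lemma sqrt_n_bound:
  assumes n: "n \<ge> NL" and a: "\<bar>a\<bar> \<le> B * (snr n ^ q * (real n powr gam / sqrt (real n)))"
  shows "\<bar>sqrt (real n) * a / Del n ^ q\<bar> \<le> B * (real n powr gam * tau n ^ q)"
proof -
  note L = NL[OF n]
  have "\<bar>sqrt (real n) * a / Del n ^ q\<bar> = sqrt (real n) * \<bar>a\<bar> / Del n ^ q" using L by (simp add: abs_mult)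
  also have "\<dots> \<le> sqrt (real n) * (B * (snr n ^ q * (real n powr gam / sqrt (real n)))) / Del n ^ q"
    using a L by (intro divide_right_mono mult_left_mono) auto
  also have "\<dots> = B * (real n powr gam * tau n ^ q)" using L by (simp add: tau_def power_divide)
  finally show ?thesis .
qed

lemma inner_bound:
  assumes n: "n \<ge> NL" and x: "\<And>i. i < n \<Longrightarrow> \<bar>x i\<bar> \<le> A / sqrt (real n)"
    and y: "\<And>i. i < n \<Longrightarrow> \<bar>y i\<bar> \<le> B * (snr n ^ q * (real n powr gam / sqrt (real n)))" and pos: "0 \<le> A" "0 \<le> B"
  shows "\<bar>inner_n n x y / Del n ^ q\<bar> \<le> A * B * (real n powr gam * tau n ^ q)"
proof -
  note L = NL[OF n]
  have "\<bar>inner_n n x y\<bar> \<le> real n * ((A / sqrt (real n)) * (B * (snr n ^ q * (real n powr gam / sqrt (real n)))))"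
    by (rule abs_inner_n_le[OF x y]) (use L pos in auto)
  also have "\<dots> = A * B * (real n powr gam * snr n ^ q)" using L by simp
  finally have "\<bar>inner_n n x y\<bar> / Del n ^ q \<le> A * B * (real n powr gam * snr n ^ q) / Del n ^ q"
    using L by (intro divide_right_mono) auto
  then show ?thesis using L by (simp add: tau_def power_divide)
qed

lemma tau_cube:
  assumes n: "n \<ge> NL"
  shows "real n powr gam * tau n ^ 3 \<le> cD * ((tau n)\<^sup>2 * real n powr (- gam))"
    and "(real n powr gam)\<^sup>2 * tau n ^ 3 \<le> cD * ((tau n)\<^sup>2 * real n powr (- gam))"
    and "real n powr gam * (tau n)\<^sup>2 \<le> cD * (tau n * (real n powr (- gam))\<^sup>2)"
proof -
  note L = NL[OF n]
  have 2: "(real n powr gam)\<^sup>2 * tau n * (tau n)\<^sup>2 \<le> cD * real n powr (- gam) * (tau n)\<^sup>2"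
    by (intro mult_right_mono eta_tau L) simp
  then show 3: "(real n powr gam)\<^sup>2 * tau n ^ 3 \<le> cD * ((tau n)\<^sup>2 * real n powr (- gam))"
    by (simp add: power2_eq_square power3_eq_cube mult_ac)
  have "1 \<le> real n powr gam" using L gam by (intro ge_one_powr_ge_zero) auto
  then have "real n powr gam \<le> (real n powr gam)\<^sup>2" using self_le_power[of "real n powr gam" 2] by simp
  then have "real n powr gam * tau n ^ 3 \<le> (real n powr gam)\<^sup>2 * tau n ^ 3"
    using L by (intro mult_right_mono) auto
  with 3 show "real n powr gam * tau n ^ 3 \<le> cD * ((tau n)\<^sup>2 * real n powr (- gam))" by linarith
  have "real n powr gam * tau n * tau n \<le> cD * (real n powr (- gam))\<^sup>2 * tau n"
    using L by (intro mult_right_mono eta_tau) auto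
  then show "real n powr gam * (tau n)\<^sup>2 \<le> cD * (tau n * (real n powr (- gam))\<^sup>2)"
    by (simp add: power2_eq_square mult_ac)
qed

lemma u_bound': "n \<ge> NL \<Longrightarrow> i < n \<Longrightarrow> m < d \<Longrightarrow> \<bar>u n m i\<bar> \<le> Ku / sqrt (real n)"
  using u_bound NL by blast

lemma vh_bound: "n \<ge> NL \<Longrightarrow> \<omega> \<in> S n \<Longrightarrow> m < d \<Longrightarrow> i < n \<Longrightarrow> \<bar>vh n \<omega> m i\<bar> \<le> (Kv * real n powr gam) / sqrt (real n)"
  using Epow_vh[of n \<omega> m i 0] by (simp add: Epow_0)

text \<open>Logarithmic bounds feed \<open>x1\<close> and \<open>y1\<close>, delocalised iterates
  feed \<open>x2\<close> and \<open>y2\<close>, and the iterates of the estimated eigenvector feed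
  the remainders. The algebraic identities are \<open>eq_A\<close> to \<open>eq_D\<close> divided by
  the appropriate powers of the gap.\<close>

lemma sop:
  assumes k: "k < d"
  shows "second_order_perturbation EF zt zz zl ze d k Zl (Zal k) (Zw k) Zups (Zy 1) (Zy 2) (Zx 1) (Zx 2)
     (ZL k) (Znu 0 k) (Znu 1 k) (Znu 3 k) (Zww k)"
proof
  show "k < d" by fact
  have "(\<lambda>n. real n powr (- gam)) \<in> o[sequentially](\<lambda>_. 1)" using gam(1) by real_asymp
  from smallo_seq_EF[OF this] show "zz \<in> o[EF](\<lambda>_. 1)" .
  show "zt \<in> O[EF](zz)"
  proof (rule bigo_EF_I[where N = NL and c = cD])
    fix n \<omega> i assume n: "NL \<le> n"
    note L = NL[OF n]
    have "tau n \<le> cD * real n powr (- betaD)" using tau_upper[OF L(1,5)] by (simp add: cD_def)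
    also have "\<dots> \<le> cD * real n powr (- gam)" using L gam cD_pos by (intro mult_left_mono powr_mono) auto
    finally show "\<bar>zt (n, \<omega>, i)\<bar> \<le> cD * \<bar>zz (n, \<omega>, i)\<bar>" using L by simp
  qed
  have "(\<lambda>_. 1) \<in> O[sequentially](\<lambda>n. ln (real n))" by real_asymp
  from bigo_seq_EF[OF this] show "(\<lambda>_. 1) \<in> O[EF](zl)" .
  have "(\<lambda>n. ln (real n) * real n powr (- gam)) \<in> O[sequentially](\<lambda>_. 1)" using gam(1) by real_asymp
  from bigo_seq_EF[OF this] show "(\<lambda>z. zl z * zz z) \<in> O[EF](\<lambda>_. 1)" .
  have "(\<lambda>_. 1) \<in> O[sequentially](\<lambda>n. real n powr gam)" using gam(1) by real_asymp
  from bigo_seq_EF[OF this] show "(\<lambda>_. 1) \<in> O[EF](ze)" .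
  show "Zl m \<in> O[EF](\<lambda>_. 1)" if "m < d" for m
  proof (rule bigo_EF_I[where N = NL and c = kap])
    fix n \<omega> i assume n: "NL \<le> n"
    show "\<bar>Zl m (n, \<omega>, i)\<bar> \<le> kap * \<bar>1\<bar>" using lam_le[OF NL(1)[OF n] that] NL(12)[OF n] by (simp add: Zl_def divide_le_eq)
  qed
  show "(\<lambda>z. 1 / Zl k z) \<in> O[EF](\<lambda>_. 1)"
  proof (rule bigo_EF_I[where N = NL and c = 1])
    fix n \<omega> i assume n: "NL \<le> n"
    show "\<bar>1 / Zl k (n, \<omega>, i)\<bar> \<le> 1 * \<bar>1\<bar>" using lam_ge[OF k, of n] NL(12)[OF n] by (simp add: Zl_def divide_le_eq)
  qed
  show "ZL k \<in> O[EF](\<lambda>_. 1)"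
  proof (rule bigo_EF_I[where N = NL and c = "kap + 1"])
    fix n \<omega> i assume n: "NL \<le> n" "\<omega> \<in> S n"
    show "\<bar>ZL k (n, \<omega>, i)\<bar> \<le> (kap + 1) * \<bar>1\<bar>" using lh_upper[OF n k] NL(12)[OF n(1)] by (simp add: ZL_def divide_le_eq)
  qed
  show "(\<lambda>z. 1 / ZL k z) \<in> O[EF](\<lambda>_. 1)"
  proof (rule bigo_EF_I[where N = NL and c = 2])
    fix n \<omega> i assume n: "NL \<le> n" "\<omega> \<in> S n"
    show "\<bar>1 / ZL k (n, \<omega>, i)\<bar> \<le> 2 * \<bar>1\<bar>" using lh_lower[OF n k] NL(12)[OF n(1)] by (simp add: ZL_def divide_le_eq)
  qed
  show "Zal k m \<in> O[EF](\<lambda>_. 1)" if "m < d" for m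
  proof (rule bigo_EF_I[where N = NL and c = 1])
    fix n \<omega> i assume n: "NL \<le> n" "\<omega> \<in> S n"
    show "\<bar>Zal k m (n, \<omega>, i)\<bar> \<le> 1 * \<bar>1\<bar>"
      using alp_le_1[OF NL(1)[OF n(1)] in_space[OF n(2)] NL(3)[OF n(1)] k that] by (simp add: Zal_def)
  qed
  show "(\<lambda>z. 1 / (Zl k z - Zl m z)) \<in> O[EF](\<lambda>_. 1)" if "m < d" "m \<noteq> k" for m
  proof (rule bigo_EF_I[where N = NL and c = 1])
    fix n \<omega> i assume n: "NL \<le> n" "\<omega> \<in> S n"
    show "\<bar>1 / (Zl k (n, \<omega>, i) - Zl m (n, \<omega>, i))\<bar> \<le> 1 * \<bar>1\<bar>"
      using lam_gap[OF NL(1)[OF n(1)] k that(1)] that NL(12)[OF n(1)]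
      by (simp add: Zl_def divide_le_eq flip: diff_divide_distrib)
  qed
  show "(\<lambda>z. 1 / (ZL k z - Zl m z)) \<in> O[EF](\<lambda>_. 1)" if "m < d" "m \<noteq> k" for m
  proof (rule bigo_EF_I[where N = NL and c = 2])
    fix n \<omega> i assume n: "NL \<le> n" "\<omega> \<in> S n"
    show "\<bar>1 / (ZL k (n, \<omega>, i) - Zl m (n, \<omega>, i))\<bar> \<le> 2 * \<bar>1\<bar>"
      using lh_gap[OF n k that(1)] that NL(12)[OF n(1)]
      by (simp add: Zl_def ZL_def divide_le_eq flip: diff_divide_distrib)
  qed
  show "Zups m \<in> O[EF](\<lambda>_. 1)" if "m < d" for m
  proof (rule bigo_EF_I[where N = NL and c = Ku])
    fix n \<omega> i assume n: "NL \<le> n" "\<omega> \<in> S n" "i < n"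
    show "\<bar>Zups m (n, \<omega>, i)\<bar> \<le> Ku * \<bar>1\<bar>"
      using u_bound'[OF n(1,3) that] NL(5)[OF n(1)] by (simp add: Zups_def abs_mult field_simps)
  qed
  show "Zx 1 m m' \<in> O[EF](\<lambda>z. zt z * (zz z)\<^sup>2)" if "m < d" "m' < d" for m m'
  proof (rule bigo_EF_I[where N = NL and c = K])
    fix n \<omega> i assume n: "NL \<le> n" "\<omega> \<in> S n"
    note L = NL[OF n(1)]
    have "\<bar>inner_n n (u n m) (Epow n \<omega> 1 (u n m'))\<bar> / Del n \<le> K * (sqrt (rho n) * ln (real n)) / Del n"
      using S_good[OF L(2) n(2)] that L by (intro divide_right_mono) (auto simp: good_def Epow_Suc_0)
    \<comment> \<open>Here \<open>sqrt (rho n)\<close> is \<open>snr n / sqrt n\<close>: the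
      quadratic form is smaller than a scaled coordinate by \<open>sqrt n\<close>, which turns the
      logarithm into a negative power of \<open>n\<close>.\<close>
    also have "\<dots> = K * (tau n * (ln (real n) / sqrt (real n)))"
      by (simp add: tau_def snr_div_sqrt[OF L(1,5), symmetric])
    also have "\<dots> \<le> K * (tau n * (real n powr (- gam))\<^sup>2)"
      using L K_nonneg by (intro mult_left_mono) auto
    finally show "\<bar>Zx 1 m m' (n, \<omega>, i)\<bar> \<le> K * \<bar>zt (n, \<omega>, i) * (zz (n, \<omega>, i))\<^sup>2\<bar>"
      using L by (simp add: Zx_def abs_mult)
  qed
  show "Zx 2 m m' \<in> O[EF](\<lambda>z. zt z * (zz z)\<^sup>2)" if "m < d" "m' < d" for m m'
  proof (rule bigo_EF_I[where N = NL and c = "Ku * 1 * cD"])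
    fix n \<omega> i assume n: "NL \<le> n" "\<omega> \<in> S n"
    note L = NL[OF n(1)]
    have "\<bar>Zx 2 m m' (n, \<omega>, i)\<bar> \<le> Ku * 1 * (real n powr gam * tau n ^ 2)"
      unfolding Zx_def fst_conv snd_conv
      by (rule inner_bound[OF n(1) u_bound'[OF n(1) _ that(1)]]) (use Epow_u[OF n that(2), of _ 2] Ku_pos in \<open>auto simp: Q0_def\<close>)
    also have "\<dots> \<le> Ku * 1 * (cD * (tau n * (real n powr (- gam))\<^sup>2))"
      using Ku_pos by (intro mult_left_mono tau_cube(3)[OF n(1)]) auto
    finally show "\<bar>Zx 2 m m' (n, \<omega>, i)\<bar> \<le> Ku * 1 * cD * \<bar>zt (n, \<omega>, i) * (zz (n, \<omega>, i))\<^sup>2\<bar>"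
      using L by (simp add: abs_mult mult.assoc)
  qed
  have y2: "\<bar>Zy 2 m (n, \<omega>, i)\<bar> \<le> 1 * (real n powr gam * tau n ^ 2)" if "m < d" "NL \<le> n" "\<omega> \<in> S n" "i < n" for m n \<omega> i
    unfolding Zy_def fst_conv snd_conv
    by (rule sqrt_n_bound[OF that(2)]) (use Epow_u[OF that(2,3,1,4), of 2] in \<open>auto simp: Q0_def\<close>)
  show "Zy 2 m \<in> O[EF](\<lambda>z. zt z * (zz z)\<^sup>2)" if m: "m < d" for m
  proof (rule bigo_EF_I[where N = NL and c = cD])
    fix n \<omega> i assume n: "NL \<le> n" "\<omega> \<in> S n" "i < n"
    show "\<bar>Zy 2 m (n, \<omega>, i)\<bar> \<le> cD * \<bar>zt (n, \<omega>, i) * (zz (n, \<omega>, i))\<^sup>2\<bar>"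
      using y2[OF m n] tau_cube(3)[OF n(1)] NL(13)[OF n(1)] by (simp add: abs_mult)
  qed
  show "Zy 2 m \<in> O[EF](\<lambda>z. (zt z)\<^sup>2 * ze z)" if m: "m < d" for m
  proof (rule bigo_EF_I[where N = NL and c = 1])
    fix n \<omega> i assume n: "NL \<le> n" "\<omega> \<in> S n" "i < n"
    show "\<bar>Zy 2 m (n, \<omega>, i)\<bar> \<le> 1 * \<bar>(zt (n, \<omega>, i))\<^sup>2 * ze (n, \<omega>, i)\<bar>"
      using y2[OF m n] by (simp add: abs_mult mult.commute)
  qed
  show "Zy 1 m \<in> O[EF](\<lambda>z. zt z * zl z)" if m: "m < d" for m
  proof (rule bigo_EF_I[where N = NL and c = K])
    fix n \<omega> i assume n: "NL \<le> n" "\<omega> \<in> S n" "i < n"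
    note L = NL[OF n(1)]
    have "\<bar>Zy 1 m (n, \<omega>, i)\<bar> = sqrt (real n) * \<bar>Epow n \<omega> 1 (u n m) i\<bar> / Del n"
      using L by (simp add: Zy_def abs_mult)
    also have "\<dots> \<le> sqrt (real n) * (K * (sqrt (rho n) * ln (real n))) / Del n"
      using S_good[OF L(2) n(2)] m n L by (intro divide_right_mono mult_left_mono) (auto simp: good_def Epow_Suc_0)
    also have "\<dots> = K * (tau n * ln (real n))" by (simp add: tau_def snr_def real_sqrt_mult)
    finally show "\<bar>Zy 1 m (n, \<omega>, i)\<bar> \<le> K * \<bar>zt (n, \<omega>, i) * zl (n, \<omega>, i)\<bar>"
      using L by (simp add: abs_mult)
  qed
  show "Zw k m \<in> O[EF](\<lambda>z. (zt z)\<^sup>2 * zz z)" if m: "m < d" for m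
  proof (rule bigo_EF_I[where N = NL and c = "Ku * Kv * cD"])
    fix n \<omega> i assume n: "NL \<le> n" "\<omega> \<in> S n"
    have "\<bar>Zw k m (n, \<omega>, i)\<bar> \<le> Ku * Kv * (real n powr gam * tau n ^ 3)"
      unfolding Zw_def fst_conv snd_conv
      by (rule inner_bound[OF n(1) u_bound'[OF n(1) _ m] Epow_vh[OF n k]]) (use Ku_pos Kv_pos in auto)
    also have "\<dots> \<le> Ku * Kv * (cD * ((tau n)\<^sup>2 * real n powr (- gam)))"
      using Ku_pos Kv_pos by (intro mult_left_mono tau_cube(1)[OF n(1)]) auto
    finally show "\<bar>Zw k m (n, \<omega>, i)\<bar> \<le> Ku * Kv * cD * \<bar>(zt (n, \<omega>, i))\<^sup>2 * zz (n, \<omega>, i)\<bar>"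
      by (simp add: abs_mult mult.assoc)
  qed
  show "Znu 3 k \<in> O[EF](\<lambda>z. (zt z)\<^sup>2 * zz z)"
  proof (rule bigo_EF_I[where N = NL and c = "Kv * cD"])
    fix n \<omega> i assume n: "NL \<le> n" "\<omega> \<in> S n" "i < n"
    have "\<bar>Znu 3 k (n, \<omega>, i)\<bar> \<le> Kv * (real n powr gam * tau n ^ 3)"
      unfolding Znu_def fst_conv snd_conv
      by (rule sqrt_n_bound[OF n(1) Epow_vh[OF n(1,2) k n(3)]]) simp
    also have "\<dots> \<le> Kv * (cD * ((tau n)\<^sup>2 * real n powr (- gam)))"
      using Kv_pos by (intro mult_left_mono tau_cube(1)[OF n(1)]) auto
    finally show "\<bar>Znu 3 k (n, \<omega>, i)\<bar> \<le> Kv * cD * \<bar>(zt (n, \<omega>, i))\<^sup>2 * zz (n, \<omega>, i)\<bar>"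
      by (simp add: abs_mult mult.assoc)
  qed
  show "Zww k \<in> O[EF](\<lambda>z. (zt z)\<^sup>2 * zz z)"
  proof (rule bigo_EF_I[where N = NL and c = "Kv * Kv * cD"])
    fix n \<omega> i assume n: "NL \<le> n" "\<omega> \<in> S n"
    have "\<bar>Zww k (n, \<omega>, i)\<bar> \<le> (Kv * real n powr gam) * Kv * (real n powr gam * tau n ^ 3)"
      unfolding Zww_def fst_conv snd_conv
      by (rule inner_bound[OF n(1) vh_bound[OF n k] Epow_vh[OF n k]]) (use Kv_pos in auto)
    also have "\<dots> = Kv * Kv * ((real n powr gam)\<^sup>2 * tau n ^ 3)" by (simp add: power2_eq_square mult_ac)
    also have "\<dots> \<le> Kv * Kv * (cD * ((tau n)\<^sup>2 * real n powr (- gam)))"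
      using Kv_pos by (intro mult_left_mono tau_cube(2)[OF n(1)]) auto
    finally show "\<bar>Zww k (n, \<omega>, i)\<bar> \<le> Kv * Kv * cD * \<bar>(zt (n, \<omega>, i))\<^sup>2 * zz (n, \<omega>, i)\<bar>"
      by (simp add: abs_mult mult.assoc)
  qed
  show "\<forall>\<^sub>F z in EF. ZL k z \<noteq> 0 \<and> Zl k z \<noteq> 0 \<and> (\<forall>m<d. m \<noteq> k \<longrightarrow> ZL k z \<noteq> Zl m z \<and> Zl k z \<noteq> Zl m z)"
    unfolding eventually_EF
  proof (intro exI[of _ NL] allI impI ballI)
    fix n \<omega> i assume n: "NL \<le> n" "\<omega> \<in> S n"
    note L = NL[OF n(1)]
    have 1: "lam n k \<noteq> 0" using lam_ge[OF k, of n] L by auto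
    have 2: "lh n \<omega> k \<noteq> lam n m" "lam n k \<noteq> lam n m" if "m < d" "m \<noteq> k" for m
      using lh_gap[OF n k that(1)] lam_gap[OF L(1) k that(1)] that L by auto
    show "ZL k (n, \<omega>, i) \<noteq> 0 \<and> Zl k (n, \<omega>, i) \<noteq> 0 \<and> (\<forall>m<d. m \<noteq> k \<longrightarrow> ZL k (n, \<omega>, i) \<noteq> Zl m (n, \<omega>, i) \<and> Zl k (n, \<omega>, i) \<noteq> Zl m (n, \<omega>, i))"
      using L 1 2 lh_nz[OF n k] by (simp add: Zl_def ZL_def)
  qed
  have ratio: "Zl m (n, \<omega>, i) * Zal k m (n, \<omega>, i) / ZL k (n, \<omega>, i) = lam n m * alp n \<omega> k m / lh n \<omega> k" if "NL \<le> n" for m n \<omega> i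
    using NL(12)[OF that] by (simp add: Zl_def Zal_def ZL_def)
  show "\<forall>\<^sub>F z in EF. Znu 0 k z = (\<Sum>m<d. Zl m z * Zal k m z / ZL k z * (Zups m z + Zy 1 m z / ZL k z + Zy 2 m z / (ZL k z)\<^sup>2)) + Znu 3 k z / ZL k z ^ 3"
    unfolding eventually_EF
  proof (intro exI[of _ NL] allI impI ballI)
    fix n \<omega> i assume n: "NL \<le> n" "\<omega> \<in> S n" "i < n"
    note L = NL[OF n(1)] and nz = lh_nz[OF n(1,2) k]
    have 1: "Zups m (n, \<omega>, i) + Zy 1 m (n, \<omega>, i) / ZL k (n, \<omega>, i) + Zy 2 m (n, \<omega>, i) / (ZL k (n, \<omega>, i))\<^sup>2
      = sqrt (real n) * (u n m i + Epow n \<omega> 1 (u n m) i / lh n \<omega> k + Epow n \<omega> 2 (u n m) i / (lh n \<omega> k)\<^sup>2)" for m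
      using L nz by (simp add: Z_defs distrib_left power_divide)
    have 3: "Znu 3 k (n, \<omega>, i) / ZL k (n, \<omega>, i) ^ 3 = sqrt (real n) * (Epow n \<omega> 3 (vh n \<omega> k) i / lh n \<omega> k ^ 3)"
      using L nz by (simp add: Z_defs power_divide)
    have "Znu 0 k (n, \<omega>, i) = sqrt (real n) * vh n \<omega> k i" by (simp add: Znu_def Epow_0)
    then show "Znu 0 k (n, \<omega>, i) = (\<Sum>m<d. Zl m (n, \<omega>, i) * Zal k m (n, \<omega>, i) / ZL k (n, \<omega>, i) * (Zups m (n, \<omega>, i) + Zy 1 m (n, \<omega>, i) / ZL k (n, \<omega>, i) + Zy 2 m (n, \<omega>, i) / (ZL k (n, \<omega>, i))\<^sup>2)) + Znu 3 k (n, \<omega>, i) / ZL k (n, \<omega>, i) ^ 3"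
      unfolding 1 3 ratio[OF n(1)] eq_A[OF in_space[OF n(2)] L(3) k n(3) nz] by (simp add: distrib_left sum_distrib_left mult_ac)
  qed
  show "\<forall>\<^sub>F z in EF. Znu 1 k z = (\<Sum>m<d. Zl m z * Zal k m z / ZL k z * (Zy 1 m z + Zy 2 m z / ZL k z)) + Znu 3 k z / (ZL k z)\<^sup>2"
    unfolding eventually_EF
  proof (intro exI[of _ NL] allI impI ballI)
    fix n \<omega> i assume n: "NL \<le> n" "\<omega> \<in> S n" "i < n"
    note L = NL[OF n(1)] and nz = lh_nz[OF n(1,2) k]
    have 1: "Zy 1 m (n, \<omega>, i) + Zy 2 m (n, \<omega>, i) / ZL k (n, \<omega>, i)
      = sqrt (real n) / Del n * (Epow n \<omega> 1 (u n m) i + Epow n \<omega> 2 (u n m) i / lh n \<omega> k)" for m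
      using L nz by (simp add: Z_defs distrib_left power2_eq_square)
    have 3: "Znu 3 k (n, \<omega>, i) / (ZL k (n, \<omega>, i))\<^sup>2 = sqrt (real n) / Del n * (Epow n \<omega> 3 (vh n \<omega> k) i / (lh n \<omega> k)\<^sup>2)"
      using L nz by (simp add: Z_defs power_divide power2_eq_square power3_eq_cube)
    have 4: "Znu 1 k (n, \<omega>, i) = sqrt (real n) / Del n * Epow n \<omega> 1 (vh n \<omega> k) i" by (simp add: Znu_def)
    show "Znu 1 k (n, \<omega>, i) = (\<Sum>m<d. Zl m (n, \<omega>, i) * Zal k m (n, \<omega>, i) / ZL k (n, \<omega>, i) * (Zy 1 m (n, \<omega>, i) + Zy 2 m (n, \<omega>, i) / ZL k (n, \<omega>, i))) + Znu 3 k (n, \<omega>, i) / (ZL k (n, \<omega>, i))\<^sup>2"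
      unfolding 1 3 4 ratio[OF n(1)] eq_D[OF in_space[OF n(2)] L(3) k n(3) nz] by (simp add: distrib_left sum_distrib_left mult_ac)
  qed
  show "\<forall>\<^sub>F z in EF. \<forall>m<d. (ZL k z - Zl m z) * Zal k m z = (\<Sum>m'<d. Zl m' z * Zal k m' z / ZL k z * (Zx 1 m m' z + Zx 2 m m' z / ZL k z)) + Zw k m z / (ZL k z)\<^sup>2"
    unfolding eventually_EF
  proof (intro exI[of _ NL] allI impI ballI)
    fix n \<omega> i m assume n: "NL \<le> n" "\<omega> \<in> S n" and m: "m < d"
    note L = NL[OF n(1)] and nz = lh_nz[OF n(1,2) k]
    have 1: "Zx 1 m m' (n, \<omega>, i) + Zx 2 m m' (n, \<omega>, i) / ZL k (n, \<omega>, i)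
      = 1 / Del n * (inner_n n (u n m) (Epow n \<omega> 1 (u n m')) + inner_n n (u n m) (Epow n \<omega> 2 (u n m')) / lh n \<omega> k)" for m'
      using L nz by (simp add: Z_defs distrib_left power2_eq_square add_divide_distrib)
    have 3: "Zw k m (n, \<omega>, i) / (ZL k (n, \<omega>, i))\<^sup>2 = 1 / Del n * (inner_n n (u n m) (Epow n \<omega> 3 (vh n \<omega> k)) / (lh n \<omega> k)\<^sup>2)"
      using L nz by (simp add: Z_defs power_divide power2_eq_square power3_eq_cube)
    have 4: "(ZL k (n, \<omega>, i) - Zl m (n, \<omega>, i)) * Zal k m (n, \<omega>, i) = 1 / Del n * ((lh n \<omega> k - lam n m) * alp n \<omega> k m)"
      by (simp add: Z_defs left_diff_distrib diff_divide_distrib)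
    show "(ZL k (n, \<omega>, i) - Zl m (n, \<omega>, i)) * Zal k m (n, \<omega>, i) = (\<Sum>m'<d. Zl m' (n, \<omega>, i) * Zal k m' (n, \<omega>, i) / ZL k (n, \<omega>, i) * (Zx 1 m m' (n, \<omega>, i) + Zx 2 m m' (n, \<omega>, i) / ZL k (n, \<omega>, i))) + Zw k m (n, \<omega>, i) / (ZL k (n, \<omega>, i))\<^sup>2"
      unfolding 1 3 4 ratio[OF n(1)] eq_B[OF L(1) in_space[OF n(2)] L(3) k m nz] by (simp only: distrib_left sum_distrib_left mult_ac)
  qed
  show "\<forall>\<^sub>F z in EF. 1 = (\<Sum>m<d. Zl m z * Zal k m z / ZL k z * (Zal k m z + 2 * ((ZL k z - Zl m z) * Zal k m z) / ZL k z - (\<Sum>m'<d. Zal k m' z * Zl m' z * Zx 1 m m' z) / (ZL k z)\<^sup>2)) + Zww k z / ZL k z ^ 3"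
    unfolding eventually_EF
  proof (intro exI[of _ NL] allI impI ballI)
    fix n \<omega> i assume n: "NL \<le> n" "\<omega> \<in> S n"
    note L = NL[OF n(1)] and nz = lh_nz[OF n(1,2) k]
    have 2: "2 * ((ZL k (n, \<omega>, i) - Zl m (n, \<omega>, i)) * Zal k m (n, \<omega>, i)) / ZL k (n, \<omega>, i) = 2 * ((lh n \<omega> k - lam n m) * alp n \<omega> k m) / lh n \<omega> k" for m
      using L nz by (simp add: Z_defs flip: diff_divide_distrib)
    have 5: "(\<Sum>m'<d. Zal k m' (n, \<omega>, i) * Zl m' (n, \<omega>, i) * Zx 1 m m' (n, \<omega>, i)) / (ZL k (n, \<omega>, i))\<^sup>2
       = (\<Sum>m'<d. alp n \<omega> k m' * lam n m' * inner_n n (u n m) (Epow n \<omega> 1 (u n m'))) / (lh n \<omega> k)\<^sup>2" for m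
      unfolding sum_divide_distrib using L nz by (intro sum.cong refl) (simp add: Z_defs power_divide power2_eq_square)
    have 3: "Zww k (n, \<omega>, i) / ZL k (n, \<omega>, i) ^ 3 = inner_n n (vh n \<omega> k) (Epow n \<omega> 3 (vh n \<omega> k)) / lh n \<omega> k ^ 3"
      using L nz by (simp add: Z_defs power_divide)
    have 6: "Zal k m (n, \<omega>, i) = alp n \<omega> k m" for m by (simp add: Zal_def)
    show "1 = (\<Sum>m<d. Zl m (n, \<omega>, i) * Zal k m (n, \<omega>, i) / ZL k (n, \<omega>, i) * (Zal k m (n, \<omega>, i) + 2 * ((ZL k (n, \<omega>, i) - Zl m (n, \<omega>, i)) * Zal k m (n, \<omega>, i)) / ZL k (n, \<omega>, i) - (\<Sum>m'<d. Zal k m' (n, \<omega>, i) * Zl m' (n, \<omega>, i) * Zx 1 m m' (n, \<omega>, i)) / (ZL k (n, \<omega>, i))\<^sup>2)) + Zww k (n, \<omega>, i) / ZL k (n, \<omega>, i) ^ 3"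
      unfolding 2 3 5 ratio[OF n(1)] unfolding 6 by (rule eq_C[OF L(1) in_space[OF n(2)] L(3) k nz])
  qed
qed

end

section \<open>The plug-in bias\<close>

context spiked_event
begin

abbreviation "bdE \<equiv> O[EF](\<lambda>_. 1 :: real)"

text \<open>The relative precision of the plug-in bias, with a single logarithm.\<close>

definition th :: "nat \<Rightarrow> real" where "th n = max (1 / qn n) (tau n) * ln (real n)"

lemma eigenvalue_diff_E: "m < d \<Longrightarrow> (\<lambda>z. ZL m z - Zl m z) \<in> O[EF](\<lambda>z. zt z * (zz z)\<^sup>2)"
  by (rule second_order_perturbation.eigenvalue_diff[OF sop])

lemma eigenvector_diff_E: "m < d \<Longrightarrow> (\<lambda>z. sgn (Zal m m z) * Znu 0 m z - Zups m z) \<in> O[EF](\<lambda>z. zt z * zl z)"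
  using second_order_perturbation.eigenvector_diff[OF sop, of m]
  by (simp add: second_order_perturbation.s_def[OF sop])

lemma noise_diff_E: "m < d \<Longrightarrow> (\<lambda>z. sgn (Zal m m z) * Znu 1 m z - Zy 1 m z) \<in> O[EF](\<lambda>z. (zt z)\<^sup>2 * ze z)"
  using second_order_perturbation.noise_eigenvector_diff[OF sop, of m]
  by (simp add: second_order_perturbation.s_def[OF sop])

lemma overlap_lower_E: "m < d \<Longrightarrow> eventually (\<lambda>z. 1/2 \<le> \<bar>Zal m m z\<bar>) EF"
  by (rule second_order_perturbation.abs_al_lower[OF sop])

lemma sgn_sq_E: "m < d \<Longrightarrow> eventually (\<lambda>z. sgn (Zal m m z) * sgn (Zal m m z) = 1) EF"
proof -
  assume "m < d"
  from overlap_lower_E[OF this] show ?thesis by eventually_elim (auto simp: sgn_if)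
qed

lemma Zups_bdd: "m < d \<Longrightarrow> Zups m \<in> bdE"
  using second_order_perturbation.bd(8)[OF sop, of m m] by simp
lemma Zl_bdd: "m < d \<Longrightarrow> Zl m \<in> bdE"
  using second_order_perturbation.bd(1)[OF sop, of m m] by simp
lemma ZL_bdd: "m < d \<Longrightarrow> ZL m \<in> bdE"
  using second_order_perturbation.bd(3)[OF sop, of m] by simp

lemma O_mult_bdd: "f \<in> bdE \<Longrightarrow> g \<in> O[EF](h) \<Longrightarrow> (\<lambda>z. f z * g z) \<in> O[EF](h)"
  using landau_o.big.mult[of f EF "\<lambda>_. 1" g h] by simp

lemma EF_mono:
  fixes g h :: "nat \<Rightarrow> real"
  assumes "f \<in> O[EF](\<lambda>z. g (fst z))" "\<And>n. n \<ge> NL \<Longrightarrow> \<bar>g n\<bar> \<le> c * \<bar>h n\<bar>"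
  shows "f \<in> O[EF](\<lambda>z. h (fst z))"
  by (rule landau_o.big_trans[OF assms(1)], rule bigo_EF_I[where N = NL and c = c]) (use assms(2) in auto)

lemma tau_le_th: "n \<ge> NL \<Longrightarrow> \<bar>tau n * ln (real n)\<bar> \<le> 1 * \<bar>th n\<bar>"
proof -
  assume n: "n \<ge> NL"
  note L = NL[OF n]
  have "tau n * ln (real n) \<le> th n" unfolding th_def using L by (intro mult_right_mono) auto
  moreover have "0 \<le> tau n * ln (real n)" using L by simp
  ultimately show ?thesis by simp
qed

lemma zeta_le_1: "n \<ge> NL \<Longrightarrow> real n powr (- gam) \<le> 1"
  using NL(4)[of n] gam powr_mono[of "- gam" 0 "real n"] by simp

lemma small_th: "f \<in> O[EF](\<lambda>z. zt z * (zz z)\<^sup>2) \<Longrightarrow> f \<in> O[EF](\<lambda>z. th (fst z))"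
proof (rule EF_mono[where g = "\<lambda>n. tau n * (real n powr (- gam))\<^sup>2" and h = th and c = 1])
  fix n assume n: "NL \<le> n"
  note L = NL[OF n]
  have "(real n powr (- gam))\<^sup>2 \<le> 1" using zeta_le_1[OF n] by (simp add: power_le_one)
  then have "tau n * (real n powr (- gam))\<^sup>2 \<le> tau n * ln (real n)"
    using L by (intro mult_left_mono) auto
  moreover have "0 \<le> tau n * (real n powr (- gam))\<^sup>2" using L by simp
  ultimately show "\<bar>tau n * (real n powr (- gam))\<^sup>2\<bar> \<le> 1 * \<bar>th n\<bar>" using tau_le_th[OF n] by linarith
qed simp

lemma med_th: "f \<in> O[EF](\<lambda>z. zt z * zl z) \<Longrightarrow> f \<in> O[EF](\<lambda>z. th (fst z))"
  by (rule EF_mono[where g = "\<lambda>n. tau n * ln (real n)" and c = 1]) (use tau_le_th in auto)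

lemma th_small: "th \<in> o[sequentially](\<lambda>_. 1)"
proof (rule landau_o.big_small_trans)
  have g: "(\<lambda>n. real n powr (- min eps gam) * ln (real n)) \<in> o[sequentially](\<lambda>_. 1)"
  proof -
    have "0 < min eps gam" using params gam by simp
    then show ?thesis by real_asymp
  qed
  then show "(\<lambda>n. real n powr (- min eps gam) * ln (real n)) \<in> o[sequentially](\<lambda>_. 1)" .
  show "th \<in> O[sequentially](\<lambda>n. real n powr (- min eps gam) * ln (real n))"
  proof (rule bigoI[of _ "1 + cD"], rule eventually_sequentiallyI[of NL])
    fix n assume n: "NL \<le> n"
    note L = NL[OF n]
    have "1 / qn n \<le> real n powr (- eps)"
      using qn[OF L(1)] L qn_ge_1[OF L(1,5)] by (simp add: powr_minus field_simps)
    also have "\<dots> \<le> real n powr (- min eps gam)" using L by (intro powr_mono) auto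
    finally have 1: "1 / qn n \<le> real n powr (- min eps gam)" .
    have "tau n \<le> cD * real n powr (- betaD)" using tau_upper[OF L(1,5)] by (simp add: cD_def)
    also have "\<dots> \<le> cD * real n powr (- min eps gam)" using L gam cD_pos by (intro mult_left_mono powr_mono) auto
    finally have 2: "tau n \<le> cD * real n powr (- min eps gam)" .
    have "max (1 / qn n) (tau n) \<le> (1 + cD) * real n powr (- min eps gam)"
      using 1 2 cD_pos by (auto simp: distrib_right intro: order_trans add_increasing add_increasing2)
    then have "th n \<le> (1 + cD) * real n powr (- min eps gam) * ln (real n)"
      unfolding th_def using L by (intro mult_right_mono) auto
    moreover have "0 \<le> th n" using L qn_ge_1[OF L(1,5)] by (auto simp: th_def le_max_iff_disj)
    ultimately show "norm (th n) \<le> (1 + cD) * norm (real n powr (- min eps gam) * ln (real n))"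
      using L by (simp add: abs_mult mult.assoc)
  qed
qed

lemma th_pos: "n \<ge> NL \<Longrightarrow> 0 < th n"
  using NL(6,13)[of n] by (simp add: th_def less_max_iff_disj)

lemma th_bdd: "f \<in> O[EF](\<lambda>z. th (fst z)) \<Longrightarrow> f \<in> bdE"
  by (rule landau_o.big_trans[OF _ landau_o.small_imp_big[OF smallo_seq_EF[OF th_small]]])

text \<open>Bounded quantities that agree up to relative precision \<open>th\<close>. The relation
  respects sums, products, averages and reciprocals away from zero, so the bias formula can be
  compared one operation at a time.\<close>

definition close :: "(nat \<times> 'a \<times> nat \<Rightarrow> real) \<Rightarrow> (nat \<times> 'a \<times> nat \<Rightarrow> real) \<Rightarrow> bool" where
  "close f g \<longleftrightarrow> f \<in> bdE \<and> g \<in> bdE \<and> (\<lambda>z. f z - g z) \<in> O[EF](\<lambda>z. th (fst z))"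

lemma closeI:
  assumes "g \<in> bdE" "(\<lambda>z. f z - g z) \<in> O[EF](\<lambda>z. th (fst z))"
  shows "close f g"
proof -
  have "(\<lambda>z. (f z - g z) + g z) \<in> bdE" by (rule sum_in_bigo(1)[OF th_bdd[OF assms(2)] assms(1)])
  then show ?thesis using assms by (simp add: close_def)
qed

lemma close_refl: "f \<in> bdE \<Longrightarrow> close f f" by (simp add: close_def)

lemma close_add: "close f g \<Longrightarrow> close f' g' \<Longrightarrow> close (\<lambda>z. f z + f' z) (\<lambda>z. g z + g' z)"
proof -
  assume a: "close f g" "close f' g'"
  then have d: "(\<lambda>z. f z - g z) \<in> O[EF](\<lambda>z. th (fst z))" "(\<lambda>z. f' z - g' z) \<in> O[EF](\<lambda>z. th (fst z))"
    by (auto simp: close_def)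
  have "(\<lambda>z. (f z - g z) + (f' z - g' z)) \<in> O[EF](\<lambda>z. th (fst z))"
    by (rule sum_in_bigo(1)[OF d])
  moreover have "(\<lambda>z. (f z - g z) + (f' z - g' z)) = (\<lambda>z. (f z + f' z) - (g z + g' z))" by auto
  ultimately show ?thesis using a by (auto simp: close_def intro: sum_in_bigo)
qed

lemma close_mult: "close f g \<Longrightarrow> close f' g' \<Longrightarrow> close (\<lambda>z. f z * f' z) (\<lambda>z. g z * g' z)"
proof -
  assume a: "close f g" "close f' g'"
  then have d: "(\<lambda>z. f z - g z) \<in> O[EF](\<lambda>z. th (fst z))" "(\<lambda>z. f' z - g' z) \<in> O[EF](\<lambda>z. th (fst z))"
    "f \<in> bdE" "g' \<in> bdE"
    by (auto simp: close_def)
  have "(\<lambda>z. f z * (f' z - g' z) + g' z * (f z - g z)) \<in> O[EF](\<lambda>z. th (fst z))"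
    by (rule sum_in_bigo(1)[OF O_mult_bdd[OF d(3,2)] O_mult_bdd[OF d(4,1)]])
  moreover have "(\<lambda>z. f z * (f' z - g' z) + g' z * (f z - g z)) = (\<lambda>z. f z * f' z - g z * g' z)"
    by (auto simp: algebra_simps)
  ultimately show ?thesis using a by (auto simp: close_def intro: O_mult_bdd)
qed

lemma close_const: "close (\<lambda>_. c) (\<lambda>_. c)" by (rule close_refl) simp

lemma close_diff: "close f g \<Longrightarrow> close f' g' \<Longrightarrow> close (\<lambda>z. f z - f' z) (\<lambda>z. g z - g' z)"
  using close_add[of f g "\<lambda>z. -1 * f' z" "\<lambda>z. -1 * g' z"] close_mult[OF close_const[of "-1"], of f' g'] by simp

lemma close_sum: "(\<And>m. m \<in> A \<Longrightarrow> close (f m) (g m)) \<Longrightarrow> close (\<lambda>z. \<Sum>m\<in>A. f m z) (\<lambda>z. \<Sum>m\<in>A. g m z)"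
proof (induction A rule: infinite_finite_induct)
  case (insert x A)
  have "close (\<lambda>z. f x z + (\<Sum>m\<in>A. f m z)) (\<lambda>z. g x z + (\<Sum>m\<in>A. g m z))"
    by (rule close_add) (use insert in auto)
  then show ?case using insert by simp
qed (simp_all add: close_refl)

lemma close_inverse:
  assumes "close f g" "eventually (\<lambda>z. a \<le> \<bar>f z\<bar>) EF" "eventually (\<lambda>z. a \<le> \<bar>g z\<bar>) EF" "0 < a"
  shows "close (\<lambda>z. 1 / f z) (\<lambda>z. 1 / g z)"
proof -
  have inv: "(\<lambda>z. 1 / h z) \<in> bdE" if "eventually (\<lambda>z. a \<le> \<bar>h z\<bar>) EF" for h
    by (rule bigoI[of _ "1 / a"], use that in eventually_elim) (use assms(4) in \<open>auto simp: divide_simps\<close>)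
  show ?thesis
  proof (rule closeI[OF inv[OF assms(3)]], rule bigo_ev_cong)
    show "(\<lambda>z. (1 / f z * (1 / g z)) * (-1 * (f z - g z))) \<in> O[EF](\<lambda>z. th (fst z))"
      by (intro O_mult_bdd inv assms) (use assms(1) in \<open>auto simp: close_def\<close>)
    show "eventually (\<lambda>z. 1 / f z - 1 / g z = (1 / f z * (1 / g z)) * (-1 * (f z - g z))) EF"
      using assms(2,3)
    proof eventually_elim
      case (elim z)
      then have "f z \<noteq> 0" "g z \<noteq> 0" using assms(4) by auto
      then show ?case by (simp add: field_simps)
    qed
  qed
qed

text \<open>With coordinates scaled by \<open>sqrt n\<close>, an inner product of two vectors is the
  average of the product of their scaled coordinates.\<close>

definition avg :: "(nat \<times> 'a \<times> nat \<Rightarrow> real) \<Rightarrow> nat \<times> 'a \<times> nat \<Rightarrow> real" where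
  "avg f z = (\<Sum>j<fst z. f (fst z, fst (snd z), j)) / real (fst z)"

lemma avg_bigo:
  fixes h :: "nat \<Rightarrow> real"
  assumes "f \<in> O[EF](\<lambda>z. h (fst z))"
  shows "avg f \<in> O[EF](\<lambda>z. h (fst z))"
proof -
  obtain c N where c: "c > 0" "\<And>n \<omega> i. n \<ge> N \<Longrightarrow> \<omega> \<in> S n \<Longrightarrow> i < n \<Longrightarrow> \<bar>f (n, \<omega>, i)\<bar> \<le> c * \<bar>h (fst (n, \<omega>, i))\<bar>"
    by (rule bigo_EF_E[OF assms]) blast
  show ?thesis
  proof (rule bigo_EF_I[where N = N and c = c])
    fix n \<omega> i assume n: "N \<le> n" "\<omega> \<in> S n" "i < n"
    have "\<bar>\<Sum>j<n. f (n, \<omega>, j)\<bar> \<le> (\<Sum>j<n. c * \<bar>h n\<bar>)"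
      by (rule order_trans[OF sum_abs sum_mono]) (use c(2)[OF n(1,2)] in auto)
    then have "\<bar>\<Sum>j<n. f (n, \<omega>, j)\<bar> / real n \<le> real n * (c * \<bar>h n\<bar>) / real n"
      by (intro divide_right_mono) auto
    then show "\<bar>avg f (n, \<omega>, i)\<bar> \<le> c * \<bar>h (fst (n, \<omega>, i))\<bar>" using n by (simp add: avg_def)
  qed
qed

lemma close_avg: "close f g \<Longrightarrow> close (avg f) (avg g)"
proof -
  assume a: "close f g"
  have "avg (\<lambda>z. f z - g z) \<in> O[EF](\<lambda>z. th (fst z))" using a by (intro avg_bigo) (auto simp: close_def)
  moreover have "avg (\<lambda>z. f z - g z) = (\<lambda>z. avg f z - avg g z)"
    by (auto simp: avg_def sum_subtractf diff_divide_distrib)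
  ultimately show ?thesis using a avg_bigo[of f "\<lambda>_. 1"] avg_bigo[of g "\<lambda>_. 1"] by (simp add: close_def)
qed

definition ZX :: "nat \<Rightarrow> nat \<times> 'a \<times> nat \<Rightarrow> real" where "ZX m z = sgn (Zal m m z) * Znu 0 m z"

lemma close_vec: "m < d \<Longrightarrow> close (ZX m) (Zups m)"
  unfolding ZX_def[abs_def] by (intro closeI Zups_bdd med_th eigenvector_diff_E)

lemma close_val: "m < d \<Longrightarrow> close (ZL m) (Zl m)"
  by (intro closeI Zl_bdd small_th eigenvalue_diff_E)

lemma ZL_gap:
  assumes "k < d" "m < d" "m \<noteq> k"
  shows "eventually (\<lambda>z. 1/2 \<le> \<bar>ZL k z - ZL m z\<bar>) EF" "eventually (\<lambda>z. 1/2 \<le> \<bar>Zl k z - Zl m z\<bar>) EF"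
proof -
  have c: "eventually (\<lambda>z. \<bar>ZL m z - Zl m z\<bar> \<le> 1/4) EF" if "m < d" for m
  proof -
    have "(\<lambda>z. ZL m z - Zl m z) \<in> o[EF](\<lambda>_. 1)"
      by (rule landau_o.big_small_trans[OF small_th[OF eigenvalue_diff_E[OF that]] smallo_seq_EF[OF th_small]])
    from landau_o.smallD[OF this, of "1/4"] show ?thesis by simp
  qed
  have g: "eventually (\<lambda>z. 1 \<le> \<bar>Zl k z - Zl m z\<bar>) EF"
    unfolding eventually_EF
  proof (intro exI[of _ NL] allI impI ballI)
    fix n \<omega> i assume n: "NL \<le> n"
    show "1 \<le> \<bar>Zl k (n, \<omega>, i) - Zl m (n, \<omega>, i)\<bar>"
      using lam_gap[OF NL(1)[OF n] assms(1,2)] assms NL(12)[OF n]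
      by (simp add: Zl_def le_divide_eq flip: diff_divide_distrib)
  qed
  then show "eventually (\<lambda>z. 1/2 \<le> \<bar>Zl k z - Zl m z\<bar>) EF" by eventually_elim simp
  show "eventually (\<lambda>z. 1/2 \<le> \<bar>ZL k z - ZL m z\<bar>) EF"
    using g c[OF assms(1)] c[OF assms(2)] by eventually_elim linarith
qed

text \<open>The bias formula in scaled variables, written with reciprocals and products in the
  pattern of the rules for \<open>close\<close>. The unscaled formula times \<open>sqrt n\<close> is
  this quantity times the square of \<open>tau n\<close>.\<close>

definition nbias :: "(nat \<Rightarrow> nat \<times> 'a \<times> nat \<Rightarrow> real) \<Rightarrow> (nat \<Rightarrow> nat \<times> 'a \<times> nat \<Rightarrow> real) \<Rightarrow> (nat \<times> 'a \<times> nat \<Rightarrow> real) \<Rightarrow> nat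
    \<Rightarrow> nat \<times> 'a \<times> nat \<Rightarrow> real" where
  "nbias \<Lambda> V D k z = V k z * D z * (1 / (\<Lambda> k z * \<Lambda> k z)) - 3/2 * (V k z * (avg (\<lambda>z. V k z * (D z * V k z)) z * (1 / (\<Lambda> k z * \<Lambda> k z))))
     + (\<Sum>m\<in>{..<d} - {k}. \<Lambda> m z * (1 / (\<Lambda> k z - \<Lambda> m z)) * (V m z * (avg (\<lambda>z. V m z * (D z * V k z)) z * (1 / (\<Lambda> k z * \<Lambda> k z)))))"

lemma close_nbias:
  assumes k: "k < d" and D: "close Dh D"
  shows "close (nbias ZL ZX Dh k) (nbias Zl Zups D k)"
proof -
  have low: "eventually (\<lambda>z. 1/4 \<le> \<bar>ZL k z * ZL k z\<bar>) EF" "eventually (\<lambda>z. 1/4 \<le> \<bar>Zl k z * Zl k z\<bar>) EF"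
    unfolding eventually_EF
  proof -
    show "\<exists>N. \<forall>n\<ge>N. \<forall>\<omega>\<in>S n. \<forall>i<n. 1/4 \<le> \<bar>ZL k (n, \<omega>, i) * ZL k (n, \<omega>, i)\<bar>"
    proof (intro exI[of _ NL] allI impI ballI)
      fix n \<omega> i assume n: "NL \<le> n" "\<omega> \<in> S n"
      have "1/2 \<le> \<bar>ZL k (n, \<omega>, i)\<bar>" using lh_lower[OF n k] NL(12)[OF n(1)] by (simp add: ZL_def le_divide_eq)
      then have "1/2 * (1/2) \<le> \<bar>ZL k (n, \<omega>, i)\<bar> * \<bar>ZL k (n, \<omega>, i)\<bar>" by (intro mult_mono) auto
      then show "1/4 \<le> \<bar>ZL k (n, \<omega>, i) * ZL k (n, \<omega>, i)\<bar>" by (simp add: abs_mult)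
    qed
    show "\<exists>N. \<forall>n\<ge>N. \<forall>\<omega>\<in>S n. \<forall>i<n. 1/4 \<le> \<bar>Zl k (n, \<omega>, i) * Zl k (n, \<omega>, i)\<bar>"
    proof (intro exI[of _ NL] allI impI ballI)
      fix n \<omega> i assume n: "NL \<le> n" "\<omega> \<in> S n"
      have "1/2 \<le> \<bar>Zl k (n, \<omega>, i)\<bar>" using lam_ge[OF k, of n] NL(12)[OF n(1)] by (simp add: Zl_def le_divide_eq)
      then have "1/2 * (1/2) \<le> \<bar>Zl k (n, \<omega>, i)\<bar> * \<bar>Zl k (n, \<omega>, i)\<bar>" by (intro mult_mono) auto
      then show "1/4 \<le> \<bar>Zl k (n, \<omega>, i) * Zl k (n, \<omega>, i)\<bar>" by (simp add: abs_mult)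
    qed
  qed
  have sq: "close (\<lambda>z. 1 / (ZL k z * ZL k z)) (\<lambda>z. 1 / (Zl k z * Zl k z))"
    by (rule close_inverse[OF close_mult[OF close_val[OF k] close_val[OF k]] low]) simp
  have av: "close (avg (\<lambda>z. ZX m z * (Dh z * ZX k z))) (avg (\<lambda>z. Zups m z * (D z * Zups k z)))" if "m < d" for m
    by (rule close_avg[OF close_mult[OF close_vec[OF that] close_mult[OF D close_vec[OF k]]]])
  have gp: "close (\<lambda>z. 1 / (ZL k z - ZL m z)) (\<lambda>z. 1 / (Zl k z - Zl m z))" if "m < d" "m \<noteq> k" for m
    by (rule close_inverse[OF close_diff[OF close_val[OF k] close_val[OF that(1)]] ZL_gap[OF k that]]) simp
  have terms: "close (\<lambda>z. \<Sum>m\<in>{..<d} - {k}. ZL m z * (1 / (ZL k z - ZL m z)) * (ZX m z * (avg (\<lambda>z. ZX m z * (Dh z * ZX k z)) z * (1 / (ZL k z * ZL k z)))))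
     (\<lambda>z. \<Sum>m\<in>{..<d} - {k}. Zl m z * (1 / (Zl k z - Zl m z)) * (Zups m z * (avg (\<lambda>z. Zups m z * (D z * Zups k z)) z * (1 / (Zl k z * Zl k z)))))"
  proof (rule close_sum)
    fix m assume "m \<in> {..<d} - {k}"
    then have m: "m < d" "m \<noteq> k" by auto
    show "close (\<lambda>z. ZL m z * (1 / (ZL k z - ZL m z)) * (ZX m z * (avg (\<lambda>z. ZX m z * (Dh z * ZX k z)) z * (1 / (ZL k z * ZL k z)))))
      (\<lambda>z. Zl m z * (1 / (Zl k z - Zl m z)) * (Zups m z * (avg (\<lambda>z. Zups m z * (D z * Zups k z)) z * (1 / (Zl k z * Zl k z)))))"
      by (rule close_mult[OF close_mult[OF close_val[OF m(1)] gp[OF m]] close_mult[OF close_vec[OF m(1)] close_mult[OF av[OF m(1)] sq]]])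
  qed
  show ?thesis unfolding nbias_def[abs_def]
    by (rule close_add[OF close_diff[OF close_mult[OF close_mult[OF close_vec[OF k] D] sq]
          close_mult[OF close_const close_mult[OF close_vec[OF k] close_mult[OF av[OF k] sq]]]] terms])
qed

lemma bias_formula_nbias:
  assumes n: "n \<ge> NL" and i: "i < n" and k: "Lm k \<noteq> 0"
    and \<Lambda>: "\<And>m. \<Lambda> m (n, \<omega>, i) = Lm m / Del n"
    and V: "\<And>m j. j < n \<Longrightarrow> V m (n, \<omega>, j) = sqrt (real n) * U m j"
    and D: "\<And>j. j < n \<Longrightarrow> D (n, \<omega>, j) = Dg j / (snr n)\<^sup>2"
  shows "sqrt (real n) * bias_formula n d Lm U Dg k i = (tau n)\<^sup>2 * nbias \<Lambda> V D k (n, \<omega>, i)"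
proof -
  note L = NL[OF n]
  have av: "avg (\<lambda>z. V m z * (D z * V k z)) (n, \<omega>, i)
     = inner_n n (U m) (\<lambda>j. Dg j * U k j / (Lm k)\<^sup>2) * ((Lm k)\<^sup>2 / (snr n)\<^sup>2)" for m
  proof -
    have alg: "(sqrt (real n) * a) * (b / e * (sqrt (real n) * c)) / real n = a * (b * c / e)" for a b c e
    proof -
      have "(sqrt (real n) * a) * (b / e * (sqrt (real n) * c)) = (sqrt (real n) * sqrt (real n)) * (a * (b * c / e))"
        by (simp only: divide_inverse mult_ac)
      also have "sqrt (real n) * sqrt (real n) = real n" by simp
      finally have *: "(sqrt (real n) * a) * (b / e * (sqrt (real n) * c)) = real n * (a * (b * c / e))" .
      show ?thesis unfolding * by (rule nonzero_mult_div_cancel_left) (use L(5) in simp)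
    qed
    have "avg (\<lambda>z. V m z * (D z * V k z)) (n, \<omega>, i) = (\<Sum>j<n. U m j * (Dg j * U k j / (snr n)\<^sup>2))"
      unfolding avg_def sum_divide_distrib fst_conv snd_conv by (intro sum.cong refl) (simp only: V D lessThan_iff alg)
    also have "\<dots> = inner_n n (U m) (\<lambda>j. Dg j * U k j / (Lm k)\<^sup>2) * ((Lm k)\<^sup>2 / (snr n)\<^sup>2)"
      unfolding inner_n_def sum_distrib_right using k by (intro sum.cong) auto
    finally show ?thesis .
  qed
  have r: "\<Lambda> m (n, \<omega>, i) * (1 / (\<Lambda> k (n, \<omega>, i) - \<Lambda> m (n, \<omega>, i))) = Lm m / (Lm k - Lm m)" for m
    using L by (simp add: \<Lambda> flip: diff_divide_distrib)
  have l: "1 / (\<Lambda> k (n, \<omega>, i) * \<Lambda> k (n, \<omega>, i)) = (Del n)\<^sup>2 / (Lm k)\<^sup>2"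
    by (simp add: \<Lambda> power2_eq_square)
  have c: "x * ((Lm k)\<^sup>2 / (snr n)\<^sup>2) * ((Del n)\<^sup>2 / (Lm k)\<^sup>2) = x / (tau n)\<^sup>2" for x
    using k L by (simp add: tau_def power_divide)
  have c0: "D (n, \<omega>, i) * ((Del n)\<^sup>2 / (Lm k)\<^sup>2) = (Dg i / (Lm k)\<^sup>2) / (tau n)\<^sup>2"
    using L by (simp add: D[OF i] tau_def power_divide)
  have t: "(tau n)\<^sup>2 \<noteq> 0" using L by simp
  show ?thesis
    unfolding nbias_def bias_formula_def Let_def r l av c snd_conv mult.assoc[of "V k (n, \<omega>, i)"] c0
    using t by (simp add: V[OF i] distrib_left right_diff_distrib sum_distrib_left mult_ac)
qed

end

text \<open>Each \<open>U m\<close> with \<open>m \<noteq> k\<close> occurs twice, so its sign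
  cancels, whereas \<open>U k\<close> occurs an odd number of times. The individual sign ambiguities
  of the estimated eigenvectors thus reduce to the single sign at \<open>k\<close>.\<close>

lemma bias_formula_signs:
  assumes sg: "\<And>m. m < d \<Longrightarrow> sg m * sg m = (1::real)" and k: "k < d"
  shows "bias_formula n d L (\<lambda>m j. sg m * V m j) Dg k i = sg k * bias_formula n d L V Dg k i"
proof -
  have inn: "inner_n n (\<lambda>j. sg m * V m j) (\<lambda>j. Dg j * (sg k * V k j) / (L k)\<^sup>2)
      = sg m * sg k * inner_n n (V m) (\<lambda>j. Dg j * V k j / (L k)\<^sup>2)" for m
    unfolding inner_n_def sum_distrib_left by (intro sum.cong) auto
  have sq: "sg m * (sg m * x) = x" if "m < d" for m x using sg[OF that] by (simp flip: mult.assoc)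
  have "(\<Sum>m\<in>{..<d} - {k}. L m / (L k - L m) * (sg m * V m i) * (sg m * sg k * inner_n n (V m) (\<lambda>j. Dg j * V k j / (L k)\<^sup>2)))
      = (\<Sum>m\<in>{..<d} - {k}. sg k * (L m / (L k - L m) * V m i * inner_n n (V m) (\<lambda>j. Dg j * V k j / (L k)\<^sup>2)))"
  proof (intro sum.cong refl)
    fix m assume "m \<in> {..<d} - {k}"
    then have "m < d" by simp
    have "a * (sg m * b) * (sg m * sg k * c) = sg k * (sg m * (sg m * (a * b * c)))" for a b c by (simp add: mult_ac)
    then show "L m / (L k - L m) * (sg m * V m i) * (sg m * sg k * inner_n n (V m) (\<lambda>j. Dg j * V k j / (L k)\<^sup>2))
      = sg k * (L m / (L k - L m) * V m i * inner_n n (V m) (\<lambda>j. Dg j * V k j / (L k)\<^sup>2))"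
      by (simp only: sq[OF \<open>m < d\<close>])
  qed
  moreover have "3/2 * (sg k * V k i) * (sg k * sg k * c) = sg k * (3/2 * V k i * c)" for c
    using sg[OF k] by simp
  ultimately show ?thesis
    unfolding bias_formula_def Let_def inn
    by (simp only:) (simp add: distrib_left right_diff_distrib sum_distrib_left mult_ac)
qed

section \<open>Estimated and true row variances\<close>

context spiked_noise
begin

definition Dh :: "nat \<Rightarrow> 'a \<Rightarrow> nat \<Rightarrow> real" where
  "Dh n \<omega> = Dhat_diag n (\<lambda>i j. lowrank d (lam n) (u n) i j + E n \<omega> i j) (lowrank d (lh n \<omega>) (vh n \<omega>))"
text \<open>The link between the estimate \<open>Dh\<close> and the variances \<open>D0\<close>. It
  approximates \<open>Dh\<close> by perturbation theory and \<open>D0\<close> by concentration;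
  being quadratic in E, it is also the right centring for the second-order expansion.\<close>

definition D2 :: "nat \<Rightarrow> 'a \<Rightarrow> nat \<Rightarrow> real" where "D2 n \<omega> i = (\<Sum>j<n. (E n \<omega> i j)\<^sup>2)"
definition D0 :: "nat \<Rightarrow> 'a \<Rightarrow> nat \<Rightarrow> real" where "D0 n \<omega> i = (\<Sum>j<n. sigma2 n i j)"

definition bhat_of :: "nat \<Rightarrow> nat \<Rightarrow> 'a \<Rightarrow> nat \<Rightarrow> real" where
  "bhat_of k n \<omega> i = bias_formula n d (lh n \<omega>) (vh n \<omega>) (Dh n \<omega>) k i"

end

context spiked_event
begin

definition ZD :: "(nat \<Rightarrow> 'a \<Rightarrow> nat \<Rightarrow> real) \<Rightarrow> nat \<times> 'a \<times> nat \<Rightarrow> real" where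
  "ZD D z = D (fst z) (fst (snd z)) (snd (snd z)) / (snr (fst z))\<^sup>2"

text \<open>The estimation error of the low-rank part: the residual of A after subtracting the
  estimate is \<open>E + PD\<close>.\<close>

definition PD :: "nat \<Rightarrow> 'a \<Rightarrow> nat \<Rightarrow> nat \<Rightarrow> real" where
  "PD n \<omega> i j = lowrank d (lam n) (u n) i j - lowrank d (lh n \<omega>) (vh n \<omega>) i j"

lemma Dh_split: "Dh n \<omega> i = D2 n \<omega> i + 2 * (\<Sum>j<n. E n \<omega> i j * PD n \<omega> i j) + (\<Sum>j<n. (PD n \<omega> i j)\<^sup>2)"
proof -
  have "Dh n \<omega> i = (\<Sum>j<n. (E n \<omega> i j)\<^sup>2 + 2 * (E n \<omega> i j * PD n \<omega> i j) + (PD n \<omega> i j)\<^sup>2)"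
    unfolding Dh_def Dhat_diag_def by (intro sum.cong refl) (simp add: PD_def power2_eq_square algebra_simps)
  then show ?thesis by (simp add: D2_def sum.distrib sum_distrib_left)
qed

lemma lowrank_row:
  "(\<Sum>j<n. E n \<omega> i j * lowrank d a U i j) = (\<Sum>m<d. a m * U m i * Epow n \<omega> 1 (U m) i)"
  unfolding lowrank_def Epow_1 mv_def sum_distrib_left by (subst sum.swap) (simp add: mult_ac)

text \<open>Pairing a row of E with a low-rank matrix yields products of a coordinate of an
  eigenvector and the same coordinate of E applied to it. These are among the expanded quantities,
  and the scaling produces the prefactor with \<open>1 / n\<close>.\<close>

lemma cross_term:
  assumes n: "n \<ge> NL"
  shows "(\<Sum>j<n. E n \<omega> i j * PD n \<omega> i j) / (snr n)\<^sup>2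
    = 1 / (real n * (tau n)\<^sup>2) * (\<Sum>m<d. Zl m (n, \<omega>, i) * Zups m (n, \<omega>, i) * Zy 1 m (n, \<omega>, i)
        - ZL m (n, \<omega>, i) * Znu 0 m (n, \<omega>, i) * Znu 1 m (n, \<omega>, i))"
proof -
  note L = NL[OF n]
  have alg: "(x / Del n) * (sqrt (real n) * y) * (sqrt (real n) * z / Del n) = x * y * z * (real n / (Del n)\<^sup>2)" for x y z
  proof -
    have "(x / Del n) * (sqrt (real n) * y) * (sqrt (real n) * z / Del n) = (sqrt (real n) * sqrt (real n)) * (x * y * z / (Del n * Del n))"
      by (simp only: divide_inverse mult_ac inverse_mult_distrib)
    then show ?thesis by (simp add: power2_eq_square)
  qed
  have "(\<Sum>j<n. E n \<omega> i j * PD n \<omega> i j)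
     = (\<Sum>m<d. lam n m * u n m i * Epow n \<omega> 1 (u n m) i - lh n \<omega> m * vh n \<omega> m i * Epow n \<omega> 1 (vh n \<omega> m) i)"
    by (simp add: PD_def right_diff_distrib sum_subtractf lowrank_row)
  moreover have "(\<Sum>m<d. Zl m (n, \<omega>, i) * Zups m (n, \<omega>, i) * Zy 1 m (n, \<omega>, i) - ZL m (n, \<omega>, i) * Znu 0 m (n, \<omega>, i) * Znu 1 m (n, \<omega>, i))
     = (\<Sum>m<d. lam n m * u n m i * Epow n \<omega> 1 (u n m) i - lh n \<omega> m * vh n \<omega> m i * Epow n \<omega> 1 (vh n \<omega> m) i) * (real n / (Del n)\<^sup>2)"
    unfolding sum_distrib_right Z_defs fst_conv snd_conv power_0 power_one_right div_by_1 Epow_0 alg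
    by (intro sum.cong refl) (simp only: left_diff_distrib)
  ultimately show ?thesis using L by (simp add: tau_def power_divide)
qed

lemma log_square_le: obtains N where "N \<ge> NL" "\<And>n. n \<ge> N \<Longrightarrow> (ln (real n))\<^sup>2 \<le> real n powr gam"
proof -
  have "eventually (\<lambda>n::nat. (ln (real n))\<^sup>2 \<le> real n powr gam) sequentially" using gam(1) by real_asymp
  then obtain N where "\<And>n. n \<ge> N \<Longrightarrow> (ln (real n))\<^sup>2 \<le> real n powr gam" unfolding eventually_sequentially by blast
  then show ?thesis by (intro that[of "max N NL"]) auto
qed

lemma ln_sq_O: "f \<in> O[EF](\<lambda>z. (zt z * zl z) * (zt z * zl z)) \<Longrightarrow> f \<in> O[EF](\<lambda>z. (zt z)\<^sup>2 * ze z)"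
proof (erule landau_o.big_trans)
  obtain N where N: "N \<ge> NL" "\<And>n. n \<ge> N \<Longrightarrow> (ln (real n))\<^sup>2 \<le> real n powr gam" by (rule log_square_le) blast
  show "(\<lambda>z. (zt z * zl z) * (zt z * zl z)) \<in> O[EF](\<lambda>z. (zt z)\<^sup>2 * ze z)"
  proof (rule bigo_EF_I[where N = N and c = 1])
    fix n \<omega> i assume n: "N \<le> n"
    have "(tau n)\<^sup>2 * (ln (real n))\<^sup>2 \<le> (tau n)\<^sup>2 * real n powr gam" using N(2)[OF n] by (intro mult_left_mono) auto
    moreover have "0 \<le> ln (real n)" "0 \<le> tau n" using NL(6,13)[of n] N(1) n by auto
    ultimately show "\<bar>(zt (n, \<omega>, i) * zl (n, \<omega>, i)) * (zt (n, \<omega>, i) * zl (n, \<omega>, i))\<bar> \<le> 1 * \<bar>(zt (n, \<omega>, i))\<^sup>2 * ze (n, \<omega>, i)\<bar>"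
      by (simp add: abs_mult power2_eq_square mult_ac)
  qed
qed

lemma small_med_E: "f \<in> O[EF](\<lambda>z. zt z * (zz z)\<^sup>2) \<Longrightarrow> f \<in> O[EF](\<lambda>z. zt z * zl z)"
proof (erule landau_o.big_trans, rule bigo_EF_I[where N = NL and c = 1])
  fix n \<omega> i assume n: "NL \<le> n"
  note L = NL[OF n]
  have "(real n powr (- gam))\<^sup>2 \<le> 1" using zeta_le_1[OF n] by (simp add: power_le_one)
  then have "(real n powr (- gam))\<^sup>2 \<le> ln (real n)" using L by simp
  then show "\<bar>zt (n, \<omega>, i) * (zz (n, \<omega>, i))\<^sup>2\<bar> \<le> 1 * \<bar>zt (n, \<omega>, i) * zl (n, \<omega>, i)\<bar>"
    using L by (simp add: abs_mult)
qed

lemma ZX_bdd: "m < d \<Longrightarrow> ZX m \<in> bdE" using close_vec[of m] by (simp add: close_def)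

text \<open>Telescoping over the three factors eigenvalue, coordinate and noise coordinate. The sign
  of the estimated eigenvector appears twice and cancels, so each difference can be taken with the
  aligned vector.\<close>

lemma cross_bracket:
  assumes m: "m < d"
  shows "(\<lambda>z. Zl m z * Zups m z * Zy 1 m z - ZL m z * Znu 0 m z * Znu 1 m z) \<in> O[EF](\<lambda>z. (zt z)\<^sup>2 * ze z)"
proof (rule bigo_ev_cong)
  have y1: "Zy 1 m \<in> O[EF](\<lambda>z. zt z * zl z)" by (rule second_order_perturbation.sm(5)[OF sop[OF m] m])
  have neg: "(\<lambda>z. f z - g z) \<in> O[EF](h) \<Longrightarrow> (\<lambda>z. g z - f z) \<in> O[EF](h)" for f g h :: "nat \<times> 'a \<times> nat \<Rightarrow> real"
  proof -
    assume "(\<lambda>z. f z - g z) \<in> O[EF](h)"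
    then have "(\<lambda>z. - 1 * (f z - g z)) \<in> O[EF](h)" by (intro O_mult_bdd) auto
    then show ?thesis by simp
  qed
  have a: "(\<lambda>z. Zups m z * ((Zl m z - ZL m z) * Zy 1 m z)) \<in> O[EF](\<lambda>z. (zt z)\<^sup>2 * ze z)"
    by (rule O_mult_bdd[OF Zups_bdd[OF m] ln_sq_O[OF landau_o.big.mult[OF small_med_E[OF neg[OF eigenvalue_diff_E[OF m]]] y1]]])
  have b: "(\<lambda>z. ZL m z * ((Zups m z - ZX m z) * Zy 1 m z)) \<in> O[EF](\<lambda>z. (zt z)\<^sup>2 * ze z)"
    unfolding ZX_def
    by (rule O_mult_bdd[OF ZL_bdd[OF m] ln_sq_O[OF landau_o.big.mult[OF neg[OF eigenvector_diff_E[OF m]] y1]]])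
  have c: "(\<lambda>z. ZL m z * (ZX m z * (Zy 1 m z - sgn (Zal m m z) * Znu 1 m z))) \<in> O[EF](\<lambda>z. (zt z)\<^sup>2 * ze z)"
    by (rule O_mult_bdd[OF ZL_bdd[OF m] O_mult_bdd[OF ZX_bdd[OF m] neg[OF noise_diff_E[OF m]]]])
  show "(\<lambda>z. Zups m z * ((Zl m z - ZL m z) * Zy 1 m z) + ZL m z * ((Zups m z - ZX m z) * Zy 1 m z)
     + ZL m z * (ZX m z * (Zy 1 m z - sgn (Zal m m z) * Znu 1 m z))) \<in> O[EF](\<lambda>z. (zt z)\<^sup>2 * ze z)"
    by (rule sum_in_bigo(1)[OF sum_in_bigo(1)[OF a b] c])
  show "eventually (\<lambda>z. Zl m z * Zups m z * Zy 1 m z - ZL m z * Znu 0 m z * Znu 1 m z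
     = Zups m z * ((Zl m z - ZL m z) * Zy 1 m z) + ZL m z * ((Zups m z - ZX m z) * Zy 1 m z)
     + ZL m z * (ZX m z * (Zy 1 m z - sgn (Zal m m z) * Znu 1 m z))) EF"
    using sgn_sq_E[OF m]
  proof eventually_elim
    case (elim z)
    have "ZX m z * (sgn (Zal m m z) * Znu 1 m z) = (sgn (Zal m m z) * sgn (Zal m m z)) * (Znu 0 m z * Znu 1 m z)"
      by (simp only: ZX_def mult_ac)
    then have "ZX m z * (sgn (Zal m m z) * Znu 1 m z) = Znu 0 m z * Znu 1 m z" using elim by simp
    then show ?case by (simp add: algebra_simps)
  qed
qed

text \<open>Because \<open>qn n\<close> is at most \<open>sqrt n\<close>, the rate \<open>th\<close>
  is at least \<open>1 / sqrt n\<close>; the loss \<open>n powr gam\<close> is at most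
  \<open>sqrt n\<close> and is therefore affordable after division by \<open>n\<close>.\<close>

lemma eta_over_n: "n \<ge> NL \<Longrightarrow> real n powr gam / real n \<le> th n"
proof -
  assume n: "n \<ge> NL"
  note L = NL[OF n]
  have q: "1 \<le> qn n" "qn n \<le> sqrt (real n)" using qn_ge_1[OF L(1,5)] qn[OF L(1)] by auto
  have "real n powr gam \<le> real n powr (1/2)" using L gam by (intro powr_mono) auto
  then have "real n powr gam / real n \<le> sqrt (real n) / real n" using L by (simp add: powr_half_sqrt divide_right_mono)
  also have "\<dots> = 1 / sqrt (real n)" by (simp add: sqrt_divide_self_eq inverse_eq_divide)
  also have "\<dots> \<le> 1 / qn n" using q L by (intro divide_left_mono) auto
  also have "\<dots> \<le> max (1 / qn n) (tau n) * 1" by simp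
  also have "\<dots> \<le> th n" unfolding th_def using L q by (intro mult_left_mono) (auto simp: le_max_iff_disj)
  finally show ?thesis .
qed

lemma cross_O: "(\<lambda>z. (\<Sum>j<fst z. E (fst z) (fst (snd z)) (snd (snd z)) j * PD (fst z) (fst (snd z)) (snd (snd z)) j) / (snr (fst z))\<^sup>2)
   \<in> O[EF](\<lambda>z. th (fst z))"
proof -
  have "(\<lambda>z. \<Sum>m<d. Zl m z * Zups m z * Zy 1 m z - ZL m z * Znu 0 m z * Znu 1 m z) \<in> O[EF](\<lambda>z. (zt z)\<^sup>2 * ze z)"
    by (rule big_sum_in_bigo) (use cross_bracket in auto)
  then obtain c N where c: "c > 0" "\<And>n \<omega> i. n \<ge> N \<Longrightarrow> \<omega> \<in> S n \<Longrightarrow> i < n \<Longrightarrow>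
     \<bar>\<Sum>m<d. Zl m (n, \<omega>, i) * Zups m (n, \<omega>, i) * Zy 1 m (n, \<omega>, i) - ZL m (n, \<omega>, i) * Znu 0 m (n, \<omega>, i) * Znu 1 m (n, \<omega>, i)\<bar>
       \<le> c * \<bar>(tau n)\<^sup>2 * real n powr gam\<bar>"
    by (rule bigo_EF_E) auto
  show ?thesis
  proof (rule bigo_EF_I[where N = "max N NL" and c = c])
    fix n \<omega> i assume n: "max N NL \<le> n" "\<omega> \<in> S n" "i < n"
    have nL: "NL \<le> n" and nN: "N \<le> n" using n by auto
    note L = NL[OF nL]
    have "\<bar>(\<Sum>j<n. E n \<omega> i j * PD n \<omega> i j) / (snr n)\<^sup>2\<bar> \<le> 1 / (real n * (tau n)\<^sup>2) * (c * \<bar>(tau n)\<^sup>2 * real n powr gam\<bar>)"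
      unfolding cross_term[OF nL] abs_mult[of "1 / _"] using c(2)[OF nN n(2,3)] L by (intro mult_mono) auto
    also have "\<dots> = c * (real n powr gam / real n)" using L by simp
    also have "\<dots> \<le> c * th n" using c(1) eta_over_n[OF nL] by (intro mult_left_mono) auto
    finally show "\<bar>(\<Sum>j<fst (n, \<omega>, i). E (fst (n, \<omega>, i)) (fst (snd (n, \<omega>, i))) (snd (snd (n, \<omega>, i))) j * PD (fst (n, \<omega>, i)) (fst (snd (n, \<omega>, i))) (snd (snd (n, \<omega>, i))) j) / (snr (fst (n, \<omega>, i)))\<^sup>2\<bar>
      \<le> c * \<bar>th (fst (n, \<omega>, i))\<bar>" using th_pos[OF nL] by simp
  qed
qed

lemma triple_product_diff:
  fixes a :: real
  assumes "\<bar>a - a'\<bar> \<le> e" "\<bar>x - x'\<bar> \<le> e" "\<bar>y - y'\<bar> \<le> e" "\<bar>x\<bar> \<le> B" "\<bar>y\<bar> \<le> B" "\<bar>a'\<bar> \<le> B" "\<bar>x'\<bar> \<le> B"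
  shows "\<bar>a * x * y - a' * x' * y'\<bar> \<le> 3 * (B * B * e)"
proof -
  have B: "0 \<le> B" "0 \<le> e" using assms by linarith+
  have "a * x * y - a' * x' * y' = (a - a') * x * y + a' * (x - x') * y + a' * x' * (y - y')"
    by (simp add: algebra_simps)
  also have "\<bar>\<dots>\<bar> \<le> \<bar>a - a'\<bar> * \<bar>x\<bar> * \<bar>y\<bar> + \<bar>a'\<bar> * \<bar>x - x'\<bar> * \<bar>y\<bar> + \<bar>a'\<bar> * \<bar>x'\<bar> * \<bar>y - y'\<bar>"
    unfolding abs_mult[symmetric] by linarith
  also have "\<dots> \<le> e * B * B + B * e * B + B * B * e"
    by (intro add_mono mult_mono assms mult_nonneg_nonneg B) auto
  finally show ?thesis by simp
qed

text \<open>Each entry of the estimation error is of order \<open>snr n * ln n / n\<close>. Summing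
  \<open>n\<close> squares and dividing by the square of \<open>snr n\<close> leaves a squared
  logarithm over \<open>n\<close>.\<close>

lemma PD_O: "(\<lambda>z. (\<Sum>j<fst z. (PD (fst z) (fst (snd z)) (snd (snd z)) j)\<^sup>2) / (snr (fst z))\<^sup>2) \<in> O[EF](\<lambda>z. th (fst z))"
proof -
  have "(\<lambda>z. \<Sum>m<d. \<bar>Zl m z - ZL m z\<bar> + \<bar>Zups m z - ZX m z\<bar>) \<in> O[EF](\<lambda>z. zt z * zl z)"
  proof (rule big_sum_in_bigo, rule sum_in_bigo)
    fix m assume "m \<in> {..<d}"
    then have m: "m < d" by simp
    have "(\<lambda>z. \<bar>ZL m z - Zl m z\<bar>) \<in> O[EF](\<lambda>z. zt z * zl z)" using small_med_E[OF eigenvalue_diff_E[OF m]] by simp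
    then show "(\<lambda>z. \<bar>Zl m z - ZL m z\<bar>) \<in> O[EF](\<lambda>z. zt z * zl z)" by (simp only: abs_minus_commute)
    have "(\<lambda>z. \<bar>ZX m z - Zups m z\<bar>) \<in> O[EF](\<lambda>z. zt z * zl z)" using eigenvector_diff_E[OF m] by (simp add: ZX_def)
    then show "(\<lambda>z. \<bar>Zups m z - ZX m z\<bar>) \<in> O[EF](\<lambda>z. zt z * zl z)" by (simp only: abs_minus_commute)
  qed
  then obtain c N1 where c: "c > 0" "\<And>n \<omega> i. n \<ge> N1 \<Longrightarrow> \<omega> \<in> S n \<Longrightarrow> i < n \<Longrightarrow>
     \<bar>\<Sum>m<d. \<bar>Zl m (n, \<omega>, i) - ZL m (n, \<omega>, i)\<bar> + \<bar>Zups m (n, \<omega>, i) - ZX m (n, \<omega>, i)\<bar>\<bar> \<le> c * \<bar>tau n * ln (real n)\<bar>"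
    by (rule bigo_EF_E) auto
  have "(\<lambda>z. \<Sum>m<d. \<bar>ZL m z\<bar> + \<bar>Zups m z\<bar> + \<bar>ZX m z\<bar>) \<in> bdE"
    by (intro big_sum_in_bigo sum_in_bigo(1)) (auto intro: ZL_bdd Zups_bdd ZX_bdd)
  then obtain B N2 where B: "B > 0" "\<And>n \<omega> i. n \<ge> N2 \<Longrightarrow> \<omega> \<in> S n \<Longrightarrow> i < n \<Longrightarrow>
     \<bar>\<Sum>m<d. \<bar>ZL m (n, \<omega>, i)\<bar> + \<bar>Zups m (n, \<omega>, i)\<bar> + \<bar>ZX m (n, \<omega>, i)\<bar>\<bar> \<le> B * \<bar>1\<bar>"
    by (rule bigo_EF_E) auto
  have "eventually (\<lambda>z. \<forall>m\<in>{..<d}. sgn (Zal m m z) * sgn (Zal m m z) = 1) EF"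
    by (rule eventually_ball_finite) (use sgn_sq_E in auto)
  then obtain N3 where N3: "\<And>n \<omega> i. n \<ge> N3 \<Longrightarrow> \<omega> \<in> S n \<Longrightarrow> i < n \<Longrightarrow> \<forall>m\<in>{..<d}. sgn (Zal m m (n, \<omega>, i)) * sgn (Zal m m (n, \<omega>, i)) = 1"
    unfolding eventually_EF by blast
  obtain N4 where N4: "N4 \<ge> NL" "\<And>n. n \<ge> N4 \<Longrightarrow> (ln (real n))\<^sup>2 \<le> real n powr gam" by (rule log_square_le) blast
  define G where "G = real d * (3 * (B * B * c))"
  show ?thesis
  proof (rule bigo_EF_I[where N = "max (max N1 N2) (max N3 N4)" and c = "G\<^sup>2"])
    fix n \<omega> i assume n: "max (max N1 N2) (max N3 N4) \<le> n" and w: "\<omega> \<in> S n" and i: "i < n"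
    have nn: "N1 \<le> n" "N2 \<le> n" "N3 \<le> n" "N4 \<le> n" "NL \<le> n" using n N4 by auto
    note L = NL[OF nn(5)]
    let ?t = "tau n * ln (real n)"
    have t: "0 \<le> ?t" using L by simp
    have diff: "\<bar>Zl m (n, \<omega>, j) - ZL m (n, \<omega>, j)\<bar> \<le> c * ?t" "\<bar>Zups m (n, \<omega>, j) - ZX m (n, \<omega>, j)\<bar> \<le> c * ?t" if "m < d" "j < n" for m j
    proof -
      have "\<bar>Zl m (n, \<omega>, j) - ZL m (n, \<omega>, j)\<bar> + \<bar>Zups m (n, \<omega>, j) - ZX m (n, \<omega>, j)\<bar>
        \<le> (\<Sum>m<d. \<bar>Zl m (n, \<omega>, j) - ZL m (n, \<omega>, j)\<bar> + \<bar>Zups m (n, \<omega>, j) - ZX m (n, \<omega>, j)\<bar>)"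
        using that by (intro member_le_sum) auto
      also have "\<dots> \<le> c * ?t" using c(2)[OF nn(1) w that(2)] t by linarith
      finally show "\<bar>Zl m (n, \<omega>, j) - ZL m (n, \<omega>, j)\<bar> \<le> c * ?t" "\<bar>Zups m (n, \<omega>, j) - ZX m (n, \<omega>, j)\<bar> \<le> c * ?t" by linarith+
    qed
    have bdd: "\<bar>ZL m (n, \<omega>, j)\<bar> \<le> B" "\<bar>Zups m (n, \<omega>, j)\<bar> \<le> B" "\<bar>ZX m (n, \<omega>, j)\<bar> \<le> B" if "m < d" "j < n" for m j
    proof -
      have "\<bar>ZL m (n, \<omega>, j)\<bar> + \<bar>Zups m (n, \<omega>, j)\<bar> + \<bar>ZX m (n, \<omega>, j)\<bar>
        \<le> (\<Sum>m<d. \<bar>ZL m (n, \<omega>, j)\<bar> + \<bar>Zups m (n, \<omega>, j)\<bar> + \<bar>ZX m (n, \<omega>, j)\<bar>)"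
        using that by (intro member_le_sum) auto
      also have "\<dots> \<le> B" using B(2)[OF nn(2) w that(2)] by linarith
      finally show "\<bar>ZL m (n, \<omega>, j)\<bar> \<le> B" "\<bar>Zups m (n, \<omega>, j)\<bar> \<le> B" "\<bar>ZX m (n, \<omega>, j)\<bar> \<le> B" by linarith+
    qed
    have PD: "\<bar>PD n \<omega> i j\<bar> \<le> Del n / real n * (G * ?t)" if j: "j < n" for j
    proof -
      have eq: "PD n \<omega> i j = Del n / real n * (\<Sum>m<d. Zl m (n, \<omega>, i) * Zups m (n, \<omega>, i) * Zups m (n, \<omega>, j) - ZL m (n, \<omega>, i) * ZX m (n, \<omega>, i) * ZX m (n, \<omega>, j))"
        unfolding PD_def lowrank_def sum_subtractf[symmetric] sum_distrib_left
      proof (intro sum.cong refl)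
        fix m assume m: "m \<in> {..<d}"
        have alg: "Del n / real n * (x / Del n * (a * (sqrt (real n) * y)) * (b * (sqrt (real n) * z))) = x * (a * y) * (b * z)" for x y z a b
        proof -
          have "Del n / real n * (x / Del n * (a * (sqrt (real n) * y)) * (b * (sqrt (real n) * z)))
            = (sqrt (real n) * sqrt (real n)) / real n * (Del n / Del n) * (x * (a * y) * (b * z))"
            by (simp only: divide_inverse mult_ac)
          then show ?thesis using L by simp
        qed
        \<comment> \<open>The aligned vectors enter an entry of the low-rank matrix in pairs, so
          replacing \<open>vh\<close> by its aligned version changes nothing once the sign squares
          to 1.\<close>
        have sg: "sgn (Zal m m (n, \<omega>, i)) * sgn (Zal m m (n, \<omega>, i)) = 1" using N3[OF nn(3) w i] m by blast
        have e: "Zal m m (n, \<omega>, j) = Zal m m (n, \<omega>, i)" by (simp add: Zal_def)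
        let ?s = "sgn (Zal m m (n, \<omega>, i))"
        have "Del n / real n * (ZL m (n, \<omega>, i) * ZX m (n, \<omega>, i) * ZX m (n, \<omega>, j)) = lh n \<omega> m * (?s * vh n \<omega> m i) * (?s * vh n \<omega> m j)"
          unfolding ZX_def e unfolding ZL_def Znu_def fst_conv snd_conv power_0 div_by_1 Epow_0 by (rule alg)
        also have "\<dots> = (?s * ?s) * (lh n \<omega> m * vh n \<omega> m i * vh n \<omega> m j)" by (simp only: mult_ac)
        finally have 1: "Del n / real n * (ZL m (n, \<omega>, i) * ZX m (n, \<omega>, i) * ZX m (n, \<omega>, j)) = lh n \<omega> m * vh n \<omega> m i * vh n \<omega> m j"
          by (simp only: sg mult_1_left)
        have 2: "Del n / real n * (Zl m (n, \<omega>, i) * Zups m (n, \<omega>, i) * Zups m (n, \<omega>, j)) = lam n m * u n m i * u n m j"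
          using alg[of "lam n m" 1 "u n m i" 1 "u n m j"] unfolding Zl_def Zups_def fst_conv snd_conv mult_1_left .
        show "lam n m * u n m i * u n m j - lh n \<omega> m * vh n \<omega> m i * vh n \<omega> m j
          = Del n / real n * (Zl m (n, \<omega>, i) * Zups m (n, \<omega>, i) * Zups m (n, \<omega>, j) - ZL m (n, \<omega>, i) * ZX m (n, \<omega>, i) * ZX m (n, \<omega>, j))"
          unfolding right_diff_distrib 1 2 ..
      qed
      have "\<bar>PD n \<omega> i j\<bar> \<le> Del n / real n * (\<Sum>m<d. 3 * (B * B * (c * ?t)))"
        unfolding eq abs_mult[of "Del n / real n"]
      proof (intro mult_mono)
        show "\<bar>\<Sum>m<d. Zl m (n, \<omega>, i) * Zups m (n, \<omega>, i) * Zups m (n, \<omega>, j) - ZL m (n, \<omega>, i) * ZX m (n, \<omega>, i) * ZX m (n, \<omega>, j)\<bar> \<le> (\<Sum>m<d. 3 * (B * B * (c * ?t)))"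
          by (rule order_trans[OF sum_abs sum_mono], rule triple_product_diff) (use diff bdd i j in auto)
      qed (use L in auto)
      moreover have "(\<Sum>m<d. 3 * (B * B * (c * ?t))) = G * ?t" by (simp add: G_def)
      ultimately show ?thesis by (simp only:)
    qed
    have G: "0 \<le> G" using B c by (simp add: G_def)
    have "(\<Sum>j<n. (PD n \<omega> i j)\<^sup>2) \<le> (\<Sum>j<n. (Del n / real n * (G * ?t))\<^sup>2)"
      by (intro sum_mono abs_le_square_iff[THEN iffD1]) (use PD L G t in auto)
    also have "\<dots> = real n * (Del n / real n * (G * ?t))\<^sup>2" by simp
    finally have "(\<Sum>j<n. (PD n \<omega> i j)\<^sup>2) / (snr n)\<^sup>2 \<le> real n * (Del n / real n * (G * ?t))\<^sup>2 / (snr n)\<^sup>2"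
      by (rule divide_right_mono) simp
    also have "\<dots> = G\<^sup>2 * ((ln (real n))\<^sup>2 / real n)"
      using L by (simp add: tau_def power_mult_distrib power_divide power2_eq_square)
    also have "\<dots> \<le> G\<^sup>2 * (real n powr gam / real n)"
      using N4(2)[OF nn(4)] by (intro mult_left_mono divide_right_mono) auto
    also have "\<dots> \<le> G\<^sup>2 * th n" using eta_over_n[OF nn(5)] by (intro mult_left_mono) auto
    finally have fin: "(\<Sum>j<n. (PD n \<omega> i j)\<^sup>2) / (snr n)\<^sup>2 \<le> G\<^sup>2 * th n" .
    have "0 \<le> (\<Sum>j<n. (PD n \<omega> i j)\<^sup>2) / (snr n)\<^sup>2" by (intro divide_nonneg_nonneg sum_nonneg) auto
    with fin show "\<bar>(\<Sum>j<fst (n, \<omega>, i). (PD (fst (n, \<omega>, i)) (fst (snd (n, \<omega>, i))) (snd (snd (n, \<omega>, i))) j)\<^sup>2) / (snr (fst (n, \<omega>, i)))\<^sup>2\<bar> \<le> G\<^sup>2 * \<bar>th (fst (n, \<omega>, i))\<bar>"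
      using th_pos[OF nn(5)] by simp
  qed
qed

lemma ZD_diff_hat: "(\<lambda>z. ZD Dh z - ZD D2 z) \<in> O[EF](\<lambda>z. th (fst z))"
proof -
  have "(\<lambda>z. 2 * ((\<Sum>j<fst z. E (fst z) (fst (snd z)) (snd (snd z)) j * PD (fst z) (fst (snd z)) (snd (snd z)) j) / (snr (fst z))\<^sup>2)
     + (\<Sum>j<fst z. (PD (fst z) (fst (snd z)) (snd (snd z)) j)\<^sup>2) / (snr (fst z))\<^sup>2) \<in> O[EF](\<lambda>z. th (fst z))"
    by (rule sum_in_bigo(1)[OF O_mult_bdd[OF _ cross_O] PD_O]) simp
  then show ?thesis by (simp add: ZD_def Dh_split add_divide_distrib)
qed

lemma ZD0_bdd: "ZD D0 \<in> bdE"
proof (rule bigo_EF_I[where N = NL and c = C])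
  fix n \<omega> i assume n: "NL \<le> n" "\<omega> \<in> S n" "i < n"
  note L = NL[OF n(1)]
  have s: "0 \<le> sigma2 n i j" "sigma2 n i j \<le> C * rho n" if "j < n" for j
    using Evar[OF L(1) n(3) that] by (auto simp: sigma2_def)
  have "D0 n \<omega> i \<le> (\<Sum>j<n. C * rho n)" unfolding D0_def by (intro sum_mono s) auto
  also have "\<dots> = C * (snr n)\<^sup>2" by (simp add: snr_sq[OF L(1)])
  finally have "D0 n \<omega> i \<le> C * (snr n)\<^sup>2" .
  moreover have "0 \<le> D0 n \<omega> i" unfolding D0_def by (intro sum_nonneg s) auto
  ultimately show "\<bar>ZD D0 (n, \<omega>, i)\<bar> \<le> C * \<bar>1\<bar>" using L by (simp add: ZD_def divide_le_eq)
qed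

lemma ZD_diff_pop: "(\<lambda>z. ZD D2 z - ZD D0 z) \<in> O[EF](\<lambda>z. th (fst z))"
proof (rule bigo_EF_I[where N = NL and c = K])
  fix n \<omega> i assume n: "NL \<le> n" "\<omega> \<in> S n" "i < n"
  note L = NL[OF n(1)]
  have "\<bar>D2 n \<omega> i - D0 n \<omega> i\<bar> \<le> K * ((snr n)\<^sup>2 / qn n * ln (real n))"
    using S_good[OF L(2) n(2)] n unfolding good_def D2_def D0_def sum_subtractf[symmetric] by blast
  then have "\<bar>D2 n \<omega> i - D0 n \<omega> i\<bar> / (snr n)\<^sup>2 \<le> K * ((snr n)\<^sup>2 / qn n * ln (real n)) / (snr n)\<^sup>2"
    by (rule divide_right_mono) simp
  also have "\<dots> = K * (1 / qn n * ln (real n))" using L by simp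
  also have "\<dots> \<le> K * th n" unfolding th_def using L K_nonneg by (intro mult_left_mono mult_right_mono) auto
  finally show "\<bar>ZD D2 (n, \<omega>, i) - ZD D0 (n, \<omega>, i)\<bar> \<le> K * \<bar>th (fst (n, \<omega>, i))\<bar>"
    using th_pos[OF n(1)] by (simp add: ZD_def flip: diff_divide_distrib)
qed

lemma close_D2_D0: "close (ZD D2) (ZD D0)" by (rule closeI[OF ZD0_bdd ZD_diff_pop])
lemma close_Dh_D2: "close (ZD Dh) (ZD D2)"
  by (rule closeI[OF _ ZD_diff_hat]) (use close_D2_D0 in \<open>simp add: close_def\<close>)
lemma close_Dh_D0: "close (ZD Dh) (ZD D0)"
proof (rule closeI[OF ZD0_bdd])
  have "(\<lambda>z. (ZD Dh z - ZD D2 z) + (ZD D2 z - ZD D0 z)) \<in> O[EF](\<lambda>z. th (fst z))"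
    by (rule sum_in_bigo(1)[OF ZD_diff_hat ZD_diff_pop])
  then show "(\<lambda>z. ZD Dh z - ZD D0 z) \<in> O[EF](\<lambda>z. th (fst z))" by simp
qed

lemma bhat_nbias:
  assumes n: "n \<ge> NL" and w: "\<omega> \<in> S n" and i: "i < n" and k: "k < d"
    and sg: "\<And>m. m < d \<Longrightarrow> sgn (alp n \<omega> m m) * sgn (alp n \<omega> m m) = 1"
  shows "sqrt (real n) * (sgn (alp n \<omega> k k) * bhat_of k n \<omega> i) = (tau n)\<^sup>2 * nbias ZL ZX (ZD Dh) k (n, \<omega>, i)"
proof -
  have "sgn (alp n \<omega> k k) * bhat_of k n \<omega> i = bias_formula n d (lh n \<omega>) (\<lambda>m j. sgn (alp n \<omega> m m) * vh n \<omega> m j) (Dh n \<omega>) k i"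
    unfolding bhat_of_def by (rule bias_formula_signs[symmetric, OF sg k])
  moreover have "sqrt (real n) * bias_formula n d (lh n \<omega>) (\<lambda>m j. sgn (alp n \<omega> m m) * vh n \<omega> m j) (Dh n \<omega>) k i
     = (tau n)\<^sup>2 * nbias ZL ZX (ZD Dh) k (n, \<omega>, i)"
    by (rule bias_formula_nbias[where Lm = "lh n \<omega>" and k = k, OF n i lh_nz[OF n w k]])
       (simp_all add: ZL_def ZX_def Zal_def Znu_def Epow_0 ZD_def)
  ultimately show ?thesis by simp
qed

lemma pop_nbias:
  assumes n: "n \<ge> NL" and i: "i < n" and k: "k < d"
  shows "sqrt (real n) * bias_formula n d (lam n) (u n) (D n \<omega>) k i = (tau n)\<^sup>2 * nbias Zl Zups (ZD D) k (n, \<omega>, i)"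
proof (rule bias_formula_nbias[OF n i])
  show "lam n k \<noteq> 0" using lam_ge[OF k, of n] NL(12)[OF n] by auto
qed (simp_all add: Zl_def Zups_def ZD_def)

text \<open>Stated for any row variance close to the estimate, because it is used twice: with
  \<open>D0\<close> for the error bound and with \<open>D2\<close> for the expansion of the
  corrected eigenvector.\<close>

lemma bias_comparison:
  assumes k: "k < d" and D: "close (ZD Dh) (ZD D)"
  obtains c N where "c > 0" "N \<ge> NL" "\<And>n \<omega> i. n \<ge> N \<Longrightarrow> \<omega> \<in> S n \<Longrightarrow> i < n \<Longrightarrow>
    \<bar>sgn (alp n \<omega> k k) * bhat_of k n \<omega> i - bias_formula n d (lam n) (u n) (D n \<omega>) k i\<bar> \<le> c * ((tau n)\<^sup>2 / sqrt (real n) * th n)"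
proof -
  have "(\<lambda>z. nbias ZL ZX (ZD Dh) k z - nbias Zl Zups (ZD D) k z) \<in> O[EF](\<lambda>z. th (fst z))"
    using close_nbias[OF k D] by (simp add: close_def)
  then obtain c N1 where c: "c > 0" "\<And>n \<omega> i. n \<ge> N1 \<Longrightarrow> \<omega> \<in> S n \<Longrightarrow> i < n \<Longrightarrow>
     \<bar>nbias ZL ZX (ZD Dh) k (n, \<omega>, i) - nbias Zl Zups (ZD D) k (n, \<omega>, i)\<bar> \<le> c * \<bar>th n\<bar>"
    by (rule bigo_EF_E) auto
  have "eventually (\<lambda>z. \<forall>m\<in>{..<d}. sgn (Zal m m z) * sgn (Zal m m z) = 1) EF"
    by (rule eventually_ball_finite) (use sgn_sq_E in auto)
  then obtain N3 where N3: "\<And>n \<omega> i. n \<ge> N3 \<Longrightarrow> \<omega> \<in> S n \<Longrightarrow> i < n \<Longrightarrow> \<forall>m\<in>{..<d}. sgn (Zal m m (n, \<omega>, i)) * sgn (Zal m m (n, \<omega>, i)) = 1"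
    unfolding eventually_EF by blast
  show ?thesis
  proof (rule that[OF c(1), of "max NL (max N1 N3)"])
    fix n \<omega> i assume n: "max NL (max N1 N3) \<le> n" and w: "\<omega> \<in> S n" and i: "i < n"
    have nL: "NL \<le> n" using n by simp
    note L = NL[OF nL]
    have sg: "sgn (alp n \<omega> m m) * sgn (alp n \<omega> m m) = 1" if "m < d" for m
      using N3[of n \<omega> i] n w i that by (simp add: Zal_def)
    have sq: "0 < sqrt (real n)" using L by simp
    let ?x = "sgn (alp n \<omega> k k) * bhat_of k n \<omega> i - bias_formula n d (lam n) (u n) (D n \<omega>) k i"
    have "sqrt (real n) * ?x = (tau n)\<^sup>2 * (nbias ZL ZX (ZD Dh) k (n, \<omega>, i) - nbias Zl Zups (ZD D) k (n, \<omega>, i))"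
      using bhat_nbias[OF nL w i k sg] pop_nbias[OF nL i k, of D \<omega>] by (simp add: right_diff_distrib)
    then have "sqrt (real n) * \<bar>?x\<bar> = (tau n)\<^sup>2 * \<bar>nbias ZL ZX (ZD Dh) k (n, \<omega>, i) - nbias Zl Zups (ZD D) k (n, \<omega>, i)\<bar>"
      by (metis abs_mult abs_of_pos[OF sq] abs_power2)
    also have "\<dots> \<le> (tau n)\<^sup>2 * (c * th n)"
      using c(2)[of n \<omega> i] n w i th_pos[OF nL] by (intro mult_left_mono) auto
    finally show "\<bar>?x\<bar> \<le> c * ((tau n)\<^sup>2 / sqrt (real n) * th n)" using sq by (simp add: field_simps)
  qed simp
qed

end

section \<open>The bias-corrected eigenvector\<close>

context spiked_noise
begin

text \<open>The event and its constant depend on the exponent \<open>c\<close>, so the locale of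
  deterministic estimates is instantiated anew for each \<open>c\<close>. Below the threshold the
  event is taken empty, which keeps it inside the sample space.\<close>

lemma event_exists:
  assumes c: "0 < c"
  shows "\<exists>K S NS. spiked_event M E N0 rho qn eps C A0 d p lam u lamA uhat betaD C1 C2 delta0 Cmu S K NS
     \<and> (\<forall>n\<ge>NS. S n \<in> sets (M n) \<and> 1 - real n powr (- c) \<le> measure (M n) (S n))"
proof -
  obtain K where K: "0 \<le> K" "hp c (good K gam (Suc Q0))" using good_whp[OF c gam(1)] by blast
  then obtain NS where NS: "\<And>n. n \<ge> NS \<Longrightarrow> \<exists>S. S \<in> sets (M n) \<and> 1 - real n powr (- c) \<le> measure (M n) S \<and> (\<forall>\<omega>\<in>S. good K gam (Suc Q0) n \<omega>)"
    unfolding hp_def by blast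
  define S where "S n = (if n \<ge> NS then (SOME S. S \<in> sets (M n) \<and> 1 - real n powr (- c) \<le> measure (M n) S \<and> (\<forall>\<omega>\<in>S. good K gam (Suc Q0) n \<omega>)) else {})" for n
  have S: "S n \<in> sets (M n) \<and> 1 - real n powr (- c) \<le> measure (M n) (S n) \<and> (\<forall>\<omega>\<in>S n. good K gam (Suc Q0) n \<omega>)" if "n \<ge> NS" for n
    using someI_ex[OF NS[OF that]] that by (simp add: S_def)
  have "spiked_event M E N0 rho qn eps C A0 d p lam u lamA uhat betaD C1 C2 delta0 Cmu S K NS"
  proof (intro spiked_event.intro spiked_noise_axioms spiked_event_axioms.intro)
    fix n show "S n \<subseteq> space (M n)"
    proof (cases "n \<ge> NS")
      case True then show ?thesis using S sets.sets_into_space by blast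
    qed (simp add: S_def)
  qed (use S K in auto)
  then show ?thesis using S by blast
qed

lemma bias_estimate:
  assumes c: "0 < c" and k: "k < d"
  shows "\<exists>K N. 0 < K \<and> (\<forall>n\<ge>N. N0 \<le> n \<and> 0 < n \<and> (\<exists>S\<in>sets (M n). 1 - real n powr (- c) \<le> measure (M n) S \<and>
     (\<forall>\<omega>\<in>S. \<forall>i<n. \<bar>sgn (alp n \<omega> k k) * bhat_of k n \<omega> i - bias_formula n d (lam n) (u n) (D0 n \<omega>) k i\<bar>
        \<le> K * ((tau n)\<^sup>2 / sqrt (real n) * (max (1 / qn n) (tau n) * ln (real n))))))"
proof -
  obtain K S NS where sp: "spiked_event M E N0 rho qn eps C A0 d p lam u lamA uhat betaD C1 C2 delta0 Cmu S K NS"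
    and S: "\<And>n. n \<ge> NS \<Longrightarrow> S n \<in> sets (M n) \<and> 1 - real n powr (- c) \<le> measure (M n) (S n)"
    using event_exists[OF c] by blast
  interpret spiked_event M E N0 rho qn eps C A0 d p lam u lamA uhat betaD C1 C2 delta0 Cmu S K NS by (rule sp)
  obtain c1 N where c1: "c1 > 0" "N \<ge> NL" "\<And>n \<omega> i. n \<ge> N \<Longrightarrow> \<omega> \<in> S n \<Longrightarrow> i < n \<Longrightarrow>
    \<bar>sgn (alp n \<omega> k k) * bhat_of k n \<omega> i - bias_formula n d (lam n) (u n) (D0 n \<omega>) k i\<bar> \<le> c1 * ((tau n)\<^sup>2 / sqrt (real n) * th n)"
    by (rule bias_comparison[OF k close_Dh_D0]) blast
  show ?thesis
  proof (intro exI[of _ c1] exI[of _ N] conjI allI impI c1(1))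
    fix n assume n: "N \<le> n"
    then have nL: "NL \<le> n" using c1(2) by simp
    show "N0 \<le> n" "0 < n" using NL[OF nL] by auto
    show "\<exists>S\<in>sets (M n). 1 - real n powr (- c) \<le> measure (M n) S \<and>
     (\<forall>\<omega>\<in>S. \<forall>i<n. \<bar>sgn (alp n \<omega> k k) * bhat_of k n \<omega> i - bias_formula n d (lam n) (u n) (D0 n \<omega>) k i\<bar>
        \<le> c1 * ((tau n)\<^sup>2 / sqrt (real n) * (max (1 / qn n) (tau n) * ln (real n))))"
      using S[OF NL(2)[OF nL]] c1(3)[OF n] unfolding th_def by (intro bexI[of _ "S n"]) auto
  qed
qed

text \<open>Kernel of the operator in the bias formula, without its identity part. The coefficient
  \<open>c\<close> is 1 for the linear term of the eigenvector and 3/2 for the quadratic term and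
  the bias.\<close>

definition gc :: "real \<Rightarrow> nat \<Rightarrow> nat \<Rightarrow> nat \<Rightarrow> nat \<Rightarrow> real" where
  "gc c k n i j = - c * (u n k i * u n k j) + (\<Sum>m\<in>{..<d} - {k}. lam n m / (lam n k - lam n m) * (u n m i * u n m j))"

definition app :: "real \<Rightarrow> nat \<Rightarrow> nat \<Rightarrow> (nat \<Rightarrow> real) \<Rightarrow> nat \<Rightarrow> real" where
  "app c k n Y i = Y i + (\<Sum>j<n. gc c k n i j * Y j)"

lemma app_inner:
  "app c k n Y i = Y i - c * u n k i * inner_n n (u n k) Y
     + (\<Sum>m\<in>{..<d} - {k}. lam n m / (lam n k - lam n m) * u n m i * inner_n n (u n m) Y)"
proof -
  have "(\<Sum>j<n. gc c k n i j * Y j) = (\<Sum>j<n. - c * u n k i * (u n k j * Y j))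
     + (\<Sum>j<n. \<Sum>m\<in>{..<d} - {k}. lam n m / (lam n k - lam n m) * u n m i * (u n m j * Y j))"
    unfolding gc_def distrib_right sum.distrib sum_distrib_right by (simp add: mult_ac)
  also have "(\<Sum>j<n. \<Sum>m\<in>{..<d} - {k}. lam n m / (lam n k - lam n m) * u n m i * (u n m j * Y j))
     = (\<Sum>m\<in>{..<d} - {k}. lam n m / (lam n k - lam n m) * u n m i * inner_n n (u n m) Y)"
    unfolding inner_n_def sum_distrib_left by (rule sum.swap)
  also have "(\<Sum>j<n. - c * u n k i * (u n k j * Y j)) = - c * u n k i * inner_n n (u n k) Y"
    unfolding inner_n_def sum_distrib_left ..
  finally show ?thesis by (simp add: app_def)
qed

lemma bias_formula_app:
  "bias_formula n d (lam n) (u n) Dg k i = app (3/2) k n (\<lambda>j. Dg j * u n k j) i / (lam n k)\<^sup>2"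
proof -
  have "inner_n n x (\<lambda>j. Dg j * u n k j / (lam n k)\<^sup>2) = inner_n n x (\<lambda>j. Dg j * u n k j) / (lam n k)\<^sup>2" for x
    unfolding inner_n_def sum_divide_distrib by simp
  then show ?thesis
    unfolding bias_formula_def Let_def app_inner
    by (simp add: add_divide_distrib diff_divide_distrib sum_divide_distrib)
qed

lemma app_diff: "app c k n (\<lambda>j. Y j - Y' j) i = app c k n Y i - app c k n Y' i"
  by (simp add: app_def right_diff_distrib sum_subtractf)

definition cg :: "real \<Rightarrow> real" where "cg c = (\<bar>c\<bar> + real d * kap) * Ku\<^sup>2"

lemma gc_bound:
  assumes n: "n \<ge> N0" and ij: "i < n" "j < n" and k: "k < d"
  shows "\<bar>gc c k n i j\<bar> \<le> cg c / real n"
proof -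
  have n0: "0 < n" using ij by simp
  have uu: "\<bar>u n m i * u n m j\<bar> \<le> Ku\<^sup>2 / real n" if "m < d" for m
  proof -
    have "\<bar>u n m i * u n m j\<bar> \<le> (Ku / sqrt (real n)) * (Ku / sqrt (real n))"
      unfolding abs_mult using u_bound[OF n ij(1) that] u_bound[OF n ij(2) that] Ku_pos n0 by (intro mult_mono) auto
    then show ?thesis by (simp add: power2_eq_square)
  qed
  have co: "\<bar>lam n m / (lam n k - lam n m)\<bar> \<le> kap" if "m < d" "m \<noteq> k" for m
  proof -
    have D: "0 < Del n" by (rule Del_pos[OF n n0])
    have "\<bar>lam n m\<bar> \<le> kap * Del n" by (rule lam_le[OF n that(1)])
    also have "\<dots> \<le> kap * \<bar>lam n k - lam n m\<bar>" using lam_gap[OF n k that(1)] that kap_pos by (intro mult_left_mono) auto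
    finally show ?thesis using lam_gap[OF n k that(1)] that D by (simp add: divide_le_eq)
  qed
  have "\<bar>gc c k n i j\<bar> \<le> \<bar>- c * (u n k i * u n k j)\<bar> + \<bar>\<Sum>m\<in>{..<d} - {k}. lam n m / (lam n k - lam n m) * (u n m i * u n m j)\<bar>"
    unfolding gc_def by (rule abs_triangle_ineq)
  also have "\<dots> \<le> \<bar>c\<bar> * (Ku\<^sup>2 / real n) + (\<Sum>m\<in>{..<d} - {k}. kap * (Ku\<^sup>2 / real n))"
  proof (intro add_mono)
    show "\<bar>- c * (u n k i * u n k j)\<bar> \<le> \<bar>c\<bar> * (Ku\<^sup>2 / real n)"
      unfolding abs_mult[of "- c"] using uu[OF k] by (intro mult_mono) auto
    show "\<bar>\<Sum>m\<in>{..<d} - {k}. lam n m / (lam n k - lam n m) * (u n m i * u n m j)\<bar> \<le> (\<Sum>m\<in>{..<d} - {k}. kap * (Ku\<^sup>2 / real n))"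
      by (rule order_trans[OF sum_abs sum_mono], subst abs_mult, intro mult_mono) (use uu co kap_pos in auto)
  qed
  also have "(\<Sum>m\<in>{..<d} - {k}. kap * (Ku\<^sup>2 / real n)) \<le> real d * (kap * (Ku\<^sup>2 / real n))"
  proof -
    have "real (card ({..<d} - {k})) * (kap * (Ku\<^sup>2 / real n)) \<le> real d * (kap * (Ku\<^sup>2 / real n))"
      using kap_pos card_mono[of "{..<d}" "{..<d} - {k}"] by (intro mult_right_mono) auto
    then show ?thesis by (simp only: sum_constant)
  qed
  finally show ?thesis by (simp add: cg_def distrib_right add_divide_distrib mult.assoc)
qed

text \<open>Delocalisation makes the kernel entries of order \<open>1 / n\<close>, so by
  Cauchy-Schwarz the operator inflates coordinatewise second moments by a constant only. Chebyshev's
  inequality then suffices for a bound in probability at a single coordinate.\<close>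

lemma app_second_moment:
  assumes n: "n \<ge> N0" and i: "i < n" and k: "k < d"
    and Y: "\<And>j. j < n \<Longrightarrow> (\<lambda>\<omega>. Y \<omega> j) \<in> borel_measurable (M n)"
      "\<And>j. j < n \<Longrightarrow> integrable (M n) (\<lambda>\<omega>. (Y \<omega> j)\<^sup>2)"
      "\<And>j. j < n \<Longrightarrow> integral\<^sup>L (M n) (\<lambda>\<omega>. (Y \<omega> j)\<^sup>2) \<le> V\<^sup>2"
    and V: "0 < V" and t: "0 < t"
  shows "measure (M n) {\<omega> \<in> space (M n). \<bar>app c k n (Y \<omega>) i\<bar> \<ge> t * V} \<le> (2 + 2 * (cg c)\<^sup>2) / t\<^sup>2"
    and "(\<lambda>\<omega>. app c k n (Y \<omega>) i) \<in> borel_measurable (M n)"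
proof -
  interpret prob_space "M n" by (rule prob)
  have n0: "0 < real n" using i by simp
  show meas: "(\<lambda>\<omega>. app c k n (Y \<omega>) i) \<in> borel_measurable (M n)"
    unfolding app_def using Y(1) i by (intro borel_measurable_add borel_measurable_sum borel_measurable_times) auto
  let ?R = "\<lambda>\<omega>. 2 * (Y \<omega> i)\<^sup>2 + 2 * ((cg c)\<^sup>2 / real n * (\<Sum>j<n. (Y \<omega> j)\<^sup>2))"
  have le: "(app c k n (Y \<omega>) i)\<^sup>2 \<le> ?R \<omega>" for \<omega>
  proof -
    have "(\<Sum>j<n. gc c k n i j * Y \<omega> j)\<^sup>2 \<le> (\<Sum>j<n. (gc c k n i j)\<^sup>2) * (\<Sum>j<n. (Y \<omega> j)\<^sup>2)"
      by (rule Cauchy_Schwarz_ineq_sum)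
    also have "(\<Sum>j<n. (gc c k n i j)\<^sup>2) \<le> (\<Sum>j<n. (cg c / real n)\<^sup>2)"
      using gc_bound[OF n i _ k] by (intro sum_mono) (metis abs_ge_zero lessThan_iff power2_abs power_mono)
    also have "(\<Sum>j<n. (cg c / real n)\<^sup>2) = (cg c)\<^sup>2 / real n" using n0 by (simp add: power_divide power2_eq_square)
    finally have "(\<Sum>j<n. gc c k n i j * Y \<omega> j)\<^sup>2 \<le> (cg c)\<^sup>2 / real n * (\<Sum>j<n. (Y \<omega> j)\<^sup>2)"
      by (simp add: mult_right_mono sum_nonneg)
    moreover have "(x + y)\<^sup>2 \<le> 2 * x\<^sup>2 + 2 * y\<^sup>2" for x y :: real
      using sum_squares_bound[of x y] by (simp add: power2_sum)
    ultimately show ?thesis unfolding app_def by (smt (verit, best))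
  qed
  have intR: "integrable (M n) ?R"
    using Y(2) i by (intro Bochner_Integration.integrable_add integrable_mult_right Bochner_Integration.integrable_sum) auto
  have "prob {\<omega> \<in> space (M n). \<bar>app c k n (Y \<omega>) i\<bar> \<ge> t * V} \<le> prob {\<omega> \<in> space (M n). (t * V)\<^sup>2 \<le> ?R \<omega>}"
  proof (rule finite_measure_mono)
    show "{\<omega> \<in> space (M n). \<bar>app c k n (Y \<omega>) i\<bar> \<ge> t * V} \<subseteq> {\<omega> \<in> space (M n). (t * V)\<^sup>2 \<le> ?R \<omega>}"
    proof
      fix \<omega> assume w: "\<omega> \<in> {\<omega> \<in> space (M n). \<bar>app c k n (Y \<omega>) i\<bar> \<ge> t * V}"
      then have "(t * V)\<^sup>2 \<le> \<bar>app c k n (Y \<omega>) i\<bar>\<^sup>2" using t V by (intro power_mono) auto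
      also have "\<dots> \<le> ?R \<omega>" using le[of \<omega>] by simp
      finally show "\<omega> \<in> {\<omega> \<in> space (M n). (t * V)\<^sup>2 \<le> ?R \<omega>}" using w by simp
    qed
    show "{\<omega> \<in> space (M n). (t * V)\<^sup>2 \<le> ?R \<omega>} \<in> sets (M n)"
      using borel_measurable_integrable[OF intR] by (intro borel_measurable_le) auto
  qed
  also have "\<dots> \<le> expectation ?R / (t * V)\<^sup>2"
    by (rule integral_Markov_inequality_measure[where A = "{}", OF intR])
       (use t V in \<open>auto intro!: add_nonneg_nonneg mult_nonneg_nonneg divide_nonneg_nonneg sum_nonneg\<close>)
  also have "expectation ?R = 2 * expectation (\<lambda>\<omega>. (Y \<omega> i)\<^sup>2) + 2 * ((cg c)\<^sup>2 / real n * (\<Sum>j<n. expectation (\<lambda>\<omega>. (Y \<omega> j)\<^sup>2)))"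
  proof -
    have s: "expectation (\<lambda>\<omega>. \<Sum>j<n. (Y \<omega> j)\<^sup>2) = (\<Sum>j<n. expectation (\<lambda>\<omega>. (Y \<omega> j)\<^sup>2))"
      by (rule Bochner_Integration.integral_sum) (use Y(2) in auto)
    show ?thesis
      unfolding s[symmetric] integral_mult_right_zero[symmetric]
      by (rule Bochner_Integration.integral_add) (use Y(2) i in \<open>auto intro!: integrable_mult_right Bochner_Integration.integrable_sum simp del: integrable_mult_right_iff\<close>)
  qed
  also have "\<dots> \<le> 2 * V\<^sup>2 + 2 * ((cg c)\<^sup>2 / real n * (\<Sum>j<n. V\<^sup>2))"
    using Y(3) i by (intro add_mono mult_left_mono sum_mono) auto
  also have "\<dots> = (2 + 2 * (cg c)\<^sup>2) * V\<^sup>2" using n0 by (simp add: algebra_simps)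
  finally show "prob {\<omega> \<in> space (M n). \<bar>app c k n (Y \<omega>) i\<bar> \<ge> t * V} \<le> (2 + 2 * (cg c)\<^sup>2) / t\<^sup>2"
    using V t by (simp add: divide_right_mono power_mult_distrib)
qed

lemma coordOP_app:
  assumes k: "k < d" and Nb: "N0 \<le> Nb"
    and X: "\<And>n \<omega> i. n \<ge> Nb \<Longrightarrow> i < n \<Longrightarrow> X n \<omega> i = app c k n (Y n \<omega>) i / lam n k ^ r"
    and Y: "\<And>n j. n \<ge> Nb \<Longrightarrow> j < n \<Longrightarrow> (\<lambda>\<omega>. Y n \<omega> j) \<in> borel_measurable (M n)"
      "\<And>n j. n \<ge> Nb \<Longrightarrow> j < n \<Longrightarrow> integrable (M n) (\<lambda>\<omega>. (Y n \<omega> j)\<^sup>2)"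
      "\<And>n j. n \<ge> Nb \<Longrightarrow> j < n \<Longrightarrow> integral\<^sup>L (M n) (\<lambda>\<omega>. (Y n \<omega> j)\<^sup>2) \<le> (V n)\<^sup>2"
    and V: "\<And>n. n \<ge> Nb \<Longrightarrow> 0 < n \<Longrightarrow> 0 < V n" "\<And>n. n \<ge> Nb \<Longrightarrow> 0 < n \<Longrightarrow> V n / Del n ^ r \<le> K0 * W n"
  shows "coordOP M X W"
  unfolding coordOP_def
proof (intro allI impI)
  fix e :: real assume e: "0 < e"
  \<comment> \<open>Chosen so that the bound of \<open>app_second_moment\<close> equals
    \<open>e\<close> exactly, independently of \<open>n\<close> and of the coordinate.\<close>
  define t where "t = sqrt ((2 + 2 * (cg c)\<^sup>2) / e)"
  have tp: "0 < t" unfolding t_def using e by (intro real_sqrt_gt_zero divide_pos_pos add_pos_nonneg) auto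
  have "t\<^sup>2 = (2 + 2 * (cg c)\<^sup>2) / e" unfolding t_def using e by simp
  then have te: "(2 + 2 * (cg c)\<^sup>2) / t\<^sup>2 = e" using e by (simp add: add_pos_nonneg add_nonneg_eq_0_iff)
  show "\<exists>K N. \<forall>n\<ge>N. \<forall>i<n. \<exists>S\<in>sets (M n). 1 - e \<le> measure (M n) S \<and> (\<forall>\<omega>\<in>S. \<bar>X n \<omega> i\<bar> \<le> K * W n)"
  proof (intro exI[of _ "t * K0"] exI[of _ Nb] allI impI)
    fix n i assume n: "Nb \<le> n" and i: "i < n"
    have n0: "N0 \<le> n" "0 < n" using n i Nb by auto
    have D: "0 < Del n" by (rule Del_pos[OF n0])
    note m = app_second_moment[where c = c, OF n0(1) i k Y[OF n] V(1)[OF n n0(2)] tp]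
    have "measure (M n) {\<omega> \<in> space (M n). \<bar>app c k n (Y n \<omega>) i\<bar> \<ge> t * V n} \<le> e" using m(1) te by simp
    from event_of_deviation[OF m(2) this] obtain S where S: "S \<in> sets (M n)" "1 - e \<le> measure (M n) S"
      "\<And>\<omega>. \<omega> \<in> S \<Longrightarrow> \<bar>app c k n (Y n \<omega>) i\<bar> \<le> t * V n" by auto
    have "\<bar>X n \<omega> i\<bar> \<le> t * K0 * W n" if "\<omega> \<in> S" for \<omega>
    proof -
      have "Del n ^ r \<le> \<bar>lam n k\<bar> ^ r" using lam_ge[OF k, of n] D by (intro power_mono) auto
      then have "\<bar>X n \<omega> i\<bar> \<le> (t * V n) / Del n ^ r"
        unfolding X[OF n i] abs_divide power_abs using S(3)[OF that] D V(1)[OF n n0(2)] tp by (intro frac_le) auto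
      also have "\<dots> = t * (V n / Del n ^ r)" by simp
      also have "\<dots> \<le> t * (K0 * W n)" using V(2)[OF n n0(2)] tp by (intro mult_left_mono) auto
      finally show ?thesis by simp
    qed
    then show "\<exists>S\<in>sets (M n). 1 - e \<le> measure (M n) S \<and> (\<forall>\<omega>\<in>S. \<bar>X n \<omega> i\<bar> \<le> t * K0 * W n)"
      using S by (intro bexI[of _ S]) auto
  qed
qed

definition Lk :: "nat \<Rightarrow> nat \<Rightarrow> nat \<Rightarrow> nat \<Rightarrow> nat \<Rightarrow> real" where
  "Lk k n i j l = ((if i = j then 1 else 0) + gc 1 k n i j) * u n k l / lam n k"

text \<open>The diagonal of \<open>E\<^sup>2\<close> is removed from the quadratic term: what remains has mean zero.\<close>

definition Qk :: "nat \<Rightarrow> nat \<Rightarrow> nat \<Rightarrow> nat \<Rightarrow> nat \<Rightarrow> nat \<Rightarrow> nat \<Rightarrow> real" where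
  "Qk k n i j l j' l' = (if l = j' \<and> l' \<noteq> j then ((if i = j then 1 else 0) + gc (3/2) k n i j) * u n k l' / (lam n k)\<^sup>2 else 0)"

text \<open>Written with \<open>E j l * E l j\<close> and not with a square, so that its
  identification with \<open>quadmap\<close> is purely algebraic; symmetry enters only when the
  removed part is recognised as \<open>D2\<close>.\<close>

definition off2 :: "nat \<Rightarrow> nat \<Rightarrow> 'a \<Rightarrow> nat \<Rightarrow> real" where
  "off2 k n \<omega> j = Epow n \<omega> 2 (u n k) j - (\<Sum>l<n. E n \<omega> j l * E n \<omega> l j) * u n k j"

lemma app_delta: "i < n \<Longrightarrow> (\<Sum>j<n. ((if i = j then 1 else 0) + gc c k n i j) * Y j) = app c k n Y i"
  by (simp add: app_def distrib_right sum.distrib if_distrib[of "\<lambda>x. x * _"] cong: if_cong)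

lemma linmap_app: "i < n \<Longrightarrow> linmap n (Lk k n) (E n \<omega>) i = app 1 k n (Epow n \<omega> 1 (u n k)) i / lam n k ^ 1"
proof -
  assume i: "i < n"
  have "linmap n (Lk k n) (E n \<omega>) i = (\<Sum>j<n. ((if i = j then 1 else 0) + gc 1 k n i j) * Epow n \<omega> 1 (u n k) j) / lam n k"
    unfolding linmap_def Lk_def Epow_1 mv_def sum_distrib_left sum_divide_distrib
    by (intro sum.cong refl) (simp add: mult_ac)
  then show ?thesis using app_delta[OF i] by simp
qed

lemma off2_expand: "j < n \<Longrightarrow> off2 k n \<omega> j = (\<Sum>l<n. \<Sum>l'<n. if l' \<noteq> j then E n \<omega> j l * E n \<omega> l l' * u n k l' else 0)"
proof -
  assume j: "j < n"
  have "Epow n \<omega> 2 (u n k) j = (\<Sum>l<n. E n \<omega> j l * (\<Sum>l'<n. E n \<omega> l l' * u n k l'))"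
    by (simp add: Epow_def numeral_2_eq_2 mv_def[of n "E n \<omega>" "mv n (E n \<omega>) (u n k)"]) (simp add: mv_def)
  also have "\<dots> = (\<Sum>l<n. \<Sum>l'<n. E n \<omega> j l * E n \<omega> l l' * u n k l')"
    by (simp add: sum_distrib_left mult.assoc)
  also have "\<dots> = (\<Sum>l<n. (\<Sum>l'<n. if l' \<noteq> j then E n \<omega> j l * E n \<omega> l l' * u n k l' else 0) + E n \<omega> j l * E n \<omega> l j * u n k j)"
  proof (intro sum.cong refl)
    fix l
    have "(\<Sum>l'<n. E n \<omega> j l * E n \<omega> l l' * u n k l')
       = (\<Sum>l'<n. (if l' \<noteq> j then E n \<omega> j l * E n \<omega> l l' * u n k l' else 0) + (if l' = j then E n \<omega> j l * E n \<omega> l l' * u n k l' else 0))"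
      by (intro sum.cong) auto
    then show "(\<Sum>l'<n. E n \<omega> j l * E n \<omega> l l' * u n k l')
       = (\<Sum>l'<n. if l' \<noteq> j then E n \<omega> j l * E n \<omega> l l' * u n k l' else 0) + E n \<omega> j l * E n \<omega> l j * u n k j"
      using j by (simp add: sum.distrib)
  qed
  finally show ?thesis by (simp add: off2_def sum.distrib sum_distrib_right)
qed

lemma quadmap_app: "i < n \<Longrightarrow> quadmap n (Qk k n) (E n \<omega>) i = app (3/2) k n (off2 k n \<omega>) i / (lam n k)\<^sup>2"
proof -
  assume i: "i < n"
  have "(\<Sum>j'<n. \<Sum>l'<n. Qk k n i j l j' l' * E n \<omega> j l * E n \<omega> j' l')
     = ((if i = j then 1 else 0) + gc (3/2) k n i j) / (lam n k)\<^sup>2 * (\<Sum>l'<n. if l' \<noteq> j then E n \<omega> j l * E n \<omega> l l' * u n k l' else 0)"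
    if "l < n" for j l
  proof -
    have "(\<Sum>j'<n. \<Sum>l'<n. Qk k n i j l j' l' * E n \<omega> j l * E n \<omega> j' l')
      = (\<Sum>j'<n. if j' = l then (\<Sum>l'<n. Qk k n i j l j' l' * E n \<omega> j l * E n \<omega> j' l') else 0)"
      by (intro sum.cong) (auto simp: Qk_def)
    also have "\<dots> = (\<Sum>l'<n. Qk k n i j l l l' * E n \<omega> j l * E n \<omega> l l')" using that by simp
    also have "\<dots> = ((if i = j then 1 else 0) + gc (3/2) k n i j) / (lam n k)\<^sup>2 * (\<Sum>l'<n. if l' \<noteq> j then E n \<omega> j l * E n \<omega> l l' * u n k l' else 0)"
      unfolding sum_distrib_left by (intro sum.cong refl) (simp add: Qk_def mult_ac)
    finally show ?thesis .
  qed
  then have "quadmap n (Qk k n) (E n \<omega>) i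
    = (\<Sum>j<n. \<Sum>l<n. ((if i = j then 1 else 0) + gc (3/2) k n i j) / (lam n k)\<^sup>2 * (\<Sum>l'<n. if l' \<noteq> j then E n \<omega> j l * E n \<omega> l l' * u n k l' else 0))"
    unfolding quadmap_def by (intro sum.cong refl) auto
  also have "\<dots> = (\<Sum>j<n. ((if i = j then 1 else 0) + gc (3/2) k n i j) * off2 k n \<omega> j) / (lam n k)\<^sup>2"
    unfolding sum_divide_distrib
  proof (intro sum.cong refl)
    fix j assume "j \<in> {..<n}"
    then have j: "j < n" by simp
    show "(\<Sum>l<n. ((if i = j then 1 else 0) + gc (3/2) k n i j) / (lam n k)\<^sup>2 * (\<Sum>l'<n. if l' \<noteq> j then E n \<omega> j l * E n \<omega> l l' * u n k l' else 0))
       = ((if i = j then 1 else 0) + gc (3/2) k n i j) * off2 k n \<omega> j / (lam n k)\<^sup>2"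
      unfolding off2_expand[OF j] sum_distrib_left[symmetric] by simp
  qed
  finally show ?thesis using app_delta[OF i] by simp
qed

text \<open>The edges \<open>{j, l}\<close> and \<open>{l, l'}\<close> share \<open>l\<close> and
  differ in the other endpoint, so they are distinct as unordered pairs and the two factors are
  independent and centred.\<close>

lemma off_diagonal_mean_zero:
  assumes n: "n \<ge> N0" and j: "j < n" and l: "l < n" and l': "l' < n" and ne: "l' \<noteq> j"
  shows "integrable (M n) (\<lambda>\<omega>. E n \<omega> j l * E n \<omega> l l')" "integral\<^sup>L (M n) (\<lambda>\<omega>. E n \<omega> j l * E n \<omega> l l') = 0"
proof -
  interpret prob_space "M n" by (rule prob)
  let ?a = "canon (l, j)" and ?b = "canon (l, l')"
  define X where "X = (\<lambda>e \<omega>. E n \<omega> (fst e) (snd e))"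
  have ab: "?a \<noteq> ?b" using canon_inj ne by metis
  have sub: "{?a, ?b} \<subseteq> upper_pairs n" using j l l' by (auto simp: canon_def upper_pairs_def)
  have "indep_vars (\<lambda>_. borel) (\<lambda>(i, j) \<omega>. E n \<omega> i j) {?a, ?b}"
    by (rule indep_vars_subset[OF Eindep[OF n, folded upper_pairs_def] sub])
  then have ind: "indep_vars (\<lambda>_. borel) X {?a, ?b}" by (simp add: X_def case_prod_unfold)
  have X: "integrable (M n) (X e)" "expectation (X e) = 0" if "e \<in> {?a, ?b}" for e
    using Emean[OF n, of "fst e" "snd e"] that sub upper_pairs_subset[of n] unfolding X_def by fastforce+
  have eq: "E n \<omega> j l * E n \<omega> l l' = (\<Prod>e\<in>{?a, ?b}. X e \<omega>)" if w: "\<omega> \<in> space (M n)" for \<omega>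
    using ab Esym[OF w j l] Esym[OF w l l'] by (auto simp: X_def canon_def min_def max_def)
  have "integrable (M n) (\<lambda>\<omega>. \<Prod>e\<in>{?a, ?b}. X e \<omega>)" by (rule indep_vars_integrable[OF _ ind X(1)]) auto
  then show "integrable (M n) (\<lambda>\<omega>. E n \<omega> j l * E n \<omega> l l')"
    by (subst Bochner_Integration.integrable_cong[OF refl eq]) auto
  have "integral\<^sup>L (M n) (\<lambda>\<omega>. E n \<omega> j l * E n \<omega> l l') = expectation (\<lambda>\<omega>. \<Prod>e\<in>{?a, ?b}. X e \<omega>)"
    by (rule Bochner_Integration.integral_cong[OF refl eq])
  also have "\<dots> = (\<Prod>e\<in>{?a, ?b}. expectation (X e))" by (rule indep_vars_lebesgue_integral[OF _ ind X(1)]) auto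
  finally show "integral\<^sup>L (M n) (\<lambda>\<omega>. E n \<omega> j l * E n \<omega> l l') = 0" using X(2)[of ?a] ab by simp
qed

lemma quadmap_mean_zero:
  assumes n: "n \<ge> N0"
  shows "integral\<^sup>L (M n) (\<lambda>\<omega>. quadmap n (Qk k n) (E n \<omega>) i) = 0"
proof -
  have trm: "integrable (M n) (\<lambda>\<omega>. Qk k n i j l j' l' * E n \<omega> j l * E n \<omega> j' l')
      \<and> integral\<^sup>L (M n) (\<lambda>\<omega>. Qk k n i j l j' l' * E n \<omega> j l * E n \<omega> j' l') = 0"
    if "j < n" "l < n" "j' < n" "l' < n" for j l j' l'
  proof (cases "l = j' \<and> l' \<noteq> j")
    case True
    then show ?thesis using off_diagonal_mean_zero[OF n that(1,2,4)]
      by (auto simp: mult.assoc)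
  next
    case False
    then have "Qk k n i j l j' l' = 0" by (auto simp: Qk_def)
    then show ?thesis by simp
  qed
  let ?f = "\<lambda>j l j' l' \<omega>. Qk k n i j l j' l' * E n \<omega> j l * E n \<omega> j' l'"
  have sum0: "integrable (M n) (\<lambda>\<omega>. \<Sum>j<n. f j \<omega>) \<and> integral\<^sup>L (M n) (\<lambda>\<omega>. \<Sum>j<n. f j \<omega>) = 0"
    if "\<And>j. j < n \<Longrightarrow> integrable (M n) (f j) \<and> integral\<^sup>L (M n) (f j) = 0" for f :: "nat \<Rightarrow> 'a \<Rightarrow> real"
  proof
    show "integrable (M n) (\<lambda>\<omega>. \<Sum>j<n. f j \<omega>)" using that by (intro Bochner_Integration.integrable_sum) auto
    have "integral\<^sup>L (M n) (\<lambda>\<omega>. \<Sum>j<n. f j \<omega>) = (\<Sum>j<n. integral\<^sup>L (M n) (f j))"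
      by (rule Bochner_Integration.integral_sum) (use that in auto)
    then show "integral\<^sup>L (M n) (\<lambda>\<omega>. \<Sum>j<n. f j \<omega>) = 0" using that by simp
  qed
  have "integrable (M n) (\<lambda>\<omega>. quadmap n (Qk k n) (E n \<omega>) i) \<and> integral\<^sup>L (M n) (\<lambda>\<omega>. quadmap n (Qk k n) (E n \<omega>) i) = 0"
    unfolding quadmap_def by (intro sum0 trm)
  then show ?thesis ..
qed

text \<open>Second moments of \<open>E u_k\<close> come from the walk count with two walkers of one
  step each.\<close>

lemma linear_term_bounded:
  assumes k: "k < d" and Nb: "N0 \<le> Nb" "\<And>n. n \<ge> Nb \<Longrightarrow> 4 \<le> max_mom n" and L: "\<And>n. n \<ge> Nb \<Longrightarrow> L n = Lk k n"
  shows "coordOP M (\<lambda>n \<omega> i. linmap n (L n) (E n \<omega>) i) (\<lambda>n. sqrt (rho n) / Del n)"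
proof (rule coordOP_app[where c = 1 and r = 1 and Y = "\<lambda>n \<omega>. Epow n \<omega> 1 (u n k)"
      and V = "\<lambda>n. 2 * (Ku / sqrt (real n)) * (C' * snr n)" and ?K0.0 = "2 * Ku * C'", OF k Nb(1)])
  fix n \<omega> i assume n: "Nb \<le> n" and i: "i < n"
  have n0: "N0 \<le> n" using n Nb by simp
  show "linmap n (L n) (E n \<omega>) i = app 1 k n (Epow n \<omega> 1 (u n k)) i / lam n k ^ 1"
    unfolding L[OF n] by (rule linmap_app[OF i])
  show "(\<lambda>\<omega>. Epow n \<omega> 1 (u n k) i) \<in> borel_measurable (M n)"
    unfolding Epow_def by (rule mv_funpow_measurable)
  note m = iterate_moment[where L = 2 and r = 1, OF n0 i u_bound[OF n0 _ k]]
  have b: "0 \<le> Ku / sqrt (real n)" using Ku_pos by simp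
  have mm: "real (2 * 1) \<le> max_mom n" using Nb(2)[OF n] by simp
  show "integrable (M n) (\<lambda>\<omega>. (Epow n \<omega> 1 (u n k) i)\<^sup>2)"
    unfolding Epow_def by (rule m(1)[OF _ b mm])
  have "integral\<^sup>L (M n) (\<lambda>\<omega>. (Epow n \<omega> 1 (u n k) i)\<^sup>2) \<le> real (2 * 1) ^ (2 * 1) * (Ku / sqrt (real n))\<^sup>2 * (C' * snr n) ^ (2 * 1)"
    unfolding Epow_def by (rule order_trans[OF abs_ge_self m(2)[OF _ b mm]])
  then show "integral\<^sup>L (M n) (\<lambda>\<omega>. (Epow n \<omega> 1 (u n k) i)\<^sup>2) \<le> (2 * (Ku / sqrt (real n)) * (C' * snr n))\<^sup>2"
    by (simp only: power_mult_distrib mult_1_right of_nat_numeral)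
next
  fix n assume n: "Nb \<le> n" "0 < n"
  have n0: "N0 \<le> n" using n Nb by simp
  show "0 < 2 * (Ku / sqrt (real n)) * (C' * snr n)"
    using Ku_pos C'_ge snr_pos[OF n0 n(2)] n by simp
  have "2 * (Ku / sqrt (real n)) * (C' * snr n) / Del n ^ 1 = 2 * Ku * C' * ((snr n / sqrt (real n)) / Del n)"
    by simp
  then show "2 * (Ku / sqrt (real n)) * (C' * snr n) / Del n ^ 1 \<le> 2 * Ku * C' * (sqrt (rho n) / Del n)"
    unfolding snr_div_sqrt[OF n0 n(2)] by simp
qed

text \<open>Both \<open>E^2 u_k\<close> and the diagonal entry of \<open>E^2\<close> are second
  iterates, the latter started from a unit coordinate vector. Two walkers of two steps give the
  factor 256, the fourth power of 4; the two parts, each doubled, add up to 1024, the square of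
  32.\<close>

lemma off2_second_moment:
  assumes n: "n \<ge> N0" and j: "j < n" and k: "k < d" and mm: "4 \<le> max_mom n"
  shows "(\<lambda>\<omega>. off2 k n \<omega> j) \<in> borel_measurable (M n)"
    and "integrable (M n) (\<lambda>\<omega>. (off2 k n \<omega> j)\<^sup>2)"
    and "integral\<^sup>L (M n) (\<lambda>\<omega>. (off2 k n \<omega> j)\<^sup>2) \<le> (32 * (Ku / sqrt (real n)) * (C' * snr n)\<^sup>2)\<^sup>2"
proof -
  let ?b = "Ku / sqrt (real n)" and ?e = "\<lambda>i. if i = j then 1 else (0::real)"
  let ?a = "\<lambda>\<omega>. (mv n (E n \<omega>) ^^ 2) (u n k) j" and ?d = "\<lambda>\<omega>. (mv n (E n \<omega>) ^^ 2) ?e j"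
  have b: "0 \<le> ?b" using Ku_pos by simp
  have m2: "real (2 * 2) \<le> max_mom n" using mm by simp
  have off: "off2 k n \<omega> j = ?a \<omega> - ?d \<omega> * u n k j" for \<omega>
  proof -
    have "?d \<omega> = (\<Sum>l<n. E n \<omega> j l * E n \<omega> l j)"
      using j by (simp add: numeral_2_eq_2 mv_def[of n "E n \<omega>" "mv n (E n \<omega>) ?e"])
        (simp add: mv_def if_distrib[of "\<lambda>x. _ * x"] cong: if_cong)
    then show ?thesis by (simp add: off2_def Epow_def)
  qed
  have am: "?a \<in> borel_measurable (M n)" and dm: "?d \<in> borel_measurable (M n)" by (rule mv_funpow_measurable)+
  show meas: "(\<lambda>\<omega>. off2 k n \<omega> j) \<in> borel_measurable (M n)"
    unfolding off using am dm by (intro borel_measurable_diff borel_measurable_times) auto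
  note ma = iterate_moment[OF n j u_bound[OF n _ k] b m2] and md = iterate_moment[where y = ?e, OF n j _ zero_le_one m2]
  have ia: "integrable (M n) (\<lambda>\<omega>. (?a \<omega>)\<^sup>2)" by (rule ma(1))
  have id: "integrable (M n) (\<lambda>\<omega>. (?d \<omega>)\<^sup>2)" by (rule md(1)) simp
  have ea: "integral\<^sup>L (M n) (\<lambda>\<omega>. (?a \<omega>)\<^sup>2) \<le> 256 * ?b\<^sup>2 * (C' * snr n) ^ 4"
    using order_trans[OF abs_ge_self ma(2)] by simp
  have ed: "integral\<^sup>L (M n) (\<lambda>\<omega>. (?d \<omega>)\<^sup>2) \<le> 256 * (C' * snr n) ^ 4"
    using order_trans[OF abs_ge_self md(2)] by simp
  let ?R = "\<lambda>\<omega>. 2 * (?a \<omega>)\<^sup>2 + 2 * ?b\<^sup>2 * (?d \<omega>)\<^sup>2"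
  have intR: "integrable (M n) ?R" using ia id by (intro Bochner_Integration.integrable_add integrable_mult_right) auto
  have le: "(off2 k n \<omega> j)\<^sup>2 \<le> ?R \<omega>" for \<omega>
  proof -
    have "(u n k j)\<^sup>2 \<le> ?b\<^sup>2" by (rule abs_le_square_iff[THEN iffD1]) (use u_bound[OF n j k] Ku_pos in simp)
    then have "(?d \<omega>)\<^sup>2 * (u n k j)\<^sup>2 \<le> (?d \<omega>)\<^sup>2 * ?b\<^sup>2" by (intro mult_left_mono) auto
    then have 1: "(?d \<omega> * u n k j)\<^sup>2 \<le> ?b\<^sup>2 * (?d \<omega>)\<^sup>2"
      unfolding power_mult_distrib mult.commute[of "?b\<^sup>2"] .
    have 2: "(x - y)\<^sup>2 \<le> 2 * x\<^sup>2 + 2 * y\<^sup>2" for x y :: real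
      using zero_le_power2[of "x + y"] by (simp add: power2_sum power2_diff)
    show ?thesis unfolding off using 2[of "?a \<omega>" "?d \<omega> * u n k j"] 1 by linarith
  qed
  show int: "integrable (M n) (\<lambda>\<omega>. (off2 k n \<omega> j)\<^sup>2)"
  proof (rule Bochner_Integration.integrable_bound[OF intR])
    show "AE \<omega> in M n. norm ((off2 k n \<omega> j)\<^sup>2) \<le> norm (?R \<omega>)"
      using order_trans[OF le abs_ge_self] by simp
  qed (use meas in simp)
  have "integral\<^sup>L (M n) (\<lambda>\<omega>. (off2 k n \<omega> j)\<^sup>2) \<le> integral\<^sup>L (M n) ?R"
    by (rule integral_mono[OF int intR le])
  also have "\<dots> = 2 * integral\<^sup>L (M n) (\<lambda>\<omega>. (?a \<omega>)\<^sup>2) + 2 * ?b\<^sup>2 * integral\<^sup>L (M n) (\<lambda>\<omega>. (?d \<omega>)\<^sup>2)"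
    unfolding integral_mult_right_zero[symmetric]
    by (rule Bochner_Integration.integral_add) (use ia id in \<open>auto intro: integrable_mult_right\<close>)
  also have "\<dots> \<le> 2 * (256 * ?b\<^sup>2 * (C' * snr n) ^ 4) + 2 * ?b\<^sup>2 * (256 * (C' * snr n) ^ 4)"
    by (intro add_mono mult_left_mono ea ed) auto
  also have "\<dots> = (32 * ?b * (C' * snr n)\<^sup>2)\<^sup>2"
    by (simp only: power_mult_distrib power_mult[symmetric]) simp
  finally show "integral\<^sup>L (M n) (\<lambda>\<omega>. (off2 k n \<omega> j)\<^sup>2) \<le> (32 * ?b * (C' * snr n)\<^sup>2)\<^sup>2" .
qed

lemma quadratic_term_bounded:
  assumes k: "k < d" and Nb: "N0 \<le> Nb" "\<And>n. n \<ge> Nb \<Longrightarrow> 4 \<le> max_mom n" and Q: "\<And>n. n \<ge> Nb \<Longrightarrow> Q n = Qk k n"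
  shows "coordOP M (\<lambda>n \<omega> i. quadmap n (Q n) (E n \<omega>) i) (\<lambda>n. sqrt (real n) * rho n / (Del n)\<^sup>2)"
proof (rule coordOP_app[where c = "3/2" and r = 2 and Y = "off2 k"
      and V = "\<lambda>n. 32 * (Ku / sqrt (real n)) * (C' * snr n)\<^sup>2" and ?K0.0 = "32 * Ku * C'\<^sup>2", OF k Nb(1)])
  fix n \<omega> i assume n: "Nb \<le> n" and i: "i < n"
  have n0: "N0 \<le> n" using n Nb by simp
  show "quadmap n (Q n) (E n \<omega>) i = app (3/2) k n (off2 k n \<omega>) i / (lam n k)\<^sup>2"
    unfolding Q[OF n] by (rule quadmap_app[OF i])
  note m = off2_second_moment[OF n0 i k Nb(2)[OF n]]
  show "(\<lambda>\<omega>. off2 k n \<omega> i) \<in> borel_measurable (M n)" by (rule m(1))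
  show "integrable (M n) (\<lambda>\<omega>. (off2 k n \<omega> i)\<^sup>2)" by (rule m(2))
  show "integral\<^sup>L (M n) (\<lambda>\<omega>. (off2 k n \<omega> i)\<^sup>2) \<le> (32 * (Ku / sqrt (real n)) * (C' * snr n)\<^sup>2)\<^sup>2" by (rule m(3))
next
  fix n assume n: "Nb \<le> n" "0 < n"
  have n0: "N0 \<le> n" using n Nb by simp
  show "0 < 32 * (Ku / sqrt (real n)) * (C' * snr n)\<^sup>2"
    using Ku_pos C'_ge snr_pos[OF n0 n(2)] n by simp
  have "32 * (Ku / sqrt (real n)) * (C' * snr n)\<^sup>2 / (Del n)\<^sup>2 = 32 * Ku * C'\<^sup>2 * ((real n / sqrt (real n)) * rho n / (Del n)\<^sup>2)"
    by (simp add: power_mult_distrib snr_sq[OF n0])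
  then show "32 * (Ku / sqrt (real n)) * (C' * snr n)\<^sup>2 / (Del n)\<^sup>2 \<le> 32 * Ku * C'\<^sup>2 * (sqrt (real n) * rho n / (Del n)\<^sup>2)"
    unfolding real_div_sqrt[OF of_nat_0_le_iff] by simp
qed

end

section \<open>Expansion of the corrected eigenvector on the good event\<close>

context spiked_event
begin

lemma eigenvector_expansion_app:
  assumes k: "k < d"
  obtains c N where "c > 0" "N \<ge> NL" "\<And>n \<omega> i. n \<ge> N \<Longrightarrow> \<omega> \<in> S n \<Longrightarrow> i < n \<Longrightarrow>
    \<bar>sgn (alp n \<omega> k k) * vh n \<omega> k i - u n k i - app 1 k n (Epow n \<omega> 1 (u n k)) i / lam n k
      - app (3/2) k n (Epow n \<omega> 2 (u n k)) i / (lam n k)\<^sup>2\<bar> \<le> c * ((tau n)\<^sup>2 / sqrt (real n) * real n powr (- gam))"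
proof -
  note ex = second_order_perturbation.eigenvector_expansion[OF sop[OF k],
    unfolded second_order_perturbation.psi_def[OF sop[OF k]] second_order_perturbation.q_def[OF sop[OF k]]
      second_order_perturbation.s_def[OF sop[OF k]]]
  obtain c N1 where c: "c > 0" "\<And>n \<omega> i. n \<ge> N1 \<Longrightarrow> \<omega> \<in> S n \<Longrightarrow> i < n \<Longrightarrow>
    \<bar>sgn (Zal k k (n, \<omega>, i)) * Znu 0 k (n, \<omega>, i) - Zups k (n, \<omega>, i)
      - (Zy 1 k (n, \<omega>, i) / Zl k (n, \<omega>, i) - Zups k (n, \<omega>, i) * Zx 1 k k (n, \<omega>, i) / Zl k (n, \<omega>, i)
        + (\<Sum>m\<in>{..<d} - {k}. Zl m (n, \<omega>, i) / (Zl k (n, \<omega>, i) - Zl m (n, \<omega>, i)) * Zups m (n, \<omega>, i) * Zx 1 m k (n, \<omega>, i) / Zl k (n, \<omega>, i)))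
      - (Zy 2 k (n, \<omega>, i) / (Zl k (n, \<omega>, i))\<^sup>2 - 3/2 * Zups k (n, \<omega>, i) * Zx 2 k k (n, \<omega>, i) / (Zl k (n, \<omega>, i))\<^sup>2
        + (\<Sum>m\<in>{..<d} - {k}. Zl m (n, \<omega>, i) / (Zl k (n, \<omega>, i) - Zl m (n, \<omega>, i)) * Zups m (n, \<omega>, i) * Zx 2 m k (n, \<omega>, i) / (Zl k (n, \<omega>, i))\<^sup>2))\<bar>
     \<le> c * \<bar>(tau n)\<^sup>2 * real n powr (- gam)\<bar>"
    by (rule bigo_EF_E[OF ex]) (simp only: fst_conv, blast)
  show ?thesis
  proof (rule that[OF c(1), of "max NL N1"])
    fix n \<omega> i assume nn: "max NL N1 \<le> n" and w: "\<omega> \<in> S n" and i: "i < n"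
    have n: "NL \<le> n" "N1 \<le> n" using nn by auto
    note L = NL[OF n(1)]
    have sq: "0 < sqrt (real n)" using L by simp
    have lz: "lam n k \<noteq> 0" using lam_ge[OF k, of n] L by auto
    have D: "Del n \<noteq> 0" using L by simp
    have gapq: "Zl m (n, \<omega>, i) / (Zl k (n, \<omega>, i) - Zl m (n, \<omega>, i)) = lam n m / (lam n k - lam n m)" for m
      using D by (simp add: Zl_def flip: diff_divide_distrib)
    have y: "Zy 1 k (n, \<omega>, i) / Zl k (n, \<omega>, i) = sqrt (real n) * (Epow n \<omega> 1 (u n k) i / lam n k)"
       "Zy 2 k (n, \<omega>, i) / (Zl k (n, \<omega>, i))\<^sup>2 = sqrt (real n) * (Epow n \<omega> 2 (u n k) i / (lam n k)\<^sup>2)"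
      using D by (simp_all add: Zy_def Zl_def power_divide)
    have x: "Zx 1 m k (n, \<omega>, i) / Zl k (n, \<omega>, i) = inner_n n (u n m) (Epow n \<omega> 1 (u n k)) / lam n k"
       "Zx 2 m k (n, \<omega>, i) / (Zl k (n, \<omega>, i))\<^sup>2 = inner_n n (u n m) (Epow n \<omega> 2 (u n k)) / (lam n k)\<^sup>2" for m
      using D by (simp_all add: Zx_def Zl_def power_divide)
    have ups: "Zups m (n, \<omega>, i) = sqrt (real n) * u n m i" for m by (simp add: Zups_def)
    have alg: "sqrt (real n) * Y - sqrt (real n) * a * X + (\<Sum>m\<in>A. g m * (sqrt (real n) * v m) * x m)
      = sqrt (real n) * (Y - a * X + (\<Sum>m\<in>A. g m * v m * x m))" for Y a X A g v and x :: "nat \<Rightarrow> real"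
      by (simp add: distrib_left right_diff_distrib sum_distrib_left mult_ac)
    have psi: "Zy 1 k (n, \<omega>, i) / Zl k (n, \<omega>, i) - Zups k (n, \<omega>, i) * Zx 1 k k (n, \<omega>, i) / Zl k (n, \<omega>, i)
        + (\<Sum>m\<in>{..<d} - {k}. Zl m (n, \<omega>, i) / (Zl k (n, \<omega>, i) - Zl m (n, \<omega>, i)) * Zups m (n, \<omega>, i) * Zx 1 m k (n, \<omega>, i) / Zl k (n, \<omega>, i))
      = sqrt (real n) * (app 1 k n (Epow n \<omega> 1 (u n k)) i / lam n k)"
      unfolding times_divide_eq_right[symmetric] x y gapq ups app_inner
      unfolding alg by (simp add: add_divide_distrib diff_divide_distrib sum_divide_distrib)
    have q: "Zy 2 k (n, \<omega>, i) / (Zl k (n, \<omega>, i))\<^sup>2 - 3/2 * Zups k (n, \<omega>, i) * Zx 2 k k (n, \<omega>, i) / (Zl k (n, \<omega>, i))\<^sup>2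
        + (\<Sum>m\<in>{..<d} - {k}. Zl m (n, \<omega>, i) / (Zl k (n, \<omega>, i) - Zl m (n, \<omega>, i)) * Zups m (n, \<omega>, i) * Zx 2 m k (n, \<omega>, i) / (Zl k (n, \<omega>, i))\<^sup>2)
      = sqrt (real n) * (app (3/2) k n (Epow n \<omega> 2 (u n k)) i / (lam n k)\<^sup>2)"
    proof -
      have "3/2 * (sqrt (real n) * a) * b = sqrt (real n) * (3/2 * a) * b" for a b by simp
      then show ?thesis
        unfolding times_divide_eq_right[symmetric, of _ _ "(Zl k (n, \<omega>, i))\<^sup>2"] x y gapq ups app_inner
        by (simp only: alg) (simp add: add_divide_distrib diff_divide_distrib sum_divide_distrib)
    qed
    have nu: "sgn (Zal k k (n, \<omega>, i)) * Znu 0 k (n, \<omega>, i) = sqrt (real n) * (sgn (alp n \<omega> k k) * vh n \<omega> k i)"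
      by (simp add: Zal_def Znu_def Epow_0)
    let ?x = "sgn (alp n \<omega> k k) * vh n \<omega> k i - u n k i - app 1 k n (Epow n \<omega> 1 (u n k)) i / lam n k
      - app (3/2) k n (Epow n \<omega> 2 (u n k)) i / (lam n k)\<^sup>2"
    have "\<bar>sqrt (real n) * ?x\<bar> \<le> c * \<bar>(tau n)\<^sup>2 * real n powr (- gam)\<bar>"
      using c(2)[OF n(2) w i] unfolding psi q nu unfolding ups right_diff_distrib[symmetric] .
    then have "sqrt (real n) * \<bar>?x\<bar> \<le> c * ((tau n)\<^sup>2 * real n powr (- gam))"
      using sq by (simp add: abs_mult)
    then show "\<bar>?x\<bar> \<le> c * ((tau n)\<^sup>2 / sqrt (real n) * real n powr (- gam))"
      using sq by (simp add: field_simps)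
  qed simp
qed

text \<open>The correction has coordinates of order \<open>tau\<close> squared over
  \<open>sqrt n\<close>, so its pairing with \<open>u_k\<close> falls below 1/4, whereas the overlap
  of the uncorrected eigenvector is at least 1/2. Subtracting the correction cannot flip the
  sign.\<close>

lemma corrected_sign:
  assumes k: "k < d"
  obtains N where "N \<ge> NL" "\<And>n \<omega>. n \<ge> N \<Longrightarrow> \<omega> \<in> S n \<Longrightarrow>
    sgn (inner_n n (u n k) (\<lambda>i. vh n \<omega> k i - bhat_of k n \<omega> i)) = sgn (alp n \<omega> k k)"
proof -
  have "nbias ZL ZX (ZD Dh) k \<in> bdE" using close_nbias[OF k close_Dh_D0] by (simp add: close_def)
  then obtain B N1 where B: "B > 0" "\<And>n \<omega> i. n \<ge> N1 \<Longrightarrow> \<omega> \<in> S n \<Longrightarrow> i < n \<Longrightarrow> \<bar>nbias ZL ZX (ZD Dh) k (n, \<omega>, i)\<bar> \<le> B * \<bar>1\<bar>"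
    by (rule bigo_EF_E) blast
  have "eventually (\<lambda>z. \<forall>m\<in>{..<d}. 1/2 \<le> \<bar>Zal m m z\<bar>) EF"
    by (rule eventually_ball_finite) (use overlap_lower_E in auto)
  then obtain N2 where N2: "\<And>n \<omega> i. n \<ge> N2 \<Longrightarrow> \<omega> \<in> S n \<Longrightarrow> i < n \<Longrightarrow> \<forall>m\<in>{..<d}. 1/2 \<le> \<bar>Zal m m (n, \<omega>, i)\<bar>"
    unfolding eventually_EF by blast
  \<comment> \<open>Calibrated so that the pairing of the correction with \<open>u_k\<close> is at
    most 1/4.\<close>
  define a where "a = 1 / (4 * (Ku * B))"
  have a: "0 < a" using Ku_pos B by (simp add: a_def)
  obtain N3 where N3: "\<And>n. n \<ge> N3 \<Longrightarrow> norm (th n) \<le> a * norm (1::real)"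
    using landau_o.smallD[OF th_small a] unfolding eventually_sequentially by blast
  show ?thesis
  proof (rule that[of "max (max NL N1) (max N2 N3)"])
    fix n \<omega> assume nn: "max (max NL N1) (max N2 N3) \<le> n" and w: "\<omega> \<in> S n"
    have n: "NL \<le> n" "N1 \<le> n" "N2 \<le> n" "N3 \<le> n" using nn by auto
    note L = NL[OF n(1)]
    have al: "1/2 \<le> \<bar>alp n \<omega> m m\<bar>" if "m < d" for m
      using N2[OF n(3) w, of 0] L(5) that by (simp add: Zal_def)
    have sg: "sgn (alp n \<omega> m m) * sgn (alp n \<omega> m m) = 1" if "m < d" for m
      using al[OF that] by (auto simp: sgn_if)
    have sq: "0 < sqrt (real n)" using L by simp
    have bh: "\<bar>bhat_of k n \<omega> i\<bar> \<le> (tau n)\<^sup>2 * B / sqrt (real n)" if i: "i < n" for i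
    proof -
      have eq: "sqrt (real n) * (sgn (alp n \<omega> k k) * bhat_of k n \<omega> i) = (tau n)\<^sup>2 * nbias ZL ZX (ZD Dh) k (n, \<omega>, i)"
        by (rule bhat_nbias[OF n(1) w i k sg])
      have "\<bar>(tau n)\<^sup>2 * nbias ZL ZX (ZD Dh) k (n, \<omega>, i)\<bar> \<le> (tau n)\<^sup>2 * B"
        using B(2)[OF n(2) w i] by (simp add: abs_mult mult_left_mono)
      then have "\<bar>sqrt (real n) * (sgn (alp n \<omega> k k) * bhat_of k n \<omega> i)\<bar> \<le> (tau n)\<^sup>2 * B"
        by (simp only: eq)
      moreover have "\<bar>sgn (alp n \<omega> k k)\<bar> = 1" using al[OF k] by (auto simp: sgn_if)
      ultimately show ?thesis using sq by (simp add: abs_mult field_simps)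
    qed
    have "tau n \<le> tau n * ln (real n)" using L by simp
    also have "\<dots> \<le> th n" unfolding th_def using L by (intro mult_right_mono) auto
    also have "\<dots> \<le> a" using N3[OF n(4)] by simp
    finally have ta: "tau n \<le> a" .
    have "\<bar>inner_n n (u n k) (bhat_of k n \<omega>)\<bar> \<le> (\<Sum>i<n. Ku / sqrt (real n) * ((tau n)\<^sup>2 * B / sqrt (real n)))"
      unfolding inner_n_def
    proof (rule order_trans[OF sum_abs sum_mono])
      fix i assume i: "i \<in> {..<n}"
      show "\<bar>u n k i * bhat_of k n \<omega> i\<bar> \<le> Ku / sqrt (real n) * ((tau n)\<^sup>2 * B / sqrt (real n))"
        unfolding abs_mult using u_bound[OF L(1) _ k, of i] bh[of i] i Ku_pos by (intro mult_mono) auto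
    qed
    also have "\<dots> = (real n / (sqrt (real n) * sqrt (real n))) * (Ku * B * (tau n)\<^sup>2)"
      by simp
    also have "\<dots> = Ku * B * (tau n)\<^sup>2" using L by simp
    also have "\<dots> \<le> Ku * B * a"
    proof (intro mult_left_mono)
      have "(tau n)\<^sup>2 \<le> tau n * 1" unfolding power2_eq_square using L by (intro mult_left_mono) auto
      then show "(tau n)\<^sup>2 \<le> a" using ta by simp
    qed (use Ku_pos B in auto)
    also have "\<dots> = 1/4" using Ku_pos B by (simp add: a_def)
    finally have "\<bar>inner_n n (u n k) (bhat_of k n \<omega>)\<bar> \<le> 1/4" .
    moreover have "inner_n n (u n k) (\<lambda>i. vh n \<omega> k i - bhat_of k n \<omega> i) = alp n \<omega> k k - inner_n n (u n k) (bhat_of k n \<omega>)"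
      by (simp add: inner_n_def alp_def right_diff_distrib sum_subtractf)
    ultimately show "sgn (inner_n n (u n k) (\<lambda>i. vh n \<omega> k i - bhat_of k n \<omega> i)) = sgn (alp n \<omega> k k)"
      using al[OF k] by (auto simp: sgn_if)
  qed simp
qed

text \<open>By symmetry the diagonal of \<open>E^2\<close> is \<open>D2\<close>, so removing it from
  the quadratic term subtracts the bias formula at \<open>D2\<close> without any error.\<close>

lemma quadmap_bias:
  assumes w: "\<omega> \<in> space (M n)" and i: "i < n"
  shows "quadmap n (Qk k n) (E n \<omega>) i
    = app (3/2) k n (Epow n \<omega> 2 (u n k)) i / (lam n k)\<^sup>2 - bias_formula n d (lam n) (u n) (D2 n \<omega>) k i"
proof -
  have "app (3/2) k n (off2 k n \<omega>) i = app (3/2) k n (\<lambda>j. Epow n \<omega> 2 (u n k) j - D2 n \<omega> j * u n k j) i"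
  proof -
    have "off2 k n \<omega> j = Epow n \<omega> 2 (u n k) j - D2 n \<omega> j * u n k j" if "j < n" for j
    proof -
      have "(\<Sum>l<n. E n \<omega> j l * E n \<omega> l j) = D2 n \<omega> j"
        unfolding D2_def power2_eq_square by (intro sum.cong refl) (use Esym[OF w that] in auto)
      then show ?thesis by (simp add: off2_def)
    qed
    then show ?thesis using i by (simp add: app_def)
  qed
  then show ?thesis
    unfolding quadmap_app[OF i] bias_formula_app by (simp add: app_diff diff_divide_distrib)
qed

text \<open>Comparing the correction with the bias at \<open>D2\<close> makes the subtracted part
  itself quadratic in E. It merges into \<open>Qk\<close>, and only the comparison error and the
  expansion error are left.\<close>

lemma corrected_remainder:
  assumes k: "k < d"
  obtains c N where "c > 0" "N \<ge> NL" "\<And>n \<omega> i. n \<ge> N \<Longrightarrow> \<omega> \<in> S n \<Longrightarrow> i < n \<Longrightarrow>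
    \<bar>(vh n \<omega> k i - bhat_of k n \<omega> i) * sgn (inner_n n (u n k) (\<lambda>i. vh n \<omega> k i - bhat_of k n \<omega> i)) - u n k i
       - linmap n (Lk k n) (E n \<omega>) i - quadmap n (Qk k n) (E n \<omega>) i\<bar>
      \<le> c * ((tau n)\<^sup>2 / sqrt (real n) * (real n powr (- gam) + th n))"
proof -
  obtain c1 N1 where 1: "c1 > 0" "N1 \<ge> NL" "\<And>n \<omega> i. n \<ge> N1 \<Longrightarrow> \<omega> \<in> S n \<Longrightarrow> i < n \<Longrightarrow>
    \<bar>sgn (alp n \<omega> k k) * vh n \<omega> k i - u n k i - app 1 k n (Epow n \<omega> 1 (u n k)) i / lam n k
      - app (3/2) k n (Epow n \<omega> 2 (u n k)) i / (lam n k)\<^sup>2\<bar> \<le> c1 * ((tau n)\<^sup>2 / sqrt (real n) * real n powr (- gam))"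
    by (rule eigenvector_expansion_app[OF k]) blast
  obtain c2 N2 where 2: "c2 > 0" "N2 \<ge> NL" "\<And>n \<omega> i. n \<ge> N2 \<Longrightarrow> \<omega> \<in> S n \<Longrightarrow> i < n \<Longrightarrow>
    \<bar>sgn (alp n \<omega> k k) * bhat_of k n \<omega> i - bias_formula n d (lam n) (u n) (D2 n \<omega>) k i\<bar> \<le> c2 * ((tau n)\<^sup>2 / sqrt (real n) * th n)"
    by (rule bias_comparison[OF k close_Dh_D2]) blast
  obtain N3 where 3: "N3 \<ge> NL" "\<And>n \<omega>. n \<ge> N3 \<Longrightarrow> \<omega> \<in> S n \<Longrightarrow>
    sgn (inner_n n (u n k) (\<lambda>i. vh n \<omega> k i - bhat_of k n \<omega> i)) = sgn (alp n \<omega> k k)"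
    by (rule corrected_sign[OF k]) blast
  show ?thesis
  proof (rule that[of "c1 + c2" "max N1 (max N2 N3)"])
    fix n \<omega> i assume nn: "max N1 (max N2 N3) \<le> n" and w: "\<omega> \<in> S n" and i: "i < n"
    have n: "N1 \<le> n" "N2 \<le> n" "N3 \<le> n" "NL \<le> n" using nn 3 by auto
    note L = NL[OF n(4)]
    let ?T = "(tau n)\<^sup>2 / sqrt (real n)" and ?s = "sgn (alp n \<omega> k k)"
    let ?b = "bias_formula n d (lam n) (u n) (D2 n \<omega>) k i"
    let ?A = "app (3/2) k n (Epow n \<omega> 2 (u n k)) i / (lam n k)\<^sup>2"
    let ?B = "app 1 k n (Epow n \<omega> 1 (u n k)) i / lam n k"
    have "\<bar>(vh n \<omega> k i - bhat_of k n \<omega> i) * ?s - u n k i - ?B - (?A - ?b)\<bar>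
      \<le> \<bar>?s * vh n \<omega> k i - u n k i - ?B - ?A\<bar> + \<bar>?s * bhat_of k n \<omega> i - ?b\<bar>"
      by (simp add: left_diff_distrib mult.commute[of ?s])
    also have "\<dots> \<le> c1 * (?T * real n powr (- gam)) + c2 * (?T * th n)"
      by (intro add_mono 1(3) 2(3) n w i)
    also have "\<dots> \<le> (c1 + c2) * (?T * (real n powr (- gam) + th n))"
    proof -
      have "0 \<le> c1 * (?T * th n)" "0 \<le> c2 * (?T * real n powr (- gam))"
        using 1(1) 2(1) th_pos[OF n(4)] by auto
      then show ?thesis by (simp only: distrib_left distrib_right)
    qed
    finally show "\<bar>(vh n \<omega> k i - bhat_of k n \<omega> i) * sgn (inner_n n (u n k) (\<lambda>i. vh n \<omega> k i - bhat_of k n \<omega> i)) - u n k i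
       - linmap n (Lk k n) (E n \<omega>) i - quadmap n (Qk k n) (E n \<omega>) i\<bar>
      \<le> (c1 + c2) * (?T * (real n powr (- gam) + th n))"
      unfolding 3(2)[OF n(3) w] quadmap_bias[OF in_space[OF w] i] linmap_app[OF i] power_one_right .
  qed (use 1 2 in auto)
qed

lemma error_rate_small: "(\<lambda>n. real n powr (- gam) + th n) \<in> o[sequentially](\<lambda>_. 1)"
proof -
  have "(\<lambda>n::nat. real n powr (- gam)) \<in> o[sequentially](\<lambda>_. 1)" using gam(1) by real_asymp
  then show ?thesis by (rule sum_in_smallo(1)[OF _ th_small])
qed

end

context spiked_noise
begin

lemma tau_rate: "n \<ge> N0 \<Longrightarrow> (tau n)\<^sup>2 / sqrt (real n) = sqrt (real n) * rho n / (Del n)\<^sup>2"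
proof -
  assume n: "n \<ge> N0"
  have "(tau n)\<^sup>2 / sqrt (real n) = (real n / sqrt (real n)) * rho n / (Del n)\<^sup>2"
    by (simp add: tau_def power_divide snr_sq[OF n])
  then show ?thesis unfolding real_div_sqrt[OF of_nat_0_le_iff] .
qed

text \<open>The remainder is defined as whatever makes the expansion an identity, at every
  \<open>n\<close> and every sample point. Its order needs checking only with high probability, on
  the good event.\<close>

lemma zero_bias:
  assumes k: "k < d"
  shows "zero_second_order_bias M E (\<lambda>n. u n k) (\<lambda>n \<omega> i. vh n \<omega> k i - bhat_of k n \<omega> i) rho Del"
proof -
  obtain Nc where Nc: "\<And>n. n \<ge> Nc \<Longrightarrow> 0 * ln (real n) + 4 \<le> max_mom n"
    using max_mom_ge[of 0 4] unfolding eventually_sequentially by blast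
  define Nb where "Nb = max N0 Nc"
  have Nb: "N0 \<le> Nb" "\<And>n. n \<ge> Nb \<Longrightarrow> 4 \<le> max_mom n" using Nc by (auto simp: Nb_def)
  \<comment> \<open>Below \<open>Nb\<close> the distributional assumptions or the fourth moment may
    be missing, so the coefficients of both maps are set to zero there; the requirement of mean zero
    for every \<open>n\<close> is then met trivially.\<close>
  define L where "L n = (if n \<ge> Nb then Lk k n else (\<lambda>_ _ _. 0))" for n
  define Q where "Q n = (if n \<ge> Nb then Qk k n else (\<lambda>_ _ _ _ _. 0))" for n
  let ?ut = "\<lambda>n \<omega> i. vh n \<omega> k i - bhat_of k n \<omega> i"
  define t where "t n \<omega> i = ?ut n \<omega> i * sgn (inner_n n (u n k) (?ut n \<omega>)) - u n k i
    - linmap n (L n) (E n \<omega>) i - quadmap n (Q n) (E n \<omega>) i" for n \<omega> i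
  have "coordoP M t (\<lambda>n. sqrt (real n) * rho n / (Del n)\<^sup>2)"
    unfolding coordoP_def
  proof (intro allI impI)
    fix e \<delta> :: real assume e: "0 < e" and \<delta>: "0 < \<delta>"
    obtain K S NS where sp: "spiked_event M E N0 rho qn eps C A0 d p lam u lamA uhat betaD C1 C2 delta0 Cmu S K NS"
      \<comment> \<open>The exponent 1 suffices here, since the failure probability only has to fall
        below a fixed \<open>e\<close> eventually.\<close>
      and S: "\<And>n. n \<ge> NS \<Longrightarrow> S n \<in> sets (M n) \<and> 1 - real n powr (- 1) \<le> measure (M n) (S n)"
      using event_exists[OF zero_less_one] by blast
    interpret spiked_event M E N0 rho qn eps C A0 d p lam u lamA uhat betaD C1 C2 delta0 Cmu S K NS by (rule sp)
    obtain c N1 where c: "c > 0" "N1 \<ge> NL" "\<And>n \<omega> i. n \<ge> N1 \<Longrightarrow> \<omega> \<in> S n \<Longrightarrow> i < n \<Longrightarrow>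
      \<bar>?ut n \<omega> i * sgn (inner_n n (u n k) (?ut n \<omega>)) - u n k i - linmap n (Lk k n) (E n \<omega>) i - quadmap n (Qk k n) (E n \<omega>) i\<bar>
      \<le> c * ((tau n)\<^sup>2 / sqrt (real n) * (real n powr (- gam) + th n))"
      by (rule corrected_remainder[OF k]) blast
    have "0 < \<delta> / c" using \<delta> c by simp
    from landau_o.smallD[OF error_rate_small this] obtain N2
      where N2: "\<And>n. n \<ge> N2 \<Longrightarrow> norm (real n powr (- gam) + th n) \<le> \<delta> / c * norm (1::real)"
      unfolding eventually_sequentially by blast
    have "eventually (\<lambda>n::nat. real n powr (- 1) \<le> e) sequentially" using e by real_asymp
    then obtain N3 where N3: "\<And>n. n \<ge> N3 \<Longrightarrow> real n powr (- 1) \<le> e" unfolding eventually_sequentially by blast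
    show "\<exists>N. \<forall>n\<ge>N. \<forall>i<n. \<exists>S\<in>sets (M n). 1 - e \<le> measure (M n) S \<and>
        (\<forall>\<omega>\<in>S. \<bar>t n \<omega> i\<bar> \<le> \<delta> * (sqrt (real n) * rho n / (Del n)\<^sup>2))"
    proof (intro exI[of _ "max (max N1 N2) (max N3 Nb)"] allI impI)
      fix n i assume nn: "max (max N1 N2) (max N3 Nb) \<le> n" and i: "i < n"
      have n: "N1 \<le> n" "N2 \<le> n" "N3 \<le> n" "Nb \<le> n" "NL \<le> n" using nn c(2) by auto
      note NLn = NL[OF n(5)]
      have "\<bar>t n \<omega> i\<bar> \<le> \<delta> * (sqrt (real n) * rho n / (Del n)\<^sup>2)" if w: "\<omega> \<in> S n" for \<omega>
      proof -
        have "\<bar>t n \<omega> i\<bar> \<le> c * ((tau n)\<^sup>2 / sqrt (real n) * (real n powr (- gam) + th n))"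
          using c(3)[OF n(1) w i] n(4) by (simp only: t_def L_def Q_def if_True)
        also have "\<dots> \<le> c * ((tau n)\<^sup>2 / sqrt (real n) * (\<delta> / c))"
          using N2[OF n(2)] c(1) by (intro mult_left_mono) auto
        also have "\<dots> = \<delta> * ((tau n)\<^sup>2 / sqrt (real n))" using c(1) by simp
        finally show ?thesis unfolding tau_rate[OF NLn(1)] .
      qed
      moreover have "S n \<in> sets (M n)" "1 - e \<le> measure (M n) (S n)" using S[OF NLn(2)] N3[OF n(3)] by auto
      ultimately show "\<exists>S\<in>sets (M n). 1 - e \<le> measure (M n) S \<and>
        (\<forall>\<omega>\<in>S. \<bar>t n \<omega> i\<bar> \<le> \<delta> * (sqrt (real n) * rho n / (Del n)\<^sup>2))" by (intro bexI[of _ "S n"]) auto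
    qed
  qed
  moreover have "coordOP M (\<lambda>n \<omega> i. linmap n (L n) (E n \<omega>) i) (\<lambda>n. sqrt (rho n) / Del n)"
    by (rule linear_term_bounded[OF k Nb]) (simp_all only: L_def if_True)
  moreover have "coordOP M (\<lambda>n \<omega> i. quadmap n (Q n) (E n \<omega>) i) (\<lambda>n. sqrt (real n) * rho n / (Del n)\<^sup>2)"
    by (rule quadratic_term_bounded[OF k Nb]) (simp_all only: Q_def if_True)
  ultimately have "second_order_expansion M E (\<lambda>n. u n k) ?ut rho Del L Q t"
    unfolding second_order_expansion_def by (simp add: t_def)
  moreover have "integral\<^sup>L (M n) (\<lambda>\<omega>. quadmap n (Q n) (E n \<omega>) i) = 0" for n i
  proof (cases "n \<ge> Nb")
    case True
    then show ?thesis using quadmap_mean_zero[of n k i] Nb(1) by (simp add: Q_def)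
  qed (simp add: Q_def quadmap_def)
  ultimately show ?thesis unfolding zero_second_order_bias_def by blast
qed

lemma bias_estimate_sup:
  assumes k: "k < d" and xi: "1 < \<xi>"
  shows "tildeOP M (\<lambda>n \<omega>. vinf n (\<lambda>i. bhat_of k n \<omega> i * sgn (alp n \<omega> k k) - bias_formula n d (lam n) (u n) (D0 n \<omega>) k i))
    (\<lambda>n. sqrt (real n) * rho n / (Del n)\<^sup>2 * max (1 / qn n) (tau n) * ln (real n) powr \<xi>)"
  unfolding tildeOP_def
proof (intro allI impI)
  fix c :: real assume c: "0 < c"
  obtain K N where K: "0 < K" and N: "\<And>n. n \<ge> N \<Longrightarrow> N0 \<le> n \<and> 0 < n \<and> (\<exists>S\<in>sets (M n). 1 - real n powr (- c) \<le> measure (M n) S \<and>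
     (\<forall>\<omega>\<in>S. \<forall>i<n. \<bar>sgn (alp n \<omega> k k) * bhat_of k n \<omega> i - bias_formula n d (lam n) (u n) (D0 n \<omega>) k i\<bar>
        \<le> K * ((tau n)\<^sup>2 / sqrt (real n) * (max (1 / qn n) (tau n) * ln (real n)))))"
    using bias_estimate[OF c k] by blast
  have "eventually (\<lambda>n::nat. 1 \<le> ln (real n)) sequentially" by real_asymp
  then obtain N1 where N1: "\<And>n. n \<ge> N1 \<Longrightarrow> 1 \<le> ln (real n)" unfolding eventually_sequentially by blast
  let ?X = "\<lambda>n \<omega> i. bhat_of k n \<omega> i * sgn (alp n \<omega> k k) - bias_formula n d (lam n) (u n) (D0 n \<omega>) k i"
  show "\<exists>K N. \<forall>n\<ge>N. \<exists>S\<in>sets (M n). 1 - real n powr (- c) \<le> measure (M n) S \<and>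
     (\<forall>\<omega>\<in>S. \<bar>vinf n (?X n \<omega>)\<bar> \<le> K * (sqrt (real n) * rho n / (Del n)\<^sup>2 * max (1 / qn n) (tau n) * ln (real n) powr \<xi>))"
  proof (intro exI[of _ K] exI[of _ "max N N1"] allI impI)
    fix n assume "max N N1 \<le> n"
    then have n: "N \<le> n" "N1 \<le> n" by auto
    obtain S where S: "S \<in> sets (M n)" "1 - real n powr (- c) \<le> measure (M n) S"
      "\<And>\<omega> i. \<omega> \<in> S \<Longrightarrow> i < n \<Longrightarrow> \<bar>sgn (alp n \<omega> k k) * bhat_of k n \<omega> i - bias_formula n d (lam n) (u n) (D0 n \<omega>) k i\<bar>
        \<le> K * ((tau n)\<^sup>2 / sqrt (real n) * (max (1 / qn n) (tau n) * ln (real n)))"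
      using N[OF n(1)] by blast
    have n0: "N0 \<le> n" "0 < n" using N[OF n(1)] by auto
    \<comment> \<open>The estimate itself carries a single logarithm; since \<open>\<xi>\<close>
      exceeds 1, the stated power dominates it once \<open>ln n\<close> is at least 1.\<close>
    have l: "ln (real n) \<le> ln (real n) powr \<xi>"
      using powr_mono[of 1 \<xi> "ln (real n)"] N1[OF n(2)] xi by simp
    let ?Y = "sqrt (real n) * rho n / (Del n)\<^sup>2 * max (1 / qn n) (tau n) * ln (real n) powr \<xi>"
    have "\<bar>vinf n (?X n \<omega>)\<bar> \<le> K * ?Y" if w: "\<omega> \<in> S" for \<omega>
    proof -
      have X: "\<bar>?X n \<omega> i\<bar> \<le> K * ?Y" if i: "i < n" for i
      proof -
        have "\<bar>?X n \<omega> i\<bar> \<le> K * ((tau n)\<^sup>2 / sqrt (real n) * (max (1 / qn n) (tau n) * ln (real n)))"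
          using S(3)[OF w i] by (simp add: mult.commute)
        also have "\<dots> \<le> K * ((tau n)\<^sup>2 / sqrt (real n) * (max (1 / qn n) (tau n) * ln (real n) powr \<xi>))"
          using K l tau_pos[OF n0] by (intro mult_left_mono) (auto simp: le_max_iff_disj)
        finally show ?thesis unfolding tau_rate[OF n0(1)] by (simp only: mult.assoc)
      qed
      have fin: "finite ((\<lambda>i. \<bar>?X n \<omega> i\<bar>) ` {..<n})" by simp
      have mem: "vinf n (?X n \<omega>) \<in> (\<lambda>i. \<bar>?X n \<omega> i\<bar>) ` {..<n}"
        unfolding vinf_def by (rule Max_in[OF fin]) (use n0 in auto)
      then obtain i where i: "i < n" "vinf n (?X n \<omega>) = \<bar>?X n \<omega> i\<bar>" by blast
      show ?thesis unfolding i(2) abs_abs by (rule X[OF i(1)])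
    qed
    then show "\<exists>S\<in>sets (M n). 1 - real n powr (- c) \<le> measure (M n) S \<and> (\<forall>\<omega>\<in>S. \<bar>vinf n (?X n \<omega>)\<bar> \<le> K * ?Y)"
      using S by blast
  qed
qed

end

theorem theorem4p1:
  fixes M :: "nat \<Rightarrow> 'a measure"
    and E :: "nat \<Rightarrow> 'a \<Rightarrow> nat \<Rightarrow> nat \<Rightarrow> real"
    and d p k N0 :: nat
    and lam :: "nat \<Rightarrow> nat \<Rightarrow> real"
    and u :: "nat \<Rightarrow> nat \<Rightarrow> nat \<Rightarrow> real"
    and lamA :: "nat \<Rightarrow> 'a \<Rightarrow> nat \<Rightarrow> real"
    and uhat :: "nat \<Rightarrow> 'a \<Rightarrow> nat \<Rightarrow> nat \<Rightarrow> real"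
    and rho qn :: "nat \<Rightarrow> real"
    and betaD C1 C2 c0 delta0 eps C A0 Cmu :: real
  defines "A \<equiv> \<lambda>n \<omega> i j. lowrank d (lam n) (u n) i j + E n \<omega> i j"
      and "Delta \<equiv> \<lambda>n. gapDelta d (lam n)"
      and "bvec \<equiv> \<lambda>n i. bias_formula n d (lam n) (u n)
             (\<lambda>i'. \<Sum>j<n. integral\<^sup>L (M n) (\<lambda>\<omega>. (E n \<omega> i' j)\<^sup>2)) k i"
      and "bhat \<equiv> \<lambda>n \<omega> i. bias_formula n d
             (\<lambda>m. lamA n \<omega> (selidx n d p m)) (\<lambda>m. uhat n \<omega> (selidx n d p m))
             (Dhat_diag n (\<lambda>i' j. lowrank d (lam n) (u n) i' j + E n \<omega> i' j)
                (lowrank d (\<lambda>m. lamA n \<omega> (selidx n d p m)) (\<lambda>m. uhat n \<omega> (selidx n d p m)))) k i"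
  assumes kp: "k < p" and pd: "p \<le> d"
    \<comment> \<open>probability spaces and the noise matrix\<close>
    and prob: "\<And>n. prob_space (M n)"
    and Emeas: "\<And>n i j. (\<lambda>\<omega>. E n \<omega> i j) \<in> borel_measurable (M n)"
    and Esym: "\<And>n \<omega> i j. \<omega> \<in> space (M n) \<Longrightarrow> i < n \<Longrightarrow> j < n \<Longrightarrow>
               E n \<omega> i j = E n \<omega> j i"
    and Eindep: "\<And>n. n \<ge> N0 \<Longrightarrow> prob_space.indep_vars (M n) (\<lambda>_. borel)
                   (\<lambda>(i, j) \<omega>. E n \<omega> i j) {(i, j). i \<le> j \<and> j < n}"
    and Emean: "\<And>n i j. n \<ge> N0 \<Longrightarrow> i < n \<Longrightarrow> j < n \<Longrightarrow>
                 integrable (M n) (\<lambda>\<omega>. E n \<omega> i j) \<and> integral\<^sup>L (M n) (\<lambda>\<omega>. E n \<omega> i j) = 0"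
    \<comment> \<open>spectral structure of P: rank d, eigenvalues lam n 0 >= ... >= lam n (d-1),
        p positive and d - p negative, orthonormal eigenvectors u n m\<close>
    and lam_sorted: "\<And>n m. n \<ge> N0 \<Longrightarrow> Suc m < d \<Longrightarrow> lam n (Suc m) \<le> lam n m"
    and lam_pos: "\<And>n m. n \<ge> N0 \<Longrightarrow> m < p \<Longrightarrow> lam n m > 0"
    and lam_neg: "\<And>n m. n \<ge> N0 \<Longrightarrow> p \<le> m \<Longrightarrow> m < d \<Longrightarrow> lam n m < 0"
    and u_orth: "\<And>n m m'. n \<ge> N0 \<Longrightarrow> m < d \<Longrightarrow> m' < d \<Longrightarrow>
                   inner_n n (u n m) (u n m') = (if m = m' then 1 else 0)"
    \<comment> \<open>eigen-decomposition of A (any choice of orthonormal eigenvectors)\<close>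
    and A_eig: "\<And>n \<omega> m i. \<omega> \<in> space (M n) \<Longrightarrow> m < n \<Longrightarrow> i < n \<Longrightarrow>
                  (\<Sum>j<n. A n \<omega> i j * uhat n \<omega> m j) = lamA n \<omega> m * uhat n \<omega> m i"
    and A_orth: "\<And>n \<omega> m m'. \<omega> \<in> space (M n) \<Longrightarrow> m < n \<Longrightarrow> m' < n \<Longrightarrow>
                  inner_n n (uhat n \<omega> m) (uhat n \<omega> m') = (if m = m' then 1 else 0)"
    and A_sorted: "\<And>n \<omega> m. \<omega> \<in> space (M n) \<Longrightarrow> Suc m < n \<Longrightarrow> lamA n \<omega> (Suc m) \<le> lamA n \<omega> m"
    \<comment> \<open>(A1)\<close>
    and A1c: "betaD > 0" "C1 > 0" "C2 > 0" "c0 > 0"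
    and A1rho: "\<And>n. n \<ge> N0 \<Longrightarrow> 0 < rho n \<and> rho n \<le> 1"
    and A1growth: "filterlim (\<lambda>n. real n * rho n / real n powr c0) at_top sequentially"
    and A1lo: "\<And>n. n \<ge> N0 \<Longrightarrow>
                 C1 * real n powr betaD * sqrt (real n * rho n) \<le> Min ((\<lambda>m. \<bar>lam n m\<bar>) ` {..<d})"
    and A1hi: "\<And>n. n \<ge> N0 \<Longrightarrow>
                 Max ((\<lambda>m. \<bar>lam n m\<bar>) ` {..<d}) \<le> C2 * real n powr betaD * sqrt (real n * rho n)"
    \<comment> \<open>(A2)\<close>
    and A2: "delta0 > 0" "\<And>n. n \<ge> N0 \<Longrightarrow> Delta n \<ge> delta0 * Min ((\<lambda>m. \<bar>lam n m\<bar>) ` {..<d})"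
    \<comment> \<open>(A3)\<close>
    and A3c: "0 < eps" "eps \<le> 1/2" "C > 0" "A0 \<ge> 11"
    and A3q: "\<And>n. n \<ge> N0 \<Longrightarrow> real n powr eps \<le> qn n \<and> qn n \<le> sqrt (real n)"
    and A3var: "\<And>n i j. n \<ge> N0 \<Longrightarrow> i < n \<Longrightarrow> j < n \<Longrightarrow>
                  integrable (M n) (\<lambda>\<omega>. (E n \<omega> i j)\<^sup>2) \<and>
                  integral\<^sup>L (M n) (\<lambda>\<omega>. (E n \<omega> i j)\<^sup>2) \<le> C * rho n"
    and A3mom: "\<And>n i j r. n \<ge> N0 \<Longrightarrow> i < n \<Longrightarrow> j < n \<Longrightarrow> 3 \<le> r \<Longrightarrow>
                  real r \<le> (2 * ln (real n)) powr (A0 * ln (ln (real n))) \<Longrightarrow>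
                  integrable (M n) (\<lambda>\<omega>. \<bar>E n \<omega> i j\<bar> ^ r) \<and>
                  integral\<^sup>L (M n) (\<lambda>\<omega>. \<bar>E n \<omega> i j\<bar> ^ r)
                    \<le> C ^ r * (real n * rho n) powr (real r / 2) / (real n * qn n ^ (r - 2))"
    \<comment> \<open>(A4)\<close>
    and A4: "Cmu \<ge> 1" "\<And>n i. n \<ge> N0 \<Longrightarrow> i < n \<Longrightarrow>
               sqrt (\<Sum>m<d. (u n m i)\<^sup>2) \<le> Cmu * sqrt (real d / real n)"
  shows "(\<forall>\<xi>>1. tildeOP M
            (\<lambda>n \<omega>. vinf n (\<lambda>i. bhat n \<omega> i * sgn (inner_n n (u n k) (uhat n \<omega> k)) - bvec n i))
            (\<lambda>n. sqrt (real n) * rho n / (Delta n)\<^sup>2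
                  * max (1 / qn n) (sqrt (real n * rho n) / Delta n) * ln (real n) powr \<xi>))
       \<and> ((\<lambda>n. (real n * rho n) powr (3/2) / (Delta n)\<^sup>2) \<longlonglongrightarrow> 0 \<longrightarrow>
          zero_second_order_bias M E (\<lambda>n. u n k)
            (\<lambda>n \<omega> i. uhat n \<omega> k i - bhat n \<omega> i) rho Delta)"
proof -
  interpret spiked_noise M E N0 rho qn eps C A0 d p lam u lamA uhat betaD C1 C2 delta0 Cmu
    by (intro spiked_noise.intro spiked_noise_axioms.intro sparse_noise.intro)
      (fact prob Emeas Esym Eindep Emean A1rho A3c A3q A3var A3mom pd lam_sorted lam_pos lam_neg u_orth
        A_eig[unfolded A_def] A_orth A_sorted A1c A1lo A1hi A2[unfolded Delta_def] A4
      | use kp pd in linarith)+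
  have k: "k < d" using kp pd by simp
  \<comment> \<open>As \<open>k\<close> lies below \<open>p\<close>, it is among the top eigenpairs,
    where \<open>selidx\<close> is the identity.\<close>
  have vk: "vh n \<omega> k = uhat n \<omega> k" for n \<omega> using kp by (simp add: vh_def selidx_def)
  have Delta: "Delta = Del" by (simp add: Delta_def Del_def fun_eq_iff)
  have b: "bhat n \<omega> i = bhat_of k n \<omega> i" for n \<omega> i
    by (simp add: bhat_def bhat_of_def Dh_def lh_def[abs_def] vh_def[abs_def])
  have b0: "bvec n i = bias_formula n d (lam n) (u n) (D0 n \<omega>) k i" for n i \<omega>
    by (simp add: bvec_def D0_def[abs_def] sigma2_def)
  have al: "inner_n n (u n k) (uhat n \<omega> k) = alp n \<omega> k k" for n \<omega> by (simp add: alp_def vk)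
  show ?thesis
  proof (intro conjI allI impI)
    fix \<xi> :: real assume "1 < \<xi>"
    from bias_estimate_sup[OF k this]
    show "tildeOP M (\<lambda>n \<omega>. vinf n (\<lambda>i. bhat n \<omega> i * sgn (inner_n n (u n k) (uhat n \<omega> k)) - bvec n i))
            (\<lambda>n. sqrt (real n) * rho n / (Delta n)\<^sup>2
                  * max (1 / qn n) (sqrt (real n * rho n) / Delta n) * ln (real n) powr \<xi>)"
      unfolding al b Delta b0[symmetric] tau_def snr_def .
  next
    show "zero_second_order_bias M E (\<lambda>n. u n k) (\<lambda>n \<omega> i. uhat n \<omega> k i - bhat n \<omega> i) rho Delta"
      using zero_bias[OF k] unfolding vk b Delta .
  qed
qed

end
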